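(* Let $(B,\mathcal S)$ be a quasitriangular Hopf algebra over a field $\Bbbk$, and let $(\mathcal C,\circ,I,\bullet,J)=({}_B\mathfrak M_B,\otimes_B,B,\otimes_\Bbbk,\Bbbk)$ be the $\bullet$-braided duoidal category of $B$-bimodules with its reversion. Then the category $\mathrm{Hopf}^{\mathrm m}_{\mathrm{coc}}(\mathcal C,\circ,\bullet)$ of cocommutative Hopf monoids $H$ whose unit $u_H:I\to H$ is a monomorphism in $\mathcal C$ is isomorphic to $((B,\mathcal S)/\mathrm{QTrHopf})^{\mathrm i}$ and is protomodular.
   Context: $((B,\mathcal S)/\mathrm{QTrHopf})^{\mathrm i}$ is the full subcategory of the coslice category $(B,\mathcal S)/\mathrm{QTrHopf}$ whose objects are the pairs $((H,\mathcal R),u_H)$ with $u_H:(B,\mathcal S)\to(H,\mathcal R)$ injective. A quasitriangular Hopf algebra $(H,\mathcal R)$ is a Hopf algebra with an invertible $\mathcal R\in H\otimes H$ such that $\Delta^{\mathrm{op}}(\cdot)=\mathcal R\Delta(\cdot)\mathcal R^{-1}$, $(\mathrm{Id}\otimes\Delta)(\mathcal R)=\mathcal R_{13}\mathcal R_{12}$, $(\Delta\otimes\mathrm{Id})(\mathcal R)=\mathcal R_{13}\mathcal R_{23}$; a morphism $f:(A,\mathcal R)\to(H,\mathcal S)$ in $\mathrm{QTrHopf}$ is a bialgebra map with $(f\otimes f)(\mathcal R)=\mathcal S$. Duoidal structure on ${}_B\mathfrak M_B$: $\circ=\otimes_B$, $I=B$; $\bullet=\otimes_\Bbbk$ with diagonal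 $B$-bimodule structure $b(x\bullet y)b'=b_1xb_1'\bullet b_2yb_2'$, $J=\Bbbk$ a $B$-bimodule via $\varepsilon_B$; interchange law $\zeta_{A,E,C,D}((a\bullet e)\circ(c\bullet d))=(a\circ c)\bullet(e\circ d)$; $\Delta_I=\Delta_B$, $m_J(k\circ k')=kk'$, $\varepsilon_I=u_J=\varepsilon_B$. Braiding for $\bullet$: $\sigma_{X,Y}(x\otimes y)=\mathcal S^{-1}(y\otimes x)\mathcal S$. Bimonoid: an object $H$ that is a monoid for $\circ$ and a comonoid for $\bullet$ with $\Delta_Hm_H=(m_H\bullet m_H)\zeta_{H,H,H,H}(\Delta_H\circ\Delta_H)$, $\varepsilon_Hm_H=m_J(\varepsilon_H\circ\varepsilon_H)$, $\Delta_Hu_H=(u_H\bullet u_H)\Delta_I$, $\varepsilon_Hu_H=\varepsilon_I$; morphisms are morphisms of monoids and comonoids; cocommutative means $\sigma_{H,H}\Delta_H=\Delta_H$. Reversion and Hopf monoids: for a $B$-bimodule $X$, $X^-$ is the vector space $X$ (elements written $x^-$) with $bx^-b'=(S_B(b')xS_B(b))^-$ (the remaining structure of the reversion is given by $\phi^\circ(x^-\circ y^-)=(y\circ x)^-$, $\phi^\circ_0(b)=S_B(b)^-$, $\phi^\bullet(x^-\bullet y^-)=(y\bullet x)^-$, $\phi^\bullet_0(k)=k^-$ and obvious rearrangement maps, and is not otherwise needed). Put $\psi_{X,Y}:X^-\bullet Y\to J\circ(I\bullet(X\circ Y))$, $x^-\bullet y\mapsto1_\Bbbk\circ(1_B\bullet(x\circ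 y))$ and $\varphi_{X,Y}:X\bullet Y^-\to((X\circ Y)\bullet I)\circ J$, $x\bullet y^-\mapsto((x\circ y)\bullet1_B)\circ1_\Bbbk$. A Hopf monoid is a bimonoid $H$ admitting a $B$-bimodule map $\Sigma_H:H\to H^-$ with, for all $h\in H$, $((m_H\bullet I)\circ J)\varphi_{H,H}(h_1\bullet\Sigma_H(h_2))=\varepsilon_H(h)\,(1_H\bullet1_B)\circ1_\Bbbk$ and $(J\circ(I\bullet m_H))\psi_{H,H}(\Sigma_H(h_1)\bullet h_2)=\varepsilon_H(h)\,1_\Bbbk\circ(1_B\bullet1_H)$, where $1_H=u_H(1_B)$. $\mathrm{Hopf}^{\mathrm m}_{\mathrm{coc}}(\mathcal C,\circ,\bullet)$ is a full subcategory of the category of bimonoids. Protomodular: a category with pullbacks of split epimorphisms along any morphism, such that all inverse image (change-of-base) functors of the fibration of points (split epimorphisms with chosen section, mapped to their codomain) reflect isomorphisms. *)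

theory Defs
  imports
    Complex_Main
    "HOL-Library.FuncSet"
    "HOL-Library.Poly_Mapping"
    "HOL-Algebra.Ring"
begin

section \<open>Categories\<close>

text \<open>Morphisms need not know their domain and codomain, so composition takes the three
  objects as arguments: \<open>cmp C X Y Z g f\<close> is the composite of \<open>f : X \<rightarrow> Y\<close> and \<open>g : Y \<rightarrow> Z\<close>.\<close>

record ('o, 'm) cat =
  Ob :: "'o set"
  Hom :: "'o \<Rightarrow> 'o \<Rightarrow> 'm set"
  idt :: "'o \<Rightarrow> 'm"
  cmp :: "'o \<Rightarrow> 'o \<Rightarrow> 'o \<Rightarrow> 'm \<Rightarrow> 'm \<Rightarrow> 'm"

locale category =
  fixes C :: "('o, 'm) cat"
  assumes idt_closed: "X \<in> Ob C \<Longrightarrow> idt C X \<in> Hom C X X"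
    and cmp_closed: "\<lbrakk>X \<in> Ob C; Y \<in> Ob C; Z \<in> Ob C; f \<in> Hom C X Y; g \<in> Hom C Y Z\<rbrakk>
      \<Longrightarrow> cmp C X Y Z g f \<in> Hom C X Z"
    and idt_left: "\<lbrakk>X \<in> Ob C; Y \<in> Ob C; f \<in> Hom C X Y\<rbrakk> \<Longrightarrow> cmp C X Y Y (idt C Y) f = f"
    and idt_right: "\<lbrakk>X \<in> Ob C; Y \<in> Ob C; f \<in> Hom C X Y\<rbrakk> \<Longrightarrow> cmp C X X Y f (idt C X) = f"
    and cmp_assoc: "\<lbrakk>W \<in> Ob C; X \<in> Ob C; Y \<in> Ob C; Z \<in> Ob C;
      f \<in> Hom C W X; g \<in> Hom C X Y; h \<in> Hom C Y Z\<rbrakk>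
      \<Longrightarrow> cmp C W Y Z h (cmp C W X Y g f) = cmp C W X Z (cmp C X Y Z h g) f"

locale cat_functor = D: category C + E: category D
  for C :: "('o, 'm) cat" and D :: "('p, 'n) cat" +
  fixes Fo :: "'o \<Rightarrow> 'p" and Fm :: "'o \<Rightarrow> 'o \<Rightarrow> 'm \<Rightarrow> 'n"
  assumes Fo_closed: "X \<in> Ob C \<Longrightarrow> Fo X \<in> Ob D"
    and Fm_closed: "\<lbrakk>X \<in> Ob C; Y \<in> Ob C; f \<in> Hom C X Y\<rbrakk> \<Longrightarrow> Fm X Y f \<in> Hom D (Fo X) (Fo Y)"
    and Fm_idt: "X \<in> Ob C \<Longrightarrow> Fm X X (idt C X) = idt D (Fo X)"
    and Fm_cmp: "\<lbrakk>X \<in> Ob C; Y \<in> Ob C; Z \<in> Ob C; f \<in> Hom C X Y; g \<in> Hom C Y Z\<rbrakk>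
      \<Longrightarrow> Fm X Z (cmp C X Y Z g f) = cmp D (Fo X) (Fo Y) (Fo Z) (Fm Y Z g) (Fm X Y f)"

definition isomorphic_categories :: "('o, 'm) cat \<Rightarrow> ('p, 'n) cat \<Rightarrow> bool" where
  "isomorphic_categories C D \<longleftrightarrow> (\<exists>Fo Fm Go Gm.
     cat_functor C D Fo Fm \<and> cat_functor D C Go Gm \<and>
     (\<forall>X\<in>Ob C. Go (Fo X) = X) \<and> (\<forall>Y\<in>Ob D. Fo (Go Y) = Y) \<and>
     (\<forall>X\<in>Ob C. \<forall>Y\<in>Ob C. \<forall>f\<in>Hom C X Y. Gm (Fo X) (Fo Y) (Fm X Y f) = f) \<and>
     (\<forall>X\<in>Ob D. \<forall>Y\<in>Ob D. \<forall>f\<in>Hom D X Y. Fm (Go X) (Go Y) (Gm X Y f) = f))"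

definition full_subcat :: "('o, 'm) cat \<Rightarrow> ('o \<Rightarrow> bool) \<Rightarrow> ('o, 'm) cat" where
  "full_subcat C P = C\<lparr>Ob := {X \<in> Ob C. P X}\<rparr>"

definition coslice :: "('o, 'm) cat \<Rightarrow> 'o \<Rightarrow> ('o \<times> 'm, 'm) cat" where
  "coslice C A = \<lparr>
     Ob = {(X, u). X \<in> Ob C \<and> u \<in> Hom C A X},
     Hom = (\<lambda>(X, u) (Y, v). {f \<in> Hom C X Y. cmp C A X Y f u = v}),
     idt = (\<lambda>(X, u). idt C X),
     cmp = (\<lambda>(X, u) (Y, v) (Z, w). cmp C X Y Z)\<rparr>"

definition monic :: "('o, 'm) cat \<Rightarrow> 'o \<Rightarrow> 'o \<Rightarrow> 'm \<Rightarrow> bool" where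
  "monic C X Y f \<longleftrightarrow> f \<in> Hom C X Y \<and>
     (\<forall>Z\<in>Ob C. \<forall>g\<in>Hom C Z X. \<forall>h\<in>Hom C Z X. cmp C Z X Y f g = cmp C Z X Y f h \<longrightarrow> g = h)"

definition isomorphism :: "('o, 'm) cat \<Rightarrow> 'o \<Rightarrow> 'o \<Rightarrow> 'm \<Rightarrow> bool" where
  "isomorphism C X Y f \<longleftrightarrow> f \<in> Hom C X Y \<and>
     (\<exists>g\<in>Hom C Y X. cmp C X Y X g f = idt C X \<and> cmp C Y X Y f g = idt C Y)"

definition is_pullback ::
  "('o, 'm) cat \<Rightarrow> 'o \<Rightarrow> 'o \<Rightarrow> 'o \<Rightarrow> 'm \<Rightarrow> 'm \<Rightarrow> 'o \<Rightarrow> 'm \<Rightarrow> 'm \<Rightarrow> bool" where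
  \<comment> \<open>\<open>P\<close> with \<open>p : P \<rightarrow> X\<close>, \<open>q : P \<rightarrow> E\<close> is a pullback of \<open>f : X \<rightarrow> Y\<close> and \<open>g : E \<rightarrow> Y\<close>\<close>
  "is_pullback C X E Y f g P p q \<longleftrightarrow>
     P \<in> Ob C \<and> p \<in> Hom C P X \<and> q \<in> Hom C P E \<and> cmp C P X Y f p = cmp C P E Y g q \<and>
     (\<forall>T\<in>Ob C. \<forall>a\<in>Hom C T X. \<forall>b\<in>Hom C T E. cmp C T X Y f a = cmp C T E Y g b \<longrightarrow>
        (\<exists>!t. t \<in> Hom C T P \<and> cmp C T P X p t = a \<and> cmp C T P E q t = b))"

definition points :: "('o, 'm) cat \<Rightarrow> 'o \<Rightarrow> ('o \<times> 'm \<times> 'm, 'm) cat" where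
  \<comment> \<open>the fibre over \<open>Y\<close> of the fibration of points\<close>
  "points C Y = \<lparr>
     Ob = {(X, f, s). X \<in> Ob C \<and> f \<in> Hom C X Y \<and> s \<in> Hom C Y X \<and> cmp C Y X Y f s = idt C Y},
     Hom = (\<lambda>(X, f, s) (X', f', s').
       {h \<in> Hom C X X'. cmp C X X' Y f' h = f \<and> cmp C Y X X' h s = s'}),
     idt = (\<lambda>(X, f, s). idt C X),
     cmp = (\<lambda>(X, f, s) (X', f', s') (X'', f'', s''). cmp C X X' X'')\<rparr>"

definition inverse_image ::
  "('o, 'm) cat \<Rightarrow> 'o \<Rightarrow> 'o \<Rightarrow> 'm \<Rightarrow> 'o \<times> 'm \<times> 'm \<Rightarrow> 'o \<times> 'm \<times> 'm \<Rightarrow> 'm \<Rightarrow> bool" where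
  \<comment> \<open>\<open>(P, q, t)\<close> over \<open>E\<close> is an inverse image along \<open>g : E \<rightarrow> Y\<close> of the point \<open>(X, f, s)\<close> over
    \<open>Y\<close>, with cartesian morphism \<open>p : P \<rightarrow> X\<close>\<close>
  "inverse_image C E Y g = (\<lambda>(X, f, s) (P, q, t) p.
     (P, q, t) \<in> Ob (points C E) \<and> is_pullback C X E Y f g P p q \<and>
     cmp C E P X p t = cmp C E Y X s g)"

text \<open>An inverse image functor \<open>g\<^sup>*\<close> depends on a choice of pullbacks; the last clause quantifies
  over all choices. In it, \<open>k : g\<^sup>*a \<rightarrow> g\<^sup>*a'\<close> is the morphism \<open>g\<^sup>*h\<close>, being the morphism of points
  over \<open>E\<close> that commutes with \<open>h\<close> and the cartesian morphisms.\<close>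

definition protomodular :: "('o, 'm) cat \<Rightarrow> bool" where
  "protomodular C \<longleftrightarrow> category C \<and>
     (\<forall>Y\<in>Ob C. \<forall>(X, f, s)\<in>Ob (points C Y). \<forall>E\<in>Ob C. \<forall>g\<in>Hom C E Y.
        \<exists>P p q. is_pullback C X E Y f g P p q) \<and>
     (\<forall>Y\<in>Ob C. \<forall>E\<in>Ob C. \<forall>g\<in>Hom C E Y.
      \<forall>a\<in>Ob (points C Y). \<forall>a'\<in>Ob (points C Y). \<forall>h\<in>Hom (points C Y) a a'.
      \<forall>d d' p p' k. inverse_image C E Y g a d p \<longrightarrow> inverse_image C E Y g a' d' p' \<longrightarrow>
        k \<in> Hom (points C E) d d' \<longrightarrow>
        cmp C (fst d) (fst d') (fst a') p' k = cmp C (fst d) (fst a) (fst a') h p \<longrightarrow>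
        isomorphism (points C E) d d' k \<longrightarrow> isomorphism (points C Y) a a' h)"


section \<open>Vector spaces and tensor products\<close>

text \<open>The ground field is a type \<open>'k\<close> of class \<open>field\<close>. A vector space is carried by a subset of
  a type, and its operations are only relevant on that subset.\<close>

record ('k, 'v) vect = "'v partial_object" +
  vzero :: 'v
  vadd :: "'v \<Rightarrow> 'v \<Rightarrow> 'v"
  vsmul :: "'k \<Rightarrow> 'v \<Rightarrow> 'v"

definition vspace :: "('k::field, 'v, 'z) vect_scheme \<Rightarrow> bool" where
  "vspace V \<longleftrightarrow>
     comm_group \<lparr>carrier = carrier V, mult = vadd V, one = vzero V\<rparr> \<and>
     (\<forall>c. \<forall>x\<in>carrier V. vsmul V c x \<in> carrier V) \<and>
     (\<forall>c. \<forall>x\<in>carrier V. \<forall>y\<in>carrier V. vsmul V c (vadd V x y) = vadd V (vsmul V c x) (vsmul V c y)) \<and>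
     (\<forall>c d. \<forall>x\<in>carrier V. vsmul V (c + d) x = vadd V (vsmul V c x) (vsmul V d x)) \<and>
     (\<forall>c d. \<forall>x\<in>carrier V. vsmul V c (vsmul V d x) = vsmul V (c * d) x) \<and>
     (\<forall>x\<in>carrier V. vsmul V 1 x = x)"

definition lin_maps :: "('k, 'v, 'z) vect_scheme \<Rightarrow> ('k, 'w, 'y) vect_scheme \<Rightarrow> ('v \<Rightarrow> 'w) set" where
  "lin_maps V W = {f \<in> carrier V \<rightarrow>\<^sub>E carrier W.
     (\<forall>x\<in>carrier V. \<forall>y\<in>carrier V. f (vadd V x y) = vadd W (f x) (f y)) \<and>
     (\<forall>c. \<forall>x\<in>carrier V. f (vsmul V c x) = vsmul W c (f x))}"

abbreviation idm :: "('v, 'z) partial_object_scheme \<Rightarrow> 'v \<Rightarrow> 'v" where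
  "idm V \<equiv> (\<lambda>x\<in>carrier V. x)"

definition ground :: "('k::field, 'k) vect" where
  "ground = \<lparr>carrier = UNIV, vzero = 0, vadd = (+), vsmul = (*)\<rparr>"

text \<open>Tensor products are quotients of the space \<open>('x \<times> 'y) \<Rightarrow>\<^sub>0 'k\<close> of formal linear combinations
  of pairs by a subspace \<open>N\<close>; their elements are cosets of \<open>N\<close>.\<close>

definition fscale :: "'k::field \<Rightarrow> ('p \<Rightarrow>\<^sub>0 'k) \<Rightarrow> ('p \<Rightarrow>\<^sub>0 'k)" where
  "fscale c p = Poly_Mapping.map ((*) c) p"

definition coset_of :: "('p \<Rightarrow>\<^sub>0 'k::field) set \<Rightarrow> ('p \<Rightarrow>\<^sub>0 'k) \<Rightarrow> ('p \<Rightarrow>\<^sub>0 'k) set" where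
  "coset_of N p = {q. q - p \<in> N}"

definition quot_space :: "(('x \<times> 'y) \<Rightarrow>\<^sub>0 'k::field) set \<Rightarrow> ('k, 'x, 'z) vect_scheme \<Rightarrow>
    ('k, 'y, 'w) vect_scheme \<Rightarrow> ('k, (('x \<times> 'y) \<Rightarrow>\<^sub>0 'k) set) vect" where
  "quot_space N X Y = \<lparr>
     carrier = coset_of N ` {p. Poly_Mapping.keys p \<subseteq> carrier X \<times> carrier Y},
     vzero = N,
     vadd = (\<lambda>s t. {p + q | p q. p \<in> s \<and> q \<in> t}),
     vsmul = (\<lambda>c t. {fscale c p + n | p n. p \<in> t \<and> n \<in> N})\<rparr>"

definition bilin_rels ::
  "('k::field, 'x, 'z) vect_scheme \<Rightarrow> ('k, 'y, 'w) vect_scheme \<Rightarrow> (('x \<times> 'y) \<Rightarrow>\<^sub>0 'k) set" where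
  "bilin_rels X Y =
     {Poly_Mapping.single (vadd X x x', y) 1 - Poly_Mapping.single (x, y) 1
        - Poly_Mapping.single (x', y) 1 | x x' y. x \<in> carrier X \<and> x' \<in> carrier X \<and> y \<in> carrier Y} \<union>
     {Poly_Mapping.single (x, vadd Y y y') 1 - Poly_Mapping.single (x, y) 1
        - Poly_Mapping.single (x, y') 1 | x y y'. x \<in> carrier X \<and> y \<in> carrier Y \<and> y' \<in> carrier Y} \<union>
     {Poly_Mapping.single (vsmul X c x, y) 1 - Poly_Mapping.single (x, y) c | c x y.
        x \<in> carrier X \<and> y \<in> carrier Y} \<union>
     {Poly_Mapping.single (x, vsmul Y c y) 1 - Poly_Mapping.single (x, y) c | c x y.
        x \<in> carrier X \<and> y \<in> carrier Y}"

definition ker\<^sub>k ::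
  "('k::field, 'x, 'z) vect_scheme \<Rightarrow> ('k, 'y, 'w) vect_scheme \<Rightarrow> (('x \<times> 'y) \<Rightarrow>\<^sub>0 'k) set" where
  "ker\<^sub>k X Y = module.span fscale (bilin_rels X Y)"

definition tens :: "('k::field, 'x, 'z) vect_scheme \<Rightarrow> ('k, 'y, 'w) vect_scheme \<Rightarrow>
    ('k, (('x \<times> 'y) \<Rightarrow>\<^sub>0 'k) set) vect" where
  "tens X Y = quot_space (ker\<^sub>k X Y) X Y"

definition elt :: "('k::field, 'x, 'z) vect_scheme \<Rightarrow> ('k, 'y, 'w) vect_scheme \<Rightarrow>
    'x \<Rightarrow> 'y \<Rightarrow> (('x \<times> 'y) \<Rightarrow>\<^sub>0 'k) set" where
  \<comment> \<open>the simple tensor of \<open>x\<close> and \<open>y\<close>\<close>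
  "elt X Y x y = coset_of (ker\<^sub>k X Y) (Poly_Mapping.single (x, y) 1)"

definition tlift :: "('k::field, 'x, 'z) vect_scheme \<Rightarrow> ('k, 'y, 'w) vect_scheme \<Rightarrow>
    ('k, 'v, 'u) vect_scheme \<Rightarrow> ('x \<Rightarrow> 'y \<Rightarrow> 'v) \<Rightarrow> (('x \<times> 'y) \<Rightarrow>\<^sub>0 'k) set \<Rightarrow> 'v" where
  \<comment> \<open>the linear map on the tensor product given on simple tensors by \<open>f\<close>\<close>
  "tlift X Y Z f = (THE g. g \<in> lin_maps (tens X Y) Z \<and>
     (\<forall>x\<in>carrier X. \<forall>y\<in>carrier Y. g (elt X Y x y) = f x y))"

definition tmap :: "('k::field, 'x, 'z) vect_scheme \<Rightarrow> ('k, 'y, 'w) vect_scheme \<Rightarrow>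
    ('k, 'x', 'z') vect_scheme \<Rightarrow> ('k, 'y', 'w') vect_scheme \<Rightarrow> ('x \<Rightarrow> 'x') \<Rightarrow> ('y \<Rightarrow> 'y') \<Rightarrow>
    (('x \<times> 'y) \<Rightarrow>\<^sub>0 'k) set \<Rightarrow> (('x' \<times> 'y') \<Rightarrow>\<^sub>0 'k) set" where
  "tmap X Y X' Y' f g = tlift X Y (tens X' Y') (\<lambda>x y. elt X' Y' (f x) (g y))"

definition tassoc :: "('k::field, 'x, 'z) vect_scheme \<Rightarrow> ('k, 'y, 'w) vect_scheme \<Rightarrow>
    ('k, 'v, 'u) vect_scheme \<Rightarrow> (((('x \<times> 'y) \<Rightarrow>\<^sub>0 'k) set \<times> 'v) \<Rightarrow>\<^sub>0 'k) set \<Rightarrow>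
    (('x \<times> (('y \<times> 'v) \<Rightarrow>\<^sub>0 'k) set) \<Rightarrow>\<^sub>0 'k) set" where
  "tassoc X Y Z = tlift (tens X Y) Z (tens X (tens Y Z))
     (\<lambda>t z. tlift X Y (tens X (tens Y Z)) (\<lambda>x y. elt X (tens Y Z) x (elt Y Z y z)) t)"

definition tlunit :: "('k::field, 'x, 'z) vect_scheme \<Rightarrow> (('k \<times> 'x) \<Rightarrow>\<^sub>0 'k) set \<Rightarrow> 'x" where
  "tlunit X = tlift ground X X (\<lambda>c x. vsmul X c x)"

definition trunit :: "('k::field, 'x, 'z) vect_scheme \<Rightarrow> (('x \<times> 'k) \<Rightarrow>\<^sub>0 'k) set \<Rightarrow> 'x" where
  "trunit X = tlift X ground X (\<lambda>x c. vsmul X c x)"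

definition coalgebra :: "('k::field, 'x, 'z) vect_scheme \<Rightarrow> ('x \<Rightarrow> (('x \<times> 'x) \<Rightarrow>\<^sub>0 'k) set) \<Rightarrow>
    ('x \<Rightarrow> 'k) \<Rightarrow> bool" where
  "coalgebra X D e \<longleftrightarrow> vspace X \<and> D \<in> lin_maps X (tens X X) \<and> e \<in> lin_maps X ground \<and>
     (\<forall>x\<in>carrier X. tassoc X X X (tmap X X (tens X X) X D (idm X) (D x))
        = tmap X X X (tens X X) (idm X) D (D x)) \<and>
     (\<forall>x\<in>carrier X. tlunit X (tmap X X ground X e (idm X) (D x)) = x) \<and>
     (\<forall>x\<in>carrier X. trunit X (tmap X X X ground (idm X) e (D x)) = x)"


section \<open>Quasitriangular Hopf algebras\<close>

record ('k, 'a) alg = "('k, 'a) vect" +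
  amul :: "'a \<Rightarrow> 'a \<Rightarrow> 'a"
  aone :: 'a

record (overloaded) ('k, 'a) bialg = "('k, 'a) alg" +
  acomul :: "'a \<Rightarrow> (('a \<times> 'a) \<Rightarrow>\<^sub>0 'k) set"
  acounit :: "'a \<Rightarrow> 'k"

definition algebra :: "('k::field, 'a, 'z) alg_scheme \<Rightarrow> bool" where
  "algebra A \<longleftrightarrow> vspace A \<and>
     ring \<lparr>carrier = carrier A, mult = amul A, one = aone A, zero = vzero A, add = vadd A\<rparr> \<and>
     (\<forall>c. \<forall>x\<in>carrier A. \<forall>y\<in>carrier A. amul A (vsmul A c x) y = vsmul A c (amul A x y) \<and>
        amul A x (vsmul A c y) = vsmul A c (amul A x y))"

definition talg :: "('k::field, 'a, 'z) alg_scheme \<Rightarrow> ('k, 'b, 'w) alg_scheme \<Rightarrow>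
    ('k, (('a \<times> 'b) \<Rightarrow>\<^sub>0 'k) set) alg" where
  "talg A B = vect.extend (tens A B) (alg.fields
     (\<lambda>s t. tlift A B (tens A B) (\<lambda>a b.
        tlift A B (tens A B) (\<lambda>a' b'. elt A B (amul A a a') (amul B b b')) t) s)
     (elt A B (aone A) (aone B)))"

definition bialgebra :: "('k::field, 'a, 'z) bialg_scheme \<Rightarrow> bool" where
  "bialgebra H \<longleftrightarrow> algebra H \<and> coalgebra H (acomul H) (acounit H) \<and>
     (\<forall>x\<in>carrier H. \<forall>y\<in>carrier H.
        acomul H (amul H x y) = amul (talg H H) (acomul H x) (acomul H y)) \<and>
     acomul H (aone H) = aone (talg H H) \<and>
     (\<forall>x\<in>carrier H. \<forall>y\<in>carrier H. acounit H (amul H x y) = acounit H x * acounit H y) \<and>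
     acounit H (aone H) = 1"

definition is_antipode :: "('k::field, 'a, 'z) bialg_scheme \<Rightarrow> ('a \<Rightarrow> 'a) \<Rightarrow> bool" where
  "is_antipode H s \<longleftrightarrow> s \<in> lin_maps H H \<and>
     (\<forall>x\<in>carrier H.
        tlift H H H (\<lambda>a b. amul H (s a) b) (acomul H x) = vsmul H (acounit H x) (aone H) \<and>
        tlift H H H (\<lambda>a b. amul H a (s b)) (acomul H x) = vsmul H (acounit H x) (aone H))"

definition hopf_algebra :: "('k::field, 'a, 'z) bialg_scheme \<Rightarrow> bool" where
  "hopf_algebra H \<longleftrightarrow> bialgebra H \<and> (\<exists>s. is_antipode H s)"

definition antipode :: "('k::field, 'a, 'z) bialg_scheme \<Rightarrow> 'a \<Rightarrow> 'a" where
  "antipode H = (THE s. is_antipode H s)"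

definition invertible_in :: "('k, 'a, 'z) alg_scheme \<Rightarrow> 'a \<Rightarrow> bool" where
  "invertible_in A x \<longleftrightarrow> x \<in> carrier A \<and>
     (\<exists>y\<in>carrier A. amul A x y = aone A \<and> amul A y x = aone A)"

definition ainv :: "('k, 'a, 'z) alg_scheme \<Rightarrow> 'a \<Rightarrow> 'a" where
  "ainv A x = (THE y. y \<in> carrier A \<and> amul A x y = aone A \<and> amul A y x = aone A)"

definition flip :: "('k::field, 'x, 'z) vect_scheme \<Rightarrow> ('k, 'y, 'w) vect_scheme \<Rightarrow>
    (('x \<times> 'y) \<Rightarrow>\<^sub>0 'k) set \<Rightarrow> (('y \<times> 'x) \<Rightarrow>\<^sub>0 'k) set" where
  "flip X Y = tlift X Y (tens Y X) (\<lambda>x y. elt Y X y x)"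

text \<open>The threefold tensor power is bracketed to the right: \<open>H \<otimes> (H \<otimes> H)\<close>.\<close>

definition leg12 :: "('k::field, 'a, 'z) alg_scheme \<Rightarrow> (('a \<times> 'a) \<Rightarrow>\<^sub>0 'k) set \<Rightarrow>
    (('a \<times> (('a \<times> 'a) \<Rightarrow>\<^sub>0 'k) set) \<Rightarrow>\<^sub>0 'k) set" where
  "leg12 H = tlift H H (tens H (tens H H)) (\<lambda>a b. elt H (tens H H) a (elt H H b (aone H)))"

definition leg13 :: "('k::field, 'a, 'z) alg_scheme \<Rightarrow> (('a \<times> 'a) \<Rightarrow>\<^sub>0 'k) set \<Rightarrow>
    (('a \<times> (('a \<times> 'a) \<Rightarrow>\<^sub>0 'k) set) \<Rightarrow>\<^sub>0 'k) set" where
  "leg13 H = tlift H H (tens H (tens H H)) (\<lambda>a b. elt H (tens H H) a (elt H H (aone H) b))"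

definition leg23 :: "('k::field, 'a, 'z) alg_scheme \<Rightarrow> (('a \<times> 'a) \<Rightarrow>\<^sub>0 'k) set \<Rightarrow>
    (('a \<times> (('a \<times> 'a) \<Rightarrow>\<^sub>0 'k) set) \<Rightarrow>\<^sub>0 'k) set" where
  "leg23 H = tlift H H (tens H (tens H H)) (\<lambda>a b. elt H (tens H H) (aone H) (elt H H a b))"

definition quasitriangular ::
  "('k::field, 'a, 'z) bialg_scheme \<Rightarrow> (('a \<times> 'a) \<Rightarrow>\<^sub>0 'k) set \<Rightarrow> bool" where
  "quasitriangular H R \<longleftrightarrow> hopf_algebra H \<and> invertible_in (talg H H) R \<and>
     (\<forall>x\<in>carrier H. flip H H (acomul H x)
        = amul (talg H H) (amul (talg H H) R (acomul H x)) (ainv (talg H H) R)) \<and>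
     tmap H H H (tens H H) (idm H) (acomul H) R
        = amul (talg H (talg H H)) (leg13 H R) (leg12 H R) \<and>
     tassoc H H H (tmap H H (tens H H) H (acomul H) (idm H) R)
        = amul (talg H (talg H H)) (leg13 H R) (leg23 H R)"

definition bialg_maps ::
  "('k::field, 'a, 'z) bialg_scheme \<Rightarrow> ('k, 'b, 'w) bialg_scheme \<Rightarrow> ('a \<Rightarrow> 'b) set" where
  "bialg_maps A H = {f \<in> lin_maps A H.
     (\<forall>x\<in>carrier A. \<forall>y\<in>carrier A. f (amul A x y) = amul H (f x) (f y)) \<and>
     f (aone A) = aone H \<and>
     (\<forall>x\<in>carrier A. acomul H (f x) = tmap A A H H f f (acomul A x)) \<and>
     (\<forall>x\<in>carrier A. acounit H (f x) = acounit A x)}"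

text \<open>In the categories below, the type \<open>'u\<close> plays the role of the universe: objects are carried
  by subsets of \<open>'u\<close>. For infinite \<open>'u\<close> a tensor product of two nonzero spaces carried by \<open>'u\<close>
  embeds into \<open>'u\<close>; for finite \<open>'u\<close> pullbacks can fail to exist for lack of room. Operations of objects are required to be \<open>undefined\<close> outside the carriers
  (maps are extensional already by \<open>lin_maps\<close>), so that two objects are equal as records iff they
  have the same carrier and the same operations on it. This is what makes it meaningful to ask for
  an isomorphism, and not only an equivalence, of categories.\<close>

definition vect_ext :: "('k, 'v, 'z) vect_scheme \<Rightarrow> bool" where
  "vect_ext V \<longleftrightarrow>
     (\<forall>x y. \<not> (x \<in> carrier V \<and> y \<in> carrier V) \<longrightarrow> vadd V x y = undefined) \<and>
     (\<forall>c x. x \<notin> carrier V \<longrightarrow> vsmul V c x = undefined)"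

definition alg_ext :: "('k, 'a, 'z) alg_scheme \<Rightarrow> bool" where
  "alg_ext A \<longleftrightarrow> vect_ext A \<and>
     (\<forall>x y. \<not> (x \<in> carrier A \<and> y \<in> carrier A) \<longrightarrow> amul A x y = undefined)"

definition QTrHopf :: "(('k::field, 'u) bialg \<times> (('u \<times> 'u) \<Rightarrow>\<^sub>0 'k) set, 'u \<Rightarrow> 'u) cat" where
  "QTrHopf = \<lparr>
     Ob = {(H, R). quasitriangular H R \<and> alg_ext H},
     Hom = (\<lambda>(A, R) (H, S). {f \<in> bialg_maps A H. tmap A A H H f f R = S}),
     idt = (\<lambda>(H, R). idm H),
     cmp = (\<lambda>(X, Q) (Y, R) (Z, S) g f. compose (carrier X) g f)\<rparr>"

definition QTrHopf_coslice_inj :: "('k::field, 'u) bialg \<Rightarrow> (('u \<times> 'u) \<Rightarrow>\<^sub>0 'k) set \<Rightarrow>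
    ((('k, 'u) bialg \<times> (('u \<times> 'u) \<Rightarrow>\<^sub>0 'k) set) \<times> ('u \<Rightarrow> 'u), 'u \<Rightarrow> 'u) cat" where
  "QTrHopf_coslice_inj B S =
     full_subcat (coslice QTrHopf (B, S)) (\<lambda>(X, u). inj_on u (carrier B))"


section \<open>The duoidal category of bimodules\<close>

record ('k, 'b, 'v) bimod = "('k, 'v) vect" +
  lact :: "'b \<Rightarrow> 'v \<Rightarrow> 'v"
  ract :: "'v \<Rightarrow> 'b \<Rightarrow> 'v"

definition bimodule :: "('k::field, 'b, 'z) alg_scheme \<Rightarrow> ('k, 'b, 'x, 'w) bimod_scheme \<Rightarrow> bool" where
  "bimodule B X \<longleftrightarrow> vspace X \<and>
     (\<forall>b\<in>carrier B. \<forall>x\<in>carrier X. lact X b x \<in> carrier X \<and> ract X x b \<in> carrier X) \<and>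
     (\<forall>b\<in>carrier B. \<forall>x\<in>carrier X. \<forall>y\<in>carrier X.
        lact X b (vadd X x y) = vadd X (lact X b x) (lact X b y) \<and>
        ract X (vadd X x y) b = vadd X (ract X x b) (ract X y b)) \<and>
     (\<forall>b\<in>carrier B. \<forall>b'\<in>carrier B. \<forall>x\<in>carrier X.
        lact X (vadd B b b') x = vadd X (lact X b x) (lact X b' x) \<and>
        ract X x (vadd B b b') = vadd X (ract X x b) (ract X x b')) \<and>
     (\<forall>c. \<forall>b\<in>carrier B. \<forall>x\<in>carrier X.
        lact X (vsmul B c b) x = vsmul X c (lact X b x) \<and>
        lact X b (vsmul X c x) = vsmul X c (lact X b x) \<and>
        ract X x (vsmul B c b) = vsmul X c (ract X x b) \<and>
        ract X (vsmul X c x) b = vsmul X c (ract X x b)) \<and>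
     (\<forall>x\<in>carrier X. lact X (aone B) x = x \<and> ract X x (aone B) = x) \<and>
     (\<forall>b\<in>carrier B. \<forall>b'\<in>carrier B. \<forall>x\<in>carrier X.
        lact X (amul B b b') x = lact X b (lact X b' x) \<and>
        ract X x (amul B b b') = ract X (ract X x b) b' \<and>
        ract X (lact X b x) b' = lact X b (ract X x b'))"

definition bimod_maps :: "('k::field, 'b, 'z) alg_scheme \<Rightarrow> ('k, 'b, 'x, 'w) bimod_scheme \<Rightarrow>
    ('k, 'b, 'y, 'v) bimod_scheme \<Rightarrow> ('x \<Rightarrow> 'y) set" where
  "bimod_maps B X Y = {f \<in> lin_maps X Y. \<forall>b\<in>carrier B. \<forall>x\<in>carrier X.
     f (lact X b x) = lact Y b (f x) \<and> f (ract X x b) = ract Y (f x) b}"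

definition bimod_ext :: "('k, 'b, 'z) alg_scheme \<Rightarrow> ('k, 'b, 'x, 'w) bimod_scheme \<Rightarrow> bool" where
  "bimod_ext B X \<longleftrightarrow> vect_ext X \<and>
     (\<forall>b x. \<not> (b \<in> carrier B \<and> x \<in> carrier X) \<longrightarrow>
        lact X b x = undefined \<and> ract X x b = undefined)"

definition bimod_cat :: "('k::field, 'u, 'z) alg_scheme \<Rightarrow> (('k, 'u, 'u) bimod, 'u \<Rightarrow> 'u) cat" where
  "bimod_cat B = \<lparr>
     Ob = {X. bimodule B X \<and> bimod_ext B X},
     Hom = bimod_maps B,
     idt = (\<lambda>X. idm X),
     cmp = (\<lambda>X Y Z g f. compose (carrier X) g f)\<rparr>"

definition unit_I :: "('k, 'b, 'z) alg_scheme \<Rightarrow> ('k, 'b, 'b) bimod" where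
  "unit_I B = vect.extend (vect.truncate B) (bimod.fields (amul B) (amul B))"

definition unit_J :: "('k::field, 'b, 'z) bialg_scheme \<Rightarrow> ('k, 'b, 'k) bimod" where
  "unit_J B = vect.extend ground
     (bimod.fields (\<lambda>b c. acounit B b * c) (\<lambda>c b. c * acounit B b))"

subsection \<open>The product \<open>\<circ>\<close>: tensor product over \<open>B\<close>\<close>

definition ker\<^sub>B :: "('k::field, 'b, 'z) alg_scheme \<Rightarrow> ('k, 'b, 'x, 'w) bimod_scheme \<Rightarrow>
    ('k, 'b, 'y, 'v) bimod_scheme \<Rightarrow> (('x \<times> 'y) \<Rightarrow>\<^sub>0 'k) set" where
  "ker\<^sub>B B X Y = module.span fscale (bilin_rels X Y \<union>
     {Poly_Mapping.single (ract X x b, y) 1 - Poly_Mapping.single (x, lact Y b y) 1 | x b y.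
        x \<in> carrier X \<and> b \<in> carrier B \<and> y \<in> carrier Y})"

definition celt :: "('k::field, 'b, 'z) alg_scheme \<Rightarrow> ('k, 'b, 'x, 'w) bimod_scheme \<Rightarrow>
    ('k, 'b, 'y, 'v) bimod_scheme \<Rightarrow> 'x \<Rightarrow> 'y \<Rightarrow> (('x \<times> 'y) \<Rightarrow>\<^sub>0 'k) set" where
  \<comment> \<open>the element \<open>x \<circ> y\<close>\<close>
  "celt B X Y x y = coset_of (ker\<^sub>B B X Y) (Poly_Mapping.single (x, y) 1)"

definition clift :: "('k::field, 'b, 'z) alg_scheme \<Rightarrow> ('k, 'b, 'x, 'w) bimod_scheme \<Rightarrow>
    ('k, 'b, 'y, 'v) bimod_scheme \<Rightarrow> ('k, 't, 'u) vect_scheme \<Rightarrow> ('x \<Rightarrow> 'y \<Rightarrow> 't) \<Rightarrow>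
    (('x \<times> 'y) \<Rightarrow>\<^sub>0 'k) set \<Rightarrow> 't" where
  "clift B X Y Z f = (THE g. g \<in> lin_maps (quot_space (ker\<^sub>B B X Y) X Y) Z \<and>
     (\<forall>x\<in>carrier X. \<forall>y\<in>carrier Y. g (celt B X Y x y) = f x y))"

definition circ :: "('k::field, 'b, 'z) alg_scheme \<Rightarrow> ('k, 'b, 'x, 'w) bimod_scheme \<Rightarrow>
    ('k, 'b, 'y, 'v) bimod_scheme \<Rightarrow> ('k, 'b, (('x \<times> 'y) \<Rightarrow>\<^sub>0 'k) set) bimod" where
  "circ B X Y = (let Q = quot_space (ker\<^sub>B B X Y) X Y in vect.extend Q (bimod.fields
     (\<lambda>b. clift B X Y Q (\<lambda>x y. celt B X Y (lact X b x) y))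
     (\<lambda>t b. clift B X Y Q (\<lambda>x y. celt B X Y x (ract Y y b)) t)))"

definition cmap :: "('k::field, 'b, 'z) alg_scheme \<Rightarrow> ('k, 'b, 'x, 'w) bimod_scheme \<Rightarrow>
    ('k, 'b, 'y, 'v) bimod_scheme \<Rightarrow> ('k, 'b, 'x', 'w') bimod_scheme \<Rightarrow>
    ('k, 'b, 'y', 'v') bimod_scheme \<Rightarrow> ('x \<Rightarrow> 'x') \<Rightarrow> ('y \<Rightarrow> 'y') \<Rightarrow>
    (('x \<times> 'y) \<Rightarrow>\<^sub>0 'k) set \<Rightarrow> (('x' \<times> 'y') \<Rightarrow>\<^sub>0 'k) set" where
  "cmap B X Y X' Y' f g = clift B X Y (circ B X' Y') (\<lambda>x y. celt B X' Y' (f x) (g y))"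

definition cassoc :: "('k::field, 'b, 'z) alg_scheme \<Rightarrow> ('k, 'b, 'x, 'w) bimod_scheme \<Rightarrow>
    ('k, 'b, 'y, 'v) bimod_scheme \<Rightarrow> ('k, 'b, 't, 'u) bimod_scheme \<Rightarrow>
    (((('x \<times> 'y) \<Rightarrow>\<^sub>0 'k) set \<times> 't) \<Rightarrow>\<^sub>0 'k) set \<Rightarrow> (('x \<times> (('y \<times> 't) \<Rightarrow>\<^sub>0 'k) set) \<Rightarrow>\<^sub>0 'k) set" where
  "cassoc B X Y Z = clift B (circ B X Y) Z (circ B X (circ B Y Z))
     (\<lambda>t z. clift B X Y (circ B X (circ B Y Z)) (\<lambda>x y. celt B X (circ B Y Z) x (celt B Y Z y z)) t)"

definition clunit :: "('k::field, 'b, 'z) alg_scheme \<Rightarrow> ('k, 'b, 'x, 'w) bimod_scheme \<Rightarrow>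
    (('b \<times> 'x) \<Rightarrow>\<^sub>0 'k) set \<Rightarrow> 'x" where
  "clunit B X = clift B (unit_I B) X X (\<lambda>b x. lact X b x)"

definition crunit :: "('k::field, 'b, 'z) alg_scheme \<Rightarrow> ('k, 'b, 'x, 'w) bimod_scheme \<Rightarrow>
    (('x \<times> 'b) \<Rightarrow>\<^sub>0 'k) set \<Rightarrow> 'x" where
  "crunit B X = clift B X (unit_I B) X (\<lambda>x b. ract X x b)"

subsection \<open>The product \<open>\<bullet>\<close>: tensor product over the ground field\<close>

definition lact2 :: "('k::field, 'b, 'z) alg_scheme \<Rightarrow> ('k, 'b, 'x, 'w) bimod_scheme \<Rightarrow>
    ('k, 'b, 'y, 'v) bimod_scheme \<Rightarrow> (('b \<times> 'b) \<Rightarrow>\<^sub>0 'k) set \<Rightarrow> (('x \<times> 'y) \<Rightarrow>\<^sub>0 'k) set \<Rightarrow>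
    (('x \<times> 'y) \<Rightarrow>\<^sub>0 'k) set" where
  \<comment> \<open>left action of \<open>B \<otimes> B\<close> on \<open>X \<otimes> Y\<close>\<close>
  "lact2 B X Y r t = tlift B B (tens X Y) (\<lambda>b b'.
     tlift X Y (tens X Y) (\<lambda>x y. elt X Y (lact X b x) (lact Y b' y)) t) r"

definition ract2 :: "('k::field, 'b, 'z) alg_scheme \<Rightarrow> ('k, 'b, 'x, 'w) bimod_scheme \<Rightarrow>
    ('k, 'b, 'y, 'v) bimod_scheme \<Rightarrow> (('x \<times> 'y) \<Rightarrow>\<^sub>0 'k) set \<Rightarrow> (('b \<times> 'b) \<Rightarrow>\<^sub>0 'k) set \<Rightarrow>
    (('x \<times> 'y) \<Rightarrow>\<^sub>0 'k) set" where
  "ract2 B X Y t r = tlift B B (tens X Y) (\<lambda>b b'.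
     tlift X Y (tens X Y) (\<lambda>x y. elt X Y (ract X x b) (ract Y y b')) t) r"

definition bull :: "('k::field, 'b, 'z) bialg_scheme \<Rightarrow> ('k, 'b, 'x, 'w) bimod_scheme \<Rightarrow>
    ('k, 'b, 'y, 'v) bimod_scheme \<Rightarrow> ('k, 'b, (('x \<times> 'y) \<Rightarrow>\<^sub>0 'k) set) bimod" where
  "bull B X Y = vect.extend (tens X Y) (bimod.fields
     (\<lambda>b t. lact2 B X Y (acomul B b) t)
     (\<lambda>t b. ract2 B X Y t (acomul B b)))"

definition interchange :: "('k::field, 'b, 'z) bialg_scheme \<Rightarrow> ('k, 'b, 'x, 'w) bimod_scheme \<Rightarrow>
    ('k, 'b, 'e, 'v) bimod_scheme \<Rightarrow> ('k, 'b, 'c, 't) bimod_scheme \<Rightarrow> ('k, 'b, 'd, 's) bimod_scheme \<Rightarrow>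
    (((('x \<times> 'e) \<Rightarrow>\<^sub>0 'k) set \<times> (('c \<times> 'd) \<Rightarrow>\<^sub>0 'k) set) \<Rightarrow>\<^sub>0 'k) set \<Rightarrow>
    (((('x \<times> 'c) \<Rightarrow>\<^sub>0 'k) set \<times> (('e \<times> 'd) \<Rightarrow>\<^sub>0 'k) set) \<Rightarrow>\<^sub>0 'k) set" where
  "interchange B A E C D = (let T = bull B (circ B A C) (circ B E D) in
     clift B (bull B A E) (bull B C D) T (\<lambda>s t.
       tlift A E T (\<lambda>a e. tlift C D T (\<lambda>c d.
         elt (circ B A C) (circ B E D) (celt B A C a c) (celt B E D e d)) t) s))"

definition mult_J :: "('k::field, 'b, 'z) bialg_scheme \<Rightarrow> (('k \<times> 'k) \<Rightarrow>\<^sub>0 'k) set \<Rightarrow> 'k" where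
  "mult_J B = clift B (unit_J B) (unit_J B) (unit_J B) (\<lambda>c c'. c * c')"

definition braiding :: "('k::field, 'b, 'z) bialg_scheme \<Rightarrow> (('b \<times> 'b) \<Rightarrow>\<^sub>0 'k) set \<Rightarrow>
    ('k, 'b, 'x, 'w) bimod_scheme \<Rightarrow> ('k, 'b, 'y, 'v) bimod_scheme \<Rightarrow>
    (('x \<times> 'y) \<Rightarrow>\<^sub>0 'k) set \<Rightarrow> (('y \<times> 'x) \<Rightarrow>\<^sub>0 'k) set" where
  "braiding B S X Y = tlift X Y (tens Y X) (\<lambda>x y.
     ract2 B Y X (lact2 B Y X (ainv (talg B B) S) (elt Y X y x)) S)"


section \<open>Bimonoids and Hopf monoids\<close>

record (overloaded) ('k, 'b, 'v) bimon = "('k, 'b, 'v) bimod" +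
  mul :: "(('v \<times> 'v) \<Rightarrow>\<^sub>0 'k) set \<Rightarrow> 'v"
  unt :: "'b \<Rightarrow> 'v"
  com :: "'v \<Rightarrow> (('v \<times> 'v) \<Rightarrow>\<^sub>0 'k) set"
  cou :: "'v \<Rightarrow> 'k"

definition circ_monoid :: "('k::field, 'b, 'z) alg_scheme \<Rightarrow> ('k, 'b, 'v, 'w) bimon_scheme \<Rightarrow> bool" where
  "circ_monoid B H \<longleftrightarrow> bimodule B H \<and>
     mul H \<in> bimod_maps B (circ B H H) H \<and> unt H \<in> bimod_maps B (unit_I B) H \<and>
     (\<forall>t\<in>carrier (circ B (circ B H H) H).
        mul H (cmap B (circ B H H) H H H (mul H) (idm H) t)
          = mul H (cmap B H (circ B H H) H H (idm H) (mul H) (cassoc B H H H t))) \<and>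
     (\<forall>t\<in>carrier (circ B (unit_I B) H).
        mul H (cmap B (unit_I B) H H H (unt H) (idm H) t) = clunit B H t) \<and>
     (\<forall>t\<in>carrier (circ B H (unit_I B)).
        mul H (cmap B H (unit_I B) H H (idm H) (unt H) t) = crunit B H t)"

text \<open>The associator and unitors of \<open>\<bullet>\<close> are those of \<open>\<otimes>\<close> over the ground field.\<close>

definition bull_comonoid :: "('k::field, 'b, 'z) bialg_scheme \<Rightarrow> ('k, 'b, 'v, 'w) bimon_scheme \<Rightarrow> bool" where
  "bull_comonoid B H \<longleftrightarrow> bimodule B H \<and>
     com H \<in> bimod_maps B H (bull B H H) \<and> cou H \<in> bimod_maps B H (unit_J B) \<and>
     coalgebra H (com H) (cou H)"

definition bimonoid :: "('k::field, 'b, 'z) bialg_scheme \<Rightarrow> ('k, 'b, 'v, 'w) bimon_scheme \<Rightarrow> bool" where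
  "bimonoid B H \<longleftrightarrow> circ_monoid B H \<and> bull_comonoid B H \<and>
     (\<forall>t\<in>carrier (circ B H H). com H (mul H t)
        = tmap (circ B H H) (circ B H H) H H (mul H) (mul H)
            (interchange B H H H H
              (cmap B H H (bull B H H) (bull B H H) (com H) (com H) t))) \<and>
     (\<forall>t\<in>carrier (circ B H H). cou H (mul H t)
        = mult_J B (cmap B H H (unit_J B) (unit_J B) (cou H) (cou H) t)) \<and>
     (\<forall>b\<in>carrier B. com H (unt H b)
        = tmap (unit_I B) (unit_I B) H H (unt H) (unt H) (acomul B b)) \<and>
     (\<forall>b\<in>carrier B. cou H (unt H b) = acounit B b)"

definition bimonoid_maps :: "('k::field, 'b, 'z) bialg_scheme \<Rightarrow> ('k, 'b, 'v, 'w) bimon_scheme \<Rightarrow>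
    ('k, 'b, 'y, 't) bimon_scheme \<Rightarrow> ('v \<Rightarrow> 'y) set" where
  "bimonoid_maps B H K = {f \<in> bimod_maps B H K.
     (\<forall>t\<in>carrier (circ B H H). f (mul H t) = mul K (cmap B H H K K f f t)) \<and>
     (\<forall>b\<in>carrier B. f (unt H b) = unt K b) \<and>
     (\<forall>x\<in>carrier H. com K (f x) = tmap H H K K f f (com H x)) \<and>
     (\<forall>x\<in>carrier H. cou K (f x) = cou H x)}"

definition bimonoid_cat ::
  "('k::field, 'u, 'z) bialg_scheme \<Rightarrow> (('k, 'u, 'u) bimon, 'u \<Rightarrow> 'u) cat" where
  "bimonoid_cat B = \<lparr>
     Ob = {H. bimonoid B H \<and> bimod_ext B H},
     Hom = bimonoid_maps B,
     idt = (\<lambda>H. idm H),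
     cmp = (\<lambda>X Y Z g f. compose (carrier X) g f)\<rparr>"

definition cocommutative :: "('k::field, 'b, 'z) bialg_scheme \<Rightarrow> (('b \<times> 'b) \<Rightarrow>\<^sub>0 'k) set \<Rightarrow>
    ('k, 'b, 'v, 'w) bimon_scheme \<Rightarrow> bool" where
  "cocommutative B S H \<longleftrightarrow> (\<forall>x\<in>carrier H. braiding B S H H (com H x) = com H x)"

definition reversion :: "('k::field, 'b, 'z) bialg_scheme \<Rightarrow> ('k, 'b, 'x, 'w) bimod_scheme \<Rightarrow>
    ('k, 'b, 'x) bimod" where
  "reversion B X = vect.extend (vect.truncate X) (bimod.fields
     (\<lambda>b x. ract X x (antipode B b)) (\<lambda>x b. lact X (antipode B b) x))"

definition psi :: "('k::field, 'b, 'z) bialg_scheme \<Rightarrow> ('k, 'b, 'x, 'w) bimod_scheme \<Rightarrow>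
    ('k, 'b, 'y, 'v) bimod_scheme \<Rightarrow> (('x \<times> 'y) \<Rightarrow>\<^sub>0 'k) set \<Rightarrow>
    (('k \<times> (('b \<times> (('x \<times> 'y) \<Rightarrow>\<^sub>0 'k) set) \<Rightarrow>\<^sub>0 'k) set) \<Rightarrow>\<^sub>0 'k) set" where
  "psi B X Y = (let I = unit_I B; J = unit_J B; XY = circ B X Y in
     tlift (reversion B X) Y (circ B J (bull B I XY))
       (\<lambda>x y. celt B J (bull B I XY) 1 (elt I XY (aone B) (celt B X Y x y))))"

definition phi :: "('k::field, 'b, 'z) bialg_scheme \<Rightarrow> ('k, 'b, 'x, 'w) bimod_scheme \<Rightarrow>
    ('k, 'b, 'y, 'v) bimod_scheme \<Rightarrow> (('x \<times> 'y) \<Rightarrow>\<^sub>0 'k) set \<Rightarrow>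
    ((((((('x \<times> 'y) \<Rightarrow>\<^sub>0 'k) set \<times> 'b) \<Rightarrow>\<^sub>0 'k) set) \<times> 'k) \<Rightarrow>\<^sub>0 'k) set" where
  "phi B X Y = (let I = unit_I B; J = unit_J B; XY = circ B X Y in
     tlift X (reversion B Y) (circ B (bull B XY I) J)
       (\<lambda>x y. celt B (bull B XY I) J (elt XY I (celt B X Y x y) (aone B)) 1))"

definition hopf_monoid :: "('k::field, 'b, 'z) bialg_scheme \<Rightarrow> ('k, 'b, 'v, 'w) bimon_scheme \<Rightarrow> bool" where
  "hopf_monoid B H \<longleftrightarrow> bimonoid B H \<and>
    (let I = unit_I B; J = unit_J B; HH = circ B H H; Hr = reversion B H; one = unt H (aone B) in
     \<exists>s \<in> bimod_maps B H Hr. \<forall>h\<in>carrier H.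
       cmap B (bull B HH I) J (bull B H I) J (tmap HH I H I (mul H) (idm I)) (idm J)
           (phi B H H (tmap H H H Hr (idm H) s (com H h)))
         = vsmul (circ B (bull B H I) J) (cou H h)
             (celt B (bull B H I) J (elt H I one (aone B)) 1) \<and>
       cmap B J (bull B I HH) J (bull B I H) (idm J) (tmap I HH I H (idm I) (mul H))
           (psi B H H (tmap H H Hr H s (idm H) (com H h)))
         = vsmul (circ B J (bull B I H)) (cou H h)
             (celt B J (bull B I H) 1 (elt I H (aone B) one)))"

definition Hopf_m_coc :: "('k::field, 'u) bialg \<Rightarrow> (('u \<times> 'u) \<Rightarrow>\<^sub>0 'k) set \<Rightarrow>
    (('k, 'u, 'u) bimon, 'u \<Rightarrow> 'u) cat" where
  "Hopf_m_coc B S = full_subcat (bimonoid_cat B) (\<lambda>H. hopf_monoid B H \<and> cocommutative B S H \<and>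
     monic (bimod_cat B) (unit_I B) (bimod.truncate H) (unt H))"

end

theory Submission
 imports Defs
begin

text \<open>
  A bimonoid \<open>H\<close> is the same thing as a bialgebra with a bialgebra map \<open>u : B \<rightarrow> H\<close>; cocommutativity becomes
  quasi-cocommutativity for \<open>(u \<otimes> u)(S)\<close>, the Hopf condition becomes an antipode (apply a linear
  retraction to the two convolution identities), and \<open>u\<close> is monic iff it is injective. Hence the identity on maps
  is an isomorphism of categories. For protomodularity, the pullback of a split epimorphism \<open>f : X \<rightarrow> Y\<close> with section \<open>s\<close>
  along \<open>g : E \<rightarrow> Y\<close> is an equalizer in \<open>X \<otimes> E\<close> with comultiplication twisted by \<open>S\<close>, and the
  antipode gives every \<open>x\<close> as a sum of products \<open>\<pi>(x\<^sub>1) s(f(x\<^sub>2))\<close> with \<open>\<pi>(x\<^sub>1)\<close> in the kernel part,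
  so a morphism of points that is invertible after pulling back is invertible.
\<close>

text \<open>Two obstacles shape the proof. First, tensors are cosets of formal sums, and nested
  quotients are unwieldy. So every identity is tested on scalars: linear forms separate points,
  hence a tensor is determined by its pairings with multilinear forms. These pairings are finite
  sums \<open>sm\<close>, in which Sweedler notation works literally and sums can be interchanged
  freely. Second, the pullback must itself be quasi-cocommutative. With projections \<open>p\<close>
  and \<open>q\<close>, the relation is needed for the pairs \<open>p,p\<close>, \<open>q,q\<close>,
  \<open>q,p\<close> and \<open>p,q\<close>. The first two come from the given objects and the third
  is built into the twisted comultiplication, but the fourth asks the pullback to commute with the
  image of \<open>S21 S\<close>, where \<open>S21\<close> is the flipped \<open>S\<close>. Here
  injectivity of the unit into \<open>Y\<close> enters: a linear retraction onto \<open>B\<close>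
  shows that coinvariant elements of \<open>X\<close> commute with this element. Finally, objects
  must be carried by \<open>'u\<close>, so the pullback is moved there along an injection of
  \<open>X \<otimes> E\<close>, which exists because \<open>'u\<close> is infinite.\<close>

abbreviation "car == carrier"
abbreviation in_carrier (infix "<:" 50) where "x <: X == x \<in> carrier X"
abbreviation (input) iff2 (infixr "<->" 25) where "P <-> Q == P = Q"
abbreviation "kk == ground"
abbreviation "eps == acounit"
abbreviation "lkp == Poly_Mapping.lookup"
abbreviation "kys == Poly_Mapping.keys"

section \<open>Vector spaces on carrier sets\<close>

abbreviation add_mon :: "('k::field, 'v, 'z) vect_scheme => 'v monoid" where
 "add_mon V == \<lparr>carrier = car V, mult = vadd V, one = vzero V\<rparr>"

lemma vspaceD:
 assumes "vspace V"
 shows "comm_group (add_mon V)"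
 and "x <: V ==> vsmul V c x <: V"
 and "[|x <: V; y <: V|] ==> vsmul V c (vadd V x y) = vadd V (vsmul V c x) (vsmul V c y)"
 and "x <: V ==> vsmul V (c + d) x = vadd V (vsmul V c x) (vsmul V d x)"
 and "x <: V ==> vsmul V c (vsmul V d x) = vsmul V (c * d) x"
 and "x <: V ==> vsmul V 1 x = x"
 using assms unfolding vspace_def by auto

context
 fixes V :: "('k::field, 'v, 'z) vect_scheme"
 assumes V: "vspace V"
begin

interpretation G: comm_group "add_mon V" by (rule vspaceD(1)[OF V])

lemma vadd_closed [simp, intro]: "x <: V ==> y <: V ==> vadd V x y <: V"
 using G.m_closed by simp

lemma vzero_closed [simp, intro]: "vzero V <: V"
 using G.one_closed by simp

lemma vsmul_closed [simp, intro]: "x <: V ==> vsmul V c x <: V" by (rule vspaceD(2)[OF V])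

lemma vadd_assoc: "[|x <: V; y <: V; z <: V|] ==>
 vadd V (vadd V x y) z = vadd V x (vadd V y z)"
 using G.m_assoc by simp

lemma vadd_comm: "[|x <: V; y <: V|] ==> vadd V x y = vadd V y x"
 using G.m_comm by simp

lemma vadd_lcomm: "[|x <: V; y <: V; z <: V|] ==>
 vadd V x (vadd V y z) = vadd V y (vadd V x z)"
 using G.m_lcomm by simp

lemma vadd_zero [simp]: "x <: V ==> vadd V (vzero V) x = x"
 "x <: V ==> vadd V x (vzero V) = x"
 using G.l_one G.r_one by simp_all

lemma vadd_cancel [simp]: "[|x <: V; y <: V; z <: V|] ==>
 vadd V x y = vadd V x z <-> y = z"
 using G.Units_l_cancel[of x y z] G.Units_eq by simp

lemma vsmul_zero [simp]: "x <: V ==> vsmul V 0 x = vzero V"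
 using vspaceD(4)[OF V, of x 0 0] vadd_cancel[of "vsmul V 0 x" "vsmul V 0 x" "vzero V"] by simp

lemma vsmul_vzero [simp]: "vsmul V c (vzero V) = vzero V"
 using vspaceD(5)[OF V, of "vzero V" c 0] by simp

lemma vsmul_one [simp]: "x <: V ==> vsmul V 1 x = x" by (rule vspaceD(6)[OF V])

lemma vneg: "x <: V ==> vadd V x (vsmul V (-1) x) = vzero V"
 "x <: V ==> vadd V (vsmul V (-1) x) x = vzero V"
 using vspaceD(4)[OF V, of x 1 "-1"] vspaceD(4)[OF V, of x "-1" 1] by simp_all

lemma vsub_eq_zero: "[|x <: V; y <: V; vadd V x (vsmul V (-1) y) = vzero V|] ==> x = y"
 by (metis vadd_assoc vadd_zero vneg(2) vsmul_closed)

end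

lemma vspaceI:
 assumes "!!x y. x <: V ==> y <: V ==> vadd V x y <: V"
 and "vzero V <: V"
 and "!!c x. x <: V ==> vsmul V c x <: V"
 and "!!x y z. x <: V ==> y <: V ==> z <: V ==>
 vadd V (vadd V x y) z = vadd V x (vadd V y z)"
 and "!!x y. x <: V ==> y <: V ==> vadd V x y = vadd V y x"
 and "!!x. x <: V ==> vadd V (vzero V) x = x"
 and smul: "!!x. x <: V ==> vsmul V 0 x = vzero V"
 and "!!c x y. x <: V ==> y <: V ==>
 vsmul V c (vadd V x y) = vadd V (vsmul V c x) (vsmul V c y)"
 and add: "!!c d x. x <: V ==> vsmul V (c + d) x = vadd V (vsmul V c x) (vsmul V d x)"
 and "!!c d x. x <: V ==> vsmul V c (vsmul V d x) = vsmul V (c * d) x"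
 and one: "!!x. x <: V ==> vsmul V 1 x = x"
 shows "vspace (V :: ('k::field, 'v, 'z) vect_scheme)"
proof -
 have "comm_group (add_mon V)"
 proof (rule comm_groupI, goal_cases)
 case (6 x)
 \<comment> \<open>Inverses are not among the assumptions; the multiple by \<open>-1\<close> serves,
   by distributing \<open>-1 + 1 = 0\<close>.\<close>
 have "vadd V (vsmul V (-1) x) x = vzero V"
 using add[of x "-1" 1] smul[of x] one[of x] 6 by simp
 thus ?case using 6 assms(3)[of x "-1"] by (auto intro!: bexI[of _ "vsmul V (-1) x"])
 qed (use assms in auto)
 thus ?thesis using assms unfolding vspace_def by auto
qed

lemma vspace_cong:
 assumes "car X = car Y" "vadd X = vadd Y" "vsmul X = vsmul Y" "vzero X = vzero Y"
 shows "vspace X = vspace Y"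
 unfolding vspace_def assms ..

lemma ground_simps [simp]: "car ground = UNIV" "vadd ground = (+)" "vsmul ground = (*)"
 "vzero ground = 0" by (simp_all add: ground_def)

lemma vspace_ground [simp, intro]: "vspace kk" by (rule vspaceI) (auto simp: algebra_simps)

section \<open>Linear maps\<close>

text \<open>Unlike \<open>lin_maps\<close>, no extensionality is demanded, so lambda terms and
  composites count as linear without being restricted to the carrier.\<close>

definition lin :: "('k, 'v, 'z) vect_scheme => ('k, 'w, 'y) vect_scheme => ('v => 'w) => bool" where
 "lin V W f <-> (\<forall>x\<in>car V. f x <: W) &
 (\<forall>x\<in>car V. \<forall>y\<in>car V. f (vadd V x y) = vadd W (f x) (f y)) &
 (\<forall>c. \<forall>x\<in>car V. f (vsmul V c x) = vsmul W c (f x))"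

lemma linI:
 assumes "!!x. x <: V ==> f x <: W"
 and "!!x y. x <: V ==> y <: V ==> f (vadd V x y) = vadd W (f x) (f y)"
 and "!!c x. x <: V ==> f (vsmul V c x) = vsmul W c (f x)"
 shows "lin V W f"
 using assms unfolding lin_def by auto

lemma linD:
 assumes "lin V W f"
 shows "x <: V ==> f x <: W"
 and "x <: V ==> y <: V ==> f (vadd V x y) = vadd W (f x) (f y)"
 and "x <: V ==> f (vsmul V c x) = vsmul W c (f x)"
 using assms unfolding lin_def by auto

lemma lin_vzero: "lin V W f ==> vspace V ==> vspace W ==> f (vzero V) = vzero W"
 using linD(3)[of V W f "vzero V" 0] linD(1)[of V W f "vzero V"] by simp

lemma lin_maps_iff: "f : lin_maps V W <-> f : extensional (car V) & lin V W f"
 unfolding lin_maps_def lin_def PiE_def by auto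

lemma lin_mapsD [dest]: "f : lin_maps V W ==> lin V W f" by (simp add: lin_maps_iff)

lemma lin_cong: "(!!x. x <: V ==> f x = g x) ==> vspace V ==> lin V W f = lin V W g"
 unfolding lin_def by simp

lemma lin_id [simp, intro]: "lin V V (%x. x)" by (rule linI) auto

lemma lin_o: "lin W Z g ==> lin V W f ==> lin V Z (%x. g (f x))"
 unfolding lin_def by auto

lemma lin_vadd: "vspace W ==> lin V W f ==> lin V W g ==> lin V W (%x. vadd W (f x) (g x))"
 by (rule linI) (auto simp: linD vadd_assoc vadd_comm vadd_lcomm vspaceD)

lemma lin_vsmul: "vspace W ==> lin V W f ==> lin V W (%x. vsmul W c (f x))"
 by (rule linI) (auto simp: linD vspaceD mult.commute)

lemma lin_vsmul_left: "vspace W ==> lin V kk f ==> w <: W ==> lin V W (%x. vsmul W (f x) w)"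
 by (rule linI) (auto simp: linD vspaceD)

definition bilin :: "('k, 'x, 'z) vect_scheme => ('k, 'y, 'w) vect_scheme =>
 ('k, 'v, 'u) vect_scheme => ('x => 'y => 'v) => bool" where
 "bilin X Y Z f <-> (\<forall>x\<in>car X. lin Y Z (f x)) & (\<forall>y\<in>car Y. lin X Z (%x. f x y))"

lemma bilinI: "(!!x. x <: X ==> lin Y Z (%y. f x y)) ==>
 (!!y. y <: Y ==> lin X Z (%x. f x y)) ==> bilin X Y Z (%x y. f x y)"
 unfolding bilin_def by auto

lemma bilinD: assumes "bilin X Y Z f"
 shows "x <: X ==> y <: Y ==> f x y <: Z"
 and "lin V X g ==> y <: Y ==> lin V Z (%v. f (g v) y)"
 and "lin V Y h ==> x <: X ==> lin V Z (%v. f x (h v))"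
 using assms unfolding bilin_def by (auto intro: lin_o dest: linD)

section \<open>Complements and separation of points\<close>

definition subsp :: "('k::field, 'v, 'z) vect_scheme => 'v set => bool" where
 "subsp V M <-> M <= car V & vzero V : M & (\<forall>x\<in>M. \<forall>y\<in>M. vadd V x y : M) &
 (\<forall>c. \<forall>x\<in>M. vsmul V c x : M)"

text \<open>Zorn's lemma gives a maximal subspace \<open>M\<close> meeting \<open>N\<close> only in
  zero. A vector outside \<open>M + N\<close> could be adjoined to \<open>M\<close> without creating
  a nonzero intersection, against maximality.\<close>

lemma ex_complement:
 assumes V: "vspace V" and N: "subsp V N"
 obtains M where "subsp V M" "M \<inter> N = {vzero V}"
 "!!v. v <: V ==> \<exists>m\<in>M. \<exists>n\<in>N. v = vadd V m n"
proof -
 let ?A = "{M. subsp V M & M \<inter> N = {vzero V}}"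
 have "\<exists>M\<in>?A. \<forall>X\<in>?A. M <= X --> X = M"
 proof (rule subset_Zorn_nonempty)
 have "{vzero V} \<in> ?A" using V N by (auto simp: subsp_def)
 thus "?A \<noteq> {}" by blast
 next
 fix C assume C: "C \<noteq> {}" "subset.chain ?A C"
 have *: "\<exists>M\<in>C. x : M & y : M" if xy: "x : \<Union>C" "y : \<Union>C" for x y
 proof -
 obtain K L where "K : C" "L : C" "x : K" "y : L" using xy by blast
 moreover have "K <= L \<or> L <= K" using C(2) calculation unfolding subset_chain_def by blast
 ultimately show ?thesis by blast
 qed
 have K: "subsp V K" "K \<inter> N = {vzero V}" if "K : C" for K
 using that C(2) unfolding subset_chain_def by blast+
 have "subsp V (\<Union>C)"
 unfolding subsp_def
 proof (intro conjI ballI allI)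
 show "\<Union>C <= car V" "vzero V : \<Union>C"
 using C(1) K unfolding subsp_def by blast+
 show "vadd V x y : \<Union>C" if "x : \<Union>C" "y : \<Union>C" for x y
 using *[OF that] K(1) unfolding subsp_def by (meson UnionI)
 show "vsmul V c x : \<Union>C" if "x : \<Union>C" for c x
 using that K(1) unfolding subsp_def by (meson UnionE UnionI)
 qed
 moreover have "\<Union>C \<inter> N = {vzero V}" using C(1) K(2) by blast
 ultimately show "\<Union>C : ?A" by blast
 qed
 then obtain M where M: "subsp V M" "M \<inter> N = {vzero V}"
 and max: "!!X. subsp V X ==> X \<inter> N = {vzero V} ==> M <= X ==> X = M"
 by auto
 have cl [simp]: "m : M ==> m <: V" "n : N ==> n <: V" for m n
 using M N by (auto simp: subsp_def)
 have "\<exists>m\<in>M. \<exists>n\<in>N. v = vadd V m n" if v: "v <: V" for v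
 proof (rule ccontr)
 assume no: "\<not> ?thesis"
 define X where "X = {vadd V (vsmul V c v) m | c m. m : M}"
 have X1: "subsp V X" unfolding subsp_def
 proof (intro conjI ballI allI)
 show "X <= car V" using V v by (auto simp: X_def)
 have "vzero V = vadd V (vsmul V 0 v) (vzero V)" using V v by simp
 moreover have "vzero V : M" using M by (auto simp: subsp_def)
 ultimately show "vzero V : X" unfolding X_def by blast
 next
 fix x y assume "x : X" "y : X"
 then obtain c d m n where *: "x = vadd V (vsmul V c v) m" "y = vadd V (vsmul V d v) n" "m : M" "n : M"
 unfolding X_def by auto
 have "vadd V x y = vadd V (vsmul V (c + d) v) (vadd V m n)"
 using * V v by (simp add: vspaceD vadd_assoc vadd_lcomm)
 moreover have "vadd V m n : M" using * M by (auto simp: subsp_def)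
 ultimately show "vadd V x y : X" unfolding X_def by blast
 next
 fix c x assume "x : X"
 then obtain d m where *: "x = vadd V (vsmul V d v) m" "m : M" unfolding X_def by auto
 have "vsmul V c x = vadd V (vsmul V (c * d) v) (vsmul V c m)"
 using * V v by (simp add: vspaceD)
 moreover have "vsmul V c m : M" using * M by (auto simp: subsp_def)
 ultimately show "vsmul V c x : X" unfolding X_def by blast
 qed
 have X2: "X \<inter> N = {vzero V}"
 proof -
 have "x = vzero V" if xXN: "x : X" "x : N" for x
 proof -
 obtain c m where *: "x = vadd V (vsmul V c v) m" "m : M" using xXN unfolding X_def by auto
 show ?thesis
 proof (cases "c = 0")
 case True
 thus ?thesis using * that M V v by auto
 next
 \<comment> \<open>An element \<open>x = c v + m\<close> of \<open>N\<close> with \<open>c\<close>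
   nonzero would exhibit \<open>v\<close> as \<open>-m/c + x/c\<close> in \<open>M + N\<close>,
   contrary to \<open>no\<close>.\<close>
 case False
 have "vadd V (vsmul V (- 1 / c) m) (vsmul V (1 / c) x)
 = vadd V (vadd V (vsmul V (- (1 / c)) m) (vsmul V (1/c) m)) v"
 using * V v False by (simp add: vspaceD vadd_assoc vadd_comm vadd_lcomm)
 also have "vadd V (vsmul V (- (1 / c)) m) (vsmul V (1/c) m) = vzero V"
 using vspaceD(4)[OF V, of m "- (1/c)" "1/c"] * V by simp
 finally have "v = vadd V (vsmul V (- 1 / c) m) (vsmul V (1 / c) x)" using V v by simp
 moreover have "vsmul V (- 1 / c) m : M" "vsmul V (1/c) x : N"
 using M N * that by (auto simp: subsp_def)
 ultimately show ?thesis using no by blast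
 qed
 qed
 moreover have "vzero V : X" "vzero V : N" using X1 N by (auto simp: subsp_def)
 ultimately show ?thesis by blast
 qed
 have "M <= X"
 proof
 fix m assume "m : M"
 hence "m = vadd V (vsmul V 0 v) m" using V v by simp
 thus "m : X" using \<open>m : M\<close> unfolding X_def by blast
 qed
 with max X1 X2 have "X = M" by blast
 moreover have "v : X"
 proof -
 have "v = vadd V (vsmul V 1 v) (vzero V)" using V v by simp
 moreover have "vzero V : M" using M by (auto simp: subsp_def)
 ultimately show ?thesis unfolding X_def by blast
 qed
 ultimately have "v : M" by simp
 moreover have "v = vadd V v (vzero V)" using V v by simp
 moreover have "vzero V : N" using N by (auto simp: subsp_def)
 ultimately show False using no by blast
 qed
 thus ?thesis using that M by blast
qed

text \<open>Projection along a complement of the image, followed by the inverse of \<open>i\<close>.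
  It supplies linear functionals, and later a linear splitting of the injective unit into
  \<open>Y\<close>.\<close>

lemma ex_retraction:
 assumes U: "vspace U" and V: "vspace V" and i: "lin U V i" "inj_on i (car U)"
 obtains r where "lin V U r" "!!u. u <: U ==> r (i u) = u"
proof -
 have N: "subsp V (i ` car U)"
 unfolding subsp_def
 proof (intro conjI ballI allI)
 show "i ` car U <= car V" using linD(1)[OF i(1)] by blast
 have "vzero V = i (vzero U)" using lin_vzero[OF i(1) U V] by simp
 thus "vzero V : i ` car U" using U by blast
 show "vadd V x y : i ` car U" if xy: "x : i ` car U" "y : i ` car U" for x y
 proof -
 obtain u w where "u <: U" "w <: U" "x = i u" "y = i w" using xy by blast
 hence "vadd U u w <: U" "vadd V x y = i (vadd U u w)"
 using U by (simp_all add: linD(2)[OF i(1)])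
 thus ?thesis by blast
 qed
 show "vsmul V c x : i ` car U" if x: "x : i ` car U" for c x
 proof -
 obtain u where "u <: U" "x = i u" using x by blast
 hence "vsmul U c u <: U" "vsmul V c x = i (vsmul U c u)"
 using U by (simp_all add: linD(3)[OF i(1)])
 thus ?thesis by blast
 qed
 qed
 obtain M where M: "subsp V M" "M \<inter> i ` car U = {vzero V}"
 and ex: "!!v. v <: V ==> \<exists>m\<in>M. \<exists>n\<in>i ` car U. v = vadd V m n"
 by (rule ex_complement[OF V N]) blast
 define r where "r v = (THE u. u <: U & (\<exists>m\<in>M. v = vadd V m (i u)))" for v
 have cl [simp]: "m : M ==> m <: V" "u <: U ==> i u <: V" for m u
 using M i by (auto simp: subsp_def linD)
 have r_eq: "r v = u" if u: "u <: U" "m : M" "v = vadd V m (i u)" for v u m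
 unfolding r_def
 proof (rule the_equality)
 show "u <: U & (\<exists>m\<in>M. v = vadd V m (i u))" using u by blast
 fix u' assume "u' <: U & (\<exists>m\<in>M. v = vadd V m (i u'))"
 then obtain m' where *: "u' <: U" "m' : M" "v = vadd V m' (i u')" by blast
 let ?d = "vadd U u' (vsmul U (-1) u)"
 have d: "i ?d = vadd V (i u') (vsmul V (-1) (i u))"
 using i u * U by (simp add: linD[OF i(1)])
 \<comment> \<open>Two decompositions of \<open>v\<close> differ by an element that lies both in
   \<open>M\<close> and in the image of \<open>i\<close>, and is therefore zero.\<close>
 have "vadd V m (vsmul V (-1) m') = vadd V (i u') (vsmul V (-1) (i u))"
 proof -
 have sw: "vadd V (vadd V a b) (vadd V c d) = vadd V (vadd V a c) (vadd V b d)"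
 if "a <: V" "b <: V" "c <: V" "d <: V" for a b c d
 using that V by (simp add: vadd_assoc vadd_lcomm)
 let ?m = "vsmul V (-1) m'" and ?n = "vsmul V (-1) (i u)"
 have cl': "?m <: V" "?n <: V" "m <: V" "m' <: V"
 "i u <: V" "i u' <: V"
 using u * V by simp_all
 have "vadd V m ?m = vadd V (vadd V m ?m) (vadd V (i u) ?n)"
 using cl' V by (simp add: vneg)
 also have "... = vadd V (vadd V m' (i u')) (vadd V ?m ?n)"
 using sw[of m ?m "i u" ?n] cl' * u by simp
 also have "... = vadd V (vadd V m' ?m) (vadd V (i u') ?n)"
 using sw[of m' "i u'" ?m ?n] cl' by simp
 also have "... = vadd V (i u') ?n"
 using cl' V by (simp add: vneg)
 finally show ?thesis .
 qed
 moreover have "vsmul V (-1) m' : M" using * M by (auto simp: subsp_def)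
 hence "vadd V m (vsmul V (-1) m') : M" using u M by (auto simp: subsp_def)
 ultimately have "i ?d : M" using d by simp
 moreover have dU: "?d <: U" using * u U by simp
 ultimately have "i ?d : M \<inter> i ` car U" by (intro IntI imageI)
 hence "i ?d = i (vzero U)" unfolding M(2) using lin_vzero[OF i(1) U V] by simp
 hence "?d = vzero U" using i(2) dU U by (meson inj_onD vzero_closed)
 thus "u' = u" using vsub_eq_zero[OF U] * u by blast
 qed
 have ex': "\<exists>m u. m : M & u <: U & v = vadd V m (i u)" if "v <: V" for v
 using ex[OF that] by auto
 have "lin V U r"
 proof (rule linI)
 fix x assume x: "x <: V"
 obtain m u where mu: "m : M" "u <: U" "x = vadd V m (i u)" using ex'[OF x] by blast
 show "r x <: U" using r_eq mu by simp
 show "r (vsmul V c x) = vsmul U c (r x)" for c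
 proof -
 have "vsmul V c m : M" using M mu by (auto simp: subsp_def)
 moreover have "vsmul V c x = vadd V (vsmul V c m) (i (vsmul U c u))"
 using mu V by (simp add: vspaceD linD[OF i(1)])
 ultimately show ?thesis using r_eq mu U by simp
 qed
 fix y assume y: "y <: V"
 obtain n w where nw: "n : M" "w <: U" "y = vadd V n (i w)" using ex'[OF y] by blast
 have "vadd V m n : M" using M mu nw by (auto simp: subsp_def)
 moreover have "vadd V x y = vadd V (vadd V m n) (i (vadd U u w))"
 using mu nw V by (simp add: linD[OF i(1)] vadd_assoc vadd_lcomm)
 ultimately show "r (vadd V x y) = vadd U (r x) (r y)" using r_eq mu nw U by simp
 qed
 moreover have "r (i u) = u" if "u <: U" for u
 using r_eq[of u "vzero V" "i u"] that V M by (auto simp: subsp_def)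
 ultimately show ?thesis using that by blast
qed

text \<open>If \<open>x - y\<close> were nonzero, scalar multiplication would embed the field as the
  line through it, and a retraction of this embedding is a functional with value 1 there. Almost all
  equations below are reduced to scalars by this criterion.\<close>

lemma functional_eqI:
 assumes V: "vspace V" and x: "x <: V" "y <: V"
 and eq: "!!ph. lin V kk ph ==> ph x = ph y"
 shows "x = y"
proof (rule ccontr)
 assume "x \<noteq> y"
 define v where "v = vadd V x (vsmul V (-1) y)"
 have v: "v <: V" "v \<noteq> vzero V"
 using V x \<open>x \<noteq> y\<close> vsub_eq_zero[OF V x] by (auto simp: v_def)
 have "inj_on (%c. vsmul V c v) UNIV"
 proof (rule injI, rule ccontr)
 fix c d assume cd: "vsmul V c v = vsmul V d v" "c \<noteq> d"
 have "vsmul V (c - d) v = vzero V"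
 using vspaceD(4)[OF V v(1), of c "- d"] vspaceD(4)[OF V v(1), of d "- d"] cd V v by simp
 hence "vsmul V (inverse (c - d) * (c - d)) v = vzero V"
 using vspaceD(5)[OF V v(1), of "inverse (c - d)" "c - d"] V by simp
 thus False using cd V v by simp
 qed
 moreover have "lin kk V (%c. vsmul V c v)" using V v by (auto intro!: linI simp: vspaceD)
 ultimately obtain ph where ph: "lin V kk ph" "!!c. ph (vsmul V c v) = c"
 using ex_retraction[of kk V "%c. vsmul V c v"] V by auto
 have "ph v = 1" using ph(2)[of 1] v V by simp
 moreover have "ph v = ph x - ph y" using V x by (simp add: v_def linD[OF ph(1)])
 ultimately show False using eq[OF ph(1)] by simp
qed

section \<open>Free vector spaces and tensor products\<close>

lemma lookup_fscale [simp]: "lkp (fscale c p) a = c * lkp p a" by (simp add: fscale_def Poly_Mapping.map.rep_eq when_def)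

lemma fscale_single [simp]: "fscale c (Poly_Mapping.single a d) = Poly_Mapping.single a (c * d)"
 by (rule poly_mapping_eqI) (simp add: lookup_single when_def)

lemma keys_fscale: "kys (fscale c p) <= kys p" by (auto simp: in_keys_iff)

global_interpretation fs: module "fscale :: 'k::field => ('p \<Rightarrow>\<^sub>0 'k) => _"
 by unfold_locales (auto intro!: poly_mapping_eqI simp: lookup_add algebra_simps)

lemma subspace_keys: "fs.subspace {p. kys p <= K}"
 unfolding fs.subspace_def by (auto dest: subsetD[OF keys_add] subsetD[OF keys_fscale])

text \<open>Linear extension of \<open>f\<close> to formal combinations. The sum is a
  \<open>finprod\<close> in the additive group, because vector spaces are carried by sets and have
  no type-class addition.\<close>

definition ev :: "('k::field, 'v, 'z) vect_scheme => ('p => 'v) => ('p \<Rightarrow>\<^sub>0 'k) => 'v" where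
 "ev Z f p = finprod (add_mon Z) (%a. vsmul Z (lkp p a) (f a)) (kys p)"

context
 fixes Z :: "('k::field, 'v, 'z) vect_scheme" and f :: "'p => 'v" and K :: "'p set"
 assumes Z: "vspace Z" and f: "!!a. a : K ==> f a <: Z"
begin

interpretation G: comm_group "add_mon Z" by (rule vspaceD(1)[OF Z])

lemma ev_superset:
 assumes "finite A" "kys p <= A" "A <= K"
 shows "ev Z f p = finprod (add_mon Z) (%a. vsmul Z (lkp p a) (f a)) A"
 unfolding ev_def using assms Z f by (intro G.finprod_mono_neutral_cong_left) (auto simp: in_keys_iff subset_iff)

lemma ev_closed: "kys p <= K ==> ev Z f p <: Z"
 unfolding ev_def using Z f G.finprod_closed[of "%a. vsmul Z (lkp p a) (f a)" "kys p"]
 by (auto simp: Pi_iff subset_iff)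

lemma ev_add:
 assumes "kys p <= K" "kys q <= K"
 shows "ev Z f (p + q) = vadd Z (ev Z f p) (ev Z f q)"
proof -
 let ?A = "kys p \<union> kys q"
 have A: "finite ?A" "?A <= K" using assms by auto
 have "ev Z f (p + q) = finprod (add_mon Z) (%a. vsmul Z (lkp (p + q) a) (f a)) ?A"
 using A keys_add[of p q] by (intro ev_superset) auto
 also have "... = finprod (add_mon Z) (%a. vsmul Z (lkp p a) (f a)
 \<otimes>\<^bsub>add_mon Z\<^esub> vsmul Z (lkp q a) (f a)) ?A"
 using A Z f by (intro G.finprod_cong') (auto simp: lookup_add vspaceD subset_iff)
 also have "... = vadd Z (finprod (add_mon Z) (%a. vsmul Z (lkp p a) (f a)) ?A)
 (finprod (add_mon Z) (%a. vsmul Z (lkp q a) (f a)) ?A)"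
 using A Z f by (subst G.finprod_multf) (auto simp: Pi_iff subset_iff)
 also have "... = vadd Z (ev Z f p) (ev Z f q)"
 using A by (subst (1 2) ev_superset[of ?A]) auto
 finally show ?thesis .
qed

lemma vsmul_finprod:
 assumes "finite A" "!!a. a : A ==> g a <: Z"
 shows "vsmul Z c (finprod (add_mon Z) g A) = finprod (add_mon Z) (%a. vsmul Z c (g a)) A"
 using assms
proof (induction A)
 case (insert a A)
 hence "finprod (add_mon Z) g A <: Z"
 using G.finprod_closed[of g A] by (auto simp: Pi_iff)
 with insert Z show ?case by (simp add: G.finprod_insert Pi_iff vspaceD)
qed (use Z in simp)

lemma ev_fscale:
 assumes "kys p <= K"
 shows "ev Z f (fscale c p) = vsmul Z c (ev Z f p)"
proof -
 have "ev Z f (fscale c p)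
 = finprod (add_mon Z) (%a. vsmul Z (lkp (fscale c p) a) (f a)) (kys p)"
 using assms keys_fscale[of c p] by (intro ev_superset) auto
 also have "... = finprod (add_mon Z) (%a. vsmul Z c (vsmul Z (lkp p a) (f a))) (kys p)"
 using assms Z f by (intro G.finprod_cong') (auto simp: vspaceD subset_iff)
 also have "... = vsmul Z c (ev Z f p)"
 using assms Z f unfolding ev_def by (intro vsmul_finprod[symmetric]) auto
 finally show ?thesis .
qed

lemma ev_single: "a : K ==> ev Z f (Poly_Mapping.single a c) = vsmul Z c (f a)"
 using Z f[of a] ev_superset[of "{a}" "Poly_Mapping.single a c"] by simp

lemma ev_diff:
 assumes "kys p <= K" "kys q <= K"
 shows "ev Z f (p - q) = vadd Z (ev Z f p) (vsmul Z (-1) (ev Z f q))"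
proof -
 have "p - q = p + fscale (-1) q" by (rule poly_mapping_eqI) (simp add: lookup_add lookup_minus)
 moreover have "kys (fscale (-1) q) <= K" using assms keys_fscale by fastforce
 ultimately show ?thesis using assms by (simp only: ev_add ev_fscale)
qed

lemma ev_span_zero:
 assumes "p : fs.span R" "!!p. p : R ==> kys p <= K & ev Z f p = vzero Z"
 shows "kys p <= K & ev Z f p = vzero Z"
 using assms(1)
proof (induction rule: fs.span_induct_alt)
 case base
 show ?case using Z by (simp add: ev_def)
next
 case (step c x y)
 have "kys (fscale c x) <= K" using assms(2)[of x] step keys_fscale by fastforce
 moreover have "kys (fscale c x + y) <= K" using calculation step keys_add by fastforce
 ultimately show ?case using step assms(2)[of x] Z by (simp add: ev_add ev_fscale)
qed

end

context
 fixes N :: "('p \<Rightarrow>\<^sub>0 'k::field) set"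
 assumes N: "fs.subspace N"
begin

lemma coset_eq_iff: "coset_of N p = coset_of N q <-> p - q : N"
proof
 assume "coset_of N p = coset_of N q"
 moreover have "p : coset_of N p" using fs.subspace_0[OF N] by (simp add: coset_of_def)
 ultimately show "p - q : N" by (simp add: coset_of_def)
next
 assume pq: "p - q : N"
 have "r - p : N <-> r - q : N" for r
 using fs.subspace_add[OF N _ pq, of "r - p"] fs.subspace_diff[OF N _ pq, of "r - q"] by auto
 thus "coset_of N p = coset_of N q" by (auto simp: coset_of_def)
qed

lemma coset_zero: "coset_of N 0 = N" by (simp add: coset_of_def)

lemma coset_add: "{a + b | a b. a : coset_of N p & b : coset_of N q} = coset_of N (p + q)"
proof (intro equalityI subsetI)
 fix r assume "r : {a + b | a b. a : coset_of N p & b : coset_of N q}"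
 then obtain a b where "r = a + b" "a - p : N" "b - q : N" by (auto simp: coset_of_def)
 thus "r : coset_of N (p + q)"
 using fs.subspace_add[OF N, of "a - p" "b - q"] by (simp add: coset_of_def algebra_simps)
next
 fix r assume "r : coset_of N (p + q)"
 hence "r = p + (r - p)" "p - p : N" "r - p - q : N"
 using fs.subspace_0[OF N] by (auto simp: coset_of_def algebra_simps)
 thus "r : {a + b | a b. a : coset_of N p & b : coset_of N q}"
 unfolding coset_of_def by blast
qed

lemma coset_scale: "{fscale c a + n | a n. a : coset_of N p & n : N} = coset_of N (fscale c p)"
proof (intro equalityI subsetI)
 fix r assume "r : {fscale c a + n | a n. a : coset_of N p & n : N}"
 then obtain a n where *: "r = fscale c a + n" "a - p : N" "n : N" by (auto simp: coset_of_def)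
 hence "fscale c (a - p) + n : N" using N fs.subspace_add fs.subspace_scale by blast
 thus "r : coset_of N (fscale c p)"
 using * by (simp add: coset_of_def fs.scale_right_diff_distrib algebra_simps)
next
 fix r assume "r : coset_of N (fscale c p)"
 hence "r = fscale c p + (r - fscale c p)" "p - p : N" "r - fscale c p : N"
 using fs.subspace_0[OF N] by (auto simp: coset_of_def algebra_simps)
 thus "r : {fscale c a + n | a n. a : coset_of N p & n : N}"
 unfolding coset_of_def by blast
qed

end

text \<open>One construction for both kinds of tensor product: \<open>M\<close> is empty over the
  field and consists of the balancing relations for the product over \<open>B\<close>. The
  assumption \<open>keysM\<close> keeps the relations among pairs from the carriers.\<close>

locale tensor_quot =
 fixes X :: "('k::field, 'x, 'zx) vect_scheme" and Y :: "('k, 'y, 'zy) vect_scheme"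
 and M :: "(('x \<times> 'y) \<Rightarrow>\<^sub>0 'k) set"
 assumes X: "vspace X" and Y: "vspace Y"
 and keysM: "p : M ==> kys p <= car X \<times> car Y"
begin

abbreviation "R == bilin_rels X Y \<union> M"
abbreviation "N == fs.span R"
abbreviation "Q == quot_space N X Y"
abbreviation "qe x y == coset_of N (Poly_Mapping.single (x, y) 1)"

lemma subspace_N: "fs.subspace N"
 by simp

lemma carrier_Q: "car Q = coset_of N ` {p. kys p <= car X \<times> car Y}"
 by (simp add: quot_space_def)

lemma Q_ops: "vzero Q = coset_of N 0" "vadd Q (coset_of N p) (coset_of N q) = coset_of N (p + q)"
 "vsmul Q c (coset_of N p) = coset_of N (fscale c p)"
 using coset_zero[OF subspace_N] coset_add[OF subspace_N] coset_scale[OF subspace_N] by (simp_all add: quot_space_def)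

lemma vspace_Q: "vspace Q"
proof -
 let ?K = "car X \<times> car Y"
 let ?P = "%p. kys p <= ?K"
 have cl: "?P (p + q)" "?P (fscale c p)" if "?P p" "?P q" for p q :: "('x \<times> 'y) \<Rightarrow>\<^sub>0 'k" and c
 using that fs.subspace_add[OF subspace_keys[of ?K], of p q] fs.subspace_scale[OF subspace_keys[of ?K], of p c]
 by simp_all
 have ex: "\<exists>p. ?P p & t = coset_of N p" if "t <: Q" for t
 using that by (auto simp: carrier_Q)
 have mem: "coset_of N p <: Q" if "?P p" for p
 using that by (auto simp: carrier_Q)
 show ?thesis
 proof (rule vspaceI, goal_cases)
 case (1 x y)
 from ex[OF 1(1)] ex[OF 1(2)] obtain px py where
 "?P px" "x = coset_of N px" "?P py" "y = coset_of N py"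
 by blast
 thus ?case by (simp add: Q_ops cl mem)
 next
 case 2
 show ?case using mem[of 0] by (simp add: Q_ops)
 next
 case (3 c x)
 from ex[OF 3(1)] obtain px where
 "?P px" "x = coset_of N px"
 by blast
 thus ?case by (simp add: Q_ops cl mem)
 next
 case (4 x y z)
 from ex[OF 4(1)] ex[OF 4(2)] ex[OF 4(3)] obtain px py pz where
 "?P px" "x = coset_of N px" "?P py" "y = coset_of N py" "?P pz" "z = coset_of N pz"
 by blast
 thus ?case by (simp add: Q_ops add.assoc)
 next
 case (5 x y)
 from ex[OF 5(1)] ex[OF 5(2)] obtain px py where
 "?P px" "x = coset_of N px" "?P py" "y = coset_of N py"
 by blast
 thus ?case by (simp add: Q_ops add.commute)
 next
 case (6 x)
 from ex[OF 6(1)] obtain px where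
 "?P px" "x = coset_of N px"
 by blast
 thus ?case by (simp add: Q_ops)
 next
 case (7 x)
 from ex[OF 7(1)] obtain px where
 "?P px" "x = coset_of N px"
 by blast
 thus ?case by (simp add: Q_ops)
 next
 case (8 c x y)
 from ex[OF 8(1)] ex[OF 8(2)] obtain px py where
 "?P px" "x = coset_of N px" "?P py" "y = coset_of N py"
 by blast
 thus ?case by (simp add: Q_ops fs.scale_right_distrib)
 next
 case (9 c d x)
 from ex[OF 9(1)] obtain px where
 "?P px" "x = coset_of N px"
 by blast
 thus ?case by (simp add: Q_ops fs.scale_left_distrib)
 next
 case (10 c d x)
 from ex[OF 10(1)] obtain px where
 "?P px" "x = coset_of N px"
 by blast
 thus ?case by (simp add: Q_ops)
 next
 case (11 x)
 from ex[OF 11(1)] obtain px where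
 "?P px" "x = coset_of N px"
 by blast
 thus ?case by (simp add: Q_ops)
 qed
qed

lemma qe_closed: "x <: X ==> y <: Y ==> qe x y <: Q" by (auto simp: carrier_Q)

lemma bilin_qe: "bilin X Y Q qe"
proof (intro bilinI linI)
 fix x y assume x: "x <: X" and y: "y <: Y"
 show "qe x y <: Q" "qe x y <: Q" using qe_closed x y by auto
 fix c
 have "Poly_Mapping.single (x, vsmul Y c y) 1 - Poly_Mapping.single (x, y) c : R"
 "Poly_Mapping.single (vsmul X c x, y) 1 - Poly_Mapping.single (x, y) c : R"
 using x y unfolding bilin_rels_def by blast+
 thus "qe x (vsmul Y c y) = vsmul Q c (qe x y)" "qe (vsmul X c x) y = vsmul Q c (qe x y)"
 by (auto simp: Q_ops coset_eq_iff fs.span_base)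
next
 fix x y y' assume "x <: X" "y <: Y" "y' <: Y"
 hence "Poly_Mapping.single (x, vadd Y y y') 1 - Poly_Mapping.single (x, y) 1
 - Poly_Mapping.single (x, y') 1 : R"
 unfolding bilin_rels_def by blast
 thus "qe x (vadd Y y y') = vadd Q (qe x y) (qe x y')" by (auto simp: Q_ops coset_eq_iff diff_diff_eq fs.span_base)
next
 fix y x x' assume "y <: Y" "x <: X" "x' <: X"
 hence "Poly_Mapping.single (vadd X x x', y) 1 - Poly_Mapping.single (x, y) 1
 - Poly_Mapping.single (x', y) 1 : R"
 unfolding bilin_rels_def by blast
 thus "qe (vadd X x x') y = vadd Q (qe x y) (qe x' y)" by (auto simp: Q_ops coset_eq_iff diff_diff_eq fs.span_base)
qed

text \<open>Coefficients are absorbed into the left factor, so sums of simple tensors without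
  scalars exhaust the quotient. Hence the rule has no case for scalar multiples or for zero.\<close>

lemma Q_induct [consumes 1, case_names elt add]:
 assumes t: "t <: Q"
 and elt: "!!x y. x <: X ==> y <: Y ==> P (qe x y)"
 and add: "!!s t. s <: Q ==> t <: Q ==> P s ==> P t ==> P (vadd Q s t)"
 shows "P t"
proof -
 have sc: "coset_of N (Poly_Mapping.single (x, y) c) = qe (vsmul X c x) y"
 if "x <: X" "y <: Y" for x y c
 using linD(3)[OF bilinD(2)[OF bilin_qe lin_id], of y x c] that by (simp add: Q_ops)
 have *: "P (coset_of N p)" if "finite A" "kys p <= A" "A <= car X \<times> car Y" for A p
 using that
 proof (induction A arbitrary: p)
 case empty
 \<comment> \<open>The zero coset is the simple tensor of two zero vectors, so it falls under the
   case \<open>elt\<close>.\<close>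
 hence "coset_of N p = coset_of N (Poly_Mapping.single (vzero X, vzero Y) 0)" by simp
 also have "... = qe (vsmul X 0 (vzero X)) (vzero Y)" using X Y by (intro sc) auto
 finally show ?case by (simp only: elt vsmul_closed[OF X] vzero_closed[OF X] vzero_closed[OF Y])
 next
 case (insert a A)
 let ?s = "Poly_Mapping.single a (lkp p a)"
 let ?q = "p - ?s"
 have k: "kys ?q <= A"
 using insert.prems by (auto simp: in_keys_iff lookup_minus lookup_single when_def split: if_splits)
 obtain x y where a: "a = (x, y)" "x <: X" "y <: Y" using insert.prems by auto
 have "P (vadd Q (coset_of N ?s) (coset_of N ?q))"
 proof (rule add)
 show "P (coset_of N ?q)" using insert.IH k insert.prems by blast
 show "coset_of N ?q <: Q" using k insert.prems by (auto simp: carrier_Q)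
 have "coset_of N ?s = qe (vsmul X (lkp p a) x) y"
 unfolding a(1) by (rule sc[OF a(2,3)])
 thus "P (coset_of N ?s)" "coset_of N ?s <: Q"
 using a elt qe_closed X by simp_all
 qed
 thus ?case by (simp add: Q_ops)
 qed
 from t obtain p where "t = coset_of N p" "kys p <= car X \<times> car Y"
 by (auto simp: carrier_Q)
 thus ?thesis using *[of "kys p" p] by simp
qed

lemma Q_lin_eq:
 assumes "lin Q Z g" "lin Q Z h" "!!x y. x <: X ==> y <: Y ==> g (qe x y) = h (qe x y)"
 and "t <: Q"
 shows "g t = h t"
 using assms(4) by (induction rule: Q_induct) (simp_all add: assms(3) linD[OF assms(1)] linD[OF assms(2)])

definition rp :: "(('x \<times> 'y) \<Rightarrow>\<^sub>0 'k) set => (('x \<times> 'y) \<Rightarrow>\<^sub>0 'k)" where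
 "rp t = (SOME p. p : t & kys p <= car X \<times> car Y)"

context
 fixes Z :: "('k, 'v, 'z) vect_scheme" and f :: "'x => 'y => 'v"
 assumes Z: "vspace Z" and f: "bilin X Y Z f"
 and kill: "!!p. p : M ==> ev Z (%a. f (fst a) (snd a)) p = vzero Z"
begin

text \<open>Bilinearity of \<open>f\<close> makes evaluation vanish on each generator of
  \<open>bilin_rels\<close>, and \<open>kill\<close> does so on the extra relations; evaluation is
  therefore constant on cosets.\<close>

lemma ev_kill:
 assumes "p : N"
 shows "kys p <= car X \<times> car Y & ev Z (%a. f (fst a) (snd a)) p = vzero Z"
proof (rule ev_span_zero[OF Z _ assms])
 show cl: "f (fst a) (snd a) <: Z" if "a : car X \<times> car Y" for a
 using that f by (auto simp: bilinD)
 fix p assume "p : R"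
 thus "kys p <= car X \<times> car Y & ev Z (%a. f (fst a) (snd a)) p = vzero Z"
 proof
 assume p: "p : bilin_rels X Y"
 have sgl: "kys (Poly_Mapping.single a c) <= car X \<times> car Y"
 if "a : car X \<times> car Y" for a and c :: 'k
 using that by simp
 have df: "kys (p - q) <= car X \<times> car Y"
 if "kys p <= car X \<times> car Y" "kys q <= car X \<times> car Y"
 for p q :: "('x \<times> 'y) \<Rightarrow>\<^sub>0 'k"
 using that fs.subspace_diff[OF subspace_keys[of "car X \<times> car Y"], of p q] by simp
 note E = ev_diff[OF Z cl] ev_single[OF Z cl]
 note L = linD[OF bilinD(2)[OF f lin_id]] linD[OF bilinD(3)[OF f lin_id]]
 have neg: "vadd Z (vadd Z (vadd Z a b) (vsmul Z (-1) a)) (vsmul Z (-1) b) = vzero Z"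
 if "a <: Z" "b <: Z" for a b
 using that Z by (simp add: vadd_assoc vadd_lcomm[OF Z, of b "vsmul Z (-1) a"] vneg)
 have neg': "vadd Z (vsmul Z c a) (vsmul Z (- c) a) = vzero Z" if "a <: Z" for a c
 using vspaceD(4)[OF Z that, of c "- c"] that Z by simp
 from p show ?thesis
 unfolding bilin_rels_def by (elim UnE CollectE exE conjE; hypsubst)
 (use X Y Z in \<open>simp_all add: E df sgl L neg neg' vneg bilinD(1)[OF f] vspaceD\<close>)
 qed (use keysM kill in auto)
qed

lemma ev_rp:
 assumes "kys p <= car X \<times> car Y"
 shows "ev Z (%a. f (fst a) (snd a)) (rp (coset_of N p)) = ev Z (%a. f (fst a) (snd a)) p"
proof -
 have cl: "f (fst a) (snd a) <: Z" if "a : car X \<times> car Y" for a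
 using that f by (auto simp: bilinD)
 have "\<exists>q. q : coset_of N p & kys q <= car X \<times> car Y"
 using assms fs.span_zero[of R] by (intro exI[of _ p]) (simp add: coset_of_def)
 hence q: "rp (coset_of N p) - p : N" "kys (rp (coset_of N p)) <= car X \<times> car Y"
 unfolding rp_def by (auto dest!: someI_ex simp: coset_of_def)
 let ?e = "ev Z (%a. f (fst a) (snd a))"
 have c: "?e (rp (coset_of N p)) <: Z" "?e p <: Z"
 using ev_closed[OF Z cl q(2)] ev_closed[OF Z cl assms] by simp_all
 have "vadd Z (?e (rp (coset_of N p))) (vsmul Z (-1) (?e p)) = vzero Z"
 using ev_kill[OF q(1)] ev_diff[OF Z cl q(2) assms] by simp
 with vsub_eq_zero[OF Z c] show ?thesis by simp
qed

lemma lin_ev_rp: "lin Q Z (%t. ev Z (%a. f (fst a) (snd a)) (rp t))"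
proof -
 have cl: "f (fst a) (snd a) <: Z" if "a : car X \<times> car Y" for a
 using that f by (auto simp: bilinD)
 let ?P = "%p. kys p <= car X \<times> car Y"
 have cl': "?P (p + q)" "?P (fscale c p)" if "?P p" "?P q" for p q :: "('x \<times> 'y) \<Rightarrow>\<^sub>0 'k" and c
 using that fs.subspace_add[OF subspace_keys[of "car X \<times> car Y"], of p q]
 fs.subspace_scale[OF subspace_keys[of "car X \<times> car Y"], of p c]
 by simp_all
 have ex: "\<exists>p. ?P p & t = coset_of N p" if "t <: Q" for t
 using that by (auto simp: carrier_Q)
 show ?thesis
 proof (rule linI, goal_cases)
 case (1 t)
 from ex[OF 1] obtain p where "?P p" "t = coset_of N p" by blast
 thus ?case by (simp add: ev_rp ev_closed[OF Z cl])
 next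
 case (2 s t)
 from ex[OF 2(1)] ex[OF 2(2)] obtain p q where "?P p" "s = coset_of N p" "?P q" "t = coset_of N q" by blast
 thus ?case by (simp add: Q_ops ev_rp cl' ev_add[OF Z cl])
 next
 case (3 c t)
 from ex[OF 3] obtain p where "?P p" "t = coset_of N p" by blast
 thus ?case by (simp add: Q_ops ev_rp cl' ev_fscale[OF Z cl])
 qed
qed

lemma ev_rp_qe: "x <: X ==> y <: Y ==> ev Z (%a. f (fst a) (snd a)) (rp (qe x y)) = f x y"
 using f Z ev_single[OF Z, of "car X \<times> car Y" "%a. f (fst a) (snd a)" "(x, y)" 1]
 by (auto simp: ev_rp bilinD)

text \<open>Evaluation at a chosen representative is a linear map with the right values. Two such
  maps agree on simple tensors and, being extensional, are equal. This gives the \<open>THE\<close>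
  in \<open>tlift\<close> and \<open>clift\<close> its meaning.\<close>

lemma the_lift:
 defines "g == (THE g. g : lin_maps Q Z & (\<forall>x\<in>car X. \<forall>y\<in>car Y. g (qe x y) = f x y))"
 shows "g : lin_maps Q Z & (\<forall>x\<in>car X. \<forall>y\<in>car Y. g (qe x y) = f x y)"
 unfolding g_def
proof (rule theI[where P = "%g. g : lin_maps Q Z & (\<forall>x\<in>car X. \<forall>y\<in>car Y. g (qe x y) = f x y)"
 and a = "\<lambda>t\<in>car Q. ev Z (%a. f (fst a) (snd a)) (rp t)"])
 let ?g = "\<lambda>t\<in>car Q. ev Z (%a. f (fst a) (snd a)) (rp t)"
 let ?h = "%t. ev Z (%a. f (fst a) (snd a)) (rp t)"
 have "lin Q Z ?g = lin Q Z ?h" by (rule lin_cong[OF _ vspace_Q]) simp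
 with lin_ev_rp have lg: "lin Q Z ?g" by simp
 have gq: "?g (qe x y) = f x y" if "x <: X" "y <: Y" for x y
 using that by (simp add: ev_rp_qe qe_closed)
 show "?g : lin_maps Q Z & (\<forall>x\<in>car X. \<forall>y\<in>car Y. ?g (qe x y) = f x y)"
 using lg gq unfolding lin_maps_iff by blast
 fix h assume h: "h : lin_maps Q Z & (\<forall>x\<in>car X. \<forall>y\<in>car Y. h (qe x y) = f x y)"
 hence lh: "lin Q Z h" by blast
 show "h = ?g"
 proof (rule extensionalityI[of _ "car Q"])
 show "h : extensional (car Q)" using h by (simp add: lin_maps_iff)
 show "?g : extensional (car Q)" by simp
 fix t assume "t <: Q"
 have hq: "h (qe x y) = ?g (qe x y)" if "x <: X" "y <: Y" for x y
 unfolding gq[OF that] using h that by blast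
 show "h t = ?g t" by (rule Q_lin_eq[OF lh lg hq \<open>t <: Q\<close>])
 qed
qed

end

end

section \<open>Tensor products over the ground field\<close>

lemma tensor_quot_tens: "vspace X ==> vspace Y ==> tensor_quot X Y {}"
 by unfold_locales auto

lemma tens_eq: "tens X Y = quot_space (fs.span (bilin_rels X Y \<union> {})) X Y"
 and elt_eq: "elt X Y x y = coset_of (fs.span (bilin_rels X Y \<union> {})) (Poly_Mapping.single (x, y) 1)"
 by (simp_all add: tens_def ker\<^sub>k_def elt_def)

lemma vspace_tens [simp, intro]: "vspace X ==> vspace Y ==> vspace (tens X Y)"
 unfolding tens_eq by (rule tensor_quot.vspace_Q[OF tensor_quot_tens])

lemma bilin_elt: "vspace X ==> vspace Y ==> bilin X Y (tens X Y) (elt X Y)"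
 unfolding tens_eq elt_eq by (rule tensor_quot.bilin_qe[OF tensor_quot_tens])

lemma elt_closed [simp, intro]: "vspace X ==> vspace Y ==> x <: X ==> y <: Y ==>
 elt X Y x y <: (tens X Y)" by (rule bilinD(1)[OF bilin_elt])

lemma lin_elt:
 assumes "vspace X" "vspace Y"
 shows "lin V X f ==> y <: Y ==> lin V (tens X Y) (%v. elt X Y (f v) y)"
 and "lin V Y g ==> x <: X ==> lin V (tens X Y) (%v. elt X Y x (g v))"
 using bilinD(2,3)[OF bilin_elt[OF assms]] by blast+

lemma tens_induct [consumes 3, case_names elt add]:
 assumes "vspace X" "vspace Y" "t <: (tens X Y)"
 and "!!x y. x <: X ==> y <: Y ==> P (elt X Y x y)"
 and "!!s t. s <: (tens X Y) ==> t <: (tens X Y) ==> P s ==> P t ==> P (vadd (tens X Y) s t)"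
 shows "P t"
 using tensor_quot.Q_induct[OF tensor_quot_tens, of X Y t P] assms unfolding tens_eq elt_eq by blast

lemma tens_lin_eq:
 assumes "vspace X" "vspace Y" "lin (tens X Y) Z g" "lin (tens X Y) Z h"
 and "!!x y. x <: X ==> y <: Y ==> g (elt X Y x y) = h (elt X Y x y)"
 and "t <: (tens X Y)"
 shows "g t = h t"
 using assms(1,2,6) by (induction rule: tens_induct) (simp_all add: assms(5) linD[OF assms(3)] linD[OF assms(4)])

lemma ev_empty_kill: "p : {} ==> ev Z f p = vzero Z"
 by simp

lemma tlift_maps:
 assumes "vspace X" "vspace Y" "vspace Z" "bilin X Y Z f"
 shows "tlift X Y Z f : lin_maps (tens X Y) Z"
 and "x <: X ==> y <: Y ==> tlift X Y Z f (elt X Y x y) = f x y"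
 using tensor_quot.the_lift[OF tensor_quot_tens, OF assms(1,2) assms(3,4) ev_empty_kill]
 unfolding tlift_def tens_eq elt_eq by blast+

lemmas tlift_elt [simp] = tlift_maps(2)

lemma lin_tlift:
 "vspace X ==> vspace Y ==> vspace Z ==> bilin X Y Z f ==> lin V (tens X Y) t ==>
 lin V Z (%v. tlift X Y Z f (t v))"
 using lin_o[OF lin_mapsD[OF tlift_maps(1)]] by blast

lemma tlift_closed [simp, intro]:
 "vspace X ==> vspace Y ==> vspace Z ==> bilin X Y Z f ==> t <: (tens X Y) ==>
 tlift X Y Z f t <: Z"
 using linD(1)[OF lin_mapsD[OF tlift_maps(1)]] by blast

subsection \<open>Summation over a representative\<close>

text \<open>Sweedler's notation: \<^term>\<open>sm X Y t F\<close> stands for the sum of \<open>F t\<^sub>1 t\<^sub>2\<close>, where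
 \<open>t = \<Sum> t\<^sub>1 \<otimes> t\<^sub>2\<close> and \<open>F\<close> is a bilinear form. Since it is defined by means of a
 representative of \<open>t\<close>, it is linear in \<open>F\<close> for arbitrary functions \<open>F\<close>.\<close>

definition rep :: "('k::field, 'x, 'z) vect_scheme => ('k, 'y, 'w) vect_scheme =>
 (('x \<times> 'y) \<Rightarrow>\<^sub>0 'k) set => (('x \<times> 'y) \<Rightarrow>\<^sub>0 'k)" where
 "rep X Y t = (if \<exists>p. p : t & kys p <= car X \<times> car Y
 then SOME p. p : t & kys p <= car X \<times> car Y else 0)"

definition sm :: "('k::field, 'x, 'z) vect_scheme => ('k, 'y, 'w) vect_scheme =>
 (('x \<times> 'y) \<Rightarrow>\<^sub>0 'k) set => ('x => 'y => 'k) => 'k" where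
 "sm X Y t F = (\<Sum>a\<in>kys (rep X Y t). lkp (rep X Y t) a * F (fst a) (snd a))"

lemma keys_rep: "kys (rep X Y t) <= car X \<times> car Y"
proof (cases "\<exists>p. p : t & kys p <= car X \<times> car Y")
 case True
 hence "(SOME p. p : t & kys p <= car X \<times> car Y) : t &
 kys (SOME p. p : t & kys p <= car X \<times> car Y) <= car X \<times> car Y"
 by (rule someI_ex)
 with True show ?thesis unfolding rep_def by simp
next
 case False
 thus ?thesis unfolding rep_def by (simp only: if_False keys_zero empty_subsetI)
qed

lemma smc:
 assumes "!!x y. x <: X ==> y <: Y ==> F x y = G x y"
 shows "sm X Y t F = sm X Y t G"
 unfolding sm_def using keys_rep[of X Y t] assms by (intro sum.cong refl) (auto simp: subset_iff)

text \<open>Declared as a congruence rule so that the simplifier may use membership of the summation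
  variables in their carriers; the Sweedler computations below rely on it.\<close>

lemma sm_arg_cong [cong]:
 "t = t' ==> (!!x y. x <: X ==> y <: Y ==> F x y = G x y) ==> sm X Y t F = sm X Y t' G"
 using smc by blast

lemma sm_add: "sm X Y t (%x y. F x y + G x y) = sm X Y t F + sm X Y t G"
 by (simp add: sm_def sum.distrib algebra_simps)

lemma sm_mult_left: "sm X Y t (%x y. c * F x y) = c * sm X Y t F" by (simp add: sm_def sum_distrib_left mult.left_commute)

lemma sm_mult_right: "sm X Y t (%x y. F x y * c) = sm X Y t F * c" by (simp add: sm_def sum_distrib_right mult.assoc)

text \<open>Both sides are finite sums over fixed representatives, so they interchange for arbitrary
  functions \<open>F\<close>. This freedom is the gain from defining \<open>sm\<close> by a
  representative.\<close>

lemma sm_swap: "sm X Y t (%x y. sm V W s (%v w. F x y v w)) = sm V W s (%v w. sm X Y t (%x y. F x y v w))"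
 unfolding sm_def sum_distrib_left by (subst sum.swap) (simp add: ac_simps)

lemma lin_smI:
 assumes "!!x y. x <: X ==> y <: Y ==> lin V kk (%v. F v x y)"
 shows "lin V kk (%v. sm X Y t (F v))"
proof (rule linI)
 fix u v assume "u <: V" "v <: V"
 hence "sm X Y t (F (vadd V u v)) = sm X Y t (%x y. F u x y + F v x y)"
 by (intro smc) (simp add: linD(2)[OF assms])
 thus "sm X Y t (F (vadd V u v)) = vadd kk (sm X Y t (F u)) (sm X Y t (F v))"
 by (simp add: sm_add)
next
 fix c v assume "v <: V"
 hence "sm X Y t (F (vsmul V c v)) = sm X Y t (%x y. c * F v x y)"
 by (intro smc) (simp add: linD(3)[OF assms])
 thus "sm X Y t (F (vsmul V c v)) = vsmul kk c (sm X Y t (F v))" by (simp add: sm_mult_left)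
qed simp

lemma finprod_ground:
 "finite A ==> finprod \<lparr>carrier = UNIV, mult = (+), one = 0\<rparr> f A = (sum f A :: 'k::field)"
proof (induction A rule: finite_induct)
 interpret G: comm_group "\<lparr>carrier = UNIV, mult = (+), one = 0 :: 'k\<rparr>"
 using vspaceD(1)[OF vspace_ground] by simp
 {
 case empty
 show ?case by simp
 next
 case (insert a A)
 thus ?case using G.finprod_insert[of A a f] by (simp add: Pi_iff)
 }
qed

text \<open>Independence of the representative for bilinear \<open>F\<close>: the representative
  picked by \<open>rep\<close> is the one underlying the lift.\<close>

lemma tlift_ground:
 assumes X: "vspace X" and Y: "vspace Y" and F: "bilin X Y kk F" and t: "t <: (tens X Y)"
 shows "tlift X Y kk F t = sm X Y t F"
proof -
 note q = tensor_quot_tens[OF X Y]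
 have t': "t <: (quot_space (fs.span (bilin_rels X Y \<union> {})) X Y)" using t unfolding tens_eq .
 then obtain p where p: "t = coset_of (fs.span (bilin_rels X Y \<union> {})) p"
 "kys p <= car X \<times> car Y"
 unfolding tensor_quot.carrier_Q[OF q] by blast
 have "p : t" using fs.span_zero[of "bilin_rels X Y \<union> {}"] by (simp add: p coset_of_def)
 with p have "rep X Y t = tensor_quot.rp X Y t"
 unfolding rep_def tensor_quot.rp_def[OF q] by (intro if_P) blast
 hence "sm X Y t F = ev kk (%a. F (fst a) (snd a)) (tensor_quot.rp X Y t)"
 unfolding sm_def ev_def by (simp add: finprod_ground)
 moreover have "tlift X Y kk F t = ev kk (%a. F (fst a) (snd a)) (tensor_quot.rp X Y t)"
 proof (rule tens_lin_eq[OF X Y _ _ _ t, where Z = kk])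
 show "lin (tens X Y) kk (tlift X Y kk F)" by (rule lin_mapsD[OF tlift_maps(1)]) (use assms in auto)
 show "lin (tens X Y) kk (%t. ev kk (%a. F (fst a) (snd a)) (tensor_quot.rp X Y t))"
 unfolding tens_eq by (rule tensor_quot.lin_ev_rp[OF q vspace_ground F ev_empty_kill])
 fix x y assume "x <: X" "y <: Y"
 thus "tlift X Y kk F (elt X Y x y) = ev kk (%a. F (fst a) (snd a)) (tensor_quot.rp X Y (elt X Y x y))"
 using tensor_quot.ev_rp_qe[OF q vspace_ground F ev_empty_kill] tlift_elt[OF X Y vspace_ground F]
 unfolding elt_eq by simp
 qed
 ultimately show ?thesis by simp
qed

lemma sm_elt [simp]:
 assumes "vspace X" "vspace Y" "bilin X Y kk F" "x <: X" "y <: Y"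
 shows "sm X Y (elt X Y x y) F = F x y"
 using tlift_ground[OF assms(1-3), of "elt X Y x y"] assms by simp

lemma lin_sm:
 assumes "vspace X" "vspace Y" "bilin X Y kk F" "lin V (tens X Y) t"
 shows "lin V kk (%v. sm X Y (t v) F)"
proof -
 have "lin (tens X Y) kk (tlift X Y kk F)" by (rule lin_mapsD[OF tlift_maps(1)]) (use assms in auto)
 moreover have "lin (tens X Y) kk (tlift X Y kk F) = lin (tens X Y) kk (%t. sm X Y t F)"
 using assms by (intro lin_cong) (auto simp: tlift_ground)
 ultimately show ?thesis using lin_o assms(4) by blast
qed

text \<open>Both sides are linear in \<open>t\<close> and agree on simple tensors. Together with
  \<open>functional_eqI\<close> this turns identities between lifts into identities of scalar
  sums.\<close>

lemma functional_tlift: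
 assumes "vspace X" "vspace Y" "vspace Z" "bilin X Y Z f" "lin Z kk ph" "t <: (tens X Y)"
 shows "ph (tlift X Y Z f t) = sm X Y t (%x y. ph (f x y))"
proof -
 have b: "bilin X Y kk (%x y. ph (f x y))"
 using assms(4,5) by (intro bilinI) (auto intro: lin_o[of Z] bilinD(2,3)[OF assms(4) lin_id])
 show ?thesis by (rule tens_lin_eq[OF assms(1,2) _ _ _ assms(6), where Z = kk])
 (use assms b in \<open>auto intro!: lin_o[OF assms(5)] lin_tlift lin_sm\<close>)
qed

lemma functional_sm:
 assumes "vspace X" "vspace Y" and ph: "lin (tens X Y) kk ph"
 shows "bilin X Y kk (%x y. ph (elt X Y x y))"
 and "t <: (tens X Y) ==> ph t = sm X Y t (%x y. ph (elt X Y x y))"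
proof -
 show b: "bilin X Y kk (%x y. ph (elt X Y x y))"
 using assms by (intro bilinI) (auto intro!: lin_o[OF ph] lin_elt)
 show "ph t = sm X Y t (%x y. ph (elt X Y x y))" if t: "t <: (tens X Y)"
 by (rule tens_lin_eq[OF assms(1,2) _ _ _ t, where Z = kk])
 (use assms ph b in \<open>auto intro!: lin_sm\<close>)
qed

text \<open>By \<open>functional_sm\<close> every linear form on the tensor product is the pairing
  with a bilinear form, and linear forms separate points.\<close>

lemma tens_eqI:
 assumes "vspace X" "vspace Y" "s <: (tens X Y)" "t <: (tens X Y)"
 and "!!F. bilin X Y kk F ==> sm X Y s F = sm X Y t F"
 shows "s = t"
proof (rule functional_eqI[of "tens X Y"])
 fix ph assume ph: "lin (tens X Y) kk ph"
 note * = functional_sm[OF assms(1,2) ph]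
 show "ph s = ph t" using *(2)[OF assms(3)] *(2)[OF assms(4)] assms(5)[OF *(1)] by simp
qed (use assms in auto)

section \<open>Multilinear maps\<close>

definition trilin :: "('k::field, 'x, 'a) vect_scheme => ('k, 'y, 'b) vect_scheme => ('k, 'z, 'c) vect_scheme =>
 ('k, 'v, 'u) vect_scheme => ('x => 'y => 'z => 'v) => bool" where
 "trilin X Y Z V f <-> (\<forall>x\<in>car X. bilin Y Z V (f x)) &
 (\<forall>y\<in>car Y. \<forall>z\<in>car Z. lin X V (%x. f x y z))"

lemma trilinI:
 assumes "!!x y. x <: X ==> y <: Y ==> lin Z V (%z. f x y z)"
 and "!!x z. x <: X ==> z <: Z ==> lin Y V (%y. f x y z)"
 and "!!y z. y <: Y ==> z <: Z ==> lin X V (%x. f x y z)"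
 shows "trilin X Y Z V (%x y z. f x y z)"
 using assms unfolding trilin_def bilin_def by auto

lemma trilinD:
 assumes "trilin X Y Z V f"
 shows "x <: X ==> y <: Y ==> z <: Z ==> f x y z <: V"
 and "lin U X g ==> y <: Y ==> z <: Z ==> lin U V (%u. f (g u) y z)"
 and "lin U Y h ==> x <: X ==> z <: Z ==> lin U V (%u. f x (h u) z)"
 and "lin U Z k ==> x <: X ==> y <: Y ==> lin U V (%u. f x y (k u))"
proof -
 have b: "bilin Y Z V (f x)" if "x <: X" for x using assms that unfolding trilin_def by blast
 show "x <: X ==> y <: Y ==> z <: Z ==> f x y z <: V"
 using bilinD(1)[OF b] .
 show "lin U Y h ==> x <: X ==> z <: Z ==> lin U V (%u. f x (h u) z)"
 using bilinD(2)[OF b] .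
 show "lin U Z k ==> x <: X ==> y <: Y ==> lin U V (%u. f x y (k u))"
 using bilinD(3)[OF b] .
 assume "y <: Y" "z <: Z"
 hence "lin X V (%x. f x y z)" using assms unfolding trilin_def by blast
 thus "lin U X g ==> lin U V (%u. f (g u) y z)" by (rule lin_o)
qed

lemma tens3_eqI:
 \<comment> \<open>equality in a triple tensor product is tested on trilinear forms\<close>
 assumes "vspace X" "vspace Y" "vspace Z" and s: "s <: (tens X (tens Y Z))" "t <: (tens X (tens Y Z))"
 and eq: "!!F. trilin X Y Z kk F ==>
 sm X (tens Y Z) s (%x p. sm Y Z p (%y z. F x y z)) = sm X (tens Y Z) t (%x p. sm Y Z p (%y z. F x y z))"
 shows "s = t"
proof (rule tens_eqI)
 fix F assume F: "bilin X (tens Y Z) kk F"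
 let ?G = "%x y z. F x (elt Y Z y z)"
 have G: "trilin X Y Z kk ?G"
 using assms(1-3) by (intro trilinI) (auto intro!: bilinD(2,3)[OF F] lin_elt)
 hence b: "bilin Y Z kk (%y z. ?G x y z)" if "x <: X" for x
 using that unfolding trilin_def by blast
 have "F x p = sm Y Z p (%y z. ?G x y z)" if x: "x <: X" and p: "p <: (tens Y Z)" for x p
 by (rule tens_lin_eq[OF assms(2,3) _ _ _ p, where Z = kk])
 (use assms x b[OF x] in \<open>auto intro!: lin_sm bilinD(3)[OF F]\<close>)
 hence "sm X (tens Y Z) u F = sm X (tens Y Z) u (%x p. sm Y Z p (%y z. ?G x y z))" for u
 by (rule smc)
 thus "sm X (tens Y Z) s F = sm X (tens Y Z) t F" using eq[OF G] by simp
qed (use assms in auto)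

section \<open>Algebras and coalgebras in terms of forms\<close>

text \<open>Products associate to the right: \<open>a*[A]b*[A]c\<close> is
  \<open>amul A a (amul A b c)\<close>. Parentheses in later formulas therefore mark the other
  bracketing.\<close>

abbreviation amul_at :: "'a => ('k, 'a, 'z) alg_scheme => 'a => 'a"  ("(_*[_]_)" [71, 0, 70] 70) where
 "x*[A]y == amul A x y"

lemma lin_mult: "lin V kk f ==> lin V kk (%v. f v * c)" "lin V kk f ==> lin V kk (%v. c * f v)"
 unfolding lin_def by (auto simp: algebra_simps)

lemma lin_idm: "vspace V ==> lin V V (idm V)" by (rule linI) auto

text \<open>Linearity in a parameter of the bilinear map rather than in the tensor. It is needed
  whenever lifts are nested, as in associators and in products of tensors.\<close>

lemma lin_tlift_body:
 assumes "vspace X" "vspace Y" "vspace Z" "!!v. v <: V ==> bilin X Y Z (F v)"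
 and F: "!!x y. x <: X ==> y <: Y ==> lin V Z (%v. F v x y)"
 and "t <: (tens X Y)" "vspace V"
 shows "lin V Z (%v. tlift X Y Z (F v) t)"
proof (rule linI)
 note b = assms(4)
 have V: "vspace V" by fact
 have l: "lin (tens X Y) Z (%t. tlift X Y Z (F v) t)" if "v <: V" for v
 using assms b[OF that] by (intro lin_tlift) auto
 show "tlift X Y Z (F v) t <: Z" if "v <: V" for v
 using that assms by simp
 show "tlift X Y Z (F (vadd V u v)) t = vadd Z (tlift X Y Z (F u) t) (tlift X Y Z (F v) t)"
 if "u <: V" "v <: V" for u v by (rule tens_lin_eq[OF assms(1,2) _ _ _ assms(6), where Z = Z])
 (use that assms l V in \<open>auto intro!: lin_vadd simp: linD(2)[OF F]\<close>)
 show "tlift X Y Z (F (vsmul V c v)) t = vsmul Z c (tlift X Y Z (F v) t)"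
 if "v <: V" for c v by (rule tens_lin_eq[OF assms(1,2) _ _ _ assms(6), where Z = Z])
 (use that assms l V in \<open>auto intro!: lin_vsmul simp: linD(3)[OF F]\<close>)
qed

lemma bilin_elt_comp:
 assumes "vspace X'" "vspace Y'" "lin X X' f" "lin Y Y' g"
 shows "bilin X Y (tens X' Y') (%x y. elt X' Y' (f x) (g y))"
 using assms by (intro bilinI lin_elt) (auto simp: linD)

lemma tmap_props:
 assumes "vspace X" "vspace Y" "vspace X'" "vspace Y'" "lin X X' f" "lin Y Y' g"
 shows tmap_maps: "tmap X Y X' Y' f g : lin_maps (tens X Y) (tens X' Y')"
 and tmap_elt: "x <: X ==> y <: Y ==> tmap X Y X' Y' f g (elt X Y x y) = elt X' Y' (f x) (g y)"
 and tmap_closed: "t <: (tens X Y) ==> tmap X Y X' Y' f g t <: (tens X' Y')"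
 and lin_tmap: "lin (tens X Y) (tens X' Y') (tmap X Y X' Y' f g)"
proof -
 note b = bilin_elt_comp[OF assms(3-6)]
 show *: "tmap X Y X' Y' f g : lin_maps (tens X Y) (tens X' Y')"
 unfolding tmap_def using tlift_maps(1)[OF assms(1,2) _ b] assms by blast
 thus "lin (tens X Y) (tens X' Y') (tmap X Y X' Y' f g)" by blast
 thus "t <: (tens X Y) ==> tmap X Y X' Y' f g t <: (tens X' Y')" by (simp add: linD)
 show "x <: X ==> y <: Y ==> tmap X Y X' Y' f g (elt X Y x y) = elt X' Y' (f x) (g y)"
 unfolding tmap_def using tlift_elt[OF assms(1,2) _ b] assms by blast
qed

lemma sm_tlift:
 assumes "vspace X" "vspace Y" "vspace V" "vspace W" "bilin X Y (tens V W) f" "bilin V W kk F"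
 and "t <: (tens X Y)"
 shows "sm V W (tlift X Y (tens V W) f t) F = sm X Y t (%x y. sm V W (f x y) F)"
 by (rule functional_tlift[where ph = "%s. sm V W s F"]) (use assms in \<open>auto intro!: lin_sm\<close>)

lemma sm_tmap:
 assumes "vspace X" "vspace Y" "vspace X'" "vspace Y'" "lin X X' f" "lin Y Y' g"
 and "t <: (tens X Y)" and F: "bilin X' Y' kk F"
 shows "sm X' Y' (tmap X Y X' Y' f g t) F = sm X Y t (%x y. F (f x) (g y))"
 unfolding tmap_def using assms bilin_elt_comp[OF assms(3-6)] by (subst sm_tlift) (auto simp: linD)

lemma sm_flip:
 assumes "vspace X" "vspace Y" "t <: (tens X Y)" and F: "bilin Y X kk F"
 shows "sm Y X (flip X Y t) F = sm X Y t (%x y. F y x)" "flip X Y t <: (tens Y X)"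
proof -
 have b: "bilin X Y (tens Y X) (%x y. elt Y X y x)"
 using assms by (intro bilinI) (auto intro!: lin_elt)
 show "sm Y X (flip X Y t) F = sm X Y t (%x y. F y x)"
 unfolding flip_def using assms b by (subst sm_tlift) auto
 show "flip X Y t <: (tens Y X)" unfolding flip_def using assms b by auto
qed

lemma bilin_sm3:
 assumes "vspace X" "vspace Y" "vspace Z" and F: "trilin X Y Z kk F"
 shows "bilin X (tens Y Z) kk (%x p. sm Y Z p (%y z. F x y z))"
 and "bilin (tens X Y) Z kk (%p z. sm X Y p (%x y. F x y z))"
proof -
 have b: "bilin Y Z kk (F x)" if "x <: X" for x
 using F that unfolding trilin_def by blast
 have b': "bilin X Y kk (%x y. F x y z)" if "z <: Z" for z
 using that by (intro bilinI) (auto intro!: trilinD(2,3)[OF F])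
 show "bilin X (tens Y Z) kk (%x p. sm Y Z p (%y z. F x y z))" by (rule bilinI; intro lin_sm lin_smI) (use assms b in \<open>auto intro!: trilinD(2)[OF F]\<close>)
 show "bilin (tens X Y) Z kk (%p z. sm X Y p (%x y. F x y z))" by (rule bilinI; intro lin_sm lin_smI) (use assms b' in \<open>auto intro!: trilinD(4)[OF F]\<close>)
qed

lemma tassoc_props:
 assumes "vspace X" "vspace Y" "vspace Z" and t: "t <: (tens (tens X Y) Z)"
 shows "tassoc X Y Z t <: (tens X (tens Y Z))"
 and "trilin X Y Z kk F ==> sm X (tens Y Z) (tassoc X Y Z t) (%x p. sm Y Z p (%y z. F x y z))
 = sm (tens X Y) Z t (%p z. sm X Y p (%x y. F x y z))"
proof -
 have b: "bilin X Y (tens X (tens Y Z)) (%x y. elt X (tens Y Z) x (elt Y Z y z))" if "z <: Z" for z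
 using assms that by (intro bilinI lin_elt) auto
 have B: "bilin (tens X Y) Z (tens X (tens Y Z))
 (%t z. tlift X Y (tens X (tens Y Z)) (%x y. elt X (tens Y Z) x (elt Y Z y z)) t)"
 using assms b by (intro bilinI lin_tlift_body lin_tlift lin_elt) auto
 show "tassoc X Y Z t <: (tens X (tens Y Z))"
 unfolding tassoc_def using assms B by simp
 assume F: "trilin X Y Z kk F"
 note b3 = bilin_sm3[OF assms(1-3) F]
 have bF: "bilin Y Z kk (F x)" if "x <: X" for x
 using F that unfolding trilin_def by blast
 show "sm X (tens Y Z) (tassoc X Y Z t) (%x p. sm Y Z p (%y z. F x y z))
 = sm (tens X Y) Z t (%p z. sm X Y p (%x y. F x y z))"
 unfolding tassoc_def using assms b3(1) B b bF by (subst sm_tlift) (auto simp: sm_tlift)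
qed

abbreviation dl :: "('k::field, 'a, 'z) bialg_scheme => 'a => ('a => 'a => 'k) => 'k" where
 "dl H x F == sm H H (acomul H x) F"

lemma coassoc_iff:
 assumes V: "vspace V" and D: "lin V (tens V V) D" and x: "x <: V"
 shows "tassoc V V V (tmap V V (tens V V) V D (idm V) (D x)) = tmap V V V (tens V V) (idm V) D (D x)
 <-> (\<forall>F. trilin V V V kk F -->
 sm V V (D x) (%a b. sm V V (D a) (%c d. F c d b)) = sm V V (D x) (%a b. sm V V (D b) (%c d. F a c d)))"
 (is "?l = ?r <-> _")
proof -
 note Dx = linD(1)[OF D x]
 have l1: "lin V (tens V V) (%v. D v)" and id: "lin V V (idm V)" using D V by (auto intro: lin_idm)
 have cl: "tmap V V (tens V V) V D (idm V) (D x) <: (tens (tens V V) V)"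
 "tmap V V V (tens V V) (idm V) D (D x) <: (tens V (tens V V))"
 using V D id Dx by (auto intro!: tmap_closed)
 have L: "sm V (tens V V) ?l (%x p. sm V V p (%y z. F x y z))
 = sm V V (D x) (%a b. sm V V (D a) (%c d. F c d b))"
 "sm V (tens V V) ?r (%x p. sm V V p (%y z. F x y z))
 = sm V V (D x) (%a b. sm V V (D b) (%c d. F a c d))" if F: "trilin V V V kk F" for F
 using V D id Dx cl F bilin_sm3[OF V V V F] by (simp_all add: tassoc_props(2) sm_tmap)
 show ?thesis
 proof
 assume "?l = ?r"
 thus "\<forall>F. trilin V V V kk F -->
 sm V V (D x) (%a b. sm V V (D a) (%c d. F c d b)) = sm V V (D x) (%a b. sm V V (D b) (%c d. F a c d))"
 using L by metis
 next
 assume *: "\<forall>F. trilin V V V kk F -->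
 sm V V (D x) (%a b. sm V V (D a) (%c d. F c d b)) = sm V V (D x) (%a b. sm V V (D b) (%c d. F a c d))"
 show "?l = ?r" by (rule tens3_eqI[OF V V V tassoc_props(1)[OF V V V cl(1)] cl(2)]) (use * L in simp)
 qed
qed

lemma counit_iff:
 assumes V: "vspace V" and D: "lin V (tens V V) D" and e: "lin V kk e" and x: "x <: V"
 shows "tlunit V (tmap V V kk V e (idm V) (D x)) = x <->
 (\<forall>ph. lin V kk ph --> sm V V (D x) (%a b. e a * ph b) = ph x)"
 and "trunit V (tmap V V V kk (idm V) e (D x)) = x <->
 (\<forall>ph. lin V kk ph --> sm V V (D x) (%a b. ph a * e b) = ph x)"
proof -
 note Dx = linD(1)[OF D x]
 have id: "lin V V (idm V)" using V by (rule lin_idm)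
 have b: "bilin kk V V (%c x. vsmul V c x)" "bilin V kk V (%x c. vsmul V c x)"
 using V by (auto intro!: bilinI lin_vsmul lin_vsmul_left)
 have cl: "tmap V V kk V e (idm V) (D x) <: (tens kk V)"
 "tmap V V V kk (idm V) e (D x) <: (tens V kk)"
 using V D id Dx e by (auto intro!: tmap_closed)
 have cl': "tlunit V (tmap V V kk V e (idm V) (D x)) <: V"
 "trunit V (tmap V V V kk (idm V) e (D x)) <: V"
 unfolding tlunit_def trunit_def using b cl V by auto
 have L: "ph (tlunit V (tmap V V kk V e (idm V) (D x))) = sm V V (D x) (%a b. e a * ph b)" (is "?l2 = ?r2")
 "ph (trunit V (tmap V V V kk (idm V) e (D x))) = sm V V (D x) (%a b. ph a * e b)"
 if ph: "lin V kk ph" for ph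
 proof -
 have bb: "bilin kk V kk (%c x. c * ph x)" "bilin V kk kk (%x c. c * ph x)"
 using ph by (auto intro!: bilinI lin_mult)
 show "?l2 = ?r2"
 "ph (trunit V (tmap V V V kk (idm V) e (D x))) = sm V V (D x) (%a b. ph a * e b)"
 unfolding tlunit_def trunit_def using V b cl id Dx e bb by (simp_all add: functional_tlift[OF _ _ _ _ ph] linD(3)[OF ph] sm_tmap mult.commute)
 qed
 show "tlunit V (tmap V V kk V e (idm V) (D x)) = x <->
 (\<forall>ph. lin V kk ph --> sm V V (D x) (%a b. e a * ph b) = ph x)"
 using L(1) functional_eqI[OF V cl'(1) x] by metis
 show "trunit V (tmap V V V kk (idm V) e (D x)) = x <->
 (\<forall>ph. lin V kk ph --> sm V V (D x) (%a b. ph a * e b) = ph x)"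
 using L(2) functional_eqI[OF V cl'(2) x] by metis
qed

text \<open>Sweedler form of the axioms: associator and unitors disappear once both sides are paired
  with trilinear or linear forms.\<close>

lemma coalgebra_iff:
 "coalgebra V D e <-> vspace V & D : lin_maps V (tens V V) & e : lin_maps V kk &
 (\<forall>x\<in>car V. (\<forall>F. trilin V V V kk F -->
 sm V V (D x) (%a b. sm V V (D a) (%c d. F c d b)) = sm V V (D x) (%a b. sm V V (D b) (%c d. F a c d)))) &
 (\<forall>x\<in>car V. \<forall>ph. lin V kk ph --> sm V V (D x) (%a b. e a * ph b) = ph x) &
 (\<forall>x\<in>car V. \<forall>ph. lin V kk ph --> sm V V (D x) (%a b. ph a * e b) = ph x)"
proof (cases "vspace V & D : lin_maps V (tens V V) & e : lin_maps V kk")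
 case True
 hence "lin V (tens V V) D" "lin V kk e" "vspace V" by auto
 with True show ?thesis unfolding coalgebra_def by (simp add: coassoc_iff counit_iff)
next
 case False
 thus ?thesis unfolding coalgebra_def by argo
qed

lemma coalgebraD:
 assumes "coalgebra V D e"
 shows "vspace V" "lin V (tens V V) D" "lin V kk e"
 and "x <: V ==> trilin V V V kk F ==>
 sm V V (D x) (%a b. sm V V (D a) (%c d. F c d b)) = sm V V (D x) (%a b. sm V V (D b) (%c d. F a c d))"
 and "x <: V ==> lin V kk ph ==> sm V V (D x) (%a b. e a * ph b) = ph x"
 and "x <: V ==> lin V kk ph ==> sm V V (D x) (%a b. ph a * e b) = ph x"
 using assms unfolding coalgebra_iff by (simp_all add: lin_maps_iff)

text \<open>Replaces the ring structure by bilinearity, so that the linearity rules apply to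
  products; additive inverses are multiples by \<open>-1\<close>.\<close>

lemma algebra_iff:
 "algebra A <-> vspace A & bilin A A A (amul A) & aone A <: A &
 (\<forall>x\<in>car A. \<forall>y\<in>car A. \<forall>z\<in>car A. (x*[A]y)*[A]z = x*[A](y*[A]z)) &
 (\<forall>x\<in>car A. aone A*[A]x = x & x*[A]aone A = x)"
proof
 let ?R = "\<lparr>carrier = car A, mult = amul A, one = aone A, zero = vzero A, add = vadd A\<rparr>"
 assume "algebra A"
 hence *: "vspace A" "ring ?R" and sm: "!!c x y. x <: A ==> y <: A ==>
 amul A (vsmul A c x) y = vsmul A c (amul A x y) & amul A x (vsmul A c y) = vsmul A c (amul A x y)"
 unfolding algebra_def by auto
 interpret R: ring ?R by fact
 have "bilin A A A (amul A)"
 using sm R.m_closed R.l_distr R.r_distr by (intro bilinI linI) simp_all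
 thus "vspace A & bilin A A A (amul A) & aone A <: A &
 (\<forall>x\<in>car A. \<forall>y\<in>car A. \<forall>z\<in>car A. (x*[A]y)*[A]z = x*[A](y*[A]z)) &
 (\<forall>x\<in>car A. aone A*[A]x = x & x*[A]aone A = x)"
 using * R.m_assoc R.one_closed R.l_one R.r_one by simp
next
 let ?R = "\<lparr>carrier = car A, mult = amul A, one = aone A, zero = vzero A, add = vadd A\<rparr>"
 assume *: "vspace A & bilin A A A (amul A) & aone A <: A &
 (\<forall>x\<in>car A. \<forall>y\<in>car A. \<forall>z\<in>car A. (x*[A]y)*[A]z = x*[A](y*[A]z)) &
 (\<forall>x\<in>car A. aone A*[A]x = x & x*[A]aone A = x)"
 hence V: "vspace A" and b: "bilin A A A (amul A)" by auto
 note L = linD[OF bilinD(2)[OF b lin_id]] linD[OF bilinD(3)[OF b lin_id]]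
 have "ring ?R"
 proof (rule ringI)
 show "abelian_group ?R"
 proof (rule abelian_groupI, goal_cases)
 case (6 x)
 thus ?case using V vneg(2)[OF V, of x] by (auto intro!: bexI[of _ "vsmul A (-1) x"])
 qed (use V in \<open>auto simp: vadd_assoc vadd_comm vadd_lcomm\<close>)
 show "Group.monoid ?R" by (rule monoidI) (use * b in \<open>auto simp: bilinD(1)\<close>)
 qed (use L in simp_all)
 thus "algebra A" unfolding algebra_def using V L by simp
qed

lemma algebraD:
 assumes "algebra A"
 shows "vspace A" and "bilin A A A (amul A)" and "aone A <: A"
 and "[|x <: A; y <: A; z <: A|] ==> (x*[A]y)*[A]z = x*[A](y*[A]z)"
 and "x <: A ==> aone A*[A]x = x" and "x <: A ==> x*[A]aone A = x"
 and "[|x <: A; y <: A|] ==> x*[A]y <: A"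
 and "lin V A f ==> y <: A ==> lin V A (%v. f v*[A]y)"
 and "lin V A f ==> x <: A ==> lin V A (%v. x*[A]f v)"
proof -
 have b: "bilin A A A (amul A)" using assms unfolding algebra_iff by blast
 show "vspace A" "bilin A A A (amul A)" "aone A <: A"
 "[|x <: A; y <: A; z <: A|] ==> (x*[A]y)*[A]z = x*[A](y*[A]z)"
 "x <: A ==> aone A*[A]x = x" "x <: A ==> x*[A]aone A = x"
 using assms unfolding algebra_iff by simp_all
 show "[|x <: A; y <: A|] ==> x*[A]y <: A"
 "lin V A f ==> y <: A ==> lin V A (%v. f v*[A]y)"
 "lin V A f ==> x <: A ==> lin V A (%v. x*[A]f v)"
 using bilinD[OF b] by blast+
qed

lemmas alg_simps = algebraD(3-7)
lemmas alg_lin = algebraD(8,9)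

subsection \<open>The tensor product of algebras\<close>

lemma talg_simps [simp]:
 "car (talg A B) = car (tens A B)" "vadd (talg A B) = vadd (tens A B)"
 "vsmul (talg A B) = vsmul (tens A B)" "vzero (talg A B) = vzero (tens A B)"
 "aone (talg A B) = elt A B (aone A) (aone B)" by (simp_all add: talg_def vect.extend_def alg.fields_def)

lemma amul_talg: "amul (talg A B) s t = tlift A B (tens A B) (%a b.
 tlift A B (tens A B) (%a' b'. elt A B (amul A a a') (amul B b b')) t) s"
 by (simp add: talg_def vect.extend_def alg.fields_def)

lemma lin_talg_iff: "lin V (talg A B) f = lin V (tens A B) f" "lin (talg A B) V g = lin (tens A B) V g"
 by (simp_all add: lin_def)

context
 fixes A :: "('k::field, 'a, 'za) alg_scheme" and B :: "('k, 'b, 'zb) alg_scheme"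
 assumes A: "algebra A" and B: "algebra B"
begin

lemma vspace_AB: "vspace A" "vspace B"
 using A B algebraD(1) by blast+

lemma bilin_talg_body:
 assumes "a <: A" "b <: B"
 shows "bilin A B (tens A B) (%a' b'. elt A B (amul A a a') (amul B b b'))"
 using assms A B vspace_AB by (intro bilin_elt_comp alg_lin) auto

lemma bilin_talg: "t <: (tens A B) ==> bilin A B (tens A B) (%a b.
 tlift A B (tens A B) (%a' b'. elt A B (amul A a a') (amul B b b')) t)"
 by (rule bilinI; rule lin_tlift_body)
 (use vspace_AB A B bilin_talg_body in \<open>auto intro!: lin_elt alg_lin simp: alg_simps\<close>)

lemma talg_closed: "s <: (tens A B) ==> t <: (tens A B) ==> s*[talg A B]t <: (tens A B)"
 unfolding amul_talg using vspace_AB bilin_talg by simp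

lemma sm_talg:
 assumes "s <: (tens A B)" "t <: (tens A B)" "bilin A B kk F"
 shows "sm A B (s*[talg A B]t) F = sm A B s (%a b. sm A B t (%a' b'. F (a*[A]a') (b*[B]b')))"
 unfolding amul_talg using assms vspace_AB bilin_talg bilin_talg_body A B
 by (simp add: sm_tlift alg_simps)

lemma elt_mult_elt:
 assumes "a <: A" "b <: B" "a' <: A" "b' <: B"
 shows "elt A B a b*[talg A B]elt A B a' b' = elt A B (a*[A]a') (b*[B]b')"
 unfolding amul_talg using assms vspace_AB bilin_talg bilin_talg_body by simp

lemma lin_talg:
 "lin V (tens A B) f ==> t <: (tens A B) ==> lin V (tens A B) (%v. f v*[talg A B]t)"
 "vspace V ==> lin V (tens A B) f ==> t <: (tens A B) ==> lin V (tens A B) (%v. t*[talg A B]f v)"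
proof -
 assume t: "t <: (tens A B)"
 show "lin V (tens A B) f ==> lin V (tens A B) (%v. f v*[talg A B]t)"
 unfolding amul_talg using vspace_AB bilin_talg[OF t] by (intro lin_tlift) auto
 have *: "lin (tens A B) (tens A B) (%s. t*[talg A B]s)"
 unfolding amul_talg by (rule lin_tlift_body)
 (use t vspace_AB A B bilin_talg bilin_talg_body in \<open>auto intro!: lin_tlift lin_id\<close>)
 assume "lin V (tens A B) f"
 thus "lin V (tens A B) (%v. t*[talg A B]f v)" by (rule lin_o[OF *])
qed

lemma algebra_talg: "algebra (talg A B)"
 unfolding algebra_iff
proof (intro conjI ballI)
 show "vspace (talg A B)" using vspace_AB vspace_cong[of "talg A B" "tens A B"] by simp
 show "bilin (talg A B) (talg A B) (talg A B) (amul (talg A B))"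
 using vspace_AB by (intro bilinI) (auto intro!: lin_talg lin_id simp: lin_talg_iff)
 show "aone (talg A B) <: (talg A B)" using A B vspace_AB by (auto simp: alg_simps)
 note cl = talg_closed
 fix x assume "x <: (talg A B)"
 hence x: "x <: (tens A B)" by simp
 have b: "bilin A B kk (%a b. F (p*[A]a) (q*[B]b))"
 "bilin A B kk (%a b. sm A B z (%a' b'. F (a*[A]a') (b*[B]b')))"
 if "p <: A" "q <: B" "bilin A B kk F" for p q z F
 using that A B by (auto intro!: bilinI lin_smI alg_lin[OF A] alg_lin[OF B] lin_id bilinD(2,3)[OF that(3)] simp: alg_simps)
 note b1 = b[OF algebraD(3)[OF A] algebraD(3)[OF B]]
 show "aone (talg A B)*[talg A B]x = x" "x*[talg A B]aone (talg A B) = x"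
 by (rule tens_eqI[OF vspace_AB], use A B x vspace_AB b b1 in \<open>simp_all add: cl alg_simps sm_talg\<close>)+
 fix y z assume "y <: (talg A B)" "z <: (talg A B)"
 hence yz: "y <: (tens A B)" "z <: (tens A B)" by simp_all
 show "(x*[talg A B]y)*[talg A B]z = x*[talg A B](y*[talg A B]z)"
 proof (rule tens_eqI[OF vspace_AB])
 fix F assume F: "bilin A B kk F"
 show "sm A B ((x*[talg A B]y)*[talg A B]z) F = sm A B (x*[talg A B](y*[talg A B]z)) F"
 using x yz F A B b b1 by (simp add: cl sm_talg alg_simps)
 qed (use x yz in \<open>auto intro!: cl\<close>)
qed

end

section \<open>Bialgebras and antipodes\<close>

text \<open>Later fact lists append \<open>algebraD\<close> to these thirteen facts. The indices to
  remember are 7 for coassociativity, 8 and 9 for the counit laws, 10 and 11 for the coproduct of a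
  product and of 1, 16 for closure of the unit, 17 for associativity, 18 and 19 for the unit laws,
  and 20 for closure of products.\<close>

lemma bialgD:
 assumes "bialgebra H"
 shows "algebra H" "coalgebra H (acomul H) (eps H)" "vspace H"
 "lin H (tens H H) (acomul H)" "lin H kk (eps H)"
 "x <: H ==> acomul H x <: (tens H H)"
 "x <: H ==> trilin H H H kk G ==>
 dl H x (%a b. dl H a (%c d. G c d b)) = dl H x (%a b. dl H b (%c d. G a c d))"
 "x <: H ==> lin H kk ph ==> dl H x (%a b. eps H a * ph b) = ph x"
 "x <: H ==> lin H kk ph ==> dl H x (%a b. ph a * eps H b) = ph x"
 "x <: H ==> y <: H ==> bilin H H kk F ==>
 dl H (x*[H]y) F = dl H x (%a b. dl H y (%c d. F (a*[H]c) (b*[H]d)))"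
 "bilin H H kk F ==> dl H (aone H) F = F (aone H) (aone H)"
 "x <: H ==> y <: H ==> eps H (x*[H]y) = eps H x * eps H y"
 "eps H (aone H) = 1"
proof -
 show A: "algebra H" and C: "coalgebra H (acomul H) (eps H)"
 using assms unfolding bialgebra_def by blast+
 show "vspace H" and D: "lin H (tens H H) (acomul H)" and "lin H kk (eps H)"
 using coalgebraD(1-3)[OF C] .
 show Dc: "x <: H ==> acomul H x <: (tens H H)" for x by (rule linD(1)[OF D])
 show "x <: H ==> trilin H H H kk G ==>
 dl H x (%a b. dl H a (%c d. G c d b)) = dl H x (%a b. dl H b (%c d. G a c d))"
 by (rule coalgebraD(4)[OF C])
 show "x <: H ==> lin H kk ph ==> dl H x (%a b. eps H a * ph b) = ph x"
 by (rule coalgebraD(5)[OF C])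
 show "x <: H ==> lin H kk ph ==> dl H x (%a b. ph a * eps H b) = ph x"
 by (rule coalgebraD(6)[OF C])
 show "eps H (aone H) = 1"
 "x <: H ==> y <: H ==> eps H (x*[H]y) = eps H x * eps H y"
 using assms unfolding bialgebra_def by simp_all
 have *: "x <: H ==> y <: H ==> acomul H (x*[H]y) = acomul H x*[talg H H]acomul H y"
 "acomul H (aone H) = elt H H (aone H) (aone H)"
 using assms unfolding bialgebra_def by simp_all
 show "x <: H ==> y <: H ==> bilin H H kk F ==>
 dl H (x*[H]y) F = dl H x (%a b. dl H y (%c d. F (a*[H]c) (b*[H]d)))"
 using *(1) A Dc by (simp add: sm_talg)
 show "bilin H H kk F ==> dl H (aone H) F = F (aone H) (aone H)"
 using *(2) algebraD[OF A] by simp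
qed

lemma bialgebraI:
 assumes A: "algebra H" and C: "coalgebra H (acomul H) (eps H)"
 and m: "!!x y F. x <: H ==> y <: H ==> bilin H H kk F ==>
 dl H (x*[H]y) F = dl H x (%a b. dl H y (%c d. F (a*[H]c) (b*[H]d)))"
 and o: "!!F. bilin H H kk F ==> dl H (aone H) F = F (aone H) (aone H)"
 and "!!x y. x <: H ==> y <: H ==> eps H (x*[H]y) = eps H x * eps H y"
 and "eps H (aone H) = 1"
 shows "bialgebra H"
proof -
 have V: "vspace H" and Dc: "!!x. x <: H ==> acomul H x <: (tens H H)"
 using coalgebraD(1,2)[OF C] by (auto simp: linD)
 have "acomul H (x*[H]y) = acomul H x*[talg H H]acomul H y" if "x <: H" "y <: H" for x y
 by (rule tens_eqI[OF V V]) (use that A m Dc in \<open>simp_all add: talg_closed sm_talg alg_simps\<close>)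
 moreover have "acomul H (aone H) = elt H H (aone H) (aone H)" by (rule tens_eqI[OF V V]) (use V A o Dc in \<open>simp_all add: alg_simps\<close>)
 ultimately show ?thesis unfolding bialgebra_def using assms by simp
qed

section \<open>Antipodes as two-sided convolution inverses\<close>

lemma is_antipode_iff:
 assumes "bialgebra H"
 shows "is_antipode H s <-> s : lin_maps H H & (\<forall>x\<in>car H. \<forall>ph. lin H kk ph -->
 dl H x (%a b. ph (s a*[H]b)) = eps H x * ph (aone H) &
 dl H x (%a b. ph (a*[H]s b)) = eps H x * ph (aone H))"
proof (cases "s : lin_maps H H")
 case True
 hence s: "lin H H s" by blast
 note H = bialgD[OF assms] algebraD[OF bialgD(1)[OF assms]]
 have b: "bilin H H H (%a b. s a*[H]b)" "bilin H H H (%a b. a*[H]s b)"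
 using s H by (auto intro!: bilinI alg_lin lin_id simp: linD)
 have e: "tlift H H H (%a b. s a*[H]b) (acomul H x) = vsmul H (eps H x) (aone H) <->
 (\<forall>ph. lin H kk ph --> dl H x (%a b. ph (s a*[H]b)) = eps H x * ph (aone H))" (is "?l = ?r <-> _")
 "tlift H H H (%a b. a*[H]s b) (acomul H x) = vsmul H (eps H x) (aone H) <->
 (\<forall>ph. lin H kk ph --> dl H x (%a b. ph (a*[H]s b)) = eps H x * ph (aone H))" (is "?l' = ?r <-> _")
 if x: "x <: H" for x
 proof -
 have cl: "?l <: H" "?l' <: H" "?r <: H"
 using H b x by simp_all
 have L: "ph ?l = dl H x (%a b. ph (s a*[H]b))" "ph ?l' = dl H x (%a b. ph (a*[H]s b))"
 "ph ?r = eps H x * ph (aone H)" if "lin H kk ph" for ph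
 using that H b x by (simp_all add: functional_tlift linD(3)[OF that])
 show "?l = ?r <-> (\<forall>ph. lin H kk ph --> dl H x (%a b. ph (s a*[H]b)) = eps H x * ph (aone H))"
 proof
 assume *: "\<forall>ph. lin H kk ph --> dl H x (%a b. ph (s a*[H]b)) = eps H x * ph (aone H)"
 show "?l = ?r" by (rule functional_eqI[OF H(3) cl(1,3)]) (use * L in simp)
 qed (use L in metis)
 show "?l' = ?r <-> (\<forall>ph. lin H kk ph --> dl H x (%a b. ph (a*[H]s b)) = eps H x * ph (aone H))"
 proof
 assume *: "\<forall>ph. lin H kk ph --> dl H x (%a b. ph (a*[H]s b)) = eps H x * ph (aone H)"
 show "?l' = ?r" by (rule functional_eqI[OF H(3) cl(2,3)]) (use * L in simp)
 qed (use L in metis)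
 qed
 have "is_antipode H s <-> (\<forall>x\<in>car H.
 (\<forall>ph. lin H kk ph --> dl H x (%a b. ph (s a*[H]b)) = eps H x * ph (aone H)) &
 (\<forall>ph. lin H kk ph --> dl H x (%a b. ph (a*[H]s b)) = eps H x * ph (aone H)))"
 unfolding is_antipode_def using True e by simp
 thus ?thesis using True by blast
qed (simp add: is_antipode_def)

text \<open>The monoid argument \<open>f = f (g h) = (f g) h = h\<close> in the convolution algebra
  of linear maps from \<open>C\<close> to \<open>A\<close>. It yields uniqueness of antipodes, their
  behaviour under the coproduct, and their naturality under bialgebra maps.\<close>

lemma conv_unique:
 assumes C: "coalgebra C D e" and A: "algebra A"
 and f: "lin C A f" and g: "lin C A g" and h: "lin C A h"
 and fg: "!!x ph. x <: C ==> lin A kk ph ==> sm C C (D x) (%a b. ph (f a*[A]g b)) = e x * ph (aone A)"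
 and gh: "!!x ph. x <: C ==> lin A kk ph ==> sm C C (D x) (%a b. ph (g a*[A]h b)) = e x * ph (aone A)"
 and x: "x <: C"
 shows "f x = h x"
proof (rule functional_eqI[OF algebraD(1)[OF A]])
 show "f x <: A" "h x <: A" using x f h by (auto simp: linD)
 fix ph assume ph: "lin A kk ph"
 note L = lin_o[OF ph] lin_o[OF f] lin_o[OF g] lin_o[OF h] alg_lin[OF A] lin_id
 note cl = linD(1)[OF f] linD(1)[OF g] linD(1)[OF h] alg_simps[OF A]
 have "ph (f x) = sm C C (D x) (%a b. ph (f a) * e b)" by (rule coalgebraD(6)[OF C x, of "%x. ph (f x)", symmetric]) (intro L)
 also have "... = sm C C (D x) (%a b. sm C C (D b) (%c d. ph (f a*[A](g c*[A]h d))))"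
 proof (rule smc)
 fix a b assume ab: "a <: C" "b <: C"
 show "ph (f a) * e b = sm C C (D b) (%c d. ph (f a*[A](g c*[A]h d)))"
 by (subst gh[where ph = "%z. ph (f a*[A]z)"]) (use ab in \<open>auto intro!: L simp: cl\<close>)
 qed
 also have "... = sm C C (D x) (%a b. sm C C (D a) (%c d. ph (f c*[A](g d*[A]h b))))"
 by (rule coalgebraD(4)[OF C x, symmetric]) (auto intro!: trilinI L simp: cl)
 also have "... = sm C C (D x) (%a b. e a * ph (h b))"
 proof (rule smc)
 fix a b assume ab: "a <: C" "b <: C"
 have "sm C C (D a) (%c d. ph (f c*[A](g d*[A]h b))) = sm C C (D a) (%c d. ph ((f c*[A]g d)*[A]h b))"
 by (rule smc) (use ab in \<open>simp add: cl\<close>)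
 also have "... = e a * ph (h b)" by (subst fg[where ph = "%z. ph (z*[A]h b)"]) (use ab in \<open>auto intro!: L simp: cl\<close>)
 finally show "sm C C (D a) (%c d. ph (f c*[A](g d*[A]h b))) = e a * ph (h b)" .
 qed
 also have "... = ph (h x)" by (rule coalgebraD(5)[OF C x, of "%x. ph (h x)"]) (intro L)
 finally show "ph (f x) = ph (h x)" .
qed

lemma acomul_mult:
 assumes "bialgebra H"
 shows "x <: H ==> y <: H ==> acomul H (x*[H]y) = acomul H x*[talg H H]acomul H y"
 and "acomul H (aone H) = elt H H (aone H) (aone H)"
 using assms unfolding bialgebra_def by simp_all

text \<open>Indices used below: 1 linearity, 2 closure, 3 products, 4 unit, 5 coproduct, 6 counit, 7
  extensionality.\<close>

lemma bmapD:
 assumes f: "f : bialg_maps A H" and A: "bialgebra A" and H: "bialgebra H"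
 shows "lin A H f" and "x <: A ==> f x <: H"
 and "x <: A ==> y <: A ==> f (x*[A]y) = f x*[H]f y"
 and "f (aone A) = aone H"
 and "x <: A ==> bilin H H kk F ==> dl H (f x) F = dl A x (%a b. F (f a) (f b))"
 and "x <: A ==> eps H (f x) = eps A x"
 and "f : extensional (car A)"
proof -
 show l: "lin A H f" and "f : extensional (car A)" using f unfolding bialg_maps_def by (auto simp: lin_maps_iff)
 thus "x <: A ==> f x <: H" by (simp add: linD)
 show "x <: A ==> y <: A ==> f (x*[A]y) = f x*[H]f y"
 "f (aone A) = aone H" "x <: A ==> eps H (f x) = eps A x"
 using f unfolding bialg_maps_def by simp_all
 assume "x <: A" "bilin H H kk F"
 moreover from this have "acomul H (f x) = tmap A A H H f f (acomul A x)"
 using f unfolding bialg_maps_def by simp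
 ultimately show "dl H (f x) F = dl A x (%a b. F (f a) (f b))"
 using l bialgD[OF A] bialgD[OF H] by (simp add: sm_tmap)
qed

lemma bialg_mapsI:
 assumes A: "bialgebra A" and H: "bialgebra H" and f: "f : lin_maps A H"
 and "!!x y. x <: A ==> y <: A ==> f (x*[A]y) = f x*[H]f y"
 and "f (aone A) = aone H"
 and d: "!!x F. x <: A ==> bilin H H kk F ==> dl H (f x) F = dl A x (%a b. F (f a) (f b))"
 and "!!x. x <: A ==> eps H (f x) = eps A x"
 shows "f : bialg_maps A H"
proof -
 have l: "lin A H f" using f by blast
 have "acomul H (f x) = tmap A A H H f f (acomul A x)" if "x <: A" for x
 by (rule tens_eqI[OF bialgD(3)[OF H] bialgD(3)[OF H]])
 (use that l bialgD[OF A] bialgD[OF H] d in \<open>auto simp: sm_tmap linD intro!: tmap_closed\<close>)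
 thus ?thesis using assms unfolding bialg_maps_def by simp
qed

lemma bialg_map_comp:
 assumes "bialgebra A" "bialgebra H" "bialgebra K" "f : bialg_maps A H" "g : bialg_maps H K"
 shows "compose (car A) g f : bialg_maps A K"
proof -
 note f = bmapD[OF assms(4,1,2)] and g = bmapD[OF assms(5,2,3)]
 have c: "compose (car A) g f x = g (f x)" if "x <: A" for x using that by (simp add: compose_def)
 note A = bialgD[OF assms(1)] algebraD[OF bialgD(1)[OF assms(1)]]
 have lc: "lin A K (compose (car A) g f) = lin A K (%x. g (f x))" by (rule lin_cong) (use A in \<open>simp_all add: compose_def\<close>)
 show ?thesis
 proof (rule bialg_mapsI[OF assms(1,3)])
 show "compose (car A) g f : lin_maps A K"
 unfolding lin_maps_iff lc using lin_o[OF g(1) f(1)] by (simp add: compose_def)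
 fix x F assume x: "x <: A" and F: "bilin K K kk F"
 have b: "bilin H H kk (%a b. F (g a) (g b))" by (intro bilinI bilinD(2,3)[OF F] lin_o[OF g(1)] lin_id) (simp_all add: g)
 show "dl K (compose (car A) g f x) F = dl A x (%a b. F (compose (car A) g f a) (compose (car A) g f b))"
 using x F b f g by (simp add: c)
 qed (use f g A in \<open>simp_all add: c\<close>)
qed

lemma idm_bialg_map: "bialgebra A ==> idm A : bialg_maps A A" by (rule bialg_mapsI)
 (auto simp: lin_maps_iff algebraD[OF bialgD(1)] intro!: lin_idm bialgD(3))

lemma antipode_unique:
 assumes H: "bialgebra H" and s: "is_antipode H s" and t: "is_antipode H t"
 shows "s = t"
proof (rule extensionalityI[of _ "car H"])
 have *: "s : lin_maps H H" "t : lin_maps H H" using s t by (auto simp: is_antipode_def)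
 thus "s : extensional (car H)" "t : extensional (car H)" by (auto simp: lin_maps_iff)
 fix x assume x: "x <: H"
 show "s x = t x" by (rule conv_unique[OF bialgD(2)[OF H] bialgD(1)[OF H] _ lin_id _ _ _ x])
 (use s t * in \<open>auto simp: is_antipode_iff[OF H]\<close>)
qed

lemma antipode_is_antipode:
 assumes "hopf_algebra H"
 shows "is_antipode H (antipode H)"
 using assms antipode_unique unfolding hopf_algebra_def antipode_def by (metis theI)

context
 fixes H :: "('k::field, 'a, 'z) bialg_scheme"
 assumes hopf: "hopf_algebra H"
begin

lemma hopfD: "bialgebra H" using hopf by (simp add: hopf_algebra_def)

lemma lin_antipode: "lin H H (antipode H)"
 using antipode_is_antipode[OF hopf] by (auto simp: is_antipode_def)

lemma antipode_closed [simp]: "x <: H ==> antipode H x <: H" by (rule linD(1)[OF lin_antipode])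

lemma antipode_inv:
 assumes "x <: H" "lin H kk ph"
 shows "dl H x (%a b. ph (antipode H a*[H]b)) = eps H x * ph (aone H)"
 and "dl H x (%a b. ph (a*[H]antipode H b)) = eps H x * ph (aone H)"
 using antipode_is_antipode[OF hopf] assms unfolding is_antipode_iff[OF hopfD] by simp_all

text \<open>Both sides equal \<open>S(x1 y1) x2 y2 S(y3) S(x3)\<close>: collapsing
  \<open>y2 S(y3)\<close> and then \<open>x2 S(x3)\<close> leaves \<open>S(x y)\<close>, while
  collapsing \<open>S(x1 y1) x2 y2\<close> leaves \<open>S(y) S(x)\<close>. This direct computation
  takes the place of convolution on the coalgebra \<open>H \<otimes> H\<close>.\<close>

lemma antipode_mult:
 assumes x: "x <: H" and y: "y <: H"
 shows "antipode H (x*[H]y) = antipode H y*[H]antipode H x"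
proof -
 note H = bialgD[OF hopfD] algebraD[OF bialgD(1)[OF hopfD]]
 let ?S = "antipode H"
 have cl: "u <: H ==> v <: H ==> u*[H]v <: H" "aone H <: H" for u v
 using H by simp_all
 show ?thesis
 proof (rule functional_eqI[OF H(3)])
 show "?S (x*[H]y) <: H" "?S y*[H]?S x <: H" using x y cl by simp_all
 fix ph assume ph: "lin H kk ph"
 note L = trilinI bilinI lin_smI lin_o[OF ph] lin_o[OF lin_antipode] alg_lin[OF H(1)] lin_mult
 lin_o[OF H(5)] lin_id
 have "ph (?S (x*[H]y)) = dl H x (%a b. dl H y (%c d. ph (?S (a*[H]c)) * eps H d) * eps H b)"
 proof -
 have "dl H y (%c d. ph (?S (a*[H]c)) * eps H d) = ph (?S (a*[H]y))" if "a <: H" for a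
 by (rule H(9)[OF y]) (use that in \<open>intro L\<close>)
 moreover have "dl H x (%a b. ph (?S (a*[H]y)) * eps H b) = ph (?S (x*[H]y))"
 by (rule H(9)[OF x]) (use y in \<open>intro L\<close>)
 ultimately show ?thesis by simp
 qed
 \<comment> \<open>The two counits are expanded to \<open>b1 S(b2)\<close> and
   \<open>d1 S(d2)\<close>, nested so that the part from \<open>y\<close> sits inside the part from
   \<open>x\<close>.\<close>
 also have "... = dl H x (%a b. dl H b (%b1 b2. dl H y (%c d. dl H d (%d1 d2.
 ph (?S (a*[H]c)*[H]b1*[H]d1*[H]?S d2*[H]?S b2)))))"
 proof (rule smc)
 fix a b assume ab: "a <: H" "b <: H"
 have i: "dl H d (%d1 d2. ph (z*[H]b1*[H]d1*[H]?S d2*[H]?S b2)) = eps H d * ph (z*[H]b1*[H]?S b2)"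
 if "z <: H" "b1 <: H" "b2 <: H" "d <: H" for z b1 b2 d
 proof -
 have "dl H d (%d1 d2. ph (z*[H]b1*[H]d1*[H]?S d2*[H]?S b2))
 = dl H d (%d1 d2. ph (z*[H]b1*[H](d1*[H]?S d2)*[H]?S b2))"
 by (rule smc) (use that H in simp)
 also have "... = eps H d * ph (z*[H]b1*[H]aone H*[H]?S b2)"
 by (rule antipode_inv(2)[where ph = "%w. ph (z*[H]b1*[H]w*[H]?S b2)"])
 (use that cl in \<open>auto intro!: L\<close>)
 finally show ?thesis using that H by simp
 qed
 have j: "dl H b (%b1 b2. ph (z*[H]b1*[H]?S b2)) = eps H b * ph z" if "z <: H" for z
 proof -
 have "lin H kk (%w. ph (z*[H]w))" using that by (intro L)
 from antipode_inv(2)[OF ab(2) this] show ?thesis using that H by simp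
 qed
 have "dl H y (%c d. ph (?S (a*[H]c)) * eps H d) * eps H b
 = dl H y (%c d. eps H d * (eps H b * ph (?S (a*[H]c))))"
 unfolding sm_mult_right[symmetric] by (simp add: ac_simps)
 also have "... = dl H y (%c d. eps H d * dl H b (%b1 b2. ph (?S (a*[H]c)*[H]b1*[H]?S b2)))"
 using ab y cl by (simp add: j)
 also have "... = dl H y (%c d. dl H b (%b1 b2. dl H d (%d1 d2.
 ph (?S (a*[H]c)*[H]b1*[H]d1*[H]?S d2*[H]?S b2))))"
 using ab y cl by (simp add: i sm_mult_left)
 also have "... = dl H b (%b1 b2. dl H y (%c d. dl H d (%d1 d2.
 ph (?S (a*[H]c)*[H]b1*[H]d1*[H]?S d2*[H]?S b2))))" by (rule sm_swap)
 finally show "dl H y (%c d. ph (?S (a*[H]c)) * eps H d) * eps H b = ..." .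
 qed
 also have "... = dl H x (%a b. dl H a (%a1 a2. dl H y (%c d. dl H d (%d1 d2.
 ph (?S (a1*[H]c)*[H]a2*[H]d1*[H]?S d2*[H]?S b)))))" by (rule H(7)[OF x, symmetric]) (auto intro!: L simp: cl)
 also have "... = dl H x (%a b. dl H a (%a1 a2. dl H y (%c d. dl H c (%c1 c2.
 ph (?S (a1*[H]c1)*[H]a2*[H]c2*[H]?S d*[H]?S b)))))" by (intro smc H(7)[OF y, symmetric]) (auto intro!: L simp: cl)
 also have "... = dl H x (%a b. dl H y (%c d. dl H a (%a1 a2. dl H c (%c1 c2.
 ph (?S (a1*[H]c1)*[H](a2*[H]c2)*[H]?S d*[H]?S b)))))" by (subst (2) sm_swap) (intro smc, use H in simp)
 \<comment> \<open>Now \<open>S(a1 c1) a2 c2\<close> is read as the antipode identity for the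
   product \<open>a c\<close>, through multiplicativity of the coproduct.\<close>
 also have "... = dl H x (%a b. dl H y (%c d. eps H a * (eps H c * ph (?S d*[H]?S b))))"
 proof (intro smc)
 fix a b c d assume m: "a <: H" "b <: H" "c <: H" "d <: H"
 let ?w = "?S d*[H]?S b"
 have w: "?w <: H" using m cl by simp
 have "dl H a (%a1 a2. dl H c (%c1 c2. ph (?S (a1*[H]c1)*[H](a2*[H]c2)*[H]?w)))
 = dl H (a*[H]c) (%p q. ph (?S p*[H]q*[H]?w))" by (rule H(10)[symmetric]) (use m w cl in \<open>auto intro!: L\<close>)
 also have "... = dl H (a*[H]c) (%p q. ph ((?S p*[H]q)*[H]?w))"
 by (rule smc) (use w H in simp)
 also have "... = eps H (a*[H]c) * ph (aone H*[H]?w)" by (rule antipode_inv(1)[where ph = "%z. ph (z*[H]?w)"]) (use m w cl in \<open>auto intro!: L\<close>)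
 finally show "dl H a (%a1 a2. dl H c (%c1 c2. ph (?S (a1*[H]c1)*[H](a2*[H]c2)*[H]?w)))
 = eps H a * (eps H c * ph ?w)"
 using m w H by simp
 qed
 also have "... = dl H x (%a b. eps H a * ph (?S y*[H]?S b))"
 unfolding sm_mult_left by (intro smc arg_cong2[of _ _ _ _ "(*)"] refl H(8)[OF y]) (auto intro!: L)
 also have "... = ph (?S y*[H]?S x)" by (rule H(8)[OF x]) (use y in \<open>auto intro!: L\<close>)
 finally show "ph (?S (x*[H]y)) = ph (?S y*[H]?S x)" .
 qed
qed

text \<open>Among linear maps from \<open>H\<close> to \<open>H \<otimes> H\<close>, the coproduct
  has as left convolution inverse its composite with \<open>S\<close>, and as right inverse the map
  \<open>h\<close> sending \<open>x\<close> to \<open>S x2 \<otimes> S x1\<close>; so these two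
  agree.\<close>

lemma antipode_comul:
 assumes x: "x <: H" and F: "bilin H H kk F"
 shows "dl H (antipode H x) F = dl H x (%a b. F (antipode H b) (antipode H a))"
proof -
 note H = bialgD[OF hopfD] algebraD[OF bialgD(1)[OF hopfD]]
 let ?S = "antipode H"
 have cl: "u <: H ==> v <: H ==> u*[H]v <: H" "aone H <: H" for u v
 using H by simp_all
 have b: "bilin H H (tens H H) (%a b. elt H H (?S b) (?S a))"
 using H by (intro bilinI lin_elt lin_o[OF lin_antipode] lin_id) simp_all
 define h where "h x = tlift H H (tens H H) (%a b. elt H H (?S b) (?S a)) (acomul H x)" for x
 have h: "lin H (tens H H) h" unfolding h_def using H b by (intro lin_tlift) auto
 have sh: "sm H H (h x) G = dl H x (%a b. G (?S b) (?S a))" if "x <: H" "bilin H H kk G" for x G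
 unfolding h_def using that H b by (simp add: sm_tlift)
 have "acomul H (?S x) = h x"
 proof (rule conv_unique[OF H(2) algebra_talg[OF H(1) H(1)], of "%x. acomul H (?S x)" "acomul H" h])
 show "lin H (talg H H) (%x. acomul H (?S x))" "lin H (talg H H) (acomul H)" "lin H (talg H H) h"
 using h H lin_antipode by (auto simp: lin_talg_iff intro!: lin_o[OF H(4)])
 fix x ph assume x: "x <: H" and ph: "lin (talg H H) kk ph"
 from ph have ph': "lin (tens H H) kk ph" by (simp add: lin_talg_iff)
 have "dl H x (%a b. ph (acomul H (?S a)*[talg H H]acomul H b)) = dl H x (%a b. ph (acomul H (?S a*[H]b)))"
 by (rule smc) (simp add: acomul_mult(1)[OF hopfD])
 also have "... = eps H x * ph (acomul H (aone H))" by (rule antipode_inv(1)[OF x lin_o[OF ph' H(4)]])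
 finally show "dl H x (%a b. ph (acomul H (?S a)*[talg H H]acomul H b)) = eps H x * ph (aone (talg H H))"
 by (simp add: acomul_mult(2)[OF hopfD])
 define G where "G a b = ph (elt H H a b)" for a b
 have G: "bilin H H kk G" unfolding G_def by (rule functional_sm(1)[OF H(3,3) ph'])
 have phG: "ph t = sm H H t G" if "t <: (tens H H)" for t
 unfolding G_def by (rule functional_sm(2)[OF H(3,3) ph' that])
 note L = trilinI bilinI lin_smI bilinD(2,3)[OF G] lin_o[OF lin_antipode] alg_lin[OF H(1)] lin_mult
 lin_o[OF H(5)] lin_id
 have "dl H x (%a b. ph (acomul H a*[talg H H]h b))
 = dl H x (%a b. dl H a (%p q. dl H b (%c d. G (p*[H]?S d) (q*[H]?S c))))"
 proof (rule smc)
 fix a b assume ab: "a <: H" "b <: H"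
 have bb: "bilin H H kk (%c d. G (p*[H]c) (q*[H]d))" if "p <: H" "q <: H" for p q
 using that by (intro L) (simp_all add: cl)
 show "ph (acomul H a*[talg H H]h b) = dl H a (%p q. dl H b (%c d. G (p*[H]?S d) (q*[H]?S c)))"
 using ab H G bb linD(1)[OF h] by (simp add: phG talg_closed sm_talg sh)
 qed
 \<comment> \<open>The four legs are regrouped so that the inner pair \<open>q S(c)\<close> meets
   and cancels first, and then the outer pair.\<close>
 also have "... = dl H x (%p b'. dl H b' (%q b. dl H b (%c d. G (p*[H]?S d) (q*[H]?S c))))"
 by (rule H(7)[OF x]) (intro L lin_sm[OF H(3,3)] H(4); simp add: cl)
 also have "... = dl H x (%p b'. dl H b' (%a d. dl H a (%q c. G (p*[H]?S d) (q*[H]?S c))))"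
 by (intro smc H(7)[symmetric]) (auto intro!: L simp: cl)
 also have "... = dl H x (%p b'. dl H b' (%a d. eps H a * G (p*[H]?S d) (aone H)))"
 by (intro smc antipode_inv(2)[where ph = "%z. G (_*[H]?S _) z"]) (auto intro!: L simp: cl)
 also have "... = dl H x (%p b'. G (p*[H]?S b') (aone H))" by (intro smc H(8)) (auto intro!: L simp: cl)
 also have "... = eps H x * G (aone H) (aone H)" by (rule antipode_inv(2)[where ph = "%z. G z (aone H)", OF x]) (auto intro!: L simp: cl)
 finally show "dl H x (%a b. ph (acomul H a*[talg H H]h b)) = eps H x * ph (aone (talg H H))"
 by (simp add: G_def)
 qed (rule x)
 thus ?thesis using sh[OF x F] by simp
qed

end

text \<open>The composites of \<open>f\<close> with the two antipodes are both convolution inverses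
  of \<open>f\<close>.\<close>

lemma bialg_map_antipode:
 assumes A: "hopf_algebra A" and H: "hopf_algebra H" and f: "f : bialg_maps A H" and x: "x <: A"
 shows "f (antipode A x) = antipode H (f x)"
proof -
 note bA = hopfD[OF A] and bH = hopfD[OF H]
 note F = bmapD[OF f bA bH]
 note H' = bialgD[OF bH] algebraD[OF bialgD(1)[OF bH]]
 show ?thesis
 proof (rule conv_unique[OF bialgD(2)[OF bA] H'(1), of "%x. f (antipode A x)" f "%x. antipode H (f x)"])
 show "lin A H (%x. f (antipode A x))" "lin A H f" "lin A H (%x. antipode H (f x))"
 using F(1) lin_antipode[OF A] lin_o[OF lin_antipode[OF H] F(1)] lin_o[OF F(1) lin_antipode[OF A]] by auto
 fix x ph assume x: "x <: A" and ph: "lin H kk ph"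
 have "dl A x (%a b. ph (f (antipode A a)*[H]f b)) = dl A x (%a b. ph (f (antipode A a*[A]b)))"
 by (rule smc) (simp add: F A)
 also have "... = eps A x * ph (f (aone A))" by (rule antipode_inv(1)[OF A x lin_o[OF ph F(1)]])
 finally show "dl A x (%a b. ph (f (antipode A a)*[H]f b)) = eps A x * ph (aone H)"
 by (simp add: F(4))
 have b: "bilin H H kk (%a b. ph (a*[H]antipode H b))" by (intro bilinI lin_o[OF ph] alg_lin[OF H'(1)] lin_o[OF lin_antipode[OF H]] lin_id) (simp_all add: H)
 show "dl A x (%a b. ph (f a*[H]antipode H (f b))) = eps A x * ph (aone H)"
 using F(5)[OF x b] antipode_inv(2)[OF H _ ph, of "f x"] x F by simp
 qed (rule x)
qed

section \<open>R-matrices\<close>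

text \<open>\<open>talg\<close> only adds a product to the space \<open>tens\<close>, so iterated
  tensor products formed with either are the same; the rules normalise to
  \<open>tens\<close>.\<close>

lemma tens_talg [simp]:
 "tens H (talg A B) = tens H (tens A B)" "elt H (talg A B) = elt H (tens A B)"
 "sm H (talg A B) = sm H (tens A B)" "bilin H (talg A B) = bilin H (tens A B)"
proof -
 have k: "ker\<^sub>k H (talg A B) = ker\<^sub>k H (tens A B)" by (simp add: ker\<^sub>k_def bilin_rels_def)
 thus "tens H (talg A B) = tens H (tens A B)" "elt H (talg A B) = elt H (tens A B)"
 by (simp_all add: tens_def quot_space_def elt_def fun_eq_iff)
 show "sm H (talg A B) = sm H (tens A B)" "bilin H (talg A B) = bilin H (tens A B)"
 by (intro ext; simp only: sm_def rep_def bilin_def lin_def talg_simps)+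
qed

lemma ainv_eqI:
 assumes "algebra A" "x <: A" "y <: A" "x*[A]y = aone A" "y*[A]x = aone A"
 shows "ainv A x = y"
 unfolding ainv_def
proof (rule the_equality)
 fix z assume "z <: A & x*[A]z = aone A & z*[A]x = aone A"
 thus "z = y" using assms algebraD(4)[OF assms(1), of z x y] algebraD(5,6)[OF assms(1)] by simp
qed (use assms in simp)

lemma ainvD:
 assumes "algebra A" "invertible_in A x"
 shows "x <: A" "ainv A x <: A" "x*[A]ainv A x = aone A" "ainv A x*[A]x = aone A"
proof -
 from assms(2) obtain y where y: "x <: A" "y <: A" "x*[A]y = aone A" "y*[A]x = aone A"
 unfolding invertible_in_def by blast
 with ainv_eqI[OF assms(1) y(1,2)] show "x <: A" "ainv A x <: A"
 "x*[A]ainv A x = aone A" "ainv A x*[A]x = aone A" by simp_all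
qed

abbreviation sm3 :: "('k::field, 'a, 'z) bialg_scheme => (('a \<times> (('a \<times> 'a) \<Rightarrow>\<^sub>0 'k) set) \<Rightarrow>\<^sub>0 'k) set =>
 ('a => 'a => 'a => 'k) => 'k" where
 "sm3 H t F == sm H (tens H H) t (%x p. sm H H p (%y z. F x y z))"

context
 fixes H :: "('k::field, 'a, 'z) bialg_scheme"
 assumes H: "bialgebra H"
begin

lemma leg_props:
 assumes R: "R <: (tens H H)"
 shows "leg12 H R <: (tens H (tens H H))" "leg13 H R <: (tens H (tens H H))"
 "leg23 H R <: (tens H (tens H H))"
 and "trilin H H H kk F ==> sm3 H (leg12 H R) F = sm H H R (%a b. F a b (aone H))"
 "trilin H H H kk F ==> sm3 H (leg13 H R) F = sm H H R (%a b. F a (aone H) b)"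
 "trilin H H H kk F ==> sm3 H (leg23 H R) F = sm H H R (%a b. F (aone H) a b)"
proof -
 note H' = bialgD[OF H] algebraD[OF bialgD(1)[OF H]]
 have b: "bilin H H (tens H (tens H H)) (%a b. elt H (tens H H) a (elt H H b (aone H)))"
 "bilin H H (tens H (tens H H)) (%a b. elt H (tens H H) a (elt H H (aone H) b))"
 "bilin H H (tens H (tens H H)) (%a b. elt H (tens H H) (aone H) (elt H H a b))"
 using H' by (auto intro!: bilinI lin_elt)
 show "leg12 H R <: (tens H (tens H H))" "leg13 H R <: (tens H (tens H H))"
 "leg23 H R <: (tens H (tens H H))"
 unfolding leg12_def leg13_def leg23_def using H' b R by auto
 assume F: "trilin H H H kk F"
 have bF: "bilin H H kk (F x)" if "x <: H" for x
 using F that unfolding trilin_def by blast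
 show "sm3 H (leg12 H R) F = sm H H R (%a b. F a b (aone H))"
 "sm3 H (leg13 H R) F = sm H H R (%a b. F a (aone H) b)"
 "sm3 H (leg23 H R) F = sm H H R (%a b. F (aone H) a b)"
 unfolding leg12_def leg13_def leg23_def using H' b R bF bilin_sm3(1)[OF H'(3,3,3) F]
 by (simp_all add: sm_tlift)
qed

lemma sm3_mult:
 assumes "s <: (tens H (tens H H))" "t <: (tens H (tens H H))" and F: "trilin H H H kk F"
 shows "s*[talg H (talg H H)]t <: (tens H (tens H H))"
 and "sm3 H (s*[talg H (talg H H)]t) F = sm3 H s (%x y z. sm3 H t (%x' y' z'.
 F (x*[H]x') (y*[H]y') (z*[H]z')))"
proof -
 note H' = bialgD[OF H] algebraD[OF bialgD(1)[OF H]]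
 note A2 = algebra_talg[OF H'(1) H'(1)]
 show "s*[talg H (talg H H)]t <: (tens H (tens H H))"
 using talg_closed[OF H'(1) A2, of s t] assms by simp
 have bF: "bilin H H kk (F x)" if "x <: H" for x
 using F that unfolding trilin_def by blast
 have "sm3 H (s*[talg H (talg H H)]t) F
 = sm H (tens H H) s (%x p. sm H (tens H H) t (%x' p'. sm H H (p*[talg H H]p') (F (x*[H]x'))))"
 using sm_talg[OF H'(1) A2, of s t "%x p. sm H H p (%y z. F x y z)"] assms bilin_sm3(1)[OF H'(3,3,3) F] by simp
 also have "... = sm H (tens H H) s (%x p. sm H (tens H H) t (%x' p'. sm H H p (%y z. sm H H p' (%y' z'.
 F (x*[H]x') (y*[H]y') (z*[H]z')))))"
 using H' bF by (simp add: sm_talg)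
 also have "... = sm3 H s (%x y z. sm3 H t (%x' y' z'.
 F (x*[H]x') (y*[H]y') (z*[H]z')))" by (intro smc sm_swap)
 finally show "sm3 H (s*[talg H (talg H H)]t) F = ..." .
qed

lemma hexagon_iff:
 assumes R: "R <: (tens H H)"
 shows "tassoc H H H (tmap H H (tens H H) H (acomul H) (idm H) R) = leg13 H R*[talg H (talg H H)]leg23 H R
 <-> (\<forall>F. trilin H H H kk F --> sm H H R (%s t. dl H s (%a b. F a b t))
 = sm H H R (%s t. sm H H R (%s' t'. F s s' (t*[H]t'))))" (is "?l1 = ?r1 <-> ?P1")
 and "tmap H H H (tens H H) (idm H) (acomul H) R = leg13 H R*[talg H (talg H H)]leg12 H R
 <-> (\<forall>F. trilin H H H kk F --> sm H H R (%s t. dl H t (%a b. F s a b))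
 = sm H H R (%s t. sm H H R (%s' t'. F (s*[H]s') t' t)))" (is "?l2 = ?r2 <-> ?P2")
proof -
 note H' = bialgD[OF H] algebraD[OF bialgD(1)[OF H]]
 note id = lin_idm[OF H'(3)]
 have t1: "tmap H H (tens H H) H (acomul H) (idm H) R <: (tens (tens H H) H)"
 using R H' id by (auto intro!: tmap_closed)
 have cl: "?l1 <: (tens H (tens H H))" "?l2 <: (tens H (tens H H))"
 using t1 R H' id by (auto intro!: tmap_closed tassoc_props(1))
 \<comment> \<open>The closure part of \<open>sm3_mult\<close> is stated relative to some trilinear
   form; the zero form instantiates it.\<close>
 have t0: "trilin H H H kk (%_ _ _. 0)" by (intro trilinI) (auto intro!: linI)
 have cr: "?r1 <: (tens H (tens H H))" "?r2 <: (tens H (tens H H))"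
 using sm3_mult(1)[OF leg_props(2)[OF R] leg_props(3)[OF R] t0]
 sm3_mult(1)[OF leg_props(2)[OF R] leg_props(1)[OF R] t0] .
 have e: "sm3 H ?l1 F = sm H H R (%s t. dl H s (%a b. F a b t))"
 "sm3 H ?l2 F = sm H H R (%s t. dl H t (%a b. F s a b))"
 "sm3 H ?r1 F = sm H H R (%s t. sm H H R (%s' t'. F s s' (t*[H]t')))"
 "sm3 H ?r2 F = sm H H R (%s t. sm H H R (%s' t'. F (s*[H]s') t' t))"
 if F: "trilin H H H kk F" for F
 proof -
 show "sm3 H ?l1 F = sm H H R (%s t. dl H s (%a b. F a b t))"
 using t1 R H' id bilin_sm3[OF H'(3,3,3) F] by (simp add: tassoc_props(2) F sm_tmap)
 show "sm3 H ?l2 F = sm H H R (%s t. dl H t (%a b. F s a b))"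
 using R H' id bilin_sm3[OF H'(3,3,3) F] by (simp add: sm_tmap)
 note L = trilinI lin_smI trilinD(2,3,4)[OF F] alg_lin[OF H'(1)] lin_id
 have m: "trilin H H H kk (%x' y' z'. F (x*[H]x') (y*[H]y') (z*[H]z'))"
 if "x <: H" "y <: H" "z <: H" for x y z
 using that by (intro L) (simp_all add: H')
 have n: "trilin H H H kk (%x y z. sm H H R (%a b. F x (y*[H]a) (z*[H]b)))"
 "trilin H H H kk (%x y z. sm H H R (%a b. F (x*[H]a) (y*[H]b) z))"
 by (intro L; simp add: H')+
 show "sm3 H ?r1 F = sm H H R (%s t. sm H H R (%s' t'. F s s' (t*[H]t')))"
 "sm3 H ?r2 F = sm H H R (%s t. sm H H R (%s' t'. F (s*[H]s') t' t))"
 using F R leg_props(1-3)[OF R] m n by (simp_all add: sm3_mult(2) leg_props(4-6) alg_simps[OF H'(1)])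
 qed
 show "?l1 = ?r1 <-> ?P1"
 proof
 assume ?P1
 show "?l1 = ?r1" by (rule tens3_eqI[OF H'(3,3,3) cl(1) cr(1)]) (use e \<open>?P1\<close> in simp)
 next
 assume "?l1 = ?r1"
 thus ?P1 using e(1,3) by simp
 qed
 show "?l2 = ?r2 <-> ?P2"
 proof
 assume ?P2
 show "?l2 = ?r2" by (rule tens3_eqI[OF H'(3,3,3) cl(2) cr(2)]) (use e \<open>?P2\<close> in simp)
 next
 assume "?l2 = ?r2"
 thus ?P2 using e(2,4) by simp
 qed
qed

text \<open>The axiom is solved for the coproduct, which becomes the inverse of \<open>R\<close>
  times the flipped coproduct times \<open>R\<close>. This is the shape in which the braiding of
  bimodules produces it.\<close>

lemma cocom_iff:
 assumes R: "invertible_in (talg H H) R" and x: "x <: H"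
 defines "Ri == ainv (talg H H) R"
 shows "flip H H (acomul H x) = (R*[talg H H]acomul H x)*[talg H H]Ri <->
 (\<forall>F. bilin H H kk F --> dl H x F = sm H H Ri (%s' t'. dl H x (%a c. sm H H R (%s t.
 F (s'*[H]c*[H]s) (t'*[H]a*[H]t)))))"
proof -
 note H' = bialgD[OF H] algebraD[OF bialgD(1)[OF H]]
 note A = algebra_talg[OF H'(1) H'(1)]
 note I = ainvD[OF A R, folded Ri_def]
 let ?D = "acomul H x" and ?f = "flip H H (acomul H x)"
 have cl: "?D <: (tens H H)" "R <: (tens H H)" "Ri <: (tens H H)" using H' x I by simp_all
 have b0: "bilin H H kk (%_ _. 0)" by (intro bilinI) (auto intro!: linI)
 have fc: "?f <: (tens H H)" using sm_flip(2)[OF H'(3,3) cl(1) b0] .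
 note S = alg_simps[OF A]
 have canc: "Ri*[talg H H]R*[talg H H]z = z" "R*[talg H H]Ri*[talg H H]z = z"
 if "z <: (tens H H)" for z
 using S(2)[of Ri R z] S(2)[of R Ri z] S(3)[of z] that cl I by (simp_all del: talg_simps(5))
 have "?f = (R*[talg H H]?D)*[talg H H]Ri <-> ?D = Ri*[talg H H](?f*[talg H H]R)"
 proof
 assume e: "?f = (R*[talg H H]?D)*[talg H H]Ri"
 show "?D = Ri*[talg H H](?f*[talg H H]R)"
 unfolding e using cl I canc talg_closed[OF H'(1,1)] by (simp add: S del: talg_simps(5))
 next
 assume e: "?D = Ri*[talg H H](?f*[talg H H]R)"
 have "(R*[talg H H](Ri*[talg H H](?f*[talg H H]R)))*[talg H H]Ri = ?f"
 using cl fc I canc talg_closed[OF H'(1,1)] by (simp add: S del: talg_simps(5))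
 thus "?f = (R*[talg H H]?D)*[talg H H]Ri" using e by simp
 qed
 moreover have "sm H H (Ri*[talg H H](?f*[talg H H]R)) F = sm H H Ri (%s' t'. dl H x (%a c. sm H H R (%s t.
 F (s'*[H]c*[H]s) (t'*[H]a*[H]t))))" if F: "bilin H H kk F" for F
 proof -
 note L = bilinI lin_smI bilinD(2,3)[OF F] alg_lin[OF H'(1)] lin_id
 have b: "bilin H H kk (%a b. F (s*[H]a) (t*[H]b))"
 "bilin H H kk (%c a. sm H H R (%s' t'. F (s*[H]c*[H]s') (t*[H]a*[H]t')))"
 if "s <: H" "t <: H" for s t
 using that by (intro L; simp add: H')+
 show ?thesis using F H' cl fc talg_closed[OF H'(1,1)] b by (simp add: sm_talg sm_flip(1))
 qed
 moreover have "?D = Ri*[talg H H](?f*[talg H H]R) <->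
 (\<forall>F. bilin H H kk F --> sm H H ?D F = sm H H (Ri*[talg H H](?f*[talg H H]R)) F)"
 using tens_eqI[OF H'(3,3) cl(1)] talg_closed[OF H'(1,1)] cl fc by metis
 ultimately show ?thesis by simp
qed

end

section \<open>Quasitriangular Hopf algebras over a base\<close>

lemma tmap_mult:
 assumes A: "bialgebra A" and H: "bialgebra H" and f: "f : bialg_maps A H"
 and "s <: (tens A A)" "t <: (tens A A)"
 shows "tmap A A H H f f (s*[talg A A]t) = tmap A A H H f f s*[talg H H]tmap A A H H f f t"
proof -
 note A' = bialgD[OF A] algebraD[OF bialgD(1)[OF A]] and H' = bialgD[OF H] algebraD[OF bialgD(1)[OF H]]
 note f' = bmapD[OF f A H]
 have tc: "tmap A A H H f f t <: (tens H H)" if "t <: (tens A A)" for t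
 using that A' H' f' by (auto intro!: tmap_closed)
 note cA = talg_closed[OF A'(1,1)] and cH = talg_closed[OF H'(1,1)]
 show ?thesis
 proof (rule tens_eqI[OF H'(3,3)])
 fix F assume F: "bilin H H kk F"
 note L = bilinI lin_smI bilinD(2,3)[OF F] alg_lin[OF H'(1)] lin_id lin_o[OF f'(1)]
 have b: "bilin A A kk (%a b. F (f a) (f b))" "bilin H H kk (%a b. sm A A t (%c d. F (a*[H]f c) (b*[H]f d)))"
 by (intro L; simp add: f' H')+
 have b2: "bilin H H kk (%c d. F (a*[H]c) (b*[H]d))" if "a <: H" "b <: H" for a b
 using that by (intro L; simp add: f' H')
 show "sm H H (tmap A A H H f f (s*[talg A A]t)) F = sm H H (tmap A A H H f f s*[talg H H]tmap A A H H f f t) F"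
 using assms A' H' f' F b b2 tc cA by (simp add: sm_tmap sm_talg)
 qed (use assms tc cA cH in auto)
qed

lemma tmap_invertible:
 assumes A: "bialgebra A" and H: "bialgebra H" and f: "f : bialg_maps A H" and R: "invertible_in (talg A A) R"
 shows "invertible_in (talg H H) (tmap A A H H f f R)"
 and "ainv (talg H H) (tmap A A H H f f R) = tmap A A H H f f (ainv (talg A A) R)"
proof -
 note A' = bialgD[OF A] algebraD[OF bialgD(1)[OF A]] and H' = bialgD[OF H] algebraD[OF bialgD(1)[OF H]]
 note f' = bmapD[OF f A H]
 note I = ainvD[OF algebra_talg[OF A'(1,1)] R]
 let ?g = "tmap A A H H f f" let ?Ri = "ainv (talg A A) R"
 have c: "?g R <: (tens H H)" "?g ?Ri <: (tens H H)"
 using I A' H' f' by (auto intro!: tmap_closed)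
 have one: "?g (elt A A (aone A) (aone A)) = elt H H (aone H) (aone H)"
 using A' H' f' by (simp add: tmap_elt)
 have i: "?g R*[talg H H]?g ?Ri = aone (talg H H)" "?g ?Ri*[talg H H]?g R = aone (talg H H)"
 using tmap_mult[OF A H f, of R ?Ri] tmap_mult[OF A H f, of ?Ri R] I one by simp_all
 thus "invertible_in (talg H H) (?g R)" unfolding invertible_in_def using c by auto
 show "ainv (talg H H) (?g R) = ?g ?Ri" by (rule ainv_eqI[OF algebra_talg[OF H'(1,1)]]) (use c i in simp_all)
qed

lemma quasitriangular_iff:
 assumes H: "hopf_algebra H" and R: "invertible_in (talg H H) R"
 shows "quasitriangular H R <->
 (\<forall>x\<in>car H. \<forall>F. bilin H H kk F --> dl H x F = sm H H (ainv (talg H H) R) (%s' t'. dl H x (%a c. sm H H R (%s t.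
 F (s'*[H]c*[H]s) (t'*[H]a*[H]t))))) &
 (\<forall>F. trilin H H H kk F --> sm H H R (%s t. dl H t (%a b. F s a b))
 = sm H H R (%s t. sm H H R (%s' t'. F (s*[H]s') t' t))) &
 (\<forall>F. trilin H H H kk F --> sm H H R (%s t. dl H s (%a b. F a b t))
 = sm H H R (%s t. sm H H R (%s' t'. F s s' (t*[H]t'))))"
proof -
 note bH = hopfD[OF H]
 have "R <: (tens H H)" using R by (simp add: invertible_in_def)
 note h = hexagon_iff[OF bH this]
 show ?thesis
 unfolding quasitriangular_def h using H R cocom_iff[OF bH R] by simp
qed

section \<open>Hexagon, inverse and counit identities of the fixed R-matrix\<close>

locale qt_hopf =
 fixes B :: "('k::field, 'b, 'z) bialg_scheme" and S :: "(('b \<times> 'b) \<Rightarrow>\<^sub>0 'k) set"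
 assumes qt: "quasitriangular B S"
begin

definition "Si == ainv (talg B B) S"
abbreviation "ss == sm B B S"
abbreviation "si == sm B B Si"

lemma hopf_B: "hopf_algebra B" and inv_S: "invertible_in (talg B B) S"
 using qt unfolding quasitriangular_def by blast+

lemmas bB = hopfD[OF hopf_B]
lemmas B = bialgD[OF bB] algebraD[OF bialgD(1)[OF bB]]
lemmas BL = alg_lin[OF B(1)]
lemmas I = ainvD[OF algebra_talg[OF B(1,1)] inv_S, folded Si_def]

lemma S_closed: "S <: (tens B B)" "Si <: (tens B B)"
 using I by simp_all

lemma ss_inv:
 assumes F: "bilin B B kk F"
 shows "ss (%s t. si (%s' t'. F (s*[B]s') (t*[B]t'))) = F (aone B) (aone B)"
 and "si (%s t. ss (%s' t'. F (s*[B]s') (t*[B]t'))) = F (aone B) (aone B)"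
 using sm_talg[OF B(1,1) S_closed F] sm_talg[OF B(1,1) S_closed(2,1) F] I(3,4) B F by simp_all

lemma hex1: "trilin B B B kk F ==> ss (%s t. dl B s (%a b. F a b t)) = ss (%s t. ss (%s' t'. F s s' (t*[B]t')))"
 and hex2: "trilin B B B kk F ==> ss (%s t. dl B t (%a b. F s a b)) = ss (%s t. ss (%s' t'. F (s*[B]s') t' t))"
 using qt unfolding quasitriangular_iff[OF hopf_B inv_S] by blast+

text \<open>Inverting \<open>S13 S23\<close> reverses the factors, which explains the order
  \<open>t' t\<close>. The proof multiplies by \<open>S13 S23\<close> and its inverse, folds
  \<open>S13 S23\<close> back with \<open>hex1\<close>, and cancels \<open>S\<close> against its
  inverse.\<close>

lemma hex1_inv:
 assumes F: "trilin B B B kk F"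
 shows "si (%s t. dl B s (%a b. F a b t)) = si (%s t. si (%s' t'. F s s' (t'*[B]t)))" (is "?l3 = ?r3")
proof -
 note L = trilinI bilinI lin_smI trilinD(2,3,4)[OF F] BL lin_id
 \<comment> \<open>Insertion of \<open>S13 S23\<close> followed by its inverse: the copies
   \<open>(s1,t1)\<close> and \<open>(s2,t2)\<close> of \<open>S\<close> are undone by
   \<open>(r2,q2)\<close> and \<open>(r1,q1)\<close>.\<close>
 have "?l3 = si (%s t. dl B s (%a b. ss (%s1 t1. ss (%s2 t2. si (%r2 q2. si (%r1 q1. F (a*[B]s1*[B]r1) (b*[B]s2*[B]r2) (t*[B]t1*[B]t2*[B]q2*[B]q1)))))))"
 proof (intro smc)
 fix s t a b assume m: "s <: B" "t <: B" "a <: B" "b <: B"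
 have "ss (%s2 t2. si (%r2 q2. si (%r1 q1.
 F (a*[B]s1*[B]r1) (b*[B]s2*[B]r2) (t*[B]t1*[B]t2*[B]q2*[B]q1))))
 = si (%r1 q1. F (a*[B]s1*[B]r1) b (t*[B]t1*[B]q1))" (is "?l4 = _") if m': "s1 <: B" "t1 <: B" for s1 t1
 proof -
 have "?l4 = ss (%s2 t2. si (%r2 q2. si (%r1 q1. F (a*[B]s1*[B]r1) (b*[B]s2*[B]r2) (t*[B]t1*[B](t2*[B]q2)*[B]q1))))"
 using m m' by (intro smc) (simp add: B)
 also have "... = si (%r1 q1. F (a*[B]s1*[B]r1) (b*[B]aone B) (t*[B]t1*[B]aone B*[B]q1))"
 by (rule ss_inv(1)[where F = "%u v. si (%r1 q1. F (a*[B]s1*[B]r1) (b*[B]u) (t*[B]t1*[B]v*[B]q1))"])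
 (use m m' in \<open>intro L; simp add: B\<close>)
 finally show ?thesis using m m' by (simp add: B)
 qed
 moreover have "ss (%s1 t1. si (%r1 q1. F (a*[B]s1*[B]r1) b (t*[B]t1*[B]q1)))
 = F (a*[B]aone B) b (t*[B]aone B)" by (rule ss_inv(1)[where F = "%u v. F (a*[B]u) b (t*[B]v)"]) (use m in \<open>intro L; simp add: B\<close>)
 ultimately show "F a b t = ss (%s1 t1. ss (%s2 t2. si (%r2 q2. si (%r1 q1.
 F (a*[B]s1*[B]r1) (b*[B]s2*[B]r2) (t*[B]t1*[B]t2*[B]q2*[B]q1)))))"
 using m by (simp add: B)
 qed
 also have "... = si (%s t. dl B s (%a b. ss (%s1 t1. dl B s1 (%s2 s3. si (%r2 q2. si (%r1 q1.
 F (a*[B]s2*[B]r1) (b*[B]s3*[B]r2) (t*[B]t1*[B]q2*[B]q1)))))))"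
 proof (rule smc, rule smc)
 fix s t a b assume m: "s <: B" "t <: B" "a <: B" "b <: B"
 have "ss (%s1 t1. dl B s1 (%s2 s3. si (%r2 q2. si (%r1 q1.
 F (a*[B]s2*[B]r1) (b*[B]s3*[B]r2) (t*[B]t1*[B]q2*[B]q1)))))
 = ss (%s1 t1. ss (%s2 t2. si (%r2 q2. si (%r1 q1.
 F (a*[B]s1*[B]r1) (b*[B]s2*[B]r2) (t*[B](t1*[B]t2)*[B]q2*[B]q1)))))"
 by (rule hex1) (use m in \<open>intro L; simp add: B\<close>)
 thus "ss (%s1 t1. ss (%s2 t2. si (%r2 q2. si (%r1 q1.
 F (a*[B]s1*[B]r1) (b*[B]s2*[B]r2) (t*[B]t1*[B]t2*[B]q2*[B]q1)))))
 = ss (%s1 t1. dl B s1 (%s2 s3. si (%r2 q2. si (%r1 q1.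
 F (a*[B]s2*[B]r1) (b*[B]s3*[B]r2) (t*[B]t1*[B]q2*[B]q1)))))"
 using m by (simp add: B)
 qed
 also have "... = si (%s t. ss (%s1 t1. dl B (s*[B]s1) (%a b. si (%r2 q2. si (%r1 q1.
 F (a*[B]r1) (b*[B]r2) ((t*[B]t1)*[B]q2*[B]q1))))))"
 proof (rule smc)
 fix s t assume m: "s <: B" "t <: B"
 have b: "bilin B B kk (%a b. si (%r2 q2. si (%r1 q1.
 F (a*[B]r1) (b*[B]r2) (t*[B]t1*[B]q2*[B]q1))))" if "t1 <: B" for t1
 using that m by (intro L; simp add: B)
 show "dl B s (%a b. ss (%s1 t1. dl B s1 (%s2 s3. si (%r2 q2. si (%r1 q1.
 F (a*[B]s2*[B]r1) (b*[B]s3*[B]r2) (t*[B]t1*[B]q2*[B]q1))))))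
 = ss (%s1 t1. dl B (s*[B]s1) (%a b. si (%r2 q2. si (%r1 q1.
 F (a*[B]r1) (b*[B]r2) ((t*[B]t1)*[B]q2*[B]q1)))))"
 using m b by (subst sm_swap) (simp add: B)
 qed
 \<comment> \<open>The inverse of \<open>S\<close> now stands directly before \<open>S\<close> under
   the coproduct; their product is 1 and only the coproduct of 1 is left.\<close>
 also have "... = dl B (aone B) (%a b. si (%r2 q2. si (%r1 q1.
 F (a*[B]r1) (b*[B]r2) (aone B*[B]q2*[B]q1))))" by (rule ss_inv(2)[where F = "%u v. dl B u (%a b. si (%r2 q2. si (%r1 q1.
 F (a*[B]r1) (b*[B]r2) (v*[B]q2*[B]q1))))"])
 (intro L lin_sm[OF B(3,3)] B(4); simp add: B)
 also have "... = si (%r2 q2. si (%r1 q1.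
 F (aone B*[B]r1) (aone B*[B]r2) (aone B*[B]q2*[B]q1)))" by (rule B(11)) (intro L; simp add: B)
 also have "... = si (%r2 q2. si (%r1 q1. F r1 r2 (q2*[B]q1)))" by (simp add: B)
 also have "... = ?r3" by (rule sm_swap)
 finally show ?thesis .
qed

text \<open>Mirror image of \<open>hex1_inv\<close>, splitting the second leg.\<close>

lemma hex2_inv:
 assumes F: "trilin B B B kk F"
 shows "si (%s t. dl B t (%a b. F s a b)) = si (%s t. si (%s' t'. F (s'*[B]s) t' t))" (is "?l5 = ?r5")
proof -
 note L = trilinI bilinI lin_smI trilinD(2,3,4)[OF F] BL lin_id
 have "?l5 = si (%s t. dl B t (%a b. ss (%s1 t1. ss (%s2 t2. si (%r2 q2. si (%r1 q1. F (s*[B]s1*[B]s2*[B]r2*[B]r1) (a*[B]t2*[B]q2) (b*[B]t1*[B]q1)))))))"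
 proof (intro smc)
 fix s t a b assume m: "s <: B" "t <: B" "a <: B" "b <: B"
 have "ss (%s2 t2. si (%r2 q2. si (%r1 q1.
 F (s*[B]s1*[B]s2*[B]r2*[B]r1) (a*[B]t2*[B]q2) (b*[B]t1*[B]q1))))
 = si (%r1 q1. F (s*[B]s1*[B]r1) a (b*[B]t1*[B]q1))" (is "?l6 = _") if m': "s1 <: B" "t1 <: B" for s1 t1
 proof -
 have "?l6 = ss (%s2 t2. si (%r2 q2. si (%r1 q1. F (s*[B]s1*[B](s2*[B]r2)*[B]r1) (a*[B]t2*[B]q2) (b*[B]t1*[B]q1))))"
 using m m' by (intro smc) (simp add: B)
 also have "... = si (%r1 q1. F (s*[B]s1*[B]aone B*[B]r1) (a*[B]aone B) (b*[B]t1*[B]q1))"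
 by (rule ss_inv(1)[where F = "%u v. si (%r1 q1. F (s*[B]s1*[B]u*[B]r1) (a*[B]v) (b*[B]t1*[B]q1))"])
 (use m m' in \<open>intro L; simp add: B\<close>)
 finally show ?thesis using m m' by (simp add: B)
 qed
 moreover have "ss (%s1 t1. si (%r1 q1. F (s*[B]s1*[B]r1) a (b*[B]t1*[B]q1)))
 = F (s*[B]aone B) a (b*[B]aone B)" by (rule ss_inv(1)[where F = "%u v. F (s*[B]u) a (b*[B]v)"]) (use m in \<open>intro L; simp add: B\<close>)
 ultimately show "F s a b = ss (%s1 t1. ss (%s2 t2. si (%r2 q2. si (%r1 q1.
 F (s*[B]s1*[B]s2*[B]r2*[B]r1) (a*[B]t2*[B]q2) (b*[B]t1*[B]q1)))))"
 using m by (simp add: B)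
 qed
 also have "... = si (%s t. dl B t (%a b. ss (%s1 t1. dl B t1 (%t2 t3. si (%r2 q2. si (%r1 q1.
 F (s*[B]s1*[B]r2*[B]r1) (a*[B]t2*[B]q2) (b*[B]t3*[B]q1)))))))"
 proof (rule smc, rule smc)
 fix s t a b assume m: "s <: B" "t <: B" "a <: B" "b <: B"
 have "ss (%s1 t1. dl B t1 (%t2 t3. si (%r2 q2. si (%r1 q1.
 F (s*[B]s1*[B]r2*[B]r1) (a*[B]t2*[B]q2) (b*[B]t3*[B]q1)))))
 = ss (%s1 t1. ss (%s2 t2. si (%r2 q2. si (%r1 q1.
 F (s*[B](s1*[B]s2)*[B]r2*[B]r1) (a*[B]t2*[B]q2) (b*[B]t1*[B]q1)))))"
 by (rule hex2) (use m in \<open>intro L; simp add: B\<close>)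
 thus "ss (%s1 t1. ss (%s2 t2. si (%r2 q2. si (%r1 q1.
 F (s*[B]s1*[B]s2*[B]r2*[B]r1) (a*[B]t2*[B]q2) (b*[B]t1*[B]q1)))))
 = ss (%s1 t1. dl B t1 (%t2 t3. si (%r2 q2. si (%r1 q1.
 F (s*[B]s1*[B]r2*[B]r1) (a*[B]t2*[B]q2) (b*[B]t3*[B]q1)))))"
 using m by (simp add: B)
 qed
 also have "... = si (%s t. ss (%s1 t1. dl B (t*[B]t1) (%a b. si (%r2 q2. si (%r1 q1.
 F ((s*[B]s1)*[B]r2*[B]r1) (a*[B]q2) (b*[B]q1))))))"
 proof (rule smc)
 fix s t assume m: "s <: B" "t <: B"
 have b: "bilin B B kk (%a b. si (%r2 q2. si (%r1 q1.
 F (s*[B]s1*[B]r2*[B]r1) (a*[B]q2) (b*[B]q1))))" if "s1 <: B" for s1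
 using that m by (intro L; simp add: B)
 show "dl B t (%a b. ss (%s1 t1. dl B t1 (%t2 t3. si (%r2 q2. si (%r1 q1.
 F (s*[B]s1*[B]r2*[B]r1) (a*[B]t2*[B]q2) (b*[B]t3*[B]q1))))))
 = ss (%s1 t1. dl B (t*[B]t1) (%a b. si (%r2 q2. si (%r1 q1.
 F ((s*[B]s1)*[B]r2*[B]r1) (a*[B]q2) (b*[B]q1)))))"
 using m b by (subst sm_swap) (simp add: B)
 qed
 also have "... = dl B (aone B) (%a b. si (%r2 q2. si (%r1 q1.
 F (aone B*[B]r2*[B]r1) (a*[B]q2) (b*[B]q1))))" by (rule ss_inv(2)[where F = "%u v. dl B v (%a b. si (%r2 q2. si (%r1 q1.
 F (u*[B]r2*[B]r1) (a*[B]q2) (b*[B]q1))))"])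
 (intro L lin_sm[OF B(3,3)] B(4); simp add: B)
 also have "... = si (%r2 q2. si (%r1 q1.
 F (aone B*[B]r2*[B]r1) (aone B*[B]q2) (aone B*[B]q1)))" by (rule B(11)) (intro L; simp add: B)
 also have "... = si (%r2 q2. si (%r1 q1. F (r2*[B]r1) q2 q1))" by (simp add: B)
 also have "... = ?r5" by (rule sm_swap)
 finally show ?thesis .
qed

text \<open>Killing a comultiplied leg of a hexagon by the counit expresses \<open>S\<close> as its
  partially counited copy times \<open>S\<close>; cancelling \<open>S\<close> shows that copy to be
  1. For the inverse, apply the counit to the product of \<open>S\<close> and its inverse.\<close>

lemma ss_counit:
 assumes ph: "lin B kk ph"
 shows "ss (%s t. eps B s * ph t) = ph (aone B)" "ss (%s t. ph s * eps B t) = ph (aone B)"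
 and "si (%s t. eps B s * ph t) = ph (aone B)" "si (%s t. ph s * eps B t) = ph (aone B)"
proof -
 have l: "ss (%s t. eps B s * ph t) = ph (aone B)" if ph: "lin B kk ph" for ph
 proof -
 note L = trilinI bilinI lin_smI lin_o[OF ph] BL lin_mult lin_o[OF B(5)] lin_id
 \<comment> \<open>The form \<open>?ps\<close> multiplies by the inverse of \<open>S\<close> before
   evaluating; this carries out the cancellation of \<open>S\<close>.\<close>
 let ?ps = "%b c. si (%r q. eps B (b*[B]r) * ph (c*[B]q))"
 have "ss (%s t. dl B s (%a b. eps B a * ?ps b t)) = ss (%s t. ss (%s' t'. eps B s * ?ps s' (t*[B]t')))"
 by (rule hex1) (intro L; simp add: B)
 moreover have "ss (%s t. dl B s (%a b. eps B a * ?ps b t)) = ss (%s t. ?ps s t)"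
 by (intro smc B(8); (intro L)?; simp add: B)
 moreover have "ss (%s t. ?ps s t) = eps B (aone B) * ph (aone B)"
 by (rule ss_inv(1)) (intro L; simp add: B)
 moreover have "ss (%s t. ss (%s' t'. eps B s * ?ps s' (t*[B]t'))) = ss (%s t. eps B s * ph t)"
 proof (rule smc)
 fix s t assume m: "s <: B" "t <: B"
 have "ss (%s' t'. si (%r q. eps B (s'*[B]r) * ph (t*[B]t'*[B]q))) = eps B (aone B) * ph (t*[B]aone B)"
 by (rule ss_inv(1)[where F = "%u v. eps B u * ph (t*[B]v)"]) (use m in \<open>intro L; simp add: B\<close>)
 thus "ss (%s' t'. eps B s * ?ps s' (t*[B]t')) = eps B s * ph t"
 using m by (simp add: sm_mult_left B(10-) del: sm_arg_cong cong: sm_arg_cong)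
 qed
 ultimately show ?thesis by (simp add: B(13))
 qed
 have r: "ss (%s t. ph s * eps B t) = ph (aone B)" if ph: "lin B kk ph" for ph
 proof -
 note L = trilinI bilinI lin_smI lin_o[OF ph] BL lin_mult lin_o[OF B(5)] lin_id
 let ?ps = "%b c. si (%r q. ph (b*[B]r) * eps B (c*[B]q))"
 have "ss (%s t. dl B t (%a b. ?ps s a * eps B b)) = ss (%s t. ss (%s' t'. ?ps (s*[B]s') t' * eps B t))"
 by (rule hex2) (intro L; simp add: B)
 moreover have "ss (%s t. dl B t (%a b. ?ps s a * eps B b)) = ss (%s t. ?ps s t)"
 by (intro smc B(9); (intro L)?; simp add: B)
 moreover have "ss (%s t. ?ps s t) = ph (aone B) * eps B (aone B)"
 by (rule ss_inv(1)) (intro L; simp add: B)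
 moreover have "ss (%s t. ss (%s' t'. ?ps (s*[B]s') t' * eps B t)) = ss (%s t. ph s * eps B t)"
 proof (rule smc)
 fix s t assume m: "s <: B" "t <: B"
 have "ss (%s' t'. si (%r q. ph (s*[B]s'*[B]r) * eps B (t'*[B]q))) = ph (s*[B]aone B) * eps B (aone B)"
 by (rule ss_inv(1)[where F = "%u v. ph (s*[B]u) * eps B v"]) (use m in \<open>intro L; simp add: B\<close>)
 thus "ss (%s' t'. ?ps (s*[B]s') t' * eps B t) = ph s * eps B t"
 using m by (simp add: sm_mult_right B(10-) del: sm_arg_cong cong: sm_arg_cong)
 qed
 ultimately show ?thesis by (simp add: B(13))
 qed
 show "ss (%s t. eps B s * ph t) = ph (aone B)" "ss (%s t. ph s * eps B t) = ph (aone B)"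
 using l[OF ph] r[OF ph] .
 note L = trilinI bilinI lin_smI lin_o[OF ph] BL lin_mult lin_o[OF B(5)] lin_id
 have "ph (aone B) = si (%r q. ss (%s t. eps B (r*[B]s) * ph (q*[B]t)))"
 by (subst ss_inv(2)[where F = "%u v. eps B u * ph v"]) (intro L; simp add: B | simp add: B)+
 also have "... = si (%r q. eps B r * ss (%s t. eps B s * ph (q*[B]t)))"
 by (simp add: B(12) sm_mult_left mult.assoc)
 also have "... = si (%r q. eps B r * ph q)"
 proof (rule smc)
 fix r q assume "q <: B"
 thus "eps B r * ss (%s t. eps B s * ph (q*[B]t)) = eps B r * ph q"
 by (subst l) (intro L | simp add: B)+
 qed
 finally show "si (%s t. eps B s * ph t) = ph (aone B)" by simp
 have "ph (aone B) = si (%r q. ss (%s t. ph (r*[B]s) * eps B (q*[B]t)))"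
 by (subst ss_inv(2)[where F = "%u v. ph u * eps B v"]) (intro L; simp add: B | simp add: B)+
 also have "... = si (%r q. ss (%s t. ph (r*[B]s) * eps B t) * eps B q)"
 by (simp add: B(12) sm_mult_left ac_simps)
 also have "... = si (%r q. ph r * eps B q)"
 proof (rule smc)
 fix r q assume "r <: B"
 thus "ss (%s t. ph (r*[B]s) * eps B t) * eps B q = ph r * eps B q"
 by (subst r) (intro L | simp add: B)+
 qed
 finally show "si (%s t. ph s * eps B t) = ph (aone B)" by simp
qed

end

definition quadlin :: "('k::field, 'x, 'a) vect_scheme => ('k, 'y, 'b) vect_scheme => ('k, 'z, 'c) vect_scheme =>
 ('k, 'w, 'd) vect_scheme => ('x => 'y => 'z => 'w => 'k) => bool" where
 "quadlin X Y Z W f <-> (\<forall>x\<in>car X. trilin Y Z W kk (f x)) &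
 (\<forall>y\<in>car Y. \<forall>z\<in>car Z. \<forall>w\<in>car W. lin X kk (%x. f x y z w))"

lemma quadlinI:
 assumes "!!y z w. y <: Y ==> z <: Z ==> w <: W ==> lin X kk (%x. f x y z w)"
 and "!!x z w. x <: X ==> z <: Z ==> w <: W ==> lin Y kk (%y. f x y z w)"
 and "!!x y w. x <: X ==> y <: Y ==> w <: W ==> lin Z kk (%z. f x y z w)"
 and "!!x y z. x <: X ==> y <: Y ==> z <: Z ==> lin W kk (%w. f x y z w)"
 shows "quadlin X Y Z W (%x y z w. f x y z w)"
 using assms unfolding quadlin_def trilin_def bilin_def by simp

lemma quadlinD:
 assumes "quadlin X Y Z W f"
 shows "lin U X g ==> y <: Y ==> z <: Z ==> w <: W ==> lin U kk (%u. f (g u) y z w)"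
 and "lin U Y h ==> x <: X ==> z <: Z ==> w <: W ==> lin U kk (%u. f x (h u) z w)"
 and "lin U Z k ==> x <: X ==> y <: Y ==> w <: W ==> lin U kk (%u. f x y (k u) w)"
 and "lin U W l ==> x <: X ==> y <: Y ==> z <: Z ==> lin U kk (%u. f x y z (l u))"
proof -
 have t: "trilin Y Z W kk (f x)" if "x <: X" for x using assms that unfolding quadlin_def by blast
 show "lin U Y h ==> x <: X ==> z <: Z ==> w <: W ==> lin U kk (%u. f x (h u) z w)"
 using trilinD(2)[OF t] .
 show "lin U Z k ==> x <: X ==> y <: Y ==> w <: W ==> lin U kk (%u. f x y (k u) w)"
 using trilinD(3)[OF t] .
 show "lin U W l ==> x <: X ==> y <: Y ==> z <: Z ==> lin U kk (%u. f x y z (l u))"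
 using trilinD(4)[OF t] .
 assume "y <: Y" "z <: Z" "w <: W"
 hence "lin X kk (%x. f x y z w)" using assms unfolding quadlin_def by blast
 thus "lin U X g ==> lin U kk (%u. f (g u) y z w)" by (rule lin_o)
qed

section \<open>Bialgebras under \<open>B\<close>, with the image of \<open>S\<close> as
  R-matrix\<close>

context qt_hopf
begin

text \<open>Quasi-cocommutativity for the image of \<open>S\<close> under \<open>u\<close>, written
  with sums over \<open>S\<close> itself so that no R-matrix of \<open>H\<close> has to be
  named.\<close>

definition qc :: "('k, 'h, 'y) bialg_scheme => ('b => 'h) => bool" where
 "qc H u <-> (\<forall>x\<in>car H. \<forall>F. bilin H H kk F -->
 dl H x (%a c. si (%s' t'. ss (%s t. F (u s'*[H]c*[H]u s) (u t'*[H]a*[H]u t)))) = dl H x F)"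

lemma push_sm:
 assumes H: "bialgebra H" and u: "u : bialg_maps B H" and F: "bilin H H kk F"
 shows "sm H H (tmap B B H H u u S) F = ss (%s t. F (u s) (u t))"
 and "sm H H (ainv (talg H H) (tmap B B H H u u S)) F = si (%s t. F (u s) (u t))"
 using bialgD(3)[OF H] bmapD(1)[OF u bB H] F B S_closed by (simp_all add: tmap_invertible[OF bB H u inv_S] sm_tmap flip: Si_def)

text \<open>A bialgebra map carries invertibility and both hexagons from \<open>S\<close> to its
  image, so quasi-cocommutativity is the one axiom with content.\<close>

lemma quasitriangular_push_iff:
 assumes hopf: "hopf_algebra H" and u: "u : bialg_maps B H"
 shows "quasitriangular H (tmap B B H H u u S) <-> qc H u"
proof -
 note bH = hopfD[OF hopf]
 note H = bialgD[OF bH] algebraD[OF bialgD(1)[OF bH]]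
 note U = bmapD[OF u bB bH]
 let ?R = "tmap B B H H u u S"
 have inv: "invertible_in (talg H H) ?R" by (rule tmap_invertible(1)[OF bB bH u inv_S])
 have 1: "sm H H (ainv (talg H H) ?R) (%s' t'. dl H x (%a c. sm H H ?R (%s t.
 F (s'*[H]c*[H]s) (t'*[H]a*[H]t))))
 = dl H x (%a c. si (%s' t'. ss (%s t. F (u s'*[H]c*[H]u s) (u t'*[H]a*[H]u t))))"
 if F: "bilin H H kk F" for F x
 proof -
 note L = bilinI lin_smI bilinD(2,3)[OF F] alg_lin[OF H(1)] lin_id
 have b: "bilin H H kk (%s t. F (p*[H]s) (q*[H]t))" "bilin H H kk (%s' t'. dl H x (%a c. ss (%s t.
 F (s'*[H]c*[H]u s) (t'*[H]a*[H]u t))))" if "p <: H" "q <: H" for p q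
 using that by (intro L; simp add: H U)+
 have c: "bilin H H kk (%s t. F (p*[H]c*[H]s) (q*[H]a*[H]t))"
 if "p <: H" "q <: H" "a <: H" "c <: H" for p q a c
 using that by (intro L; simp add: H U)
 show ?thesis
 using b c algebraD(3)[OF H(1)] by (simp add: push_sm[OF bH u] sm_swap[of B B Si])
 qed
 have h: "ss (%s t. dl H (u t) (%a b. F (u s) a b)) = ss (%s t. ss (%s' t'. F (u s*[H]u s') (u t') (u t)))" (is "?l8 = ?r8")
 "ss (%s t. dl H (u s) (%a b. F a b (u t))) = ss (%s t. ss (%s' t'. F (u s) (u s') (u t*[H]u t')))"
 if F: "trilin H H H kk F" for F
 proof -
 note L = trilinI bilinI lin_smI trilinD(2,3,4)[OF F] lin_o[OF U(1)] lin_id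
 have b: "bilin H H kk (F s)" "bilin H H kk (%a b. F a b s)" if "s <: H" for s
 using that by (intro L; simp add: U)+
 have t: "trilin B B B kk (%a b c. F (u a) (u b) (u c))" by (intro L; simp add: U)
 show "?l8 = ?r8"
 "ss (%s t. dl H (u s) (%a b. F a b (u t))) = ss (%s t. ss (%s' t'. F (u s) (u s') (u t*[H]u t')))"
 using hex1[OF t] hex2[OF t] b by (simp_all add: U(2,5) flip: U(3))
 qed
 have h': "sm H H ?R (%s t. dl H t (%a b. F s a b)) = sm H H ?R (%s t. sm H H ?R (%s' t'. F (s*[H]s') t' t))"
 "sm H H ?R (%s t. dl H s (%a b. F a b t)) = sm H H ?R (%s t. sm H H ?R (%s' t'. F s s' (t*[H]t')))"
 if F: "trilin H H H kk F" for F
 proof -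
 note L = trilinI bilinI lin_smI trilinD(2,3,4)[OF F] lin_o[OF U(1)] alg_lin[OF H(1)] lin_id
 have b: "bilin H H kk (%s t. dl H t (%a b. F s a b))" "bilin H H kk (%s t. dl H s (%a b. F a b t))"
 "bilin H H kk (%s t. ss (%s' t'. F (s*[H]u s') (u t') t))"
 "bilin H H kk (%s t. ss (%s' t'. F s (u s') (t*[H]u t')))" by (intro L lin_sm[OF H(3,3)] H(4); simp add: U H)+
 have c: "bilin H H kk (%s' t'. F (s*[H]s') t' t)" "bilin H H kk (%s' t'. F s s' (t*[H]t'))"
 if "s <: H" "t <: H" for s t using that by (intro L; simp add: U H)+
 show "sm H H ?R (%s t. dl H t (%a b. F s a b)) = sm H H ?R (%s t. sm H H ?R (%s' t'. F (s*[H]s') t' t))"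
 "sm H H ?R (%s t. dl H s (%a b. F a b t)) = sm H H ?R (%s t. sm H H ?R (%s' t'. F s s' (t*[H]t')))"
 using b c h[OF F] by (simp_all add: push_sm(1)[OF bH u])
 qed
 show ?thesis
 unfolding quasitriangular_iff[OF hopf inv] qc_def using 1 h' by auto
qed

context
 fixes H :: "('k, 'h, 'y) bialg_scheme" and u :: "'b => 'h"
 assumes bH: "bialgebra H" and u: "u : bialg_maps B H"
begin

lemma dl_conj:
 assumes "b <: B" "c <: B" "h <: H" and F: "bilin H H kk F"
 shows "dl H (u b*[H]h*[H]u c) F = dl H h (%h1 h2. dl B b (%b1 b2. dl B c (%c1 c2.
 F (u b1*[H]h1*[H]u c1) (u b2*[H]h2*[H]u c2))))"
proof -
 note H = bialgD[OF bH] algebraD[OF bialgD(1)[OF bH]]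
 note U = bmapD[OF u bB bH]
 note L = bilinI lin_smI bilinD(2,3)[OF F] alg_lin[OF H(1)] lin_id lin_sm[OF H(3,3)] H(4)
 have b1: "bilin H H kk (%a d. F (p*[H]a) (q*[H]d))" if "p <: H" "q <: H" for p q
 using that by (intro L; simp add: U H)
 have b2: "bilin H H kk (%a d. F (p*[H]p'*[H]a) (q*[H]q'*[H]d))"
 if "p <: H" "q <: H" "p' <: H" "q' <: H" for p q p' q'
 using that by (intro L; simp add: U H)
 have b3: "bilin H H kk (%a d. dl H k (%h1 h2. dl B c (%c1 c2. F (a*[H]h1*[H]u c1) (d*[H]h2*[H]u c2))))" for k
 by (intro L; simp add: U H)
 show ?thesis
 using assms b1 b2 b3 by (simp add: H U sm_swap[of B B "acomul B b"])
qed

text \<open>The coproduct of the conjugate \<open>u(s') h u(s)\<close> comultiplies the first legs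
  of \<open>S\<close> and of its inverse, and the hexagons replace each by two copies. In braided
  terms: braiding past a coproduct is braiding past each of its factors.\<close>

lemma conj1:
 assumes h: "h <: H" and G: "quadlin H H B B G"
 shows "si (%s' t'. ss (%s t. dl H (u s'*[H]h*[H]u s) (%f1 f2. G f1 f2 t' t)))
 = dl H h (%h1 h2. si (%s' t'. si (%s'' t''. ss (%s t. ss (%sg tu.
 G (u s'*[H]h1*[H]u s) (u s''*[H]h2*[H]u sg) (t''*[B]t') (t*[B]tu))))))" (is "?l9 = ?r9")
proof -
 note H = bialgD[OF bH] algebraD[OF bialgD(1)[OF bH]]
 note U = bmapD[OF u bB bH]
 note L = trilinI bilinI lin_smI quadlinD[OF G] alg_lin[OF H(1)] BL lin_id lin_o[OF U(1)]
 have b: "bilin H H kk (%f1 f2. G f1 f2 t' t)" if "t' <: B" "t <: B" for t t'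
 using that by (intro L)
 have "?l9 = dl H h (%h1 h2. si (%s' t'. dl B s' (%b1 b2. ss (%s t. dl B s (%c1 c2. G (u b1*[H]h1*[H]u c1) (u b2*[H]h2*[H]u c2) t' t)))))"
 using h b by (simp add: dl_conj sm_swap[of B B S] sm_swap[of B B Si H H] cong: smc)
 also have "... = dl H h (%h1 h2. si (%s' t'. dl B s' (%b1 b2. ss (%s t. ss (%sg tu.
 G (u b1*[H]h1*[H]u s) (u b2*[H]h2*[H]u sg) t' (t*[B]tu))))))"
 by (rule smc, rule smc, rule smc, rule hex1) (intro L; simp add: U H)
 also have "... = ?r9" by (rule smc, rule hex1_inv) (intro L; simp add: U H B)
 finally show ?thesis .
qed

text \<open>The same with the second legs, so the two copies act on \<open>h1\<close> and
  \<open>h2\<close> in the opposite order.\<close>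

lemma conj2:
 assumes h: "h <: H" and G: "quadlin H H B B G"
 shows "si (%s' t'. ss (%s t. dl H (u t'*[H]h*[H]u t) (%f1 f2. G f1 f2 s' s)))
 = dl H h (%h1 h2. si (%s' t'. si (%s'' t''. ss (%s t. ss (%sg tu.
 G (u t''*[H]h1*[H]u tu) (u t'*[H]h2*[H]u t) (s''*[B]s') (s*[B]sg))))))" (is "?l10 = ?r10")
proof -
 note H = bialgD[OF bH] algebraD[OF bialgD(1)[OF bH]]
 note U = bmapD[OF u bB bH]
 note L = trilinI bilinI lin_smI quadlinD[OF G] alg_lin[OF H(1)] BL lin_id lin_o[OF U(1)]
 have b: "bilin H H kk (%f1 f2. G f1 f2 t' t)" if "t' <: B" "t <: B" for t t'
 using that by (intro L)
 have "?l10 = dl H h (%h1 h2. si (%s' t'. dl B t' (%b1 b2. ss (%s t. dl B t (%c1 c2. G (u b1*[H]h1*[H]u c1) (u b2*[H]h2*[H]u c2) s' s)))))"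
 using h b by (simp add: dl_conj sm_swap[of B B S] sm_swap[of B B Si H H] cong: smc)
 also have "... = dl H h (%h1 h2. si (%s' t'. dl B t' (%b1 b2. ss (%s t. ss (%sg tu.
 G (u b1*[H]h1*[H]u tu) (u b2*[H]h2*[H]u t) s' (s*[B]sg))))))"
 by (rule smc, rule smc, rule smc, rule hex2) (intro L; simp add: U H)
 also have "... = ?r10" by (rule smc, rule hex2_inv) (intro L; simp add: U H B)
 finally show ?thesis .
qed

end

end

section \<open>The twisted tensor product\<close>

text \<open>Tensor products look only at carrier, addition and scalars, so records of different
  types over the same space give the same tensor product.\<close>

lemma tens_cong:
 assumes "car X = car X'" "vadd X = vadd X'" "vsmul X = vsmul X'"
 and "car Y = car Y'" "vadd Y = vadd Y'" "vsmul Y = vsmul Y'"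
 shows "tens X Y = tens X' Y'" "elt X Y = elt X' Y'" "sm X Y = sm X' Y'"
proof -
 have k: "ker\<^sub>k X Y = ker\<^sub>k X' Y'" by (simp add: ker\<^sub>k_def bilin_rels_def assms)
 thus "tens X Y = tens X' Y'" "elt X Y = elt X' Y'" by (simp_all add: tens_def quot_space_def elt_def fun_eq_iff assms)
 show "sm X Y = sm X' Y'" by (intro ext; simp only: sm_def rep_def assms)+
qed

lemma lin_cong_space:
 assumes "car X = car X'" "vadd X = vadd X'" "vsmul X = vsmul X'"
 and "car Y = car Y'" "vadd Y = vadd Y'" "vsmul Y = vsmul Y'"
 shows "lin X Y = lin X' Y'" "lin_maps X Y = lin_maps X' Y'" by (intro ext; simp only: lin_def assms) (simp only: lin_maps_def assms)

text \<open>Comultiplication of a product of two comonoids in a braided category: the inner legs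
  \<open>x2\<close> and \<open>e1\<close> change places by the braiding, that is, by the flip
  followed by conjugation with \<open>S\<close>.\<close>

definition comul_pair :: "('k::field, 'b, 'z) bialg_scheme => (('b \<times> 'b) \<Rightarrow>\<^sub>0 'k) set => (('b \<times> 'b) \<Rightarrow>\<^sub>0 'k) set =>
 ('k, 'x, 'p) bialg_scheme => ('b => 'x) => ('k, 'e, 'q) bialg_scheme => ('b => 'e) => 'x => 'e => _" where
 "comul_pair B S Si X uX E uE x e = (let T = tens (tens X E) (tens X E) in
 tlift X X T (%x1 x2. tlift E E T (%e1 e2. tlift B B T (%s' t'. tlift B B T (%s t.
 elt (tens X E) (tens X E) (elt X E x1 (uE s'*[E]e1*[E]uE s)) (elt X E (uX t'*[X]x2*[X]uX t) e2))
 S) Si) (acomul E e)) (acomul X x))"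

context qt_hopf
begin

text \<open>The comultiplication of \<open>X \<otimes> E\<close> is twisted by the image of \<open>S\<close> in \<open>E \<otimes> X\<close>,
 so that the diagonal map \<open>B \<rightarrow> X \<otimes> E\<close> becomes a morphism.\<close>

definition tw :: "('k, 'x, 'p) bialg_scheme => ('b => 'x) => ('k, 'e, 'q) bialg_scheme => ('b => 'e) =>
 ('k, (('x \<times> 'e) \<Rightarrow>\<^sub>0 'k) set) bialg" where
 "tw X uX E uE = alg.extend (talg X E) (bialg.fields
 (tlift X E (tens (tens X E) (tens X E)) (comul_pair B S Si X uX E uE))
 (tlift X E kk (%x e. eps X x * eps E e)))"

lemma tw_simps [simp]:
 "car (tw X uX E uE) = car (tens X E)" "vadd (tw X uX E uE) = vadd (tens X E)"
 "vsmul (tw X uX E uE) = vsmul (tens X E)" "vzero (tw X uX E uE) = vzero (tens X E)"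
 "aone (tw X uX E uE) = elt X E (aone X) (aone E)"
 "amul (tw X uX E uE) = amul (talg X E)"
 "acomul (tw X uX E uE) = tlift X E (tens (tens X E) (tens X E)) (comul_pair B S Si X uX E uE)"
 "eps (tw X uX E uE) = tlift X E kk (%x e. eps X x * eps E e)" by (simp_all add: tw_def alg.extend_def bialg.fields_def talg_def vect.extend_def alg.fields_def)

lemma tw_tens:
 "tens (tw X uX E uE) (tw X uX E uE) = tens (tens X E) (tens X E)"
 "elt (tw X uX E uE) (tw X uX E uE) = elt (tens X E) (tens X E)"
 "sm (tw X uX E uE) (tw X uX E uE) = sm (tens X E) (tens X E)" by (rule tens_cong; simp)+

lemma lin_tw: "lin (tw X uX E uE) V = lin (tens X E) V" "lin V (tw X uX E uE) = lin V (tens X E)"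
 by (intro ext; simp add: lin_def)+

end

locale qt_pair = qt_hopf B S for B :: "('k::field, 'b, 'z) bialg_scheme" and S +
 fixes X :: "('k, 'x, 'p) bialg_scheme" and uX :: "'b => 'x"
 and E :: "('k, 'e, 'q) bialg_scheme" and uE :: "'b => 'e"
 assumes bX: "bialgebra X" and uX: "uX : bialg_maps B X"
 and bE: "bialgebra E" and uE: "uE : bialg_maps B E"
begin

abbreviation "W == tw X uX E uE"
abbreviation "XE == tens X E"
lemmas X = bialgD[OF bX] algebraD[OF bialgD(1)[OF bX]]
lemmas E = bialgD[OF bE] algebraD[OF bialgD(1)[OF bE]]
lemmas XL = alg_lin[OF X(1)]
lemmas EL = alg_lin[OF E(1)]
lemmas UX = bmapD[OF uX bB bX]
lemmas UE = bmapD[OF uE bB bE]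

lemma vspace_XE [simp]: "vspace XE" "vspace (tens XE XE)"
 using X E by simp_all

lemmas XEL = lin_elt[OF X(3) E(3)]
lemmas plin = bilinI trilinI lin_smI XEL XL EL BL lin_id lin_o[OF UX(1)] lin_o[OF UE(1)] lin_mult
 lin_o[OF X(5)] lin_o[OF E(5)]
lemmas cl = X(6) E(6) X(16) E(16) X(20) E(20) UX(2) UE(2) elt_closed[OF X(3) E(3)] B(6,16,20)

lemma bilin_comul_pair:
 shows "bilin X E (tens XE XE) (comul_pair B S Si X uX E uE)"
 and "[|bilin XE XE kk F; x <: X; e <: E|] ==> sm XE XE (comul_pair B S Si X uX E uE x e) F
 = dl X x (%x1 x2. dl E e (%e1 e2. si (%s' t'. ss (%s t.
 F (elt X E x1 (uE s'*[E]e1*[E]uE s)) (elt X E (uX t'*[X]x2*[X]uX t) e2)))))"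
proof -
 let ?T = "tens XE XE"
 let ?f = "%x1 x2 e1 e2 s' t' s t. elt XE XE (elt X E x1 (uE s'*[E]e1*[E]uE s)) (elt X E (uX t'*[X]x2*[X]uX t) e2)"
 note EE = lin_elt[OF vspace_XE(1,1)]
 have b1: "bilin B B ?T (%s t. ?f x1 x2 e1 e2 s' t' s t)"
 if "x1 <: X" "x2 <: X" "e1 <: E" "e2 <: E" "s' <: B" "t' <: B"
 for x1 x2 e1 e2 s' t'
 using that by (intro plin EE; simp add: cl)
 \<comment> \<open>The nested lifts are peeled off from the inside. \<open>f2\<close>,
   \<open>f3\<close> and \<open>f4\<close> are the partial evaluations, each shown linear in the
   remaining variables before the next lift is formed.\<close>
 define f2 where "f2 x1 x2 e1 e2 s' t' = tlift B B ?T (%s t. ?f x1 x2 e1 e2 s' t' s t) S" for x1 x2 e1 e2 s' t'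
 have b2: "bilin B B ?T (%s' t'. f2 x1 x2 e1 e2 s' t')"
 if "x1 <: X" "x2 <: X" "e1 <: E" "e2 <: E"
 for x1 x2 e1 e2
 unfolding f2_def using that b1 by (intro bilinI lin_tlift_body plin(4-) EE; simp add: cl B(3) S_closed)
 have c2: "f2 x1 x2 e1 e2 s' t' <: ?T"
 if "x1 <: X" "x2 <: X" "e1 <: E" "e2 <: E" "s' <: B" "t' <: B"
 for x1 x2 e1 e2 s' t'
 using bilinD(1)[OF b2] that by blast
 have l2: "lin E ?T (%e2. f2 x1 x2 e1 e2 s' t')" "lin E ?T (%e1. f2 x1 x2 e1 e2 s' t')"
 "lin X ?T (%x2. f2 x1 x2 e1 e2 s' t')" "lin X ?T (%x1. f2 x1 x2 e1 e2 s' t')"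
 if "x1 <: X" "x2 <: X" "e1 <: E" "e2 <: E" "s' <: B" "t' <: B"
 for x1 x2 e1 e2 s' t'
 unfolding f2_def using that b1 by (intro lin_tlift_body plin(4-) EE; simp add: cl B(3) X(3) E(3) S_closed)+
 define f3 where "f3 x1 x2 e1 e2 = tlift B B ?T (%s' t'. f2 x1 x2 e1 e2 s' t') Si" for x1 x2 e1 e2
 have l3: "lin E ?T (%e2. f3 x1 x2 e1 e2)" "lin E ?T (%e1. f3 x1 x2 e1 e2)"
 "lin X ?T (%x2. f3 x1 x2 e1 e2)" "lin X ?T (%x1. f3 x1 x2 e1 e2)"
 if "x1 <: X" "x2 <: X" "e1 <: E" "e2 <: E"
 for x1 x2 e1 e2
 unfolding f3_def using that b2 l2 by (intro lin_tlift_body; simp add: B(3) X(3) E(3) S_closed)+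
 have b3: "bilin E E ?T (f3 x1 x2)" if "x1 <: X" "x2 <: X" for x1 x2
 using that l3 by (intro bilinI) simp_all
 define f4 where "f4 x1 x2 e = tlift E E ?T (f3 x1 x2) (acomul E e)" for x1 x2 e
 have l4': "lin E ?T (f4 x1 x2)" if "x1 <: X" "x2 <: X" for x1 x2
 unfolding f4_def using that b3 by (intro lin_tlift; simp add: E(3,4))
 have l4: "lin X ?T (%x2. f4 x1 x2 e)" "lin X ?T (%x1. f4 x1 x2 e)"
 if "x1 <: X" "x2 <: X" "e <: E" for x1 x2 e
 unfolding f4_def using that b3 l3 by (intro lin_tlift_body lin_tlift; simp add: X(3) E(3,4,6))+
 have b4: "bilin X X ?T (%x1 x2. f4 x1 x2 e)" if "e <: E" for e
 using that l4 by (intro bilinI) simp_all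
 have e: "comul_pair B S Si X uX E uE x e = tlift X X ?T (%x1 x2. f4 x1 x2 e) (acomul X x)" for x e
 by (simp add: comul_pair_def f2_def[abs_def] f3_def[abs_def] f4_def Let_def)
 show "bilin X E ?T (comul_pair B S Si X uX E uE)"
 unfolding bilin_def e using l4' b4 by (auto intro!: lin_tlift_body lin_tlift simp: X E)
 assume F: "bilin XE XE kk F" and x: "x <: X" and e': "e <: E"
 show "sm XE XE (comul_pair B S Si X uX E uE x e) F
 = dl X x (%x1 x2. dl E e (%e1 e2. si (%s' t'. ss (%s t.
 F (elt X E x1 (uE s'*[E]e1*[E]uE s)) (elt X E (uX t'*[X]x2*[X]uX t) e2)))))" (is "?l11 = _")
 proof -
 have 4: "?l11 = dl X x (%x1 x2. sm XE XE (f4 x1 x2 e) F)"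
 unfolding e using x e' b4 F by (simp add: sm_tlift X)
 have 3: "sm XE XE (f4 x1 x2 e) F = dl E e (%e1 e2. sm XE XE (f3 x1 x2 e1 e2) F)"
 if "x1 <: X" "x2 <: X" for x1 x2
 unfolding f4_def using that e' b3 F by (simp add: sm_tlift E)
 have 2: "sm XE XE (f3 x1 x2 e1 e2) F = si (%s' t'. sm XE XE (f2 x1 x2 e1 e2 s' t') F)"
 if "x1 <: X" "x2 <: X" "e1 <: E" "e2 <: E" for x1 x2 e1 e2
 unfolding f3_def using that b2 F by (simp add: sm_tlift B(3) S_closed)
 have 1: "sm XE XE (f2 x1 x2 e1 e2 s' t') F = ss (%s t. F (elt X E x1 (uE s'*[E]e1*[E]uE s)) (elt X E (uX t'*[X]x2*[X]uX t) e2))"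
 if "x1 <: X" "x2 <: X" "e1 <: E" "e2 <: E" "s' <: B" "t' <: B"
 for x1 x2 e1 e2 s' t'
 unfolding f2_def using that b1 F by (simp add: sm_tlift B(3) S_closed cl)
 show ?thesis unfolding 4 by (simp add: 1 2 3)
 qed
qed

lemma bilin_counit_pair: "bilin X E kk (%x e. eps X x * eps E e)" by (intro plin)

lemma acomul_W_maps: "acomul W : lin_maps XE (tens XE XE)"
 and acounit_W_maps: "eps W : lin_maps XE kk"
proof -
 show "acomul W : lin_maps XE (tens XE XE)"
 using tlift_maps(1)[OF X(3) E(3) _ bilin_comul_pair(1)] by simp
 show "eps W : lin_maps XE kk"
 using tlift_maps(1)[OF X(3) E(3) vspace_ground bilin_counit_pair] by simp
qed

lemma dl_W_elt:
 assumes "bilin XE XE kk F" "x <: X" "e <: E"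
 shows "dl W (elt X E x e) F = dl X x (%x1 x2. dl E e (%e1 e2. si (%s' t'. ss (%s t.
 F (elt X E x1 (uE s'*[E]e1*[E]uE s)) (elt X E (uX t'*[X]x2*[X]uX t) e2)))))"
 unfolding tw_tens using assms bilin_comul_pair X(3) E(3) by simp

lemma lin_dl_W:
 assumes F: "bilin XE XE kk F" and f: "lin V XE f"
 shows "lin V kk (%v. dl W (f v) F)"
 unfolding tw_tens using lin_o[OF lin_mapsD[OF acomul_W_maps] f] F by (intro lin_sm) auto

lemma acounit_W_elt: "x <: X ==> e <: E ==> eps W (elt X E x e) = eps X x * eps E e"
 using tlift_elt[OF X(3) E(3) vspace_ground bilin_counit_pair] by simp

lemma XE_eq:
 \<comment> \<open>linear forms on \<open>X \<otimes> E\<close> are compared on simple tensors\<close>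
 assumes "lin XE kk g" "lin XE kk h" "w <: XE"
 and "!!x y. x <: X ==> y <: E ==> g (elt X E x y) = h (elt X E x y)"
 shows "g w = h w" by (rule tens_lin_eq[OF X(3) E(3) assms(1,2,4,3)])

lemma W_algebra: "algebra W"
 using algebra_talg[OF X(1) E(1)] vspace_cong[of W XE] unfolding algebra_iff
 by (simp add: bilin_def lin_def)

lemma W_mult: "[|x <: X; e <: E; x' <: X; e' <: E|] ==>
 elt X E x e*[W]elt X E x' e' = elt X E (x*[X]x') (e*[E]e')"
 using elt_mult_elt[OF X(1) E(1)] by simp

text \<open>A counit on one factor of the coproduct kills one leg each of \<open>S\<close> and its
  inverse, so \<open>ss_counit\<close> removes the twist and the ordinary counit laws
  remain.\<close>

lemma W_counit:
 assumes w: "w <: XE" and ph: "lin XE kk ph"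
 shows "dl W w (%a b. eps W a * ph b) = ph w" "dl W w (%a b. ph a * eps W b) = ph w"
proof -
 note L = plin lin_o[OF ph]
 have eW: "lin XE kk (eps W)" using acounit_W_maps by blast
 have b: "bilin XE XE kk (%a b. eps W a * ph b)" "bilin XE XE kk (%a b. ph a * eps W b)"
 using lin_o[OF eW lin_id] ph by (auto intro!: bilinI lin_mult simp del: tw_simps)
 show "dl W w (%a b. eps W a * ph b) = ph w"
 proof (rule XE_eq[OF lin_dl_W[OF b(1) lin_id] ph w])
 fix x e assume m: "x <: X" "e <: E"
 have "dl W (elt X E x e) (%a b. eps W a * ph b)
 = dl X x (%x1 x2. dl E e (%e1 e2. si (%s' t'. eps B s' * ss (%s t. eps B s *
 (eps X x1 * (eps E e1 * ph (elt X E (uX t'*[X]x2*[X]uX t) e2)))))))"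
 unfolding dl_W_elt[OF b(1) m] by (simp add: acounit_W_elt cl E(12) UE(6) ac_simps sm_mult_left del: tw_simps)
 also have "... = dl X x (%x1 x2. dl E e (%e1 e2. eps X x1 * (eps E e1 * ph (elt X E x2 e2))))"
 proof (rule smc, rule smc)
 fix x1 x2 e1 e2 assume m: "x1 <: X" "x2 <: X" "e1 <: E" "e2 <: E"
 have "ss (%s t. eps B s * (eps X x1 * (eps E e1 * ph (elt X E (uX t'*[X]x2*[X]uX t) e2))))
 = eps X x1 * (eps E e1 * ph (elt X E (uX t'*[X]x2*[X]uX (aone B)) e2))" if "t' <: B" for t'
 by (rule ss_counit(1)) (use m that in \<open>intro L; simp add: cl\<close>)
 moreover have "si (%s' t'. eps B s' * (eps X x1 * (eps E e1 * ph (elt X E (uX t'*[X]x2*[X]uX (aone B)) e2))))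
 = eps X x1 * (eps E e1 * ph (elt X E (uX (aone B)*[X]x2*[X]uX (aone B)) e2))"
 by (rule ss_counit(3)) (use m in \<open>intro L; simp add: cl\<close>)
 ultimately show "si (%s' t'. eps B s' * ss (%s t. eps B s *
 (eps X x1 * (eps E e1 * ph (elt X E (uX t'*[X]x2*[X]uX t) e2)))))
 = eps X x1 * (eps E e1 * ph (elt X E x2 e2))"
 using m by (simp add: UX(4) X(14-))
 qed
 also have "... = dl X x (%x1 x2. eps X x1 * ph (elt X E x2 e))"
 unfolding sm_mult_left by (intro smc arg_cong2[of _ _ _ _ "(*)"] refl E(8); use m in \<open>(intro L)?; simp add: cl\<close>)
 also have "... = ph (elt X E x e)" by (rule X(8); use m in \<open>(intro L)?; simp add: cl\<close>)
 finally show "dl W (elt X E x e) (%a b. eps W a * ph b) = ph (elt X E x e)" .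
 qed
 show "dl W w (%a b. ph a * eps W b) = ph w"
 proof (rule XE_eq[OF lin_dl_W[OF b(2) lin_id] ph w])
 fix x e assume m: "x <: X" "e <: E"
 have "dl W (elt X E x e) (%a b. ph a * eps W b)
 = dl X x (%x1 x2. dl E e (%e1 e2. si (%s' t'. ss (%s t.
 ((ph (elt X E x1 (uE s'*[E]e1*[E]uE s)) * eps E e2) * eps X x2) * eps B t) * eps B t')))"
 unfolding dl_W_elt[OF b(2) m] by (simp add: acounit_W_elt cl X(12) UX(6) ac_simps sm_mult_left del: tw_simps)
 also have "... = dl X x (%x1 x2. dl E e (%e1 e2. (ph (elt X E x1 e1) * eps E e2) * eps X x2))"
 proof (rule smc, rule smc)
 fix x1 x2 e1 e2 assume m: "x1 <: X" "x2 <: X" "e1 <: E" "e2 <: E"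
 have "ss (%s t. ((ph (elt X E x1 (uE s'*[E]e1*[E]uE s)) * eps E e2) * eps X x2) * eps B t)
 = (ph (elt X E x1 (uE s'*[E]e1*[E]uE (aone B))) * eps E e2) * eps X x2" if "s' <: B" for s'
 by (rule ss_counit(2)) (use m that in \<open>intro L; simp add: cl\<close>)
 moreover have "si (%s' t'. ((ph (elt X E x1 (uE s'*[E]e1*[E]uE (aone B))) * eps E e2) * eps X x2) * eps B t')
 = (ph (elt X E x1 (uE (aone B)*[E]e1*[E]uE (aone B))) * eps E e2) * eps X x2"
 by (rule ss_counit(4)) (use m in \<open>intro L; simp add: cl\<close>)
 ultimately show "si (%s' t'. ss (%s t.
 ((ph (elt X E x1 (uE s'*[E]e1*[E]uE s)) * eps E e2) * eps X x2) * eps B t) * eps B t')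
 = (ph (elt X E x1 e1) * eps E e2) * eps X x2"
 using m by (simp add: UE(4) E(14-))
 qed
 also have "... = dl X x (%x1 x2. ph (elt X E x1 e) * eps X x2)"
 unfolding sm_mult_right by (intro smc arg_cong2[of _ _ _ _ "(*)"] refl E(9); use m in \<open>(intro L)?; simp add: cl\<close>)
 also have "... = ph (elt X E x e)" by (rule X(9); use m in \<open>(intro L)?; simp add: cl\<close>)
 finally show "dl W (elt X E x e) (%a b. ph a * eps W b) = ph (elt X E x e)" .
 qed
qed

text \<open>Conjugation is multiplicative: with \<open>S\<close> and its inverse inserted between
  two factors, the conjugate of a product becomes the product of the conjugates. Linearity reduces
  the claim to simple tensors.\<close>

lemma W_mult_dl:
 assumes w: "w <: XE" "w' <: XE" and F: "bilin XE XE kk F"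
 shows "dl W (w*[W]w') F = dl W w (%a b. dl W w' (%c d. F (a*[W]c) (b*[W]d)))"
proof -
 have WL: "lin V XE f ==> y <: XE ==> lin V XE (%v. f v*[W]y)"
 "lin V XE f ==> y <: XE ==> lin V XE (%v. y*[W]f v)"
 for V :: "('k, 'v, 'vz) vect_scheme" and f y
 using alg_lin[OF W_algebra, of V f y] unfolding lin_tw by simp_all
 have Wc: "a <: XE ==> b <: XE ==> a*[W]b <: XE" for a b
 using algebraD(7)[OF W_algebra, of a b] by simp
 note FL = bilinD(2,3)[OF F]
 have b1: "bilin XE XE kk (%c d. F (a*[W]c) (b*[W]d))" if "a <: XE" "b <: XE" for a b
 using that by (intro bilinI FL WL lin_id; simp add: Wc del: tw_simps)
 have b2: "bilin XE XE kk (%a b. dl W w' (%c d. F (a*[W]c) (b*[W]d)))" for w'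
 by (intro bilinI lin_smI FL WL lin_id; simp add: Wc del: tw_simps(2-))
 have l1: "lin XE kk (%w. dl W (w*[W]w') F)" if "w' <: XE" for w'
 using that by (intro lin_dl_W[OF F] WL lin_id)
 have l2: "lin XE kk (%w'. dl W (w*[W]w') F)" if "w <: XE" for w
 using that by (intro lin_dl_W[OF F] WL lin_id)
 have l3: "lin XE kk (%w'. dl W w (%a b. dl W w' (%c d. F (a*[W]c) (b*[W]d))))" for w
 by (intro lin_smI lin_dl_W lin_id b1) (simp_all only: tw_simps(1))
 show ?thesis
 proof (rule XE_eq[OF l1[OF w(2)] lin_dl_W[OF b2 lin_id] w(1)])
 fix x e assume m: "x <: X" "e <: E"
 show "dl W (elt X E x e*[W]w') F = dl W (elt X E x e) (%a b. dl W w' (%c d. F (a*[W]c) (b*[W]d)))"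
 proof (rule XE_eq[OF l2 l3 w(2)])
 show "elt X E x e <: XE" using m cl by simp
 fix x' e' assume m': "x' <: X" "e' <: E"
 note L = plin FL
 have bx: "bilin X X kk (%x1 x2. dl E (e*[E]e') (%e1 e2. si (%s' t'. ss (%s t.
 F (elt X E x1 (uE s'*[E]e1*[E]uE s)) (elt X E (uX t'*[X]x2*[X]uX t) e2)))))"
 by (intro L; simp add: cl)
 have be: "bilin E E kk (%e1 e2. si (%s' t'. ss (%s t.
 F (elt X E x1 (uE s'*[E]e1*[E]uE s)) (elt X E (uX t'*[X]x2*[X]uX t) e2))))"
 if "x1 <: X" "x2 <: X" for x1 x2
 using that by (intro L; simp add: cl)
 have "dl W (elt X E x e*[W]elt X E x' e') F = dl W (elt X E (x*[X]x') (e*[E]e')) F"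
 using m m' by (simp only: W_mult)
 also have "... = dl X x (%a b. dl X x' (%a' b'. dl E e (%c d. dl E e' (%c' d'. si (%s' t'. ss (%s t.
 F (elt X E (a*[X]a') (uE s'*[E](c*[E]c')*[E]uE s))
 (elt X E (uX t'*[X](b*[X]b')*[X]uX t) (d*[E]d'))))))))"
 unfolding dl_W_elt[OF F X(20)[OF m(1) m'(1)] E(20)[OF m(2) m'(2)]] X(10)[OF m(1) m'(1) bx]
 using m m' by (simp add: cl E(10)[OF _ _ be])
 \<comment> \<open>The trivial product of \<open>S\<close>, in the copy \<open>(s,t)\<close>, with
   its inverse, in the copy \<open>(p',q')\<close>, is inserted between \<open>c\<close> and
   \<open>c'\<close> and between \<open>b\<close> and \<open>b'\<close>.\<close>
 also have "... = dl X x (%a b. dl X x' (%a' b'. dl E e (%c d. dl E e' (%c' d'. si (%s' t'. ss (%s t. si (%p' q'. ss (%p q.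
 F (elt X E (a*[X]a') ((uE s'*[E]c*[E]uE s)*[E]uE p'*[E]c'*[E]uE p))
 (elt X E ((uX t'*[X]b*[X]uX t)*[X]uX q'*[X]b'*[X]uX q) (d*[E]d'))))))))))"
 proof (rule smc, rule smc, rule smc, rule smc, rule smc)
 fix a b a' b' c d c' d' s' t'
 assume k: "a <: X" "b <: X" "a' <: X" "b' <: X"
 "c <: E" "d <: E" "c' <: E" "d' <: E" "s' <: B" "t' <: B"
 have "ss (%s t. si (%p' q'. ss (%p q.
 F (elt X E (a*[X]a') (uE s'*[E]c*[E]uE (s*[B]p')*[E]c'*[E]uE p))
 (elt X E (uX t'*[X]b*[X]uX (t*[B]q')*[X]b'*[X]uX q) (d*[E]d')))))
 = ss (%p q. F (elt X E (a*[X]a') (uE s'*[E]c*[E]uE (aone B)*[E]c'*[E]uE p))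
 (elt X E (uX t'*[X]b*[X]uX (aone B)*[X]b'*[X]uX q) (d*[E]d')))"
 by (rule ss_inv(1)[where F = "%u v. ss (%p q. F (elt X E (a*[X]a') (uE s'*[E]c*[E]uE u*[E]c'*[E]uE p))
 (elt X E (uX t'*[X]b*[X]uX v*[X]b'*[X]uX q) (d*[E]d')))"])
 (use k in \<open>intro L; simp add: cl\<close>)
 thus "ss (%s t. F (elt X E (a*[X]a') (uE s'*[E](c*[E]c')*[E]uE s))
 (elt X E (uX t'*[X](b*[X]b')*[X]uX t) (d*[E]d')))
 = ss (%s t. si (%p' q'. ss (%p q.
 F (elt X E (a*[X]a') ((uE s'*[E]c*[E]uE s)*[E]uE p'*[E]c'*[E]uE p))
 (elt X E ((uX t'*[X]b*[X]uX t)*[X]uX q'*[X]b'*[X]uX q) (d*[E]d')))))"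
 using k by (simp add: UX(2-4) UE(2-4) X(16-) E(16-))
 qed
 also have "... = dl X x (%a b. dl E e (%c d. si (%s' t'. ss (%s t. dl X x' (%a' b'. dl E e' (%c' d'. si (%p' q'. ss (%p q.
 F (elt X E (a*[X]a') ((uE s'*[E]c*[E]uE s)*[E]uE p'*[E]c'*[E]uE p))
 (elt X E ((uX t'*[X]b*[X]uX t)*[X]uX q'*[X]b'*[X]uX q) (d*[E]d'))))))))))"
 by (simp only: sm_swap[of B B S X X "acomul X x'"] sm_swap[of B B Si X X "acomul X x'"]
 sm_swap[of B B S E E "acomul E e'"] sm_swap[of B B Si E E "acomul E e'"]
 sm_swap[of E E "acomul E e" X X "acomul X x'"])
 also have "... = dl W (elt X E x e) (%a b. dl W (elt X E x' e') (%c d. F (a*[W]c) (b*[W]d)))"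
 using m m' b1 by (simp add: dl_W_elt[OF b2] dl_W_elt W_mult cl del: tw_simps)
 finally show "dl W (elt X E x e*[W]elt X E x' e') F
 = dl W (elt X E x e) (%a b. dl W (elt X E x' e') (%c d. F (a*[W]c) (b*[W]d)))" .
 qed
 qed
qed

lemma sm_perm5:
 "si (%a b. ss (%c d. ss (%g h. si (%k l. ss (%p q. F a b c d g h k l p q)))))
 = si (%k l. ss (%c d. ss (%p q. si (%a b. ss (%g h. F a b c d g h k l p q)))))" (is "?l13 = ?r13")
proof -
 have "?l13 = si (%a b. ss (%c d. si (%k l. ss (%g h. ss (%p q. F a b c d g h k l p q)))))"
 by (rule smc, rule smc, rule sm_swap)
 also have "... = si (%a b. si (%k l. ss (%c d. ss (%g h. ss (%p q. F a b c d g h k l p q)))))"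
 by (rule smc, rule sm_swap)
 also have "... = si (%k l. si (%a b. ss (%c d. ss (%g h. ss (%p q. F a b c d g h k l p q)))))"
 by (rule sm_swap)
 also have "... = si (%k l. ss (%c d. si (%a b. ss (%g h. ss (%p q. F a b c d g h k l p q)))))"
 by (rule smc, rule sm_swap)
 also have "... = si (%k l. ss (%c d. si (%a b. ss (%p q. ss (%g h. F a b c d g h k l p q)))))"
 by (rule smc, rule smc, rule smc, rule sm_swap)
 also have "... = ?r13" by (rule smc, rule smc, rule sm_swap)
 finally show ?thesis .
qed

text \<open>Each side becomes a sum over three copies of \<open>S\<close> and three of its inverse.
  The hexagons split the twist of a coproduct: \<open>conj1\<close> for the factor in
  \<open>E\<close> on one side, \<open>conj2\<close> for the factor in \<open>X\<close> on the
  other.\<close>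

lemma W_coassoc:
 assumes w: "w <: XE" and F: "trilin XE XE XE kk F"
 shows "dl W w (%a b. dl W a (%c d. F c d b)) = dl W w (%a b. dl W b (%c d. F a c d))"
proof -
 note FL = trilinD(2,3,4)[OF F]
 have b1: "bilin XE XE kk (%c d. F c d b)" "bilin XE XE kk (%c d. F b c d)" if "b <: XE" for b
 using that by (intro bilinI FL lin_id; simp)+
 have b2: "bilin XE XE kk (%a b. dl W a (%c d. F c d b))" "bilin XE XE kk (%a b. dl W b (%c d. F a c d))"
 by (rule bilinI; (rule lin_dl_W)?; (intro lin_smI)?; use b1 in \<open>(intro FL lin_id)?; simp only: tw_simps(1)\<close>)+
 show ?thesis
 proof (rule XE_eq[OF lin_dl_W[OF b2(1) lin_id] lin_dl_W[OF b2(2) lin_id] w])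
 fix x e assume m: "x <: X" "e <: E"
 note L = quadlinI plin FL
 have "dl W (elt X E x e) (%a b. dl W a (%c d. F c d b))
 = dl X x (%x1 x2. dl E e (%e1 e2. si (%s' t'. ss (%s t. dl X x1 (%a b. dl E (uE s'*[E]e1*[E]uE s) (%f1 f2.
 si (%p' q'. ss (%p q. F (elt X E a (uE p'*[E]f1*[E]uE p)) (elt X E (uX q'*[X]b*[X]uX q) f2)
 (elt X E (uX t'*[X]x2*[X]uX t) e2)))))))))"
 unfolding dl_W_elt[OF b2(1) m] by (simp add: dl_W_elt b1 cl del: tw_simps)
 also have "... = dl X x (%x1 x2. dl X x1 (%a b. dl E e (%e1 e2. si (%s' t'. ss (%s t. dl E (uE s'*[E]e1*[E]uE s) (%f1 f2.
 si (%p' q'. ss (%p q. F (elt X E a (uE p'*[E]f1*[E]uE p)) (elt X E (uX q'*[X]b*[X]uX q) f2)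
 (elt X E (uX t'*[X]x2*[X]uX t) e2)))))))))" by (simp only: sm_swap[of B B S X X] sm_swap[of B B Si X X] sm_swap[of E E "acomul E e" X X])
 also have "... = dl X x (%x1 x2. dl X x1 (%a b. dl E e (%e1 e2. dl E e1 (%c d.
 si (%s' t'. si (%s'' t''. ss (%s t. ss (%sg tu. si (%p' q'. ss (%p q.
 F (elt X E a (uE p'*[E](uE s'*[E]c*[E]uE s)*[E]uE p))
 (elt X E (uX q'*[X]b*[X]uX q) (uE s''*[E]d*[E]uE sg))
 (elt X E (uX (t''*[B]t')*[X]x2*[X]uX (t*[B]tu)) e2)))))))))))"
 by (rule smc, rule smc, rule smc, rule conj1[OF bE uE, where G = "%f1 f2 t' t.
 si (%p' q'. ss (%p q. F (elt X E _ (uE p'*[E]f1*[E]uE p)) (elt X E (uX q'*[X]_*[X]uX q) f2)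
 (elt X E (uX t'*[X]_*[X]uX t) _)))"])
 ((intro L)?; simp add: cl)+
 \<comment> \<open>A renaming of copies: after the reordering by \<open>sm_perm5\<close>, the former
   pair \<open>(p,q)\<close> of the inner twist is called \<open>(sg,tu)\<close> and vice versa, and
   likewise for the inverses.\<close>
 also have "... = dl X x (%x1 x2. dl X x1 (%a b. dl E e (%e1 e2. dl E e1 (%c d.
 si (%s' t'. si (%s'' t''. ss (%s t. ss (%sg tu. si (%p' q'. ss (%p q.
 F (elt X E a (uE (s''*[B]s')*[E]c*[E]uE (s*[B]sg)))
 (elt X E (uX t''*[X]b*[X]uX tu) (uE p'*[E]d*[E]uE p))
 (elt X E (uX q'*[X](uX t'*[X]x2*[X]uX t)*[X]uX q) e2)))))))))))"
 by (rule smc, rule smc, rule smc, rule smc, rule smc, subst sm_perm5)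
 (simp add: UX(2,3) UE(2,3) X(17,20) E(17,20) B(20))
 also have "... = dl X x (%a x2. dl X x2 (%b x3. dl E e (%e1 e2. dl E e1 (%c d.
 si (%s' t'. si (%s'' t''. ss (%s t. ss (%sg tu. si (%p' q'. ss (%p q.
 F (elt X E a (uE (s''*[B]s')*[E]c*[E]uE (s*[B]sg)))
 (elt X E (uX t''*[X]b*[X]uX tu) (uE p'*[E]d*[E]uE p))
 (elt X E (uX q'*[X](uX t'*[X]x3*[X]uX t)*[X]uX q) e2)))))))))))"
 by (rule X(7)[OF m(1)]) (intro L; simp add: cl)
 also have "... = dl X x (%a x2. dl X x2 (%b x3. dl E e (%c e2. dl E e2 (%d e3.
 si (%s' t'. si (%s'' t''. ss (%s t. ss (%sg tu. si (%p' q'. ss (%p q.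
 F (elt X E a (uE (s''*[B]s')*[E]c*[E]uE (s*[B]sg)))
 (elt X E (uX t''*[X]b*[X]uX tu) (uE p'*[E]d*[E]uE p))
 (elt X E (uX q'*[X](uX t'*[X]x3*[X]uX t)*[X]uX q) e3)))))))))))"
 by (rule smc, rule smc, rule E(7)[OF m(2)]) (intro L; simp add: cl)
 also have "... = dl X x (%x1 x2. dl E e (%e1 e2. dl E e2 (%e21 e22. dl X x2 (%h1 h2.
 si (%s' t'. si (%s'' t''. ss (%s t. ss (%sg tu. si (%p' q'. ss (%p q.
 F (elt X E x1 (uE (s''*[B]s')*[E]e1*[E]uE (s*[B]sg)))
 (elt X E (uX t''*[X]h1*[X]uX tu) (uE p'*[E]e21*[E]uE p))
 (elt X E (uX q'*[X](uX t'*[X]h2*[X]uX t)*[X]uX q) e22)))))))))))"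
 by (simp only: sm_swap[of E E _ X X])
 also have "... = dl X x (%x1 x2. dl E e (%e1 e2. dl E e2 (%e21 e22. si (%s' t'. ss (%s t.
 dl X (uX t'*[X]x2*[X]uX t) (%f1 f2. si (%p' q'. ss (%p q.
 F (elt X E x1 (uE s'*[E]e1*[E]uE s)) (elt X E f1 (uE p'*[E]e21*[E]uE p))
 (elt X E (uX q'*[X]f2*[X]uX q) e22)))))))))" by (rule smc, rule smc, rule smc, rule conj2[OF bX uX, symmetric, where G = "%f1 f2 s' s. si (%p' q'. ss (%p q.
 F (elt X E _ (uE s'*[E]_*[E]uE s)) (elt X E f1 (uE p'*[E]_*[E]uE p))
 (elt X E (uX q'*[X]f2*[X]uX q) _)))"])
 ((intro L)?; simp add: cl)+
 also have "... = dl X x (%x1 x2. dl E e (%e1 e2. si (%s' t'. ss (%s t.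
 dl X (uX t'*[X]x2*[X]uX t) (%f1 f2. dl E e2 (%e21 e22. si (%p' q'. ss (%p q.
 F (elt X E x1 (uE s'*[E]e1*[E]uE s)) (elt X E f1 (uE p'*[E]e21*[E]uE p))
 (elt X E (uX q'*[X]f2*[X]uX q) e22)))))))))" by (simp only: sm_swap[of B B S E E] sm_swap[of B B Si E E] sm_swap[of X X _ E E])
 also have "... = dl W (elt X E x e) (%a b. dl W b (%c d. F a c d))"
 unfolding dl_W_elt[OF b2(2) m] by (simp add: dl_W_elt b1 cl del: tw_simps)
 finally show "dl W (elt X E x e) (%a b. dl W a (%c d. F c d b))
 = dl W (elt X E x e) (%a b. dl W b (%c d. F a c d))" .
 qed
qed

lemma bialgebra_W: "bialgebra W"
proof (rule bialgebraI[OF W_algebra])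
 have t: "trilin W W W kk G = trilin XE XE XE kk G" "bilin W W kk F = bilin XE XE kk F" for G F
 by (simp_all add: trilin_def bilin_def lin_tw)
 show "coalgebra W (acomul W) (eps W)"
 unfolding coalgebra_iff t tw_tens(1) lin_tw lin_cong_space(2)[of W XE "tens XE XE" "tens XE XE", simplified]
 lin_cong_space(2)[of W XE kk kk, simplified]
 using acomul_W_maps acounit_W_maps W_coassoc W_counit vspace_cong[of W XE] by (simp del: tw_simps(7,8))
 show "dl W (w*[W]w') F = dl W w (%a b. dl W w' (%c d. F (a*[W]c) (b*[W]d)))"
 if "w <: W" "w' <: W" "bilin W W kk F" for w w' F
 using W_mult_dl that unfolding t by simp
 show "dl W (aone W) F = F (aone W) (aone W)" if "bilin W W kk F" for F
 proof -
 from that have F: "bilin XE XE kk F" by (simp add: t)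
 note L = plin bilinD(2,3)[OF F]
 have bx: "bilin X X kk (%x1 x2. dl E (aone E) (%e1 e2. si (%s' t'. ss (%s t.
 F (elt X E x1 (uE s'*[E]e1*[E]uE s)) (elt X E (uX t'*[X]x2*[X]uX t) e2)))))"
 by (intro L; simp add: cl)
 have be: "bilin E E kk (%e1 e2. si (%s' t'. ss (%s t.
 F (elt X E x1 (uE s'*[E]e1*[E]uE s)) (elt X E (uX t'*[X]x2*[X]uX t) e2))))"
 if "x1 <: X" "x2 <: X" for x1 x2
 using that by (intro L; simp add: cl)
 have "si (%s' t'. ss (%s t. F (elt X E (aone X) (uE (s'*[B]s))) (elt X E (uX (t'*[B]t)) (aone E))))
 = F (elt X E (aone X) (uE (aone B))) (elt X E (uX (aone B)) (aone E))"
 by (rule ss_inv(2)) (intro L; simp add: cl)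
 thus ?thesis
 unfolding tw_simps(5) dl_W_elt[OF F X(16) E(16)] X(11)[OF bx] E(11)[OF be[OF X(16) X(16)]]
 by (simp add: UX(2-4) UE(2-4) X(16-) E(16-))
 qed
 show "eps W (aone W) = 1" using acounit_W_elt[OF X(16) E(16)] X E by simp
 have l: "lin XE kk (eps W)" using acounit_W_maps by blast
 have WL: "y <: XE ==> lin XE XE (%v. v*[W]y)" "y <: XE ==> lin XE XE (%v. y*[W]v)" for y
 using alg_lin[OF W_algebra lin_id, of y] unfolding lin_tw by simp_all
 fix w w' assume "w <: W" "w' <: W"
 hence w: "w <: XE" "w' <: XE" by simp_all
 show "eps W (w*[W]w') = eps W w * eps W w'"
 proof (rule XE_eq[OF lin_o[OF l WL(1)[OF w(2)]] lin_mult(1)[OF l] w(1)])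
 fix x e assume m: "x <: X" "e <: E"
 show "eps W (elt X E x e*[W]w') = eps W (elt X E x e) * eps W w'"
 proof (rule XE_eq[OF lin_o[OF l WL(2)] lin_mult(2)[OF l] w(2)])
 fix x' e' assume m': "x' <: X" "e' <: E"
 show "eps W (elt X E x e*[W]elt X E x' e') = eps W (elt X E x e) * eps W (elt X E x' e')"
 unfolding W_mult[OF m m'] using m m' by (simp add: acounit_W_elt cl X(12) E(12) del: tw_simps)
 qed (use m cl in simp)
 qed
qed

end

section \<open>Retracts of bialgebras\<close>

text \<open>Values outside \<open>C\<close> are \<open>undefined\<close> because membership in the
  category demands \<open>alg_ext\<close>.\<close>

definition retract_vect :: "('k::field, 'w, 'z) vect_scheme => 'u set => ('u => 'w) => ('w => 'u) => ('k, 'u) vect" where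
 "retract_vect W C i r = \<lparr>carrier = C, vzero = r (vzero W),
 vadd = (%x y. if x : C & y : C then r (vadd W (i x) (i y)) else undefined),
 vsmul = (%c x. if x : C then r (vsmul W c (i x)) else undefined)\<rparr>"

definition retract_bialg :: "('k::field, 'w, 'z) bialg_scheme => 'u set => ('u => 'w) => ('w => 'u) => ('k, 'u) bialg" where
 "retract_bialg W C i r = alg.extend (vect.extend (retract_vect W C i r)
 (alg.fields (%x y. if x : C & y : C then r (i x*[W]i y) else undefined) (r (aone W))))
 (bialg.fields (\<lambda>v\<in>C. tmap W W (retract_vect W C i r) (retract_vect W C i r) r r (acomul W (i v)))
 (\<lambda>v\<in>C. eps W (i v)))"

text \<open>\<open>i\<close> embeds \<open>C\<close> in \<open>W\<close> and \<open>r\<close>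
  retracts onto it, so \<open>C\<close> may live in any type. The law \<open>ir_comul\<close> says
  that coproducts of elements of the image lie in the image tensored with itself, without forming a
  tensor product of subspaces.\<close>

locale bialg_retract =
 fixes W :: "('k::field, 'w, 'z) bialg_scheme" and C :: "'u set" and i :: "'u => 'w" and r :: "'w => 'u"
 assumes bW: "bialgebra W"
 and i: "v : C ==> i v <: W" and r: "w <: W ==> r w : C" and ri: "v : C ==> r (i v) = v"
 and lin_ir: "lin W W (%w. i (r w))"
 and ir_one: "i (r (aone W)) = aone W"
 and ir_mult: "v : C ==> v' : C ==> i (r (i v*[W]i v')) = i v*[W]i v'"
 and ir_comul: "v : C ==> bilin W W kk F ==> dl W (i v) (%a b. F (i (r a)) (i (r b))) = dl W (i v) F"
begin

abbreviation "P == retract_bialg W C i r"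
abbreviation "V == retract_vect W C i r"

lemma V_simps [simp]: "car V = C" "vzero V = r (vzero W)"
 "v : C ==> v' : C ==> vadd V v v' = r (vadd W (i v) (i v'))" "v : C ==> vsmul V c v = r (vsmul W c (i v))"
 by (simp_all add: retract_vect_def)

lemma P_V: "car P = car V" "vadd P = vadd V" "vsmul P = vsmul V" "vzero P = vzero V"
 by (simp_all add: retract_bialg_def alg.extend_def bialg.fields_def vect.extend_def alg.fields_def)

lemma P_simps [simp]: "car P = C" "vzero P = r (vzero W)"
 "v : C ==> v' : C ==> vadd P v v' = r (vadd W (i v) (i v'))" "v : C ==> vsmul P c v = r (vsmul W c (i v))"
 "v : C ==> v' : C ==> v*[P]v' = r (i v*[W]i v')" "aone P = r (aone W)"
 by (simp_all add: P_V) (simp_all add: retract_bialg_def alg.extend_def bialg.fields_def vect.extend_def alg.fields_def)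

lemma P_co: "v : C ==> acomul P v = tmap W W V V r r (acomul W (i v))"
 "v : C ==> eps P v = eps W (i v)"
 "acomul P : extensional C" "eps P : extensional C" by (simp_all add: retract_bialg_def alg.extend_def bialg.fields_def vect.extend_def alg.fields_def)

lemma tens_PV: "tens P P = tens V V" "sm P P = sm V V" by (rule tens_cong; simp add: P_V)+

lemma alg_ext_P: "alg_ext P" by (simp add: alg_ext_def vect_ext_def P_V)
 (simp add: retract_vect_def retract_bialg_def alg.extend_def bialg.fields_def vect.extend_def alg.fields_def)

lemmas W = bialgD[OF bW] algebraD[OF bialgD(1)[OF bW]]

lemma r_lin: "w <: W ==> w' <: W ==> r (vadd W w w') = vadd V (r w) (r w')"
 "w <: W ==> r (vsmul W c w) = vsmul V c (r w)"
proof -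
 assume w: "w <: W"
 show "r (vsmul W c w) = vsmul V c (r w)"
 using w linD(3)[OF lin_ir w, of c] ri[of "r (vsmul W c w)"] r W(3) by simp
 assume w': "w' <: W"
 show "r (vadd W w w') = vadd V (r w) (r w')"
 using w w' linD(2)[OF lin_ir w w'] ri[of "r (vadd W w w')"] r W(3) by simp
qed

lemma i_lin: "v : C ==> v' : C ==> i (r (vadd W (i v) (i v'))) = vadd W (i v) (i v')"
 "v : C ==> i (r (vsmul W c (i v))) = vsmul W c (i v)" "i (r (vzero W)) = vzero W"
 using linD(2,3)[OF lin_ir] lin_vzero[OF lin_ir W(3,3)] by (simp_all add: i ri)

lemma lin_i: "lin V W i" and lin_r: "lin W V r" by (rule linI; simp add: i i_lin) (rule linI; simp add: r r_lin[simplified])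

lemma vspace_V: "vspace V"
proof (rule vspaceI)
 note s = i i_lin r vadd_assoc[OF W(3)] vspaceD(3-6)[OF W(3)] vadd_zero[OF W(3)] vsmul_zero[OF W(3)] ri
 fix x y assume xy: "x <: V" "y <: V"
 thus "vadd V x y <: V" using W(3) by (simp add: s)
 show "vadd V x y = vadd V y x" using xy W(3) vadd_comm[OF W(3), of "i x" "i y"] by (simp add: s)
 show "vsmul V c (vadd V x y) = vadd V (vsmul V c x) (vsmul V c y)" for c using xy W(3) by (simp add: s)
 fix z assume "z <: V"
 thus "vadd V (vadd V x y) z = vadd V x (vadd V y z)" using xy W(3) by (simp add: s)
qed (use W(3) in \<open>simp_all add: i i_lin r vadd_assoc[OF W(3)] vspaceD(3-6)[OF W(3)] ri\<close>)

lemma vspace_P: "vspace P"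
 using vspace_V vspace_cong[of P V] by (simp add: P_V)

lemma lin_P: "lin P U = lin V U" by (intro ext) (simp only: lin_def P_V)

lemma lin_P': "lin U P = lin U V" by (intro ext) (simp only: lin_def P_V)

lemma bilin_P: "bilin P P kk F = bilin V V kk F" by (simp only: bilin_def lin_P P_V)

lemma dl_P:
 assumes "v : C" "bilin V V kk F"
 shows "dl P v F = dl W (i v) (%a b. F (r a) (r b))"
 unfolding tens_PV P_co(1)[OF assms(1)] using assms W vspace_V lin_r by (intro sm_tmap) (auto simp: i)

lemma bilin_r:
 assumes F: "bilin V V kk F"
 shows "bilin W W kk (%a b. F (r a) (r b))" by (intro bilinI bilinD(2,3)[OF F] lin_r) (auto simp: r)

lemma dl_P_i:
 assumes "v : C" "bilin W W kk F"
 shows "dl P v (%a b. F (i a) (i b)) = dl W (i v) F"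
proof -
 have "bilin V V kk (%a b. F (i a) (i b))" by (intro bilinI bilinD(2,3)[OF assms(2)] lin_i) (auto simp: i)
 thus ?thesis using assms by (simp add: dl_P ir_comul)
qed

text \<open>Coproducts in \<open>P\<close> are computed in \<open>W\<close>: a form on
  \<open>P\<close> that is the restriction of a form on \<open>W\<close> may be replaced by the
  latter.\<close>

lemma dl_P_eq:
 assumes "v : C" "bilin W W kk F" and "!!a b. a : C ==> b : C ==> G a b = F (i a) (i b)"
 shows "dl P v G = dl W (i v) F"
proof -
 have "dl P v G = dl P v (%a b. F (i a) (i b))" by (rule smc) (simp add: assms(3))
 thus ?thesis using dl_P_i[OF assms(1,2)] by simp
qed

lemma algebra_P: "algebra P"
 unfolding algebra_iff
proof (intro conjI ballI)
 note WL = alg_lin[OF W(1)]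
 have l: "lin V V (%y. r (i x*[W]i y))" "lin V V (%y. r (i y*[W]i x))" if "x : C" for x
 using that by (intro lin_o[OF lin_r] WL lin_i; simp add: i)+
 have l': "lin V V (%y. x*[P]y) = lin V V (%y. r (i x*[W]i y))"
 "lin V V (%y. y*[P]x) = lin V V (%y. r (i y*[W]i x))" if "x : C" for x
 using that by (intro lin_cong vspace_V; simp)+
 show "bilin P P P (amul P)"
 unfolding bilin_def lin_P lin_P' using l l' by simp
 show "vspace P" by (rule vspace_P)
qed (simp_all add: W r i ri ir_mult ir_one)

lemma bialgebra_P: "bialgebra P"
proof (rule bialgebraI[OF algebra_P])
 have t: "trilin P P P kk G = trilin V V V kk G" for G by (simp only: trilin_def bilin_P P_V lin_P)
 have lc: "lin V (tens V V) (acomul P) = lin V (tens V V) (%v. tmap W W V V r r (acomul W (i v)))"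
 "lin V kk (eps P) = lin V kk (%v. eps W (i v))" by (intro lin_cong vspace_V; simp add: P_co)+
 show "coalgebra P (acomul P) (eps P)"
 unfolding coalgebra_iff lin_maps_iff tens_PV(1) lin_P t P_V(1) V_simps(1)
 proof (intro conjI ballI allI impI)
 show "lin V (tens V V) (acomul P)" "lin V kk (eps P)"
 unfolding lc using lin_o[OF lin_tmap[OF W(3,3) vspace_V vspace_V lin_r lin_r] lin_o[OF W(4) lin_i]]
 lin_o[OF W(5) lin_i] by simp_all
 fix v assume v: "v : C"
 {
 fix F assume F: "trilin V V V kk F"
 note L = trilinI bilinI lin_smI trilinD(2,3,4)[OF F] lin_r lin_id lin_sm[OF W(3,3)] W(4)
 have b: "bilin W W kk (%a b. dl W a (%c d. F (r c) (r d) (r b)))"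
 "bilin W W kk (%a b. dl W b (%c d. F (r a) (r c) (r d)))" by (intro L; simp add: r)+
 have b': "bilin V V kk (%c d. F c d x)" "bilin V V kk (%c d. F x c d)" if "x : C" for x
 using that by (intro L; simp)+
 have T: "trilin W W W kk (%a b c. F (r a) (r b) (r c))" by (intro L; simp add: r)
 have "dl P v (%a b. dl P a (%c d. F c d b)) = dl W (i v) (%a b. dl W a (%c d. F (r c) (r d) (r b)))"
 by (rule dl_P_eq[OF v b(1)]) (simp add: dl_P b' ri)
 also have "... = dl W (i v) (%a b. dl W b (%c d. F (r a) (r c) (r d)))"
 by (rule W(7)[OF i[OF v] T])
 also have "... = dl P v (%a b. dl P b (%c d. F a c d))" by (rule dl_P_eq[OF v b(2), symmetric]) (simp add: dl_P b' ri)
 finally show "dl P v (%a b. dl P a (%c d. F c d b)) = dl P v (%a b. dl P b (%c d. F a c d))" .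
 }
 {
 fix ph assume ph: "lin V kk ph"
 have b: "bilin W W kk (%a b. eps W a * ph (r b))" "bilin W W kk (%a b. ph (r a) * eps W b)"
 using lin_o[OF ph lin_r] W(5) by (auto intro!: bilinI lin_mult)
 show "dl P v (%a b. eps P a * ph b) = ph v"
 using dl_P_eq[OF v b(1), of "%a b. eps P a * ph b"] W(8)[OF i[OF v] lin_o[OF ph lin_r]] v
 by (simp add: P_co ri)
 show "dl P v (%a b. ph a * eps P b) = ph v"
 using dl_P_eq[OF v b(2), of "%a b. ph a * eps P b"] W(9)[OF i[OF v] lin_o[OF ph lin_r]] v
 by (simp add: P_co ri)
 }
 qed (simp_all add: vspace_P P_co)
 fix x y F assume xy: "x <: P" "y <: P" and "bilin P P kk F"
 hence F: "bilin V V kk F" and xy: "x : C" "y : C" by (simp_all add: bilin_P)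
 note FL = bilinD(2,3)[OF F]
 note L = bilinI lin_smI FL lin_o[OF lin_r] alg_lin[OF W(1)] lin_id
 have b: "bilin W W kk (%c d. F (r (a*[W]c)) (r (b*[W]d)))"
 "bilin W W kk (%a b. dl W (i y) (%c d. F (r (a*[W]c)) (r (b*[W]d))))"
 if "a <: W" "b <: W" for a b
 using that by (intro L; simp add: r W)+
 have "dl P (x*[P]y) F = dl W (i x*[W]i y) (%a b. F (r a) (r b))"
 using xy F by (simp add: dl_P r i W ir_mult del: P_simps(3,4))
 also have "... = dl W (i x) (%a b. dl W (i y) (%c d. F (r (a*[W]c)) (r (b*[W]d))))"
 using xy by (intro W(10) i bilin_r F)
 also have "... = dl P x (%a b. dl P y (%c d. F (a*[P]c) (b*[P]d)))"
 proof (rule dl_P_eq[OF xy(1) b(2)[OF W(16,16)], symmetric])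
 fix a b assume "a : C" "b : C"
 thus "dl P y (%c d. F (a*[P]c) (b*[P]d)) = dl W (i y) (%c d. F (r (i a*[W]c)) (r (i b*[W]d)))"
 by (intro dl_P_eq[OF xy(2) b(1)]) (simp_all add: i)
 qed
 finally show "dl P (x*[P]y) F = dl P x (%a b. dl P y (%c d. F (a*[P]c) (b*[P]d)))" .
next
 fix F assume "bilin P P kk F"
 hence F: "bilin V V kk F" by (simp add: bilin_P)
 show "dl P (aone P) F = F (aone P) (aone P)"
 using F bilin_r[OF F] by (simp add: dl_P r W ir_one)
qed (simp_all add: P_co i r W ir_mult ir_one)

end

section \<open>Pullbacks of split epimorphisms\<close>

locale split_cospan = qt_pair B S X uX E uE
 for B :: "('k::field, 'b, 'z) bialg_scheme" and S
 and X :: "('k, 'x, 'p) bialg_scheme" and uX and E :: "('k, 'e, 'q) bialg_scheme" and uE +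
 fixes Y :: "('k, 'y, 'o) bialg_scheme" and uY :: "'b => 'y" and f :: "'x => 'y" and s :: "'y => 'x" and g :: "'e => 'y"
 assumes hX: "hopf_algebra X" and hY: "hopf_algebra Y" and hE: "hopf_algebra E"
 and uY: "uY : bialg_maps B Y"
 and qcX: "qc X uX" and qcE: "qc E uE"
 and f: "f : bialg_maps X Y" and s: "s : bialg_maps Y X" and g: "g : bialg_maps E Y"
 and fu: "b <: B ==> f (uX b) = uY b" and su: "b <: B ==> s (uY b) = uX b"
 and gu: "b <: B ==> g (uE b) = uY b"
 and fs: "y <: Y ==> f (s y) = y"
begin

lemmas bY = hopfD[OF hY]
lemmas Y = bialgD[OF bY] algebraD[OF bialgD(1)[OF bY]]
lemmas YL = alg_lin[OF Y(1)]
lemmas UY = bmapD[OF uY bB bY]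
lemmas f' = bmapD[OF f bX bY]
lemmas s' = bmapD[OF s bY bX]
lemmas g' = bmapD[OF g bE bY]
lemmas SY = antipode_closed[OF hY]

text \<open>Convolution inverse of the composite of \<open>s\<close> and \<open>f\<close>. The
  element \<open>x1 (ka x2)\<close> is the coinvariant part of \<open>x\<close>, the analogue of
  \<open>x s(f x)^-1\<close> in a group.\<close>

abbreviation "ka b == s (antipode Y (f b))"

lemmas pb_lin = quadlinI plin YL lin_o[OF UY(1)] lin_o[OF f'(1)] lin_o[OF s'(1)] lin_o[OF g'(1)]
 lin_o[OF lin_antipode[OF hY]] lin_o[OF Y(5)] lin_sm[OF X(3,3)] lin_sm[OF E(3,3)] X(4) E(4)
lemmas pcl = cl Y(6,16,20) UY(2) f'(2) s'(2) g'(2) SY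

section \<open>The projection onto the equalizer\<close>

lemma bilin_proj_elt:
 "bilin X E XE (%x e. tlift X X XE (%a b. tlift E E XE (%c d. elt X E (a*[X]ka b*[X]s (g c)) d) (acomul E e)) (acomul X x))"
 and sm_proj_elt: "x <: X ==> e <: E ==> bilin X E kk F ==>
 sm X E (tlift X X XE (%a b. tlift E E XE (%c d. elt X E (a*[X]ka b*[X]s (g c)) d) (acomul E e)) (acomul X x)) F
 = dl X x (%a b. dl E e (%c d. F (a*[X]ka b*[X]s (g c)) d))"
proof -
 note vs = vspace_XE(1) X(3) E(3)
 have b1: "bilin E E XE (%c d. elt X E (a*[X]ka b*[X]s (g c)) d)" if "a <: X" "b <: X" for a b
 using that by (intro pb_lin; simp add: pcl)
 have b2: "bilin X X XE (%a b. tlift E E XE (%c d. elt X E (a*[X]ka b*[X]s (g c)) d) (acomul E e))"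
 if "e <: E" for e
 using that b1 by (intro bilinI lin_tlift_body pb_lin(5-); simp add: pcl vs)
 show "bilin X E XE (%x e. tlift X X XE (%a b. tlift E E XE (%c d. elt X E (a*[X]ka b*[X]s (g c)) d) (acomul E e)) (acomul X x))"
 by (rule bilinI; intro lin_tlift_body lin_tlift; use b1 b2 in \<open>simp add: pcl vs X(4) E(4)\<close>)
 assume x: "x <: X" and e: "e <: E" and F: "bilin X E kk F"
 show "sm X E (tlift X X XE (%a b. tlift E E XE (%c d. elt X E (a*[X]ka b*[X]s (g c)) d) (acomul E e)) (acomul X x)) F
 = dl X x (%a b. dl E e (%c d. F (a*[X]ka b*[X]s (g c)) d))"
 unfolding sm_tlift[OF X(3,3) X(3) E(3) b2[OF e] F X(6)[OF x]] by (rule smc) (simp add: sm_tlift[OF E(3,3) X(3) E(3) b1 F E(6)[OF e]] F X(3) E(3) pcl)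
qed

text \<open>In a pullback of groups, \<open>x\<close> is \<open>x s(f x)^-1 s(g e)\<close>, so the
  pair \<open>(x,e)\<close> is recovered from a kernel element and \<open>e\<close>. This is the
  Hopf version: the coproduct of \<open>e\<close> provides one copy for \<open>g\<close> and one for
  the second factor.\<close>

definition proj :: "(('x \<times> 'e) \<Rightarrow>\<^sub>0 'k) set => (('x \<times> 'e) \<Rightarrow>\<^sub>0 'k) set" where
 "proj = tlift X E XE (%x e. tlift X X XE (%a b. tlift E E XE (%c d. elt X E (a*[X]ka b*[X]s (g c)) d) (acomul E e)) (acomul X x))"

lemma lin_proj: "lin XE XE proj"
 unfolding proj_def by (rule lin_mapsD[OF tlift_maps(1)[OF X(3) E(3) vspace_XE(1) bilin_proj_elt]])

lemma proj_closed: "w <: XE ==> proj w <: XE" by (rule linD(1)[OF lin_proj])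

lemma sm_proj: "w <: XE ==> bilin X E kk F ==> sm X E (proj w) F
 = sm X E w (%x e. dl X x (%a b. dl E e (%c d. F (a*[X]ka b*[X]s (g c)) d)))"
 unfolding proj_def using bilin_proj_elt X(3) E(3) by (simp add: sm_tlift sm_proj_elt)

text \<open>The equalizer of \<open>x \<otimes> e \<mapsto> x\<^sub>1 \<otimes> f x\<^sub>2 \<otimes> e\<close> and \<open>x \<otimes> e \<mapsto> x \<otimes> g e\<^sub>1 \<otimes> e\<^sub>2\<close>.\<close>

definition pb :: "(('x \<times> 'e) \<Rightarrow>\<^sub>0 'k) set set" where
 "pb = {w : car XE. \<forall>F. trilin X Y E kk F -->
 sm X E w (%x e. dl X x (%a b. F a (f b) e)) = sm X E w (%x e. dl E e (%c d. F x (g c) d))}"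

lemma pbD: "w : pb ==> w <: XE"
 "w : pb ==> trilin X Y E kk F ==>
 sm X E w (%x e. dl X x (%a b. F a (f b) e)) = sm X E w (%x e. dl E e (%c d. F x (g c) d))"
 unfolding pb_def by auto

lemma form_g:
 \<comment> \<open>\<open>x S(g e\<^sub>1) g e\<^sub>2 \<otimes> e\<^sub>3 = x \<otimes> e\<close>\<close>
 assumes F: "bilin X E kk F" and m: "x <: X" "e <: E"
 shows "dl E e (%p q. dl E q (%c d. F (x*[X]s (antipode Y (g p))*[X]s (g c)) d)) = F x e" (is "?l14 = _")
proof -
 note L = pb_lin bilinD(2,3)[OF F] lin_o[OF lin_antipode[OF hE]]
 have "?l14 = dl E e (%q d. dl E q (%p c. F (x*[X]s (antipode Y (g p))*[X]s (g c)) d))"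
 by (rule E(7)[OF m(2), symmetric]) (use m in \<open>intro L; simp add: pcl\<close>)
 also have "... = dl E e (%q d. dl E q (%p c. F (x*[X]s (g (antipode E p*[E]c))) d))"
 using m by (simp add: bialg_map_antipode[OF hE hY g, symmetric] antipode_closed[OF hE] g'(2,3) s'(3))
 also have "... = dl E e (%q d. eps E q * F x d)"
 proof (rule smc)
 fix q d assume k: "q <: E" "d <: E"
 have "dl E q (%p c. F (x*[X]s (g (antipode E p*[E]c))) d) = eps E q * F (x*[X]s (g (aone E))) d"
 by (rule antipode_inv(1)[OF hE k(1), where ph = "%z. F (x*[X]s (g z)) d"])
 (use m k in \<open>intro L; simp add: pcl\<close>)
 thus "dl E q (%p c. F (x*[X]s (g (antipode E p*[E]c))) d) = eps E q * F x d"
 using m by (simp add: g'(4) s'(4) X(19))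
 qed
 also have "... = F x e" by (rule E(8)[OF m(2)]) (use m in \<open>intro L; simp\<close>)
 finally show ?thesis .
qed

text \<open>Membership in \<open>pb\<close> exchanges \<open>f x2\<close> for \<open>g e1\<close>
  inside \<open>ka\<close>; then the antipode of \<open>g e1\<close> cancels against
  \<open>g e2\<close>.\<close>

lemma proj_pb:
 assumes w: "w : pb"
 shows "proj w = w"
proof (rule tens_eqI[OF X(3) E(3) proj_closed[OF pbD(1)[OF w]] pbD(1)[OF w]])
 fix F assume F: "bilin X E kk F"
 note L = pb_lin bilinD(2,3)[OF F]
 have "sm X E (proj w) F = sm X E w (%x e. dl X x (%a b. dl E e (%c d. F (a*[X]ka b*[X]s (g c)) d)))"
 by (rule sm_proj[OF pbD(1)[OF w] F])
 also have "... = sm X E w (%x e. dl E e (%p q. dl E q (%c d. F (x*[X]s (antipode Y (g p))*[X]s (g c)) d)))"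
 by (rule pbD(2)[OF w, where F = "%a y e. dl E e (%c d. F (a*[X]s (antipode Y y)*[X]s (g c)) d)"])
 (intro L; simp add: pcl)
 also have "... = sm X E w F" by (simp add: form_g[OF F])
 finally show "sm X E (proj w) F = sm X E w F" .
qed

text \<open>Under \<open>f\<close> the second leg of \<open>a (ka b) s(g c)\<close> is
  \<open>f a2 S(f b1) g c2\<close>, because the antipode reverses legs. After regrouping,
  \<open>a2\<close> and \<open>b1\<close> are adjacent and cancel, leaving
  \<open>g c2\<close>.\<close>

lemma proj_in_pb:
 assumes w: "w <: XE"
 shows "proj w : pb"
 unfolding pb_def
proof (intro CollectI conjI allI impI)
 show "proj w <: XE" by (rule proj_closed[OF w])
 fix F assume F: "trilin X Y E kk F"
 note L = pb_lin trilinD(2,3,4)[OF F]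
 let ?S = "antipode Y"
 have b: "bilin X E kk (%x e. dl X x (%a b. F a (f b) e))" "bilin X E kk (%x e. dl E e (%c d. F x (g c) d))"
 by (rule bilinI; intro lin_sm[OF X(3,3)] lin_sm[OF E(3,3)] lin_smI X(4) E(4); intro L; simp add: pcl)+
 have "sm X E (proj w) (%x e. dl X x (%a b. F a (f b) e))
 = sm X E w (%x e. dl X x (%a b. dl E e (%c d. dl X (a*[X]ka b*[X]s (g c)) (%p q. F p (f q) d))))"
 by (rule sm_proj[OF w b(1)])
 also have "... = sm X E w (%x e. dl X x (%a b. dl E e (%c d. dl E c (%c1 c2. F (a*[X]ka b*[X]s (g c1)) (g c2) d))))"
 proof (rule smc)
 fix x e assume m: "x <: X" "e <: E"
 \<comment> \<open>Multiplicativity of the coproduct is used twice, and then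
   \<open>antipode_comul\<close>, which puts \<open>b2\<close> in the first leg and
   \<open>b1\<close> in the second.\<close>
 have d: "dl X (a*[X]ka b*[X]s (g c)) (%p q. F p (f q) d)
 = dl X a (%a1 a2. dl X b (%b1 b2. dl E c (%c1 c2. F (a1*[X]ka b2*[X]s (g c1)) (f a2*[Y]?S (f b1)*[Y]g c2) d)))"
 if k: "a <: X" "b <: X" "c <: E" "d <: E" for a b c d
 proof -
 have b1: "bilin X X kk (%p q. F p (f q) d)"
 "bilin X X kk (%u v. F (p*[X]u) (f (q*[X]v)) d)"
 "bilin X X kk (%u v. F (p*[X]p'*[X]u) (f (q*[X]q'*[X]v)) d)"
 if "p <: X" "q <: X" "p' <: X" "q' <: X" for p q p' q'
 using that k by (intro L; simp add: pcl)+
 have b1': "bilin X X kk (%p q. F p (f q) d)" using k by (intro L; simp add: pcl)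
 have b2: "bilin X X kk (%u v. dl X (s (g c)) (%u' v'. F (p*[X]u*[X]u') (f (q*[X]v*[X]v')) d))"
 if "p <: X" "q <: X" for p q
 using that k by (intro L; simp add: pcl)
 have b3: "bilin Y Y kk (%u v. dl X (s (g c)) (%u' v'. F (p*[X]s u*[X]u') (f (q*[X]s v*[X]v')) d))"
 "bilin Y Y kk (%u v. dl X (s (g c)) (%u' v'. F (p*[X]s (?S v)*[X]u') (f (q*[X]s (?S u)*[X]v')) d))"
 if "p <: X" "q <: X" for p q
 using that k by (intro L; simp add: pcl)+
 have b4: "bilin Y Y kk (%u v. F (p*[X]p'*[X]s u) (f (q*[X]q'*[X]s v)) d)"
 if "p <: X" "q <: X" "p' <: X" "q' <: X" for p q p' q'
 using that k by (intro L; simp add: pcl)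
 have "dl X (a*[X]ka b*[X]s (g c)) (%p q. F p (f q) d)
 = dl X a (%a1 a2. dl X (ka b*[X]s (g c)) (%u v. F (a1*[X]u) (f (a2*[X]v)) d))"
 by (rule X(10)[OF _ _ b1']) (use k in \<open>simp_all add: pcl\<close>)
 also have "... = dl X a (%a1 a2. dl X (ka b) (%u v. dl X (s (g c)) (%u' v'. F (a1*[X]u*[X]u') (f (a2*[X]v*[X]v')) d)))"
 by (rule smc, rule X(10)) (use k b1 in \<open>simp_all add: pcl\<close>)
 also have "... = dl X a (%a1 a2. dl Y (?S (f b)) (%u v. dl X (s (g c)) (%u' v'. F (a1*[X]s u*[X]u') (f (a2*[X]s v*[X]v')) d)))"
 by (rule smc, rule s'(5)) (use k b2 in \<open>simp_all add: pcl\<close>)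
 also have "... = dl X a (%a1 a2. dl X b (%b1 b2. dl X (s (g c)) (%u' v'. F (a1*[X]ka b2*[X]u') (f (a2*[X]ka b1*[X]v')) d)))"
 using k b3 by (simp add: antipode_comul[OF hY] f'(2,5))
 also have "... = dl X a (%a1 a2. dl X b (%b1 b2. dl E c (%c1 c2. F (a1*[X]ka b2*[X]s (g c1)) (f a2*[Y]?S (f b1)*[Y]g c2) d)))"
 proof (rule smc, rule smc)
 fix a1 a2 b1 b2 assume j: "a1 <: X" "a2 <: X" "b1 <: X" "b2 <: X"
 have "dl X (s (g c)) (%u' v'. F (a1*[X]ka b2*[X]u') (f (a2*[X]ka b1*[X]v')) d)
 = dl Y (g c) (%u' v'. F (a1*[X]ka b2*[X]s u') (f (a2*[X]ka b1*[X]s v')) d)"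
 by (rule s'(5)) (use k j b1 in \<open>simp_all add: pcl\<close>)
 also have "... = dl E c (%c1 c2. F (a1*[X]ka b2*[X]s (g c1)) (f (a2*[X]ka b1*[X]s (g c2))) d)"
 by (rule g'(5)) (use k j b4 in \<open>simp_all add: pcl\<close>)
 also have "... = dl E c (%c1 c2. F (a1*[X]ka b2*[X]s (g c1)) (f a2*[Y]?S (f b1)*[Y]g c2) d)"
 using j k by (simp add: f'(2,3) fs pcl)
 finally show "dl X (s (g c)) (%u' v'. F (a1*[X]ka b2*[X]u') (f (a2*[X]ka b1*[X]v')) d) = ..." .
 qed
 finally show ?thesis .
 qed
 have "dl X x (%a b. dl E e (%c d. dl X (a*[X]ka b*[X]s (g c)) (%p q. F p (f q) d)))
 = dl E e (%c d. dl E c (%c1 c2. dl X x (%a b. dl X a (%a1 a2. dl X b (%b1 b2.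
 F (a1*[X]ka b2*[X]s (g c1)) (f a2*[Y]?S (f b1)*[Y]g c2) d)))))"
 by (simp add: d sm_swap[of X X _ E E])
 also have "... = dl E e (%c d. dl E c (%c1 c2. dl X x (%a b. F (a*[X]ka b*[X]s (g c1)) (g c2) d)))"
 proof (rule smc, rule smc)
 fix c d c1 c2 assume k: "c <: E" "d <: E" "c1 <: E" "c2 <: E"
 let ?G = "%a y b. F (a*[X]ka b*[X]s (g c1)) (y*[Y]g c2) d"
 have "dl X x (%a b. dl X a (%a1 a2. dl X b (%b1 b2.
 F (a1*[X]ka b2*[X]s (g c1)) (f a2*[Y]?S (f b1)*[Y]g c2) d)))
 = dl X x (%a r. dl X r (%a2 b. dl X b (%b1 b2.
 F (a*[X]ka b2*[X]s (g c1)) (f a2*[Y]?S (f b1)*[Y]g c2) d)))"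
 by (rule X(7)[OF m(1)]) (use k in \<open>intro L; simp add: pcl\<close>)
 also have "... = dl X x (%a r. dl X r (%q b2. dl X q (%a2 b1.
 F (a*[X]ka b2*[X]s (g c1)) (f a2*[Y]?S (f b1)*[Y]g c2) d)))"
 by (rule smc, rule X(7)[symmetric]) (use k in \<open>(intro L)?; simp add: pcl\<close>)+
 \<comment> \<open>\<open>f a2 S(f b1)\<close> is the image under \<open>f\<close> of
   \<open>a2 S(b1)\<close>, so the antipode identity of \<open>X\<close> collapses it.\<close>
 also have "... = dl X x (%a r. dl X r (%q b2. eps X q * F (a*[X]ka b2*[X]s (g c1)) (g c2) d))"
 proof (rule smc, rule smc)
 fix a r q b2 assume j: "a <: X" "q <: X" "b2 <: X"
 have "dl X q (%a2 b1. F (a*[X]ka b2*[X]s (g c1)) (f a2*[Y]?S (f b1)*[Y]g c2) d)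
 = dl X q (%a2 b1. F (a*[X]ka b2*[X]s (g c1)) (f (a2*[X]antipode X b1)*[Y]g c2) d)"
 using k j by (simp add: bialg_map_antipode[OF hX hY f, symmetric] f'(2,3) antipode_closed[OF hX] Y(17) g'(2))
 also have "... = eps X q * F (a*[X]ka b2*[X]s (g c1)) (f (aone X)*[Y]g c2) d"
 by (rule antipode_inv(2)[OF hX j(2), where ph = "%z. F (a*[X]ka b2*[X]s (g c1)) (f z*[Y]g c2) d"])
 (use k j in \<open>intro L; simp add: pcl\<close>)
 finally show "dl X q (%a2 b1. F (a*[X]ka b2*[X]s (g c1)) (f a2*[Y]?S (f b1)*[Y]g c2) d)
 = eps X q * F (a*[X]ka b2*[X]s (g c1)) (g c2) d"
 using k by (simp add: f'(4) Y(18) g'(2))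
 qed
 also have "... = dl X x (%a b. F (a*[X]ka b*[X]s (g c1)) (g c2) d)"
 by (rule smc, rule X(8)) (use k in \<open>(intro L)?; simp add: pcl\<close>)+
 finally show "dl X x (%a b. dl X a (%a1 a2. dl X b (%b1 b2.
 F (a1*[X]ka b2*[X]s (g c1)) (f a2*[Y]?S (f b1)*[Y]g c2) d))) = ..." .
 qed
 also have "... = dl X x (%a b. dl E e (%c d. dl E c (%c1 c2. F (a*[X]ka b*[X]s (g c1)) (g c2) d)))"
 by (simp only: sm_swap[of E E _ X X])
 finally show "dl X x (%a b. dl E e (%c d. dl X (a*[X]ka b*[X]s (g c)) (%p q. F p (f q) d))) = ..." .
 qed
 also have "... = sm X E w (%x e. dl X x (%a b. dl E e (%c d. dl E d (%p q. F (a*[X]ka b*[X]s (g c)) (g p) q))))"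
 by (rule smc, rule smc, rule E(7)) ((intro L)?; simp add: pcl)+
 also have "... = sm X E (proj w) (%x e. dl E e (%c d. F x (g c) d))"
 by (rule sm_proj[OF w b(2), symmetric])
 finally show "sm X E (proj w) (%x e. dl X x (%a b. F a (f b) e)) = sm X E (proj w) (%x e. dl E e (%c d. F x (g c) d))" .
qed

lemma pb_one: "aone W : pb"
proof -
 have "sm X E (elt X E (aone X) (aone E)) (%x e. dl X x (%a b. F a (f b) e))
 = sm X E (elt X E (aone X) (aone E)) (%x e. dl E e (%c d. F x (g c) d))" if F: "trilin X Y E kk F" for F
 proof -
 note L = pb_lin trilinD(2,3,4)[OF F]
 have b: "bilin X E kk (%x e. dl X x (%a b. F a (f b) e))" "bilin X E kk (%x e. dl E e (%c d. F x (g c) d))"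
 by (rule bilinI; intro lin_sm[OF X(3,3)] lin_sm[OF E(3,3)] lin_smI X(4) E(4); intro L; simp add: pcl)+
 have b': "bilin X X kk (%a b. F a (f b) (aone E))" "bilin E E kk (%c d. F (aone X) (g c) d)"
 by (intro L; simp add: pcl)+
 show ?thesis using b b' by (simp add: X(3,11,16) E(3,11,16) f'(4) g'(4))
 qed
 thus ?thesis unfolding pb_def using X E by simp
qed

lemma pb_mult:
 assumes w: "w : pb" "w' : pb"
 shows "w*[W]w' : pb"
 unfolding pb_def
proof (intro CollectI conjI allI impI)
 note wc = pbD(1)[OF w(1)] pbD(1)[OF w(2)]
 show "w*[W]w' <: XE" using talg_closed[OF X(1) E(1)] wc by simp
 fix F assume F: "trilin X Y E kk F"
 note L = pb_lin trilinD(2,3,4)[OF F]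
 have b: "bilin X E kk (%x e. dl X x (%a b. F a (f b) e))" "bilin X E kk (%x e. dl E e (%c d. F x (g c) d))"
 by (rule bilinI; intro lin_sm[OF X(3,3)] lin_sm[OF E(3,3)] lin_smI X(4) E(4); intro L; simp add: pcl)+
 have bx: "bilin X X kk (%a b. F a (f b) e)" if "e <: E" for e using that by (intro L; simp add: pcl)
 have be: "bilin E E kk (%c d. F x (g c) d)" if "x <: X" for x using that by (intro L; simp add: pcl)
 have "sm X E (w*[W]w') (%x e. dl X x (%a b. F a (f b) e))
 = sm X E w (%x e. sm X E w' (%x' e'. dl X x (%a b. dl X x' (%a' b'. F (a*[X]a') (f b*[Y]f b') (e*[E]e')))))"
 using wc b(1) by (simp add: sm_talg[OF X(1) E(1)] X(10)[OF _ _ bx] E(20) f'(3))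
 also have "... = sm X E w (%x e. dl X x (%a b. sm X E w' (%x' e'. dl X x' (%a' b'. F (a*[X]a') (f b*[Y]f b') (e*[E]e')))))"
 by (rule smc, rule sm_swap)
 also have "... = sm X E w (%x e. dl E e (%c d. sm X E w' (%x' e'. dl X x' (%a' b'. F (x*[X]a') (g c*[Y]f b') (d*[E]e')))))"
 by (rule pbD(2)[OF w(1), where F = "%a y e. sm X E w' (%x' e'. dl X x' (%a' b'. F (a*[X]a') (y*[Y]f b') (e*[E]e')))"])
 (intro L; simp add: pcl)
 also have "... = sm X E w (%x e. dl E e (%c d. sm X E w' (%x' e'. dl E e' (%c' d'. F (x*[X]x') (g c*[Y]g c') (d*[E]d')))))"
 by (rule smc, rule smc, rule pbD(2)[OF w(2), where F = "%a' y e'. F (_*[X]a') (_*[Y]y) (_*[E]e')"])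
 (intro L; simp add: pcl)
 also have "... = sm X E w (%x e. sm X E w' (%x' e'. dl E e (%c d. dl E e' (%c' d'. F (x*[X]x') (g c*[Y]g c') (d*[E]d')))))"
 by (rule smc, rule sm_swap)
 also have "... = sm X E (w*[W]w') (%x e. dl E e (%c d. F x (g c) d))"
 using wc b(2) by (simp add: sm_talg[OF X(1) E(1)] E(10)[OF _ _ be] X(20) g'(3))
 finally show "sm X E (w*[W]w') (%x e. dl X x (%a b. F a (f b) e)) = sm X E (w*[W]w') (%x e. dl E e (%c d. F x (g c) d))" .
qed

end

context qt_hopf
begin

lemma qcD:
 assumes "qc H u" "x <: H" "bilin H H kk F"
 shows "si (%s' t'. ss (%s t. dl H x (%a c. F (u s'*[H]c*[H]u s) (u t'*[H]a*[H]u t)))) = dl H x F" (is "?l15 = _")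
proof -
 have "?l15 = dl H x (%a c. si (%s' t'. ss (%s t. F (u s'*[H]c*[H]u s) (u t'*[H]a*[H]u t))))"
 by (simp only: sm_swap[of B B S H H] sm_swap[of B B Si H H])
 thus ?thesis using assms unfolding qc_def by simp
qed

lemma sm_perm4:
 "si (%a b. si (%c d. ss (%g h. ss (%k l. F a b c d g h k l))))
 = si (%c d. ss (%k l. si (%a b. ss (%g h. F a b c d g h k l))))" (is "?l16 = ?r16")
proof -
 have "?l16 = si (%c d. si (%a b. ss (%g h. ss (%k l. F a b c d g h k l))))"
 by (rule sm_swap)
 also have "... = si (%c d. si (%a b. ss (%k l. ss (%g h. F a b c d g h k l))))"
 by (rule smc, rule smc, rule sm_swap)
 also have "... = ?r16" by (rule smc, rule sm_swap)
 finally show ?thesis .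
qed

end

context qt_pair
begin

lemma dl_W_sm:
 assumes F: "bilin XE XE kk F" and w: "w <: XE"
 shows "dl W w F = sm X E w (%x e. dl X x (%x1 x2. dl E e (%e1 e2. si (%s' t'. ss (%s t.
 F (elt X E x1 (uE s'*[E]e1*[E]uE s)) (elt X E (uX t'*[X]x2*[X]uX t) e2))))))"
proof -
 note L = plin bilinD(2,3)[OF F] lin_sm[OF X(3,3)] lin_sm[OF E(3,3)] X(4) E(4)
 have b: "bilin X E kk (%x e. dl X x (%x1 x2. dl E e (%e1 e2. si (%s' t'. ss (%s t.
 F (elt X E x1 (uE s'*[E]e1*[E]uE s)) (elt X E (uX t'*[X]x2*[X]uX t) e2))))))"
 by (intro L; simp add: cl)
 have "dl W w F = sm X E w (%x e. dl W (elt X E x e) F)"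
 using functional_sm(2)[OF X(3) E(3) lin_dl_W[OF F lin_id] w] .
 thus ?thesis by (simp add: dl_W_elt[OF F] del: tw_simps)
qed

end

section \<open>The twisted comultiplication restricts to the equalizer\<close>

context split_cospan
begin

text \<open>Directed forms of \<open>sm_swap\<close> that move coproduct sums of \<open>X\<close>,
  or of \<open>E\<close>, outward; as rewrite rules they bring expressions to a common
  order.\<close>

lemmas out_X = sm_swap[of B B S X X] sm_swap[of B B Si X X] sm_swap[of E E _ X X]
lemmas out_E = sm_swap[of B B S E E] sm_swap[of B B Si E E]

text \<open>The left factor of the twisted coproduct of \<open>w\<close> satisfies the equation of
  \<open>pb\<close>. Quasi-cocommutativity of \<open>X\<close> exchanges the leg seen by
  \<open>f\<close> with the conjugated one, and a hexagon splits the twist on \<open>E\<close>; both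
  sides become instances of \<open>GA\<close>, to which the equation for \<open>w\<close>
  applies.\<close>

lemma pb_comul_left_aux:
 assumes w: "w : pb" and PH: "quadlin X Y E XE PH"
 shows "sm X E w (%x e. dl X x (%x1 x2. dl E e (%e1 e2. si (%s' t'. ss (%s t.
 dl X x1 (%a b. PH a (f b) (uE s'*[E]e1*[E]uE s) (elt X E (uX t'*[X]x2*[X]uX t) e2)))))))
 = sm X E w (%x e. dl X x (%x1 x2. dl E e (%e1 e2. si (%s' t'. ss (%s t.
 dl E (uE s'*[E]e1*[E]uE s) (%p q. PH x1 (g p) q (elt X E (uX t'*[X]x2*[X]uX t) e2)))))))"
proof -
 note L = pb_lin quadlinD[OF PH]
 define GA where "GA x y e = dl X x (%x1 x2. dl E e (%e1 e2. si (%s' t'. si (%s'' t''. ss (%s t. ss (%sg tu.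
 PH x1 (uY s'*[Y]y*[Y]uY s) (uE s''*[E]e1*[E]uE sg)
 (elt X E (uX (t''*[B]t')*[X]x2*[X]uX (t*[B]tu)) e2)))))))" for x y e
 have tGA: "trilin X Y E kk GA"
 unfolding GA_def by (intro L; simp add: pcl)
 have A: "dl X x (%x1 x2. dl E e (%e1 e2. si (%s' t'. ss (%s t.
 dl X x1 (%a b. PH a (f b) (uE s'*[E]e1*[E]uE s) (elt X E (uX t'*[X]x2*[X]uX t) e2))))))
 = dl X x (%p q. GA p (f q) e)" (is "?l17 = _") if m: "x <: X" "e <: E" for x e
 proof -
 have "?l17 = dl X x (%x1 x2. dl X x1 (%a b. dl E e (%e1 e2. si (%s' t'. ss (%s t. PH a (f b) (uE s'*[E]e1*[E]uE s) (elt X E (uX t'*[X]x2*[X]uX t) e2))))))"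
 by (simp only: out_X)
 also have "... = dl X x (%a r. dl X r (%b x2. dl E e (%e1 e2. si (%s' t'. ss (%s t.
 PH a (f b) (uE s'*[E]e1*[E]uE s) (elt X E (uX t'*[X]x2*[X]uX t) e2))))))"
 by (rule X(7)[OF m(1)]) (use m in \<open>intro L; simp add: pcl\<close>)
 also have "... = dl X x (%a r. dl E e (%e1 e2. si (%s'' t''. ss (%sg tu. dl X r (%b x2.
 PH a (f b) (uE s''*[E]e1*[E]uE sg) (elt X E (uX t''*[X]x2*[X]uX tu) e2))))))"
 by (simp only: out_X)
 \<comment> \<open>The two legs of \<open>r\<close> trade places, at the price of a further
   conjugation by \<open>S\<close>.\<close>
 also have "... = dl X x (%a r. dl E e (%e1 e2. si (%s'' t''. ss (%sg tu. si (%s' t'. ss (%s t. dl X r (%x2 q.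
 PH a (f (uX s'*[X]q*[X]uX s)) (uE s''*[E]e1*[E]uE sg)
 (elt X E (uX t''*[X](uX t'*[X]x2*[X]uX t)*[X]uX tu) e2))))))))"
 by (rule smc, rule smc, rule smc, rule smc, rule qcD[OF qcX, symmetric, where F = "%b x2.
 PH _ (f b) (uE _*[E]_*[E]uE _) (elt X E (uX _*[X]x2*[X]uX _) _)"])
 ((intro L)?; simp add: pcl)+
 also have "... = dl X x (%a r. dl X r (%x2 q. dl E e (%e1 e2. si (%s'' t''. ss (%sg tu. si (%s' t'. ss (%s t.
 PH a (f (uX s'*[X]q*[X]uX s)) (uE s''*[E]e1*[E]uE sg)
 (elt X E (uX t''*[X](uX t'*[X]x2*[X]uX t)*[X]uX tu) e2))))))))"
 by (simp only: out_X)
 also have "... = dl X x (%a r. dl X r (%x2 q. dl E e (%e1 e2. si (%s' t'. si (%s'' t''. ss (%s t. ss (%sg tu.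
 PH a (uY s'*[Y]f q*[Y]uY s) (uE s''*[E]e1*[E]uE sg)
 (elt X E (uX (t''*[B]t')*[X]x2*[X]uX (t*[B]tu)) e2))))))))"
 by (rule smc, rule smc, rule smc, subst sm_perm4) (simp add: UX(2,3) f'(2,3) fu X(17,20) B(20))
 also have "... = dl X x (%p q. dl X p (%a x2. dl E e (%e1 e2. si (%s' t'. si (%s'' t''. ss (%s t. ss (%sg tu.
 PH a (uY s'*[Y]f q*[Y]uY s) (uE s''*[E]e1*[E]uE sg)
 (elt X E (uX (t''*[B]t')*[X]x2*[X]uX (t*[B]tu)) e2))))))))"
 by (rule X(7)[OF m(1), symmetric]) (use m in \<open>intro L; simp add: pcl\<close>)
 finally show ?thesis unfolding GA_def .
 qed
 have Bc: "dl X x (%x1 x2. dl E e (%e1 e2. si (%s' t'. ss (%s t.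
 dl E (uE s'*[E]e1*[E]uE s) (%p q. PH x1 (g p) q (elt X E (uX t'*[X]x2*[X]uX t) e2))))))
 = dl E e (%c d. GA x (g c) d)" (is "?l18 = ?r18") if m: "x <: X" "e <: E" for x e
 proof -
 have "?l18 = dl X x (%x1 x2. dl E e (%e1 e2. dl E e1 (%c d. si (%s' t'. si (%s'' t''. ss (%s t. ss (%sg tu. PH x1 (g (uE s'*[E]c*[E]uE s)) (uE s''*[E]d*[E]uE sg) (elt X E (uX (t''*[B]t')*[X]x2*[X]uX (t*[B]tu)) e2))))))))"
 by (rule smc, rule smc, rule conj1[OF bE uE, where G = "%f1 f2 t' t.
 PH _ (g f1) f2 (elt X E (uX t'*[X]_*[X]uX t) _)"])
 ((intro L)?; simp add: pcl)+
 also have "... = dl X x (%x1 x2. dl E e (%e1 e2. dl E e1 (%c d. si (%s' t'. si (%s'' t''. ss (%s t. ss (%sg tu.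
 PH x1 (uY s'*[Y]g c*[Y]uY s) (uE s''*[E]d*[E]uE sg)
 (elt X E (uX (t''*[B]t')*[X]x2*[X]uX (t*[B]tu)) e2))))))))"
 by (simp add: UE(2) g'(2,3) gu E(20))
 also have "... = dl X x (%x1 x2. dl E e (%c r. dl E r (%d e2. si (%s' t'. si (%s'' t''. ss (%s t. ss (%sg tu.
 PH x1 (uY s'*[Y]g c*[Y]uY s) (uE s''*[E]d*[E]uE sg)
 (elt X E (uX (t''*[B]t')*[X]x2*[X]uX (t*[B]tu)) e2))))))))"
 by (rule smc, rule E(7)[OF m(2)]) (intro L; simp add: pcl)
 also have "... = ?r18"
 unfolding GA_def by (simp only: out_X)
 finally show ?thesis .
 qed
 show ?thesis
 using pbD(2)[OF w tGA] by (simp add: A Bc)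
qed

text \<open>Mirror image for the right factor: \<open>conj2\<close> splits the twist on
  \<open>X\<close>, and quasi-cocommutativity of \<open>E\<close> exchanges the legs.\<close>

lemma pb_comul_right_aux:
 assumes w: "w : pb" and PH: "quadlin XE X Y E PH"
 shows "sm X E w (%x e. dl X x (%x1 x2. dl E e (%e1 e2. si (%s' t'. ss (%s t.
 dl X (uX t'*[X]x2*[X]uX t) (%a b. PH (elt X E x1 (uE s'*[E]e1*[E]uE s)) a (f b) e2))))))
 = sm X E w (%x e. dl X x (%x1 x2. dl E e (%e1 e2. si (%s' t'. ss (%s t.
 dl E e2 (%c d. PH (elt X E x1 (uE s'*[E]e1*[E]uE s)) (uX t'*[X]x2*[X]uX t) (g c) d))))))"
proof -
 note L = pb_lin quadlinD[OF PH]
 define GA where "GA x y e = dl X x (%x1 x2. dl E e (%e1 e2. si (%s' t'. si (%s'' t''. ss (%s t. ss (%sg tu.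
 PH (elt X E x1 (uE (s''*[B]s')*[E]e1*[E]uE (s*[B]sg))) (uX t''*[X]x2*[X]uX tu)
 (uY t'*[Y]y*[Y]uY t) e2))))))" for x y e
 have tGA: "trilin X Y E kk GA"
 unfolding GA_def by (intro L; simp add: pcl)
 have A: "dl X x (%x1 x2. dl E e (%e1 e2. si (%s' t'. ss (%s t.
 dl X (uX t'*[X]x2*[X]uX t) (%a b. PH (elt X E x1 (uE s'*[E]e1*[E]uE s)) a (f b) e2)))))
 = dl X x (%p q. GA p (f q) e)" (is "?l19 = _") if m: "x <: X" "e <: E" for x e
 proof -
 have "?l19 = dl X x (%x1 x2. dl E e (%e1 e2. dl X x2 (%h1 h2. si (%s' t'. si (%s'' t''. ss (%s t. ss (%sg tu. PH (elt X E x1 (uE (s''*[B]s')*[E]e1*[E]uE (s*[B]sg))) (uX t''*[X]h1*[X]uX tu) (f (uX t'*[X]h2*[X]uX t)) e2)))))))"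
 by (rule smc, rule smc, rule conj2[OF bX uX, where G = "%f1 f2 s' s.
 PH (elt X E _ (uE s'*[E]_*[E]uE s)) f1 (f f2) _"])
 ((intro L)?; simp add: pcl)+
 also have "... = dl X x (%x1 x2. dl X x2 (%h1 h2. dl E e (%e1 e2. si (%s' t'. si (%s'' t''. ss (%s t. ss (%sg tu.
 PH (elt X E x1 (uE (s''*[B]s')*[E]e1*[E]uE (s*[B]sg))) (uX t''*[X]h1*[X]uX tu)
 (f (uX t'*[X]h2*[X]uX t)) e2)))))))" by (simp only: out_X)
 also have "... = dl X x (%x1 x2. dl X x2 (%h1 h2. dl E e (%e1 e2. si (%s' t'. si (%s'' t''. ss (%s t. ss (%sg tu.
 PH (elt X E x1 (uE (s''*[B]s')*[E]e1*[E]uE (s*[B]sg))) (uX t''*[X]h1*[X]uX tu)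
 (uY t'*[Y]f h2*[Y]uY t) e2)))))))" by (simp add: UX(2) f'(2,3) fu X(20))
 also have "... = dl X x (%p q. dl X p (%x1 x2. dl E e (%e1 e2. si (%s' t'. si (%s'' t''. ss (%s t. ss (%sg tu.
 PH (elt X E x1 (uE (s''*[B]s')*[E]e1*[E]uE (s*[B]sg))) (uX t''*[X]x2*[X]uX tu)
 (uY t'*[Y]f q*[Y]uY t) e2)))))))" by (rule X(7)[OF m(1), symmetric]) (use m in \<open>intro L; simp add: pcl\<close>)
 finally show ?thesis unfolding GA_def .
 qed
 have Bc: "dl X x (%x1 x2. dl E e (%e1 e2. si (%s' t'. ss (%s t.
 dl E e2 (%c d. PH (elt X E x1 (uE s'*[E]e1*[E]uE s)) (uX t'*[X]x2*[X]uX t) (g c) d)))))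
 = dl E e (%c d. GA x (g c) d)" (is "?l20 = ?r20") if m: "x <: X" "e <: E" for x e
 proof -
 have "?l20 = dl X x (%x1 x2. dl E e (%e1 e2. dl E e2 (%c d. si (%s' t'. ss (%s t. PH (elt X E x1 (uE s'*[E]e1*[E]uE s)) (uX t'*[X]x2*[X]uX t) (g c) d)))))"
 by (simp only: out_E)
 also have "... = dl X x (%x1 x2. dl E e (%r d. dl E r (%e1 c. si (%s' t'. ss (%s t.
 PH (elt X E x1 (uE s'*[E]e1*[E]uE s)) (uX t'*[X]x2*[X]uX t) (g c) d)))))"
 by (rule smc, rule E(7)[OF m(2), symmetric]) (intro L; simp add: pcl)
 also have "... = dl X x (%x1 x2. dl E e (%r d. si (%s'' t''. ss (%sg tu. dl E r (%a b.
 PH (elt X E x1 (uE s''*[E]a*[E]uE sg)) (uX t''*[X]x2*[X]uX tu) (g b) d)))))"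
 by (simp only: out_E)
 also have "... = dl X x (%x1 x2. dl E e (%r d. si (%s'' t''. ss (%sg tu. si (%s' t'. ss (%s t. dl E r (%a c.
 PH (elt X E x1 (uE s''*[E](uE s'*[E]c*[E]uE s)*[E]uE sg)) (uX t''*[X]x2*[X]uX tu)
 (g (uE t'*[E]a*[E]uE t)) d)))))))" by (rule smc, rule smc, rule smc, rule smc, rule qcD[OF qcE, symmetric, where F = "%a b.
 PH (elt X E _ (uE _*[E]a*[E]uE _)) (uX _*[X]_*[X]uX _) (g b) _"])
 ((intro L)?; simp add: pcl)+
 also have "... = dl X x (%x1 x2. dl E e (%r d. dl E r (%a c. si (%s'' t''. ss (%sg tu. si (%s' t'. ss (%s t.
 PH (elt X E x1 (uE s''*[E](uE s'*[E]c*[E]uE s)*[E]uE sg)) (uX t''*[X]x2*[X]uX tu)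
 (g (uE t'*[E]a*[E]uE t)) d)))))))" by (simp only: out_E)
 also have "... = dl X x (%x1 x2. dl E e (%r d. dl E r (%a c. si (%s' t'. si (%s'' t''. ss (%s t. ss (%sg tu.
 PH (elt X E x1 (uE (s''*[B]s')*[E]c*[E]uE (s*[B]sg))) (uX t''*[X]x2*[X]uX tu)
 (uY t'*[Y]g a*[Y]uY t) d)))))))" by (rule smc, rule smc, rule smc, subst sm_perm4) (simp add: UE(2,3) g'(2,3) gu E(17,20) B(20))
 also have "... = dl X x (%x1 x2. dl E e (%a r. dl E r (%c d. si (%s' t'. si (%s'' t''. ss (%s t. ss (%sg tu.
 PH (elt X E x1 (uE (s''*[B]s')*[E]c*[E]uE (s*[B]sg))) (uX t''*[X]x2*[X]uX tu)
 (uY t'*[Y]g a*[Y]uY t) d)))))))" by (rule smc, rule E(7)[OF m(2)]) (intro L; simp add: pcl)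
 also have "... = ?r20"
 unfolding GA_def by (simp only: out_X)
 finally show ?thesis .
 qed
 show ?thesis
 using pbD(2)[OF w tGA] by (simp add: A Bc)
qed

lemma proj_elt_form:
 assumes F: "lin XE kk F" and m: "x <: X" "e <: E"
 shows "F (proj (elt X E x e)) = dl X x (%a b. dl E e (%c d. F (elt X E (a*[X]ka b*[X]s (g c)) d)))" (is "_ = ?r21")
 and "F (elt X E x e) = dl E e (%p q. dl E q (%c d. F (elt X E (x*[X]s (antipode Y (g p))*[X]s (g c)) d)))"
proof -
 note b = functional_sm(1)[OF X(3) E(3) F]
 note L = pb_lin bilinD(2,3)[OF b]
 have b': "bilin X E kk (%x e. dl X x (%a b. dl E e (%c d. F (elt X E (a*[X]ka b*[X]s (g c)) d))))"
 by (rule bilinI; intro lin_sm[OF X(3,3)] lin_sm[OF E(3,3)] lin_smI X(4) E(4); intro L; simp add: pcl)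
 have c: "elt X E x e <: XE" using m pcl by simp
 have "F (proj (elt X E x e)) = sm X E (proj (elt X E x e)) (%x e. F (elt X E x e))"
 by (rule functional_sm(2)[OF X(3) E(3) F proj_closed[OF c]])
 also have "... = sm X E (elt X E x e) (%x e. dl X x (%a b. dl E e (%c d. F (elt X E (a*[X]ka b*[X]s (g c)) d))))"
 by (rule sm_proj[OF c b])
 also have "... = ?r21" by (rule sm_elt[OF X(3) E(3) b' m])
 finally show "F (proj (elt X E x e)) = ?r21" .
 show "F (elt X E x e) = dl E e (%p q. dl E q (%c d. F (elt X E (x*[X]s (antipode Y (g p))*[X]s (g c)) d)))"
 by (rule form_g[OF b m, symmetric])
qed

text \<open>The coproduct of \<open>w\<close> lies in \<open>pb\<close> tensored with itself, in the
  form asked for by \<open>ir_comul\<close>. Each factor is treated separately: with the antipode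
  formula of \<open>proj\<close> as the form in the auxiliary lemma, one side is the projected
  factor and the other the factor itself.\<close>

lemma pb_comul:
 assumes w: "w : pb" and F: "bilin XE XE kk F"
 shows "dl W w (%a b. F (proj a) (proj b)) = dl W w F" (is "?l22 = _")
proof -
 note FL = bilinD(2,3)[OF F]
 have b1: "bilin XE XE kk (%a b. F (proj a) (proj b))" "bilin XE XE kk (%a b. F a (proj b))"
 by (intro bilinI FL lin_proj lin_id; simp add: proj_closed)+
 \<comment> \<open>The halfway form, in which only the right factor is still projected.\<close>
 let ?F = "%a b. F a (proj b)"
 have l: "lin XE kk (%a. F a c)" "lin XE kk (%b. F c b)" "lin XE kk (%a. F a (proj c))" if "c <: XE" for c
 using that by (intro FL lin_id lin_proj; simp add: proj_closed)+
 note L = pb_lin FL bilinD(2,3)[OF b1(2)]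
 have q: "quadlin X Y E XE (%a y e c'. dl E e (%c d. ?F (elt X E (a*[X]s (antipode Y y)*[X]s (g c)) d) c'))"
 "quadlin XE X Y E (%c' a y e. dl E e (%c d. F c' (elt X E (a*[X]s (antipode Y y)*[X]s (g c)) d)))"
 by (intro L; simp add: pcl)+
 have "?l22 = dl W w ?F"
 using pb_comul_left_aux[OF w q(1)] by (simp add: dl_W_sm[OF b1(1) pbD(1)[OF w]] dl_W_sm[OF b1(2) pbD(1)[OF w]] pcl
 proj_elt_form(1)[OF l(3)] proj_elt_form(2)[OF l(3), symmetric] del: tw_simps)
 also have "... = dl W w F"
 using pb_comul_right_aux[OF w q(2)] by (simp add: dl_W_sm[OF b1(2) pbD(1)[OF w]] dl_W_sm[OF F pbD(1)[OF w]] pcl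
 proj_elt_form(1)[OF l(2)] proj_elt_form(2)[OF l(2), symmetric] del: tw_simps)
 finally show ?thesis .
qed

end

section \<open>Carrying a tensor product by an infinite type\<close>

text \<open>An infinite type is equinumerous with its square, so pairs can be coded. A list is coded
  by nested pairs together with its length, without which lists of different lengths could
  collide.\<close>

lemma ex_inj_lists:
 assumes "infinite (UNIV :: 'u set)"
 shows "\<exists>f :: ('u \<times> 'u) list => 'u. inj f"
proof -
 obtain c :: "'u \<times> 'u => 'u" where c: "inj c"
 using card_of_Times_same_infinite[OF assms] unfolding card_of_ordIso[symmetric] by (auto simp: bij_betw_def)
 obtain \<nu> :: "nat => 'u" where \<nu>: "inj \<nu>" using assms unfolding infinite_iff_countable_subset by auto
 define fo where "fo = foldr (%p z. c (c p, z))"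
 have fo: "fo xs z = fo ys z ==> length xs = length ys ==> xs = ys" for xs ys z
 proof (induction xs arbitrary: ys)
 case (Cons p xs)
 thus ?case by (cases ys) (auto simp: fo_def inj_eq[OF c])
 qed (simp add: fo_def)
 have "inj (%xs. c (\<nu> (length xs), fo xs (\<nu> 0)))" by (rule injI) (auto simp: inj_eq[OF c] inj_eq[OF \<nu>] intro: fo)
 thus ?thesis by blast
qed

text \<open>A tensor is a finite sum of simple tensors with coefficients absorbed in the factors,
  hence is determined by a list of pairs over \<open>'u\<close>, whatever the size of the
  field.\<close>

lemma ex_inj_tens:
 fixes X :: "('k::field, 'u, 'p) vect_scheme" and Y :: "('k, 'u, 'q) vect_scheme"
 assumes inf: "infinite (UNIV :: 'u set)" and X: "vspace X" and Y: "vspace Y"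
 shows "\<exists>f :: (('u \<times> 'u) \<Rightarrow>\<^sub>0 'k) set => 'u. inj_on f (car (tens X Y))"
proof -
 let ?T = "tens X Y"
 define val where "val xs = foldr (%p. vadd ?T (elt X Y (fst p) (snd p))) xs (vzero ?T)" for xs
 note T = vspace_tens[OF X Y]
 have val_closed: "set xs <= car X \<times> car Y ==> val xs <: ?T" for xs
 by (induction xs) (auto simp: val_def T X Y)
 have val_append: "set xs <= car X \<times> car Y ==> set ys <= car X \<times> car Y ==>
 val (xs @ ys) = vadd ?T (val xs) (val ys)" for xs ys
 proof (induction xs)
 case Nil
 thus ?case using val_closed[of ys] by (simp add: val_def T)
 next
 case (Cons p xs)
 thus ?case using val_closed[of xs] val_closed[of ys] by (auto simp: val_def vadd_assoc[OF T] X Y)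
 qed
 have "\<exists>xs. set xs <= car X \<times> car Y & t = val xs" if "t <: ?T" for t
 using X Y that
 proof (induction rule: tens_induct)
 case (elt x y)
 thus ?case by (intro exI[of _ "[(x, y)]"]) (auto simp: val_def X Y T)
 next
 case (add s t)
 then obtain xs ys where "set xs <= car X \<times> car Y" "s = val xs"
 "set ys <= car X \<times> car Y" "t = val ys" by auto
 thus ?case by (intro exI[of _ "xs @ ys"]) (auto simp: val_append)
 qed
 then obtain l where l: "!!t. t <: ?T ==> t = val (l t)" by metis
 obtain f :: "('u \<times> 'u) list => 'u" where f: "inj f" using ex_inj_lists[OF inf] by blast
 have "inj_on (%t. f (l t)) (car ?T)"
 proof (rule inj_onI)
 fix s t assume "s <: ?T" "t <: ?T" "f (l s) = f (l t)"
 thus "s = t" using l[of s] l[of t] by (simp add: inj_eq[OF f])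
 qed
 thus ?thesis by blast
qed

section \<open>Maps into and out of the twisted tensor product\<close>

text \<open>Both sides are the fourfold coproduct, bracketed as two pairs or with the middle pair
  isolated.\<close>

lemma dl_regroup:
 assumes H: "bialgebra H" and y: "y <: H" and Q: "quadlin H H H H Q"
 shows "dl H y (%c d. dl H c (%c1 c2. dl H d (%d1 d2. Q c1 c2 d1 d2)))
 = dl H y (%a r. dl H r (%m d. dl H m (%b c. Q a b c d)))" (is "?l23 = ?r23")
proof -
 note H' = bialgD[OF H]
 note L = trilinI lin_smI lin_sm[OF H'(3,3)] H'(4) bilinI quadlinD[OF Q] lin_id
 have "?l23 = dl H y (%a r. dl H r (%b q. dl H q (%c d. Q a b c d)))"
 by (rule H'(7)[OF y, where G = "%a b q. dl H q (%c d. Q a b c d)"]) (intro L; simp)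
 also have "... = ?r23" by (rule smc, rule H'(7)[symmetric]) ((intro L)?; simp)+
 finally show ?thesis .
qed

context qt_pair
begin

definition pW :: "(('x \<times> 'e) \<Rightarrow>\<^sub>0 'k) set => 'x" where
 "pW = tlift X E X (%x e. vsmul X (eps E e) x)"

definition qW :: "(('x \<times> 'e) \<Rightarrow>\<^sub>0 'k) set => 'e" where
 "qW = tlift X E E (%x e. vsmul E (eps X x) e)"

lemma bilin_pq: "bilin X E X (%x e. vsmul X (eps E e) x)" "bilin X E E (%x e. vsmul E (eps X x) e)"
 by (intro bilinI lin_vsmul lin_vsmul_left X E lin_id; simp)+

lemma pqW: "lin XE X pW" "lin XE E qW"
 "pW : extensional (car XE)" "qW : extensional (car XE)"
 using tlift_maps(1)[OF X(3) E(3) X(3) bilin_pq(1)] tlift_maps(1)[OF X(3) E(3) E(3) bilin_pq(2)]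
 by (simp_all add: pW_def qW_def lin_maps_iff)

lemma pqW_elt: "x <: X ==> e <: E ==> pW (elt X E x e) = vsmul X (eps E e) x"
 "x <: X ==> e <: E ==> qW (elt X E x e) = vsmul E (eps X x) e"
 using tlift_elt[OF X(3) E(3) X(3) bilin_pq(1)] tlift_elt[OF X(3) E(3) E(3) bilin_pq(2)]
 by (simp_all add: pW_def qW_def)

lemma pqW_form: "w <: XE ==> lin X kk ph ==> ph (pW w) = sm X E w (%x e. ph x * eps E e)"
 "w <: XE ==> lin E kk ps ==> ps (qW w) = sm X E w (%x e. eps X x * ps e)"
 using functional_tlift[OF X(3) E(3) X(3) bilin_pq(1), of ph w]
 functional_tlift[OF X(3) E(3) E(3) bilin_pq(2), of ps w] by (simp_all add: pW_def qW_def linD(3)[of X kk ph] linD(3)[of E kk ps] mult.commute)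

text \<open>Taking the projections in the opposite order kills the outer legs and leaves exactly the
  inner twist. On the pullback this becomes the quasi-cocommutativity relation for the pair
  \<open>q,p\<close>.\<close>

lemma dl_W_qp:
 assumes w: "w <: XE" and F: "bilin E X kk F"
 shows "dl W w (%a b. F (qW a) (pW b))
 = sm X E w (%x e. si (%s' t'. ss (%s t. F (uE s'*[E]e*[E]uE s) (uX t'*[X]x*[X]uX t))))" (is "?l24 = _")
proof -
 note L = plin bilinD(2,3)[OF F] lin_o[OF pqW(1)] lin_o[OF pqW(2)] lin_sm[OF X(3,3)] X(4)
 have b: "bilin XE XE kk (%a b. F (qW a) (pW b))" by (intro L; simp add: linD(1)[OF pqW(1)] linD(1)[OF pqW(2)])
 have v: "F (vsmul E c e) (vsmul X d x) = c * (d * F e x)" if "x <: X" "e <: E" for c d x e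
 using that linD(3)[OF bilinD(2)[OF F lin_id], of "vsmul X d x" e c] linD(3)[OF bilinD(3)[OF F lin_id], of e x d] X(3) by simp
 let ?PH = "%x e. si (%s' t'. ss (%s t. F (uE s'*[E]e*[E]uE s) (uX t'*[X]x*[X]uX t)))"
 have "?l24 = sm X E w (%x e. dl X x (%x1 x2. dl E e (%e1 e2. (eps X x1 * ?PH x2 e1) * eps E e2)))"
 by (simp add: dl_W_sm[OF b w] pqW_elt cl v sm_mult_left mult_ac del: tw_simps)
 also have "... = sm X E w (%x e. dl X x (%x1 x2. eps X x1 * ?PH x2 e))"
 by (rule smc, rule smc, rule E(9)) ((intro L)?; simp add: cl)+
 also have "... = sm X E w ?PH" by (rule smc, rule X(8)) ((intro L)?; simp add: cl)+
 finally show ?thesis .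
qed

text \<open>The projection applies a counit of \<open>E\<close>, which removes the twist by
  \<open>ss_counit\<close>; hence it respects coproducts.\<close>

lemma dl_W_p:
 assumes w: "w <: XE" and F: "bilin X X kk F"
 shows "dl X (pW w) F = dl W w (%a b. F (pW a) (pW b))"
proof -
 note L = plin bilinD(2,3)[OF F] lin_o[OF pqW(1)] lin_o[OF pqW(2)] lin_sm[OF X(3,3)] X(4)
 have b: "bilin XE XE kk (%a b. F (pW a) (pW b))" by (intro L; simp add: linD(1)[OF pqW(1)] linD(1)[OF pqW(2)])
 have v: "F (vsmul X c e) (vsmul X d x) = c * (d * F e x)" if "x <: X" "e <: X" for c d x e
 using that linD(3)[OF bilinD(2)[OF F lin_id], of "vsmul X d x" e c] linD(3)[OF bilinD(3)[OF F lin_id], of e x d] X(3) by simp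
 have l: "lin X kk (%x. dl X x F)" using F by (intro lin_sm[OF X(3,3)] X(4))
 have "dl W w (%a b. F (pW a) (pW b))
 = sm X E w (%x e. dl X x (%x1 x2. dl E e (%e1 e2. (si (%s' t'. ss (%s t. eps E (uE s'*[E]e1*[E]uE s) * F x1 (uX t'*[X]x2*[X]uX t)))) * eps E e2)))"
 by (simp add: dl_W_sm[OF b w] pqW_elt cl v sm_mult_left mult_ac del: tw_simps)
 also have "... = sm X E w (%x e. dl X x (%x1 x2. si (%s' t'. ss (%s t. eps E (uE s'*[E]e*[E]uE s) * F x1 (uX t'*[X]x2*[X]uX t)))))"
 by (rule smc, rule smc, rule E(9)) ((intro L)?; simp add: cl)+
 also have "... = sm X E w (%x e. dl X x F * eps E e)"
 proof (rule smc)
 fix x e assume m: "x <: X" "e <: E"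
 have "dl X x (%x1 x2. si (%s' t'. ss (%s t. eps E (uE s'*[E]e*[E]uE s) * F x1 (uX t'*[X]x2*[X]uX t))))
 = dl X x (%x1 x2. eps E e * F x1 x2)"
 proof (rule smc)
 fix x1 x2 assume k: "x1 <: X" "x2 <: X"
 have "si (%s' t'. ss (%s t. eps E (uE s'*[E]e*[E]uE s) * F x1 (uX t'*[X]x2*[X]uX t)))
 = si (%s' t'. eps B s' * (ss (%s t. eps B s * (eps E e * F x1 (uX t'*[X]x2*[X]uX t)))))"
 using m by (simp add: E UE sm_mult_left[symmetric] mult_ac)
 also have "... = si (%s' t'. eps B s' * (eps E e * F x1 (uX t'*[X]x2*[X]uX (aone B))))"
 by (rule smc, subst ss_counit(1)[where ph = "%t. eps E e * F x1 (uX _*[X]x2*[X]uX t)"]) (use k in \<open>(intro L)?; simp add: cl\<close>)+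
 also have "... = eps E e * F x1 (uX (aone B)*[X]x2*[X]uX (aone B))"
 by (rule ss_counit(3)) (use k in \<open>intro L; simp add: cl\<close>)
 finally show "si (%s' t'. ss (%s t. eps E (uE s'*[E]e*[E]uE s) * F x1 (uX t'*[X]x2*[X]uX t))) = eps E e * F x1 x2"
 using k by (simp add: UX(4) X)
 qed
 thus "dl X x (%x1 x2. si (%s' t'. ss (%s t. eps E (uE s'*[E]e*[E]uE s) * F x1 (uX t'*[X]x2*[X]uX t)))) = dl X x F * eps E e"
 by (simp add: sm_mult_left mult.commute)
 qed
 also have "... = dl X (pW w) F" by (rule pqW_form(1)[OF w l, symmetric])
 finally show ?thesis by (rule sym)
qed

lemma dl_W_q:
 assumes w: "w <: XE" and F: "bilin E E kk F"
 shows "dl E (qW w) F = dl W w (%a b. F (qW a) (qW b))"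
proof -
 note L = plin bilinD(2,3)[OF F] lin_o[OF pqW(1)] lin_o[OF pqW(2)] lin_sm[OF E(3,3)] E(4)
 have b: "bilin XE XE kk (%a b. F (qW a) (qW b))" by (intro L; simp add: linD(1)[OF pqW(1)] linD(1)[OF pqW(2)])
 have v: "F (vsmul E c e) (vsmul E d x) = c * (d * F e x)" if "x <: E" "e <: E" for c d x e
 using that linD(3)[OF bilinD(2)[OF F lin_id], of "vsmul E d x" e c] linD(3)[OF bilinD(3)[OF F lin_id], of e x d] E(3) by simp
 have l: "lin E kk (%x. dl E x F)" using F by (intro lin_sm[OF E(3,3)] E(4))
 have "dl W w (%a b. F (qW a) (qW b))
 = sm X E w (%x e. dl X x (%x1 x2. eps X x1 * dl E e (%e1 e2. (si (%s' t'. ss (%s t. eps X (uX t'*[X]x2*[X]uX t) * F (uE s'*[E]e1*[E]uE s) e2))))))"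
 by (simp add: dl_W_sm[OF b w] pqW_elt cl v sm_mult_left mult_ac del: tw_simps)
 also have "... = sm X E w (%x e. dl E e (%e1 e2. (si (%s' t'. ss (%s t. eps X (uX t'*[X]x*[X]uX t) * F (uE s'*[E]e1*[E]uE s) e2)))))"
 by (rule smc, rule X(8)) ((intro L)?; simp add: cl)+
 also have "... = sm X E w (%x e. eps X x * dl E e F)"
 proof (rule smc)
 fix x e assume m: "x <: X" "e <: E"
 have "dl E e (%e1 e2. si (%s' t'. ss (%s t. eps X (uX t'*[X]x*[X]uX t) * F (uE s'*[E]e1*[E]uE s) e2)))
 = dl E e (%e1 e2. eps X x * F e1 e2)"
 proof (rule smc)
 fix e1 e2 assume k: "e1 <: E" "e2 <: E"
 have "si (%s' t'. ss (%s t. eps X (uX t'*[X]x*[X]uX t) * F (uE s'*[E]e1*[E]uE s) e2))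
 = si (%s' t'. (ss (%s t. (eps X x * F (uE s'*[E]e1*[E]uE s) e2) * eps B t)) * eps B t')"
 using m by (simp add: X UX sm_mult_left[symmetric] mult_ac)
 also have "... = si (%s' t'. (eps X x * F (uE s'*[E]e1*[E]uE (aone B)) e2) * eps B t')"
 by (rule smc, subst ss_counit(2)[where ph = "%s. eps X x * F (uE _*[E]e1*[E]uE s) e2"]) (use k in \<open>(intro L)?; simp add: cl\<close>)+
 also have "... = eps X x * F (uE (aone B)*[E]e1*[E]uE (aone B)) e2"
 by (rule ss_counit(4)) (use k in \<open>intro L; simp add: cl\<close>)
 finally show "si (%s' t'. ss (%s t. eps X (uX t'*[X]x*[X]uX t) * F (uE s'*[E]e1*[E]uE s) e2)) = eps X x * F e1 e2"
 using k by (simp add: UE(4) E)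
 qed
 thus "dl E e (%e1 e2. si (%s' t'. ss (%s t. eps X (uX t'*[X]x*[X]uX t) * F (uE s'*[E]e1*[E]uE s) e2))) = eps X x * dl E e F"
 by (simp add: sm_mult_left)
 qed
 also have "... = dl E (qW w) F" by (rule pqW_form(2)[OF w l, symmetric])
 finally show ?thesis by (rule sym)
qed

text \<open>In the direct order the projections keep the outer legs, which the twist leaves alone,
  and so recover the tensor itself.\<close>

lemma dl_W_pq:
 assumes w: "w <: XE" and F: "bilin X E kk F"
 shows "dl W w (%a b. F (pW a) (qW b)) = sm X E w F" (is "?l25 = _")
proof -
 note L = plin bilinD(2,3)[OF F] lin_o[OF pqW(1)] lin_o[OF pqW(2)] lin_sm[OF E(3,3)] E(4)
 have b: "bilin XE XE kk (%a b. F (pW a) (qW b))" by (intro L; simp add: linD(1)[OF pqW(1)] linD(1)[OF pqW(2)])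
 have v: "F (vsmul X c e) (vsmul E d x) = c * (d * F e x)" if "x <: E" "e <: X" for c d x e
 using that linD(3)[OF bilinD(2)[OF F lin_id], of "vsmul E d x" e c] linD(3)[OF bilinD(3)[OF F lin_id], of e x d] E(3) by simp
 have c: "si (%s' t'. ss (%s t. eps E (uE s'*[E]e*[E]uE s) * eps X (uX t'*[X]x*[X]uX t))) = eps E e * eps X x" (is "?l26 = _")
 if m: "x <: X" "e <: E" for x e
 proof -
 have "?l26 = eps E e * eps X x * (si (%s' t'. eps B s' * eps B t') * ss (%s' t'. eps B s' * eps B t'))"
 using m by (simp add: X E UX UE sm_mult_left[symmetric] sm_mult_right[symmetric] mult_ac)
 thus ?thesis using ss_counit(1)[OF B(5)] ss_counit(3)[OF B(5)] B(13) by simp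
 qed
 have "?l25 = sm X E w (%x e. dl X x (%x1 x2. dl E e (%e1 e2. (si (%s' t'. ss (%s t. eps E (uE s'*[E]e1*[E]uE s) * eps X (uX t'*[X]x2*[X]uX t)))) * F x1 e2)))"
 by (simp add: dl_W_sm[OF b w] pqW_elt cl v sm_mult_left mult_ac del: tw_simps)
 also have "... = sm X E w (%x e. dl X x (%x1 x2. dl E e (%e1 e2. eps E e1 * F x1 e2) * eps X x2))"
 by (simp add: c sm_mult_left[symmetric] mult_ac)
 also have "... = sm X E w (%x e. dl X x (%x1 x2. F x1 e * eps X x2))"
 by (rule smc, rule smc, subst E(8)) ((intro L)?; simp add: cl)+
 also have "... = sm X E w F" by (rule smc, rule X(9)) ((intro L)?; simp add: cl)+
 finally show ?thesis .
qed

lemma pW_map: "pW : bialg_maps W X" and qW_map: "qW : bialg_maps W E"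
proof -
 have lm: "lin_maps W V = lin_maps XE V" for V :: "('k, 'v, 'vz) vect_scheme"
 by (rule lin_cong_space(2)) simp_all
 note Wl = lin_talg[OF X(1) E(1)] lin_id
 note p = linD[OF pqW(1)] linD[OF pqW(2)]
 have mult: "pW (w*[talg X E]w') = pW w*[X]pW w' & qW (w*[talg X E]w') = qW w*[E]qW w'"
 if w: "w <: XE" "w' <: XE" for w w'
 proof
 have ax: "eps X (x*[X]x') = eps X x * eps X x'" if "x <: X" "x' <: X" for x x' using that X by simp
 have ae: "eps E (x*[E]x') = eps E x * eps E x'" if "x <: E" "x' <: E" for x x' using that E by simp
 have vx: "vsmul X c x*[X]vsmul X d x' = vsmul X (c * d) (x*[X]x')" if "x <: X" "x' <: X" for c d x x'
 using that X(3) linD(3)[OF XL(1)[OF lin_id], of "vsmul X d x'" x c] linD(3)[OF XL(2)[OF lin_id], of x x' d]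
 by (simp add: X vspaceD(5)[OF X(3)])
 have ve: "vsmul E c x*[E]vsmul E d x' = vsmul E (c * d) (x*[E]x')" if "x <: E" "x' <: E" for c d x x'
 using that E(3) linD(3)[OF EL(1)[OF lin_id], of "vsmul E d x'" x c] linD(3)[OF EL(2)[OF lin_id], of x x' d]
 by (simp add: E vspaceD(5)[OF E(3)])
 have e: "pW (elt X E x e*[talg X E]elt X E x' e') = pW (elt X E x e)*[X]pW (elt X E x' e')"
 "qW (elt X E x e*[talg X E]elt X E x' e') = qW (elt X E x e)*[E]qW (elt X E x' e')"
 if "x <: X" "e <: E" "x' <: X" "e' <: E" for x e x' e'
 using that by (simp_all add: elt_mult_elt[OF X(1) E(1)] pqW_elt vx ve ax ae cl)
 have e2: "pW (elt X E x e*[talg X E]w') = pW (elt X E x e)*[X]pW w'"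
 "qW (elt X E x e*[talg X E]w') = qW (elt X E x e)*[E]qW w'"
 if m: "x <: X" "e <: E" for x e by (rule tens_lin_eq[OF X(3) E(3) lin_o[OF pqW(1) Wl(2)] XL(2)[OF pqW(1)] _ w(2)];
 use m e vspace_XE in \<open>simp add: p cl\<close>)
 (rule tens_lin_eq[OF X(3) E(3) lin_o[OF pqW(2) Wl(2)] EL(2)[OF pqW(2)] _ w(2)];
 use m e vspace_XE in \<open>simp add: p cl\<close>)
 show "pW (w*[talg X E]w') = pW w*[X]pW w'" by (rule tens_lin_eq[OF X(3) E(3) lin_o[OF pqW(1) Wl(1)] XL(1)[OF pqW(1)] _ w(1)];
 use w e2 in \<open>simp add: p cl\<close>)
 show "qW (w*[talg X E]w') = qW w*[E]qW w'" by (rule tens_lin_eq[OF X(3) E(3) lin_o[OF pqW(2) Wl(1)] EL(1)[OF pqW(2)] _ w(1)];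
 use w e2 in \<open>simp add: p cl\<close>)
 qed
 have cou: "eps X (pW w) = eps W w & eps E (qW w) = eps W w" if w: "w <: XE" for w
 proof -
 have l: "lin XE kk (eps W)" using acounit_W_maps by blast
 have "eps X (pW w) = eps W w" by (rule XE_eq[OF lin_o[OF X(5) pqW(1)] l w]; simp add: pqW_elt acounit_W_elt linD(3)[OF X(5)] del: tw_simps)
 moreover have "eps E (qW w) = eps W w" by (rule XE_eq[OF lin_o[OF E(5) pqW(2)] l w]; simp add: pqW_elt acounit_W_elt linD(3)[OF E(5)] del: tw_simps)
 ultimately show ?thesis by simp
 qed
 show "pW : bialg_maps W X" by (rule bialg_mapsI[OF bialgebra_W bX])
 (use pqW mult cou dl_W_p in \<open>simp_all add: lm lin_maps_iff pqW_elt X E del: tw_simps(7,8)\<close>)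
 show "qW : bialg_maps W E" by (rule bialg_mapsI[OF bialgebra_W bE])
 (use pqW mult cou dl_W_q in \<open>simp_all add: lm lin_maps_iff pqW_elt X E del: tw_simps(7,8)\<close>)
qed

end

context bialg_retract
begin

lemma into_P:
 assumes T: "bialgebra T" and l: "lin T W t" and ir: "!!y. y <: T ==> i (r (t y)) = t y"
 and m: "!!y y'. y <: T ==> y' <: T ==> t (y*[T]y') = t y*[W]t y'"
 and o: "t (aone T) = aone W"
 and d: "!!y F. y <: T ==> bilin W W kk F ==> dl W (t y) F = dl T y (%a b. F (t a) (t b))"
 and c: "!!y. y <: T ==> eps W (t y) = eps T y"
 shows "(\<lambda>y\<in>car T. r (t y)) : bialg_maps T P"
proof (rule bialg_mapsI[OF T bialgebra_P])
 note T' = bialgD[OF T] algebraD[OF bialgD(1)[OF T]]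
 have tW: "t y <: W" if "y <: T" for y using linD(1)[OF l] that .
 have "lin T P (\<lambda>y\<in>car T. r (t y)) = lin T P (%y. r (t y))" by (rule lin_cong) (simp_all add: T')
 thus "(\<lambda>y\<in>car T. r (t y)) : lin_maps T P"
 using lin_o[OF lin_r l] by (simp add: lin_maps_iff lin_P')
 show "(\<lambda>y\<in>car T. r (t y)) (aone T) = aone P" by (simp add: T' o)
 fix y assume y: "y <: T"
 show "eps P ((\<lambda>y\<in>car T. r (t y)) y) = eps T y" using y by (simp add: P_co r tW ir c)
 show "(\<lambda>y\<in>car T. r (t y)) (y*[T]y') = (\<lambda>y\<in>car T. r (t y)) y*[P](\<lambda>y\<in>car T. r (t y)) y'"
 if "y' <: T" for y' using y that by (simp add: T' r tW ir m)
 fix F assume "bilin P P kk F"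
 hence F: "bilin V V kk F" by (simp add: bilin_P)
 show "dl P ((\<lambda>y\<in>car T. r (t y)) y) F = dl T y (%a b. F ((\<lambda>y\<in>car T. r (t y)) a) ((\<lambda>y\<in>car T. r (t y)) b))"
 using y F by (simp add: dl_P r tW ir d bilin_r)
qed

lemma out_P:
 assumes Z: "bialgebra Z" and h: "h : bialg_maps W Z"
 shows "(\<lambda>v\<in>C. h (i v)) : bialg_maps P Z"
proof (rule bialg_mapsI[OF bialgebra_P Z])
 note h' = bmapD[OF h bW Z]
 have "lin V Z (\<lambda>v\<in>C. h (i v)) = lin V Z (%v. h (i v))" by (rule lin_cong) (simp_all add: vspace_V)
 thus "(\<lambda>v\<in>C. h (i v)) : lin_maps P Z"
 using lin_o[OF h'(1) lin_i] by (simp add: lin_maps_iff lin_P)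
 show "(\<lambda>v\<in>C. h (i v)) (aone P) = aone Z" using h'(4) W(16) by (simp add: r ir_one)
 fix v assume "v <: P"
 hence v: "v : C" by simp
 show "eps Z ((\<lambda>v\<in>C. h (i v)) v) = eps P v" using v by (simp add: P_co h'(6) i)
 show "(\<lambda>v\<in>C. h (i v)) (v*[P]v') = (\<lambda>v\<in>C. h (i v)) v*[Z](\<lambda>v\<in>C. h (i v)) v'"
 if "v' <: P" for v' using v that W(20) by (simp add: r ir_mult h'(3) i)
 fix F assume F: "bilin Z Z kk F"
 have b: "bilin W W kk (%a b. F (h a) (h b))" by (intro bilinI bilinD(2,3)[OF F] h'(1)) (auto simp: h'(2))
 show "dl Z ((\<lambda>v\<in>C. h (i v)) v) F = dl P v (%a b. F ((\<lambda>v\<in>C. h (i v)) a) ((\<lambda>v\<in>C. h (i v)) b))"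
 using dl_P_eq[OF v b, of "%a b. F ((\<lambda>v\<in>C. h (i v)) a) ((\<lambda>v\<in>C. h (i v)) b)"] h'(5)[OF i[OF v] F] v by simp
qed

end

context qt_hopf
begin

lemma tmap_idm_S: "tmap B B B B (idm B) (idm B) S = S"
proof (rule tens_eqI[OF B(3,3) _ S_closed(1)])
 note l = lin_idm[OF B(3)]
 show "tmap B B B B (idm B) (idm B) S <: (tens B B)" by (rule tmap_closed[OF B(3,3,3,3) l l S_closed(1)])
 show "sm B B (tmap B B B B (idm B) (idm B) S) F = ss F" if "bilin B B kk F" for F
 unfolding sm_tmap[OF B(3,3,3,3) l l S_closed(1) that] by (rule smc) simp
qed

text \<open>The matrix \<open>S\<close> is its own image under the identity. This allows the unit of
  the pullback to be built as an induced map out of \<open>B\<close>.\<close>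

lemma qc_B: "qc B (idm B)"
 using quasitriangular_push_iff[OF hopf_B idm_bialg_map[OF bB]] qt by (simp add: tmap_idm_S)

end

section \<open>Pairing two maps into the twisted tensor product\<close>

context qt_pair
begin

text \<open>Pairing of two maps through the coproduct of their domain; the candidate for the map
  into the pullback induced by a cone.\<close>

definition jt :: "('k, 't, 'tz) bialg_scheme => ('t => 'x) => ('t => 'e) => 't => (('x \<times> 'e) \<Rightarrow>\<^sub>0 'k) set" where
 "jt T a b y = tlift T T XE (%c d. elt X E (a c) (b d)) (acomul T y)"

context
 fixes T :: "('k, 't, 'tz) bialg_scheme" and a b
 assumes T: "bialgebra T" and a: "a : bialg_maps T X" and b: "b : bialg_maps T E"
begin

lemmas T' = bialgD[OF T] algebraD[OF bialgD(1)[OF T]]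
lemmas ma = bmapD[OF a T bX]
lemmas mb = bmapD[OF b T bE]

lemma bilin_jt: "bilin T T XE (%c d. elt X E (a c) (b d))" by (intro bilinI XEL ma(1) mb(1); simp add: ma(2) mb(2))

lemma lin_jt: "lin T XE (jt T a b)"
 unfolding jt_def using lin_tlift[OF T'(3,3) vspace_XE(1) bilin_jt T'(4)] .

lemma jt_closed: "y <: T ==> jt T a b y <: XE" by (rule linD(1)[OF lin_jt])

lemma jt_form:
 "y <: T ==> lin XE kk ph ==> ph (jt T a b y) = dl T y (%c d. ph (elt X E (a c) (b d)))"
 unfolding jt_def by (rule functional_tlift[OF T'(3,3) vspace_XE(1) bilin_jt _ T'(6)])

lemma jt_sm:
 assumes y: "y <: T" and F: "bilin X E kk F"
 shows "sm X E (jt T a b y) F = dl T y (%c d. F (a c) (b d))"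
 unfolding jt_def sm_tlift[OF T'(3,3) X(3) E(3) bilin_jt F T'(6)[OF y]]
 by (rule smc) (simp add: F X(3) E(3) ma(2) mb(2))

lemma jt_pq:
 assumes y: "y <: T"
 shows "pW (jt T a b y) = a y" "qW (jt T a b y) = b y"
proof -
 note L = plin lin_o[OF ma(1)] lin_o[OF mb(1)]
 show "pW (jt T a b y) = a y"
 proof (rule functional_eqI[OF X(3)])
 show "pW (jt T a b y) <: X" "a y <: X" using y by (simp_all add: linD(1)[OF pqW(1)] jt_closed ma(2))
 fix ph assume ph: "lin X kk ph"
 have "ph (pW (jt T a b y)) = dl T y (%c d. ph (a c) * eps E (b d))"
 unfolding pqW_form(1)[OF jt_closed[OF y] ph] by (rule jt_sm[OF y]) (intro L lin_o[OF ph])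
 also have "... = ph (a y)" using T'(9)[OF y lin_o[OF ph ma(1)]] by (simp add: mb(6))
 finally show "ph (pW (jt T a b y)) = ph (a y)" .
 qed
 show "qW (jt T a b y) = b y"
 proof (rule functional_eqI[OF E(3)])
 show "qW (jt T a b y) <: E" "b y <: E" using y by (simp_all add: linD(1)[OF pqW(2)] jt_closed mb(2))
 fix ph assume ph: "lin E kk ph"
 have "ph (qW (jt T a b y)) = dl T y (%c d. eps X (a c) * ph (b d))"
 unfolding pqW_form(2)[OF jt_closed[OF y] ph] by (rule jt_sm[OF y]) (intro L lin_o[OF ph])
 also have "... = ph (b y)" using T'(8)[OF y lin_o[OF ph mb(1)]] by (simp add: ma(6))
 finally show "ph (qW (jt T a b y)) = ph (b y)" .
 qed
qed

lemma jt_mult: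
 assumes y: "y <: T" "y' <: T"
 shows "jt T a b (y*[T]y') = jt T a b y*[W]jt T a b y'"
proof (rule tens_eqI[OF X(3) E(3)])
 show "jt T a b (y*[T]y') <: XE" by (rule jt_closed) (simp add: y T')
 show "jt T a b y*[W]jt T a b y' <: XE" using talg_closed[OF X(1) E(1)] jt_closed y by simp
 fix F assume F: "bilin X E kk F"
 note L = plin lin_o[OF ma(1)] lin_o[OF mb(1)] bilinD(2,3)[OF F] alg_lin[OF T'(1)]
 have b1: "bilin X E kk (%x e. F (x'*[X]x) (e'*[E]e))" if "x' <: X" "e' <: E" for x' e'
 using that by (intro L; simp add: cl)
 have b2: "bilin X E kk (%x e. dl T y' (%c d. F (x*[X]a c) (e*[E]b d)))"
 by (intro L; simp add: cl ma(2) mb(2))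
 have b3: "bilin T T kk (%c d. F (a c) (b d))" by (intro L; simp add: ma(2) mb(2))
 have "sm X E (jt T a b (y*[T]y')) F = dl T y (%c d. dl T y' (%c' d'. F (a (c*[T]c')) (b (d*[T]d'))))"
 by (subst jt_sm) (simp_all add: y F T' b3)
 also have "... = sm X E (jt T a b y*[W]jt T a b y') F"
 using y F by (simp add: sm_talg[OF X(1) E(1)] jt_closed jt_sm b1 b2 ma mb)
 finally show "sm X E (jt T a b (y*[T]y')) F = sm X E (jt T a b y*[W]jt T a b y') F" .
qed

lemma jt_one: "jt T a b (aone T) = aone W"
 unfolding jt_def acomul_mult(2)[OF T] using bilin_jt T'(3,16) by (simp add: ma(4) mb(4))

lemma jt_counit:
 assumes y: "y <: T"
 shows "eps W (jt T a b y) = eps T y"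
proof -
 have l: "lin XE kk (eps W)" using acounit_W_maps by blast
 have "eps W (jt T a b y) = dl T y (%c d. eps T c * eps T d)" by (simp add: jt_form[OF y l] acounit_W_elt ma mb del: tw_simps)
 thus ?thesis using T'(8)[OF y T'(5)] by simp
qed

text \<open>The twisted coproduct of \<open>a y1 \<otimes> b y2\<close> has inner legs
  \<open>b y3\<close> and \<open>a y2\<close>, conjugated by \<open>S\<close>. As \<open>a\<close>
  and \<open>b\<close> respect the units, the conjugation takes place in \<open>T\<close>, whose
  quasi-cocommutativity removes it and restores the order of the legs.\<close>

lemma jt_dl:
 assumes uT: "uT : bialg_maps B T" and au: "!!c. c <: B ==> a (uT c) = uX c"
 and bu: "!!c. c <: B ==> b (uT c) = uE c" and qcT: "qc T uT"
 and y: "y <: T" and F: "bilin XE XE kk F"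
 shows "dl W (jt T a b y) F = dl T y (%c d. F (jt T a b c) (jt T a b d))" (is "_ = ?r27")
proof -
 note UT = bmapD[OF uT bB T]
 note L = plin quadlinI bilinD(2,3)[OF F] lin_o[OF ma(1)] lin_o[OF mb(1)] alg_lin[OF T'(1)] lin_o[OF UT(1)] lin_sm[OF T'(3,3)] T'(4)
 note c = cl ma(2) mb(2) T'(6,16,20) UT(2)
 have "dl W (jt T a b y) F = dl T y (%c d. dl X (a c) (%x1 x2. dl E (b d) (%e1 e2. si (%s' t'. ss (%s t.
 F (elt X E x1 (uE s'*[E]e1*[E]uE s)) (elt X E (uX t'*[X]x2*[X]uX t) e2))))))"
 by (simp add: jt_form[OF y lin_dl_W[OF F lin_id]] dl_W_elt[OF F] ma(2) mb(2) del: tw_simps)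
 also have "... = dl T y (%c d. dl T c (%x1 x2. dl T d (%e1 e2. si (%s' t'. ss (%s t.
 F (elt X E (a x1) (uE s'*[E]b e1*[E]uE s)) (elt X E (uX t'*[X]a x2*[X]uX t) (b e2)))))))"
 proof (rule smc)
 fix x e assume m: "x <: T" "e <: T"
 have "dl X (a x) (%x1 x2. dl E (b e) (%e1 e2. si (%s' t'. ss (%s t.
 F (elt X E x1 (uE s'*[E]e1*[E]uE s)) (elt X E (uX t'*[X]x2*[X]uX t) e2)))))
 = dl T x (%x1 x2. dl E (b e) (%e1 e2. si (%s' t'. ss (%s t.
 F (elt X E (a x1) (uE s'*[E]e1*[E]uE s)) (elt X E (uX t'*[X]a x2*[X]uX t) e2)))))"
 by (rule ma(5)[OF m(1)]) (intro L; simp add: c)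
 also have "... = dl T x (%x1 x2. dl T e (%e1 e2. si (%s' t'. ss (%s t.
 F (elt X E (a x1) (uE s'*[E]b e1*[E]uE s)) (elt X E (uX t'*[X]a x2*[X]uX t) (b e2))))))"
 by (rule smc, rule mb(5)[OF m(2)]) (intro L; simp add: c)
 finally show "dl X (a x) (%x1 x2. dl E (b e) (%e1 e2. si (%s' t'. ss (%s t.
 F (elt X E x1 (uE s'*[E]e1*[E]uE s)) (elt X E (uX t'*[X]x2*[X]uX t) e2))))) = ..." .
 qed
 also have "... = dl T y (%x r. dl T r (%m d. dl T m (%z z'. si (%s' t'. ss (%s t.
 F (elt X E (a x) (uE s'*[E]b z'*[E]uE s)) (elt X E (uX t'*[X]a z*[X]uX t) (b d)))))))"
 by (rule dl_regroup[OF T y]) (intro L; simp add: c)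
 also have "... = dl T y (%x r. dl T r (%m d. dl T m (%z z'. F (elt X E (a x) (b z)) (elt X E (a z') (b d)))))"
 proof (rule smc, rule smc)
 fix x m d assume k: "x <: T" "m <: T" "d <: T"
 have bF: "bilin T T kk (%z z'. F (elt X E (a x) (b z)) (elt X E (a z') (b d)))" using k by (intro L; simp add: c)
 have "dl T m (%z z'. si (%s' t'. ss (%s t.
 F (elt X E (a x) (uE s'*[E]b z'*[E]uE s)) (elt X E (uX t'*[X]a z*[X]uX t) (b d)))))
 = dl T m (%z z'. si (%s' t'. ss (%s t.
 F (elt X E (a x) (b (uT s'*[T]z'*[T]uT s))) (elt X E (a (uT t'*[T]z*[T]uT t)) (b d)))))"
 by (simp add: ma(3) mb(3) c au bu)
 also have "... = dl T m (%z z'. F (elt X E (a x) (b z)) (elt X E (a z') (b d)))"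
 by (rule qcT[unfolded qc_def, rule_format, OF k(2) bF])
 finally show "dl T m (%z z'. si (%s' t'. ss (%s t.
 F (elt X E (a x) (uE s'*[E]b z'*[E]uE s)) (elt X E (uX t'*[X]a z*[X]uX t) (b d))))) = ..." .
 qed
 also have "... = dl T y (%c d. dl T c (%c1 c2. dl T d (%d1 d2. F (elt X E (a c1) (b c2)) (elt X E (a d1) (b d2)))))"
 by (rule dl_regroup[OF T y, symmetric]) (intro L; simp add: c)
 also have "... = ?r27"
 proof (rule smc)
 fix c d assume k: "c <: T" "d <: T"
 have l1: "lin XE kk (%v. F v w)" if "w <: XE" for w using that by (intro L)
 have l2: "lin XE kk (%v. F w v)" if "w <: XE" for w using that by (intro L)
 show "dl T c (%c1 c2. dl T d (%d1 d2. F (elt X E (a c1) (b c2)) (elt X E (a d1) (b d2)))) = F (jt T a b c) (jt T a b d)"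
 using jt_form[OF k(1) l1[OF jt_closed[OF k(2)]]] jt_form[OF k(2) l2] by (simp add: cl ma(2) mb(2))
 qed
 finally show ?thesis .
qed

end

end

context split_cospan
begin

lemma jt_pb:
 assumes T: "bialgebra T" and a: "a : bialg_maps T X" and b: "b : bialg_maps T E"
 and ab: "!!y. y <: T ==> f (a y) = g (b y)" and y: "y <: T"
 shows "jt T a b y : pb"
 unfolding pb_def
proof (intro CollectI conjI allI impI)
 note ma = bmapD[OF a T bX]
 note mb = bmapD[OF b T bE]
 note T' = bialgD[OF T]
 show "jt T a b y <: XE" by (rule jt_closed[OF T a b y])
 fix F assume F: "trilin X Y E kk F"
 note L = pb_lin trilinD(2,3,4)[OF F] lin_o[OF ma(1)] lin_o[OF mb(1)]
 have b': "bilin X E kk (%x e. dl X x (%a b. F a (f b) e))" "bilin X E kk (%x e. dl E e (%c d. F x (g c) d))"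
 by (rule bilinI; intro lin_sm[OF X(3,3)] lin_sm[OF E(3,3)] lin_smI X(4) E(4); intro L; simp add: pcl)+
 have bx: "bilin X X kk (%a b. F a (f b) e)" if "e <: E" for e using that by (intro L; simp add: pcl)
 have be: "bilin E E kk (%c d. F x (g c) d)" if "x <: X" for x using that by (intro L; simp add: pcl)
 have "sm X E (jt T a b y) (%x e. dl X x (%a b. F a (f b) e)) = dl T y (%c d. dl T c (%c1 c2. F (a c1) (f (a c2)) (b d)))"
 unfolding jt_sm[OF T a b y b'(1)] by (rule smc) (simp add: ma(5)[OF _ bx] mb(2))
 also have "... = dl T y (%c d. dl T d (%d1 d2. F (a c) (f (a d1)) (b d2)))"
 by (rule T'(7)[OF y, where G = "%c1 c2 d. F (a c1) (f (a c2)) (b d)"]) (intro L; simp add: pcl ma(2) mb(2))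
 also have "... = sm X E (jt T a b y) (%x e. dl E e (%c d. F x (g c) d))"
 unfolding jt_sm[OF T a b y b'(2)] by (rule smc) (simp add: mb(5)[OF _ be] ma(2) ab)
 finally show "sm X E (jt T a b y) (%x e. dl X x (%a b. F a (f b) e)) = sm X E (jt T a b y) (%x e. dl E e (%c d. F x (g c) d))" .
qed

text \<open>Pair the equation of \<open>pb\<close> with the counits on the two outer
  factors.\<close>

lemma pb_pq:
 assumes w: "w : pb"
 shows "f (pW w) = g (qW w)"
proof (rule functional_eqI[OF Y(3)])
 note wc = pbD(1)[OF w]
 show "f (pW w) <: Y" "g (qW w) <: Y" using wc by (simp_all add: pcl linD(1)[OF pqW(1)] linD(1)[OF pqW(2)])
 fix ps assume ps: "lin Y kk ps"
 have l: "lin X kk (%x. ps (f x))" "lin E kk (%x. ps (g x))" by (rule lin_o[OF ps f'(1)]) (rule lin_o[OF ps g'(1)])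
 have "ps (f (pW w)) = sm X E w (%x e. dl X x (%a b. eps X a * (ps (f b))) * eps E e)"
 unfolding pqW_form(1)[OF wc l(1)] by (rule smc) (simp add: X(8)[OF _ l(1)])
 also have "... = sm X E w (%x e. dl X x (%a b. eps X a * ps (f b) * eps E e))"
 by (simp only: sm_mult_right)
 also have "... = sm X E w (%x e. dl E e (%c d. eps X x * ps (g c) * eps E d))"
 by (rule pbD(2)[OF w, where F = "%x y e. eps X x * ps y * eps E e"])
 (intro pb_lin lin_o[OF ps])
 also have "... = sm X E w (%x e. eps X x * dl E e (%c d. ps (g c) * eps E d))"
 by (simp add: sm_mult_left mult.assoc)
 also have "... = ps (g (qW w))"
 unfolding pqW_form(2)[OF wc l(2)] by (rule smc) (simp add: E(9)[OF _ l(2)])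
 finally show "ps (f (pW w)) = ps (g (qW w))" .
qed

end

section \<open>Quasi-cocommutativity of the pullback\<close>

context qt_hopf
begin

text \<open>The relation \<open>(m \<otimes> n) S\<^sup>-\<^sup>1 \<Delta>\<^sup>o\<^sup>p S = (m \<otimes> n) \<Delta>\<close>.\<close>

definition sh :: "('k, 'h, 'y) bialg_scheme => ('b => 'h) => ('k, 'm, 'mz) vect_scheme => ('k, 'n, 'nz) vect_scheme => ('h => 'm) => ('h => 'n) => bool" where
 "sh H u M N m n <-> (\<forall>v\<in>car H. \<forall>F. bilin M N kk F -->
 dl H v (%a c. si (%s' t'. ss (%s t. F (m (u s'*[H]c*[H]u s)) (n (u t'*[H]a*[H]u t)))))
 = dl H v (%a c. F (m a) (n c)))"

context
 fixes H :: "('k, 'h, 'y) bialg_scheme" and u :: "'b => 'h"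
 assumes bH: "bialgebra H" and u: "u : bialg_maps B H"
begin

lemmas Hd = bialgD[OF bH] algebraD[OF bialgD(1)[OF bH]]
lemmas Ud = bmapD[OF u bB bH]
lemmas Hl = bilinI trilinI quadlinI lin_smI lin_o[OF Ud(1)] alg_lin[OF Hd(1)] BL lin_id lin_sm[OF Hd(3,3)] Hd(4)
lemmas Hc = Hd(6,16,20) Ud(2) B(6,16,20)

text \<open>Quasi-cocommutativity multiplied by \<open>S\<close> from the left: flipped coproduct
  times \<open>S\<close> equals \<open>S\<close> times coproduct.\<close>

lemma qc_comm:
 assumes qc: "qc H u" and x: "x <: H" and F: "bilin H H kk F"
 shows "dl H x (%a c. ss (%s t. F (c*[H]u s) (a*[H]u t))) = dl H x (%a c. ss (%s t. F (u s*[H]a) (u t*[H]c)))" (is "?l28 = ?r28")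
proof -
 note L = Hl bilinD(2,3)[OF F]
 have b: "bilin H H kk (%y z. ss (%sg tu. F (u sg*[H]y) (u tu*[H]z)))" by (intro L; simp add: Hc)
 have "?l28 = dl H x (%a c. ss (%sg tu. si (%s' t'. ss (%s t. F (u (sg*[B]s')*[H]c*[H]u s) (u (tu*[B]t')*[H]a*[H]u t)))))"
 proof (rule smc)
 fix a c assume m: "a <: H" "c <: H"
 have "ss (%sg tu. si (%s' t'. ss (%s t. F (u (sg*[B]s')*[H]c*[H]u s) (u (tu*[B]t')*[H]a*[H]u t))))
 = ss (%s t. F (u (aone B)*[H]c*[H]u s) (u (aone B)*[H]a*[H]u t))"
 by (rule ss_inv(1)) (use m in \<open>intro L; simp add: Hc\<close>)
 thus "ss (%s t. F (c*[H]u s) (a*[H]u t)) = ss (%sg tu. si (%s' t'. ss (%s t. F (u (sg*[B]s')*[H]c*[H]u s) (u (tu*[B]t')*[H]a*[H]u t))))"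
 using m by (simp add: Ud(2,4) Hd)
 qed
 also have "... = dl H x (%a c. si (%s' t'. ss (%s t. ss (%sg tu. F (u sg*[H]u s'*[H]c*[H]u s) (u tu*[H]u t'*[H]a*[H]u t)))))"
 proof (rule smc)
 fix a c assume m: "a <: H" "c <: H"
 let ?G = "%s t s' t' sg tu. F (u sg*[H]u s'*[H]c*[H]u s) (u tu*[H]u t'*[H]a*[H]u t)"
 have "ss (%sg tu. si (%s' t'. ss (%s t. F (u (sg*[B]s')*[H]c*[H]u s) (u (tu*[B]t')*[H]a*[H]u t))))
 = ss (%sg tu. si (%s' t'. ss (%s t. ?G s t s' t' sg tu)))"
 using m by (simp add: Ud(2,3) Hd(17) Hc)
 also have "... = si (%s' t'. ss (%sg tu. ss (%s t. ?G s t s' t' sg tu)))" by (rule sm_swap)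
 also have "... = si (%s' t'. ss (%s t. ss (%sg tu. ?G s t s' t' sg tu)))" by (rule smc, rule sm_swap)
 finally show "ss (%sg tu. si (%s' t'. ss (%s t. F (u (sg*[B]s')*[H]c*[H]u s) (u (tu*[B]t')*[H]a*[H]u t)))) = ..." .
 qed
 also have "... = ?r28" by (rule qc[unfolded qc_def, rule_format, OF x b])
 finally show ?thesis .
qed

text \<open>Two uses of \<open>qc_comm\<close> carry \<open>S21 S\<close> past a coproduct, the
  second flip restoring the order of the legs.\<close>

lemma dl_central:
 assumes qc: "qc H u" and x: "x <: H" and G: "bilin H H kk G"
 shows "dl H x (%c d. ss (%sg tu. ss (%s t. G (c*[H]u tu*[H]u s) (d*[H]u sg*[H]u t))))
 = dl H x (%c d. ss (%sg tu. ss (%s t. G (u tu*[H]u s*[H]c) (u sg*[H]u t*[H]d))))" (is "?l29 = ?r29")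
proof -
 note L = Hl bilinD(2,3)[OF G]
 have b1: "bilin H H kk (%y z. ss (%s t. G (z*[H]u s) (y*[H]u t)))" by (intro L; simp add: Hc)
 have b2: "bilin H H kk (%y z. G (p*[H]y) (q*[H]z))" if "p <: H" "q <: H" for p q
 using that by (intro L; simp add: Hc)
 have "?l29 = dl H x (%c d. ss (%sg tu. ss (%s t. G ((c*[H]u tu)*[H]u s) ((d*[H]u sg)*[H]u t))))"
 by (simp add: Hd(17) Hc)
 also have "... = dl H x (%c d. ss (%sg tu. ss (%s t. G ((u tu*[H]d)*[H]u s) ((u sg*[H]c)*[H]u t))))"
 by (rule qc_comm[OF qc x b1])
 also have "... = ss (%sg tu. dl H x (%c d. ss (%s t. G (u tu*[H]d*[H]u s) (u sg*[H]c*[H]u t))))"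
 by (simp only: sm_swap[of H H "acomul H x" B B S]) (simp add: Hd(17) Hc)
 also have "... = ss (%sg tu. dl H x (%c d. ss (%s t. G (u tu*[H]u s*[H]c) (u sg*[H]u t*[H]d))))"
 by (rule smc, rule qc_comm[OF qc x b2]) (simp_all add: Hc)
 also have "... = ?r29" by (rule sm_swap)
 finally show ?thesis .
qed

lemma shD: "sh H u M N m n ==> v <: H ==> bilin M N kk F ==>
 dl H v (%a c. si (%s' t'. ss (%s t. F (m (u s'*[H]c*[H]u s)) (n (u t'*[H]a*[H]u t)))))
 = dl H v (%a c. F (m a) (n c))"
 unfolding sh_def by blast

lemma sh_cong:
 assumes "!!x. x <: H ==> m x = m' x" "!!x. x <: H ==> n x = n' x"
 shows "sh H u M N m n = sh H u M N m' n'"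
 unfolding sh_def using assms by (simp add: Hc)

context
 fixes X :: "('k, 'x, 'p) bialg_scheme" and E :: "('k, 'e, 'q) bialg_scheme" and p q ps
 assumes X: "bialgebra X" and E: "bialgebra E" and p: "p : bialg_maps H X" and q: "q : bialg_maps H E"
 and ps: "bilin X E H ps"
 and det: "!!y ph. y <: H ==> lin H kk ph ==> dl H y (%a b. ph (ps (p a) (q b))) = ph y"
begin

lemmas pm = bmapD[OF p bH X]
lemmas qm = bmapD[OF q bH E]

text \<open>By \<open>det\<close> an element is reassembled from its images under \<open>p\<close>
  and \<open>q\<close>. The conjugated argument is written in this way, \<open>conj1\<close> gives
  each part its own conjugation, and the relations for \<open>p,n\<close> and \<open>q,n\<close>
  remove them in turn.\<close>

lemma sh_left:
 assumes N: "bialgebra N" and n: "n : bialg_maps H N" and pn: "sh H u X N p n" and qn: "sh H u E N q n"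
 shows "sh H u H N (%x. x) n"
 unfolding sh_def
proof (intro ballI allI impI)
 fix v F assume v: "v <: H" and F: "bilin H N kk F"
 note N' = bialgD[OF N] algebraD[OF bialgD(1)[OF N]]
 note nm = bmapD[OF n bH N]
 note L = Hl bilinD(2,3)[OF F] lin_o[OF pm(1)] lin_o[OF qm(1)] lin_o[OF nm(1)] bilinD(2,3)[OF ps] alg_lin[OF N'(1)]
 note c = Hc pm(2) qm(2) nm(2) N'(20) bilinD(1)[OF ps]
 note lF = bilinD(2)[OF F lin_id]
 have "dl H v (%a c. si (%s' t'. ss (%s t. F (u s'*[H]c*[H]u s) (n (u t'*[H]a*[H]u t)))))
 = dl H v (%a c. si (%s' t'. ss (%s t. dl H (u s'*[H]c*[H]u s) (%y y'. F (ps (p y) (q y')) (n (u t'*[H]a*[H]u t))))))"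
 by (simp add: det[OF _ lF] c)
 also have "... = dl H v (%a c. dl H c (%c1 c2. si (%s' t'. si (%s'' t''. ss (%s t. ss (%sg tu.
 F (ps (p (u s'*[H]c1*[H]u s)) (q (u s''*[H]c2*[H]u sg))) (n (u (t''*[B]t')*[H]a*[H]u (t*[B]tu)))))))))"
 by (rule smc, rule conj1[OF bH u, where G = "%f1 f2 t' t. F (ps (p f1) (q f2)) (n (u t'*[H]_*[H]u t))"])
 ((intro L)?; simp add: c)+
 also have "... = dl H v (%a c. dl H c (%c1 c2. si (%s'' t''. ss (%sg tu. si (%s' t'. ss (%s t.
 F (ps (p (u s'*[H]c1*[H]u s)) (q (u s''*[H]c2*[H]u sg))) (n (u t'')*[N]n (u t'*[H]a*[H]u t)*[N]n (u tu))))))))"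
 by (subst sm_perm4) (simp add: Ud(2,3) nm(2,3) Hc Hd(17) N'(17,20))
 also have "... = dl H v (%r c2. dl H r (%a c1. si (%s'' t''. ss (%sg tu. si (%s' t'. ss (%s t.
 F (ps (p (u s'*[H]c1*[H]u s)) (q (u s''*[H]c2*[H]u sg))) (n (u t'')*[N]n (u t'*[H]a*[H]u t)*[N]n (u tu))))))))"
 by (rule Hd(7)[OF v, symmetric]) (intro L; simp add: c)
 also have "... = dl H v (%r c2. si (%s'' t''. ss (%sg tu. dl H r (%a c1. si (%s' t'. ss (%s t.
 F (ps (p (u s'*[H]c1*[H]u s)) (q (u s''*[H]c2*[H]u sg))) (n (u t'')*[N]n (u t'*[H]a*[H]u t)*[N]n (u tu))))))))"
 by (rule smc, subst sm_swap[of H H _ B B Si], rule smc, rule sm_swap)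
 also have "... = dl H v (%r c2. si (%s'' t''. ss (%sg tu. dl H r (%a c1.
 F (ps (p a) (q (u s''*[H]c2*[H]u sg))) (n (u t'')*[N]n c1*[N]n (u tu))))))"
 by (rule smc, rule smc, rule smc, rule shD[OF pn]) ((intro L)?; simp add: c)+
 also have "... = dl H v (%r c2. dl H r (%a c1. si (%s'' t''. ss (%sg tu.
 F (ps (p a) (q (u s''*[H]c2*[H]u sg))) (n (u t''*[H]c1*[H]u tu))))))"
 by (simp add: sm_swap[of H H _ B B] nm(3) Hc)
 also have "... = dl H v (%a r. dl H r (%c1 c2. si (%s'' t''. ss (%sg tu.
 F (ps (p a) (q (u s''*[H]c2*[H]u sg))) (n (u t''*[H]c1*[H]u tu))))))"
 by (rule Hd(7)[OF v]) (intro L; simp add: c)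
 also have "... = dl H v (%a r. dl H r (%c1 c2. F (ps (p a) (q c1)) (n c2)))"
 by (rule smc, rule shD[OF qn]) ((intro L)?; simp add: c)+
 also have "... = dl H v (%r c2. dl H r (%a c1. F (ps (p a) (q c1)) (n c2)))"
 by (rule Hd(7)[OF v, symmetric]) (intro L; simp add: c)
 also have "... = dl H v (%a c. F a (n c))" by (simp add: det[OF _ lF] c)
 finally show "dl H v (%a c. si (%s' t'. ss (%s t. F (u s'*[H]c*[H]u s) (n (u t'*[H]a*[H]u t))))) = dl H v (%a c. F a (n c))" .
qed

text \<open>As \<open>sh_left\<close>, for the second argument and with
  \<open>conj2\<close>.\<close>

lemma sh_right:
 assumes N: "bialgebra N" and n: "n : bialg_maps H N" and np: "sh H u N X n p" and nq: "sh H u N E n q"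
 shows "sh H u N H n (%x. x)"
 unfolding sh_def
proof (intro ballI allI impI)
 fix v F assume v: "v <: H" and F: "bilin N H kk F"
 note N' = bialgD[OF N] algebraD[OF bialgD(1)[OF N]]
 note nm = bmapD[OF n bH N]
 note L = Hl bilinD(2,3)[OF F] lin_o[OF pm(1)] lin_o[OF qm(1)] lin_o[OF nm(1)] bilinD(2,3)[OF ps] alg_lin[OF N'(1)]
 note c = Hc pm(2) qm(2) nm(2) N'(20) bilinD(1)[OF ps]
 note lF = bilinD(3)[OF F lin_id]
 have "dl H v (%a c. si (%s' t'. ss (%s t. F (n (u s'*[H]c*[H]u s)) (u t'*[H]a*[H]u t))))
 = dl H v (%a c. si (%s' t'. ss (%s t. dl H (u t'*[H]a*[H]u t) (%y y'. F (n (u s'*[H]c*[H]u s)) (ps (p y) (q y'))))))"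
 by (simp add: det[OF _ lF] c)
 also have "... = dl H v (%a c. dl H a (%a1 a2. si (%s' t'. si (%s'' t''. ss (%s t. ss (%sg tu.
 F (n (u (s''*[B]s')*[H]c*[H]u (s*[B]sg))) (ps (p (u t''*[H]a1*[H]u tu)) (q (u t'*[H]a2*[H]u t)))))))))"
 by (rule smc, rule conj2[OF bH u, where G = "%f1 f2 s' s. F (n (u s'*[H]_*[H]u s)) (ps (p f1) (q f2))"])
 ((intro L)?; simp add: c)+
 also have "... = dl H v (%a c. dl H a (%a1 a2. si (%s'' t''. ss (%sg tu. si (%s' t'. ss (%s t.
 F (n (u s'')*[N]n (u s'*[H]c*[H]u s)*[N]n (u sg)) (ps (p (u t''*[H]a1*[H]u tu)) (q (u t'*[H]a2*[H]u t)))))))))"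
 by (subst sm_perm4) (simp add: Ud(2,3) nm(2,3) Hc Hd(17) N'(17,20))
 also have "... = dl H v (%a1 r. dl H r (%a2 c. si (%s'' t''. ss (%sg tu. si (%s' t'. ss (%s t.
 F (n (u s'')*[N]n (u s'*[H]c*[H]u s)*[N]n (u sg)) (ps (p (u t''*[H]a1*[H]u tu)) (q (u t'*[H]a2*[H]u t)))))))))"
 by (rule Hd(7)[OF v]) (intro L; simp add: c)
 also have "... = dl H v (%a1 r. si (%s'' t''. ss (%sg tu. dl H r (%a2 c. si (%s' t'. ss (%s t.
 F (n (u s'')*[N]n (u s'*[H]c*[H]u s)*[N]n (u sg)) (ps (p (u t''*[H]a1*[H]u tu)) (q (u t'*[H]a2*[H]u t)))))))))"
 by (rule smc, subst sm_swap[of H H _ B B Si], rule smc, rule sm_swap)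
 also have "... = dl H v (%a1 r. si (%s'' t''. ss (%sg tu. dl H r (%a2 c.
 F (n (u s'')*[N]n a2*[N]n (u sg)) (ps (p (u t''*[H]a1*[H]u tu)) (q c))))))"
 by (rule smc, rule smc, rule smc, rule shD[OF nq]) ((intro L)?; simp add: c)+
 also have "... = dl H v (%a1 r. dl H r (%a2 c. si (%s'' t''. ss (%sg tu.
 F (n (u s''*[H]a2*[H]u sg)) (ps (p (u t''*[H]a1*[H]u tu)) (q c))))))"
 by (simp add: sm_swap[of H H _ B B] nm(3) Hc)
 also have "... = dl H v (%r c. dl H r (%a1 a2. si (%s'' t''. ss (%sg tu.
 F (n (u s''*[H]a2*[H]u sg)) (ps (p (u t''*[H]a1*[H]u tu)) (q c))))))"
 by (rule Hd(7)[OF v, symmetric]) (intro L; simp add: c)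
 also have "... = dl H v (%r c. dl H r (%a1 a2. F (n a1) (ps (p a2) (q c))))"
 by (rule smc, rule shD[OF np]) ((intro L)?; simp add: c)+
 also have "... = dl H v (%a1 r. dl H r (%a2 c. F (n a1) (ps (p a2) (q c))))"
 by (rule Hd(7)[OF v]) (intro L; simp add: c)
 also have "... = dl H v (%a c. F (n a) c)" by (simp add: det[OF _ lF] c)
 finally show "dl H v (%a c. si (%s' t'. ss (%s t. F (n (u s'*[H]c*[H]u s)) (u t'*[H]a*[H]u t)))) = dl H v (%a c. F (n a) c)" .
qed

text \<open>The second argument is first widened from the projections to the identity, and then the
  first.\<close>

lemma qc_jointly:
 assumes "sh H u X X p p" "sh H u X E p q" "sh H u E X q p" "sh H u E E q q"
 shows "qc H u"
proof -
 note i = idm_bialg_map[OF bH]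
 have "sh H u X H p (idm H)" "sh H u E H q (idm H)"
 using sh_right[OF X p assms(1,2)] sh_right[OF E q assms(3,4)] by (simp_all add: sh_cong[of p p "%x. x" "idm H"] sh_cong[of q q "%x. x" "idm H"])
 from sh_left[OF bH i this] have "sh H u H H (%x. x) (%x. x)" by (simp add: sh_cong[of "%x. x" "%x. x" "%x. x" "idm H"])
 thus ?thesis unfolding sh_def qc_def .
qed

end

text \<open>Conjugation by units commutes with \<open>p\<close>, so the relation of \<open>X\<close>
  can be evaluated at \<open>p v\<close>.\<close>

lemma sh_same:
 assumes X: "bialgebra X" and p: "p : bialg_maps H X" and pu: "!!b. b <: B ==> p (u b) = uX b"
 and uX: "uX : bialg_maps B X" and qc: "qc X uX"
 shows "sh H u X X p p"
 unfolding sh_def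
proof (intro ballI allI impI)
 fix v F assume v: "v <: H" and F: "bilin X X kk F"
 note pm = bmapD[OF p bH X]
 note X' = bialgD[OF X] algebraD[OF bialgD(1)[OF X]]
 note um = bmapD[OF uX bB X]
 have b: "bilin X X kk (%a c. si (%s' t'. ss (%s t. F (uX s'*[X]c*[X]uX s) (uX t'*[X]a*[X]uX t))))"
 by (intro bilinI lin_smI bilinD(2,3)[OF F] alg_lin[OF X'(1)] lin_id; simp add: um(2) X'(20))
 have "dl H v (%a c. si (%s' t'. ss (%s t. F (p (u s'*[H]c*[H]u s)) (p (u t'*[H]a*[H]u t)))))
 = dl X (p v) (%a c. si (%s' t'. ss (%s t. F (uX s'*[X]c*[X]uX s) (uX t'*[X]a*[X]uX t))))"
 unfolding pm(5)[OF v b] by (simp add: pm(3) pu Hc)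
 also have "... = dl X (p v) F" by (rule qc[unfolded qc_def, rule_format, OF pm(2)[OF v] F])
 also have "... = dl H v (%a c. F (p a) (p c))" by (rule pm(5)[OF v F])
 finally show "dl H v (%a c. si (%s' t'. ss (%s t. F (p (u s'*[H]c*[H]u s)) (p (u t'*[H]a*[H]u t))))) = ..." .
qed

end

end

section \<open>Coinvariant elements and centrality of \<open>S21 S\<close>\<close>

context split_cospan
begin

lemma coinv:
 \<comment> \<open>\<open>\<pi> x = x\<^sub>1 ka x\<^sub>2\<close> is coinvariant under \<open>f\<close>\<close>
 assumes x: "x <: X" and PH: "bilin X Y kk PH"
 shows "dl X x (%a b. dl X (a*[X]ka b) (%c d. PH c (f d))) = dl X x (%a b. PH (a*[X]ka b) (aone Y))" (is "_ = ?r30")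
proof -
 note L = pb_lin bilinD(2,3)[OF PH] lin_o[OF X(4)] lin_o[OF E(4)]
 \<comment> \<open>The projection of \<open>x \<otimes> 1\<close> is the coinvariant part of
   \<open>x\<close> tensored with 1. That it lies in \<open>pb\<close> is the assertion, once the
   factor in \<open>E\<close> has been removed by a counit.\<close>
 let ?w = "elt X E x (aone E)"
 have w: "?w <: XE" using x by (simp add: cl)
 have b: "bilin X E kk (%x e. dl X x (%a b. PH a (f b) * eps E e))"
 "bilin X E kk (%x e. dl E e (%c d. PH x (g c) * eps E d))" by (intro L; simp add: pcl)+
 have b1: "bilin E E kk (%c d. dl X (a*[X]ka b*[X]s (g c)) (%a b. PH a (f b) * eps E d))"
 "bilin E E kk (%c d. dl E d (%c' d'. PH (a*[X]ka b*[X]s (g c)) (g c') * eps E d'))"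
 if "a <: X" "b <: X" for a b
 using that by (intro L; simp add: pcl)+
 have b2: "bilin E E kk (%c d. PH a (g c) * eps E d)" if "a <: X" for a
 using that by (intro L; simp add: pcl)
 have b3: "bilin X E kk (%x e. dl X x (%a b. dl E e (%c d. dl X (a*[X]ka b*[X]s (g c)) (%a b. PH a (f b) * eps E d))))"
 "bilin X E kk (%x e. dl X x (%a b. dl E e (%c d. dl E d (%c' d'. PH (a*[X]ka b*[X]s (g c)) (g c') * eps E d'))))"
 by (intro L; simp add: pcl)+
 have "sm X E (proj ?w) (%x e. dl X x (%a b. PH a (f b) * eps E e)) = sm X E (proj ?w) (%x e. dl E e (%c d. PH x (g c) * eps E d))"
 by (rule pbD(2)[OF proj_in_pb[OF w], where F = "%x y e. PH x y * eps E e"]) (intro L)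
 moreover have "sm X E (proj ?w) (%x e. dl X x (%a b. PH a (f b) * eps E e)) = dl X x (%a b. dl X (a*[X]ka b) (%c d. PH c (f d)))"
 unfolding sm_proj[OF w b(1)] sm_elt[OF X(3) E(3) b3(1) x E(16)]
 by (rule smc) (simp add: E(11)[OF b1(1)] g'(4) s'(4) X(19) E(13) pcl)
 moreover have "sm X E (proj ?w) (%x e. dl E e (%c d. PH x (g c) * eps E d)) = ?r30"
 unfolding sm_proj[OF w b(2)] sm_elt[OF X(3) E(3) b3(2) x E(16)]
 by (rule smc) (simp add: E(11)[OF b1(2)] E(11)[OF b2] g'(4) s'(4) X(19) E(13) pcl)
 ultimately show ?thesis by simp
qed

text \<open>On a coinvariant element the second leg becomes 1 under \<open>f\<close>, so centrality
  of \<open>S21 S\<close> with respect to the coproduct of \<open>X\<close> speaks about that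
  element alone. It arises with the second leg in \<open>Y\<close>; injectivity of \<open>uY\<close>
  gives the retraction \<open>rh\<close> that brings this leg back to \<open>B\<close>.\<close>

lemma coinv_central:
 assumes inj: "inj_on uY (car B)" and x: "x <: X" and G: "bilin X B kk G"
 shows "dl X x (%a b. ss (%sg tu. ss (%p q. G ((a*[X]ka b)*[X]uX tu*[X]uX p) (sg*[B]q))))
 = dl X x (%a b. ss (%sg tu. ss (%p q. G (uX tu*[X]uX p*[X]a*[X]ka b) (sg*[B]q))))"
proof -
 obtain rh where rh: "lin Y B rh" and rhu: "!!b. b <: B ==> rh (uY b) = b"
 using ex_retraction[OF B(3) Y(3) UY(1) inj] by blast
 note L = pb_lin bilinD(2,3)[OF G] lin_o[OF rh]
 let ?R = "%c y. ss (%sg tu. ss (%p q. G (c*[X]uX tu*[X]uX p) (rh (y*[Y]uY sg*[Y]uY q))))"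
 let ?L = "%c y. ss (%sg tu. ss (%p q. G (uX tu*[X]uX p*[X]c) (rh (uY sg*[Y]uY q*[Y]y))))"
 note c = pcl linD(1)[OF rh]
 have b: "bilin X Y kk ?R" "bilin X Y kk ?L" by (intro L; simp add: c)+
 have b': "bilin X X kk (%y z. G y (rh (f z)))" by (intro L; simp add: c)
 have u: "rh (uY sg*[Y]uY q) = sg*[B]q" if "sg <: B" "q <: B" for sg q
 using that rhu[of "sg*[B]q"] by (simp add: UY(3) B(20))
 have "dl X x (%a b. ss (%sg tu. ss (%p q. G ((a*[X]ka b)*[X]uX tu*[X]uX p) (sg*[B]q))))
 = dl X x (%a b. ?R (a*[X]ka b) (aone Y))" by (simp add: Y(18) u c)
 also have "... = dl X x (%a b. dl X (a*[X]ka b) (%c d. ?R c (f d)))" by (rule coinv[OF x b(1), symmetric])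
 also have "... = dl X x (%a b. dl X (a*[X]ka b) (%c d. ?L c (f d)))"
 using dl_central[OF bX uX qcX _ b'] by (simp add: f'(3) fu c)
 also have "... = dl X x (%a b. ?L (a*[X]ka b) (aone Y))" by (rule coinv[OF x b(2)])
 also have "... = dl X x (%a b. ss (%sg tu. ss (%p q. G (uX tu*[X]uX p*[X]a*[X]ka b) (sg*[B]q))))"
 by (simp add: Y(19) u c)
 finally show ?thesis .
qed

lemma pb_central:
 \<comment> \<open>the pullback commutes with the image of \<open>S\<^sub>2\<^sub>1 S\<close>; this needs \<open>u\<^sub>Y\<close> to be injective\<close>
 assumes inj: "inj_on uY (car B)" and w: "w : pb" and G: "bilin X E kk G"
 shows "sm X E w (%x e. ss (%sg tu. ss (%p q. G (x*[X]uX tu*[X]uX p) (e*[E]uE sg*[E]uE q))))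
 = sm X E w (%x e. ss (%sg tu. ss (%p q. G (uX tu*[X]uX p*[X]x) (uE sg*[E]uE q*[E]e))))"
proof -
 note L = pb_lin bilinD(2,3)[OF G]
 let ?R = "%x e. ss (%sg tu. ss (%p q. G (x*[X]uX tu*[X]uX p) (e*[E]uE sg*[E]uE q)))"
 let ?L = "%x e. ss (%sg tu. ss (%p q. G (uX tu*[X]uX p*[X]x) (uE sg*[E]uE q*[E]e)))"
 have b: "bilin X E kk ?R" "bilin X E kk ?L" by (intro L; simp add: pcl)+
 note wp = proj_pb[OF w] pbD(1)[OF w]
 have "sm X E w ?R = sm X E w (%x e. dl X x (%a b. dl E e (%c d. ?R (a*[X]ka b*[X]s (g c)) d)))"
 using sm_proj[OF wp(2) b(1)] unfolding wp(1) .
 also have "... = sm X E w (%x e. dl X x (%a b. dl E e (%c d. ?L (a*[X]ka b*[X]s (g c)) d)))"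
 proof (rule smc)
 fix x e assume m: "x <: X" "e <: E"
 have "dl X x (%a b. dl E e (%c d. ?R (a*[X]ka b*[X]s (g c)) d))
 = dl X x (%a b. dl E e (%c d. ss (%sg tu. ss (%p q. G ((a*[X]ka b)*[X]s (g (c*[E]uE tu*[E]uE p))) (d*[E]uE sg*[E]uE q)))))"
 by (simp add: g'(3) s'(3) gu su X(17) pcl)
 \<comment> \<open>Centrality in \<open>E\<close> carries \<open>S21 S\<close> past the coproduct of
   \<open>e\<close>. Its legs beside \<open>c\<close> act in \<open>X\<close> because
   \<open>s\<close>, \<open>g\<close> and the units are compatible.\<close>
 also have "... = dl X x (%a b. dl E e (%c d. ss (%sg tu. ss (%p q. G ((a*[X]ka b)*[X]s (g (uE tu*[E]uE p*[E]c))) (uE sg*[E]uE q*[E]d)))))"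
 by (rule smc, rule dl_central[OF bE uE qcE m(2), where G = "%y z. G (_*[X]s (g y)) z"]) (intro L; simp add: pcl)
 also have "... = dl E e (%c d. dl X x (%a b. ss (%sg tu. ss (%p q. G (((a*[X]ka b)*[X]uX tu*[X]uX p)*[X]s (g c)) (uE (sg*[B]q)*[E]d)))))"
 by (subst sm_swap) (simp add: g'(3) s'(3) gu su X(17) E(17) UE(3) pcl)
 \<comment> \<open>For the passage past the coinvariant part, the leg that
   \<open>coinv_central\<close> leaves in \<open>B\<close> is sent to \<open>E\<close> by
   \<open>uE\<close>.\<close>
 also have "... = dl E e (%c d. dl X x (%a b. ss (%sg tu. ss (%p q. G ((uX tu*[X]uX p*[X]a*[X]ka b)*[X]s (g c)) (uE (sg*[B]q)*[E]d)))))"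
 by (rule smc, rule coinv_central[OF inj m(1), where G = "%y z. G (y*[X]s (g _)) (uE z*[E]_)"]) (intro L; simp add: pcl)
 also have "... = dl X x (%a b. dl E e (%c d. ?L (a*[X]ka b*[X]s (g c)) d))"
 by (subst sm_swap) (simp add: X(17) E(17) UE(3) pcl)
 finally show "dl X x (%a b. dl E e (%c d. ?R (a*[X]ka b*[X]s (g c)) d)) = ..." .
 qed
 also have "... = sm X E w ?L" using sm_proj[OF wp(2) b(2)] unfolding wp(1) by (rule sym)
 finally show ?thesis .
qed

end

section \<open>The equalizer as a bialgebra on a prescribed type, and its universal property\<close>

locale pb_carrier = split_cospan B S X uX E uE Y uY f s g
 for B :: "('k::field, 'b, 'z) bialg_scheme" and S
 and X :: "('k, 'x, 'p) bialg_scheme" and uX and E :: "('k, 'e, 'q) bialg_scheme" and uE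
 and Y :: "('k, 'y, 'o) bialg_scheme" and uY and f s g +
 fixes j :: "(('x \<times> 'e) \<Rightarrow>\<^sub>0 'k) set => 'c"
 assumes inj_j: "inj_on j (car (tens X E))" and inj_uY: "inj_on uY (car B)"
begin

text \<open>The equalizer is copied into the type \<open>'c\<close>, which in the application is the
  type that carries all objects of the category.\<close>

definition "CP = j ` pb"
definition "iP = inv_into pb j"
definition "rP w = j (proj w)"

lemma iP_j: "w : pb ==> iP (j w) = w"
 unfolding iP_def by (rule inv_into_f_f) (use inj_j pbD(1) in \<open>auto simp: inj_on_def\<close>)

lemma iP_pb: "v : CP ==> iP v : pb"
 unfolding CP_def using iP_j by auto

lemma iP_rP: "w <: XE ==> iP (rP w) = proj w"
 unfolding rP_def by (rule iP_j[OF proj_in_pb])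

lemma bilin_W: "bilin W W kk F = bilin XE XE kk F"
 unfolding bilin_def lin_tw by simp

sublocale R: bialg_retract W CP iP rP
proof
 show "bialgebra W" by (rule bialgebra_W)
 show "iP v <: W" if "v : CP" for v using pbD(1)[OF iP_pb[OF that]] by simp
 show "rP w : CP" if "w <: W" for w using proj_in_pb that by (simp add: rP_def CP_def)
 show "rP (iP v) = v" if "v : CP" for v
 using that proj_pb[OF iP_pb[OF that]] iP_j by (auto simp: rP_def CP_def)
 show "lin W W (%w. iP (rP w))"
 unfolding lin_tw using lin_cong[of XE "%w. iP (rP w)" proj XE] lin_proj by (simp add: iP_rP)
 show "iP (rP (aone W)) = aone W" using proj_pb[OF pb_one] iP_rP[OF pbD(1)[OF pb_one]] by simp
 show "iP (rP (iP v*[W]iP v')) = iP v*[W]iP v'" if "v : CP" "v' : CP" for v v'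
 using pb_mult[OF iP_pb[OF that(1)] iP_pb[OF that(2)]] by (simp only: iP_rP[OF pbD(1)] proj_pb)
 fix v F assume v: "v : CP" and "bilin W W kk F"
 hence F: "bilin XE XE kk F" by (simp add: bilin_W)
 have "dl W (iP v) (%a b. F (iP (rP a)) (iP (rP b))) = dl W (iP v) (%a b. F (proj a) (proj b))"
 by (rule smc) (simp add: iP_rP)
 thus "dl W (iP v) (%a b. F (iP (rP a)) (iP (rP b))) = dl W (iP v) F"
 using pb_comul[OF iP_pb[OF v] F] by simp
qed

abbreviation "P == retract_bialg W CP iP rP"
definition "p0 = (\<lambda>v\<in>CP. pW (iP v))"
definition "q0 = (\<lambda>v\<in>CP. qW (iP v))"

lemmas bP = R.bialgebra_P
lemma p0_map: "p0 : bialg_maps P X" and q0_map: "q0 : bialg_maps P E"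
 unfolding p0_def q0_def by (rule R.out_P[OF bX pW_map]) (rule R.out_P[OF bE qW_map])

lemmas Pd = bialgD[OF bP] algebraD[OF bialgD(1)[OF bP]]
lemmas pd = bmapD[OF p0_map bP bX]
lemmas qd = bmapD[OF q0_map bP bE]

lemma iP_closed: "v : CP ==> iP v <: XE"
 using pbD(1)[OF iP_pb] .

lemma fp_gq: "v : CP ==> f (p0 v) = g (q0 v)"
 using pb_pq[OF iP_pb] by (simp add: p0_def q0_def)

text \<open>By \<open>dl_W_pq\<close> an element \<open>v\<close> of the pullback is the tensor of
  \<open>p0 v1\<close> and \<open>q0 v2\<close>. Uniqueness of induced maps rests on this.\<close>

lemma iP_sm:
 assumes v: "v : CP" and F: "bilin X E kk F"
 shows "sm X E (iP v) F = dl P v (%a b. F (p0 a) (q0 b))"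
proof -
 have b: "bilin W W kk (%a b. F (pW a) (qW b))"
 unfolding bilin_W by (intro bilinI bilinD(2,3)[OF F] pqW; simp add: linD(1)[OF pqW(1)] linD(1)[OF pqW(2)])
 have "dl P v (%a b. F (p0 a) (q0 b)) = dl W (iP v) (%a b. F (pW a) (qW b))"
 by (rule R.dl_P_eq[OF v b]) (simp add: p0_def q0_def)
 thus ?thesis using dl_W_pq[OF iP_closed[OF v] F] by simp
qed

lemma iP_form:
 assumes v: "v : CP" and ph: "lin XE kk ph"
 shows "ph (iP v) = dl P v (%a b. ph (elt X E (p0 a) (q0 b)))"
 using functional_sm(2)[OF X(3) E(3) ph iP_closed[OF v]] iP_sm[OF v functional_sm(1)[OF X(3) E(3) ph]] by simp

lemma lin_rP: "lin XE P rP"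
 using R.lin_r unfolding R.lin_P' lin_tw .

definition "into T a b = (\<lambda>y\<in>car T. rP (jt T a b y))"

lemma into_map:
 assumes T: "bialgebra T" and a: "a : bialg_maps T X" and b: "b : bialg_maps T E"
 and uT: "uT : bialg_maps B T" and au: "!!c. c <: B ==> a (uT c) = uX c"
 and bu: "!!c. c <: B ==> b (uT c) = uE c" and qcT: "qc T uT"
 and ab: "!!y. y <: T ==> f (a y) = g (b y)"
 shows "into T a b : bialg_maps T P"
 and "y <: T ==> iP (into T a b y) = jt T a b y"
 and "y <: T ==> p0 (into T a b y) = a y" and "y <: T ==> q0 (into T a b y) = b y"
proof -
 have pb: "jt T a b y : pb" if "y <: T" for y by (rule jt_pb[OF T a b ab that])
 have i: "iP (rP (jt T a b y)) = jt T a b y" if "y <: T" for y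
 using pb[OF that] by (simp add: iP_rP[OF pbD(1)] proj_pb)
 show "into T a b : bialg_maps T P" unfolding into_def
 proof (rule R.into_P[OF T])
 show "lin T W (jt T a b)" unfolding lin_tw by (rule lin_jt[OF T a b])
 show "dl W (jt T a b y) F = dl T y (%c d. F (jt T a b c) (jt T a b d))"
 if "y <: T" "bilin W W kk F" for y F
 using jt_dl[OF T a b uT au bu qcT that(1)] that(2) unfolding bilin_W by blast
 qed (use i jt_mult[OF T a b] jt_one[OF T a b] jt_counit[OF T a b] in \<open>simp_all only:\<close>)
 assume y: "y <: T"
 have "rP (jt T a b y) : CP" using R.r jt_closed[OF T a b y] by simp
 thus "iP (into T a b y) = jt T a b y" "p0 (into T a b y) = a y" "q0 (into T a b y) = b y"
 using y i[OF y] jt_pq[OF T a b y] by (simp_all add: into_def p0_def q0_def)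
qed

lemma into_unique:
 assumes T: "bialgebra T" and t: "t : bialg_maps T P" "t' : bialg_maps T P"
 and p: "!!y. y <: T ==> p0 (t y) = p0 (t' y)" and q: "!!y. y <: T ==> q0 (t y) = q0 (t' y)"
 shows "t = t'"
proof
 fix y
 note td = bmapD[OF t(1) T bP] bmapD[OF t(2) T bP]
 show "t y = t' y"
 proof (cases "y <: T")
 case True
 have c: "t y : CP" "t' y : CP" using td(2,9)[OF True] by simp_all
 have "iP (t y) = iP (t' y)"
 proof (rule tens_eqI[OF X(3) E(3) iP_closed iP_closed])
 show "t y : CP" "t' y : CP" by (fact c)+
 fix F assume F: "bilin X E kk F"
 have b: "bilin P P kk (%a b. F (p0 a) (q0 b))" by (intro bilinI bilinD(2,3)[OF F] pd(1) qd(1) pd(2) qd(2))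
 show "sm X E (iP (t y)) F = sm X E (iP (t' y)) F"
 unfolding iP_sm[OF c(1) F] iP_sm[OF c(2) F] td(5)[OF True b] td(12)[OF True b]
 by (rule smc) (simp add: p q)
 qed
 hence "rP (iP (t y)) = rP (iP (t' y))" by (rule arg_cong)
 thus ?thesis unfolding R.ri[OF c(1)] R.ri[OF c(2)] .
 next
 case False
 show ?thesis unfolding extensional_arb[OF td(7) False] extensional_arb[OF td(14) False] ..
 qed
qed

definition "uP = into B uX uE"

lemma uP: "uP : bialg_maps B P" "b <: B ==> p0 (uP b) = uX b" "b <: B ==> q0 (uP b) = uE b"
 using into_map[OF bB uX uE idm_bialg_map[OF bB] _ _ qc_B] by (simp_all add: uP_def fu gu)

lemma inj_uP: "inj_on uX (car B) ==> inj_on uP (car B)"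
proof (rule inj_onI)
 fix x y assume i: "inj_on uX (car B)" and m: "x <: B" "y <: B" and "uP x = uP y"
 hence "p0 (uP x) = p0 (uP y)" by (rule_tac arg_cong)
 thus "x = y" using inj_onD[OF i _ m] unfolding uP(2)[OF m(1)] uP(2)[OF m(2)] by blast
qed

end

section \<open>Antipode and quasi-cocommutativity of the pullback\<close>

context pb_carrier
begin

text \<open>Since \<open>v\<close> is \<open>p0 v1 \<otimes> q0 v2\<close> and antipodes reverse
  coproducts, an antipode of the pullback is forced to have this value, with \<open>b\<close> and
  \<open>a\<close> crossed.\<close>

definition sg :: "'c => (('x \<times> 'e) \<Rightarrow>\<^sub>0 'k) set" where
 "sg v = tlift P P XE (%a b. elt X E (antipode X (p0 b)) (antipode E (q0 a))) (acomul P v)"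

abbreviation "SX == antipode X"
abbreviation "SE == antipode E"

lemmas ap_lin = pb_lin lin_o[OF pd(1)] lin_o[OF qd(1)] lin_o[OF lin_antipode[OF hX]] lin_o[OF lin_antipode[OF hE]]
 lin_sm[OF Pd(3,3)] Pd(4)
lemmas apc = pcl pd(2) qd(2) antipode_closed[OF hX] antipode_closed[OF hE]

lemma bilin_sg: "bilin P P XE (%a b. elt X E (SX (p0 b)) (SE (q0 a)))"
 by (intro ap_lin; simp add: apc)

lemma lin_sg: "lin P XE sg"
 unfolding sg_def[abs_def] by (rule lin_tlift[OF Pd(3,3) vspace_XE(1) bilin_sg Pd(4)])

lemma sg_form: "v : CP ==> lin XE kk ph ==> ph (sg v) = dl P v (%a b. ph (elt X E (SX (p0 b)) (SE (q0 a))))"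
 unfolding sg_def by (rule functional_tlift[OF Pd(3,3) vspace_XE(1) bilin_sg _ Pd(6)]) simp_all

lemma sg_sm:
 assumes v: "v : CP" and F: "bilin X E kk F"
 shows "sm X E (sg v) F = dl P v (%a b. F (SX (p0 b)) (SE (q0 a)))" (is "_ = ?r31")
proof -
 have "sm X E (sg v) F = dl P v (%a b. sm X E (elt X E (SX (p0 b)) (SE (q0 a))) F)"
 unfolding sg_def by (rule sm_tlift[OF Pd(3,3) X(3) E(3) bilin_sg F Pd(6)]) (use v in simp)
 also have "... = ?r31" by (rule smc, rule sm_elt[OF X(3) E(3) F]) (simp_all only: apc)
 finally show ?thesis .
qed

text \<open>Once the coproducts are reversed, the equation of \<open>pb\<close> is coassociativity
  together with \<open>f S p0 = g S q0\<close> on the middle leg.\<close>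

lemma sg_pb:
 assumes v: "v : CP"
 shows "sg v : pb"
 unfolding pb_def
proof (intro CollectI conjI allI impI)
 show "sg v <: XE" using linD(1)[OF lin_sg] v by simp
 have vP: "v <: P" using v by simp
 fix F assume F: "trilin X Y E kk F"
 note L = ap_lin trilinD(2,3,4)[OF F]
 have b: "bilin X E kk (%x e. dl X x (%a b. F a (f b) e))" "bilin X E kk (%x e. dl E e (%c d. F x (g c) d))"
 by (intro L; simp add: apc)+
 have b1: "bilin X X kk (%a b. F a (f b) e)" "bilin X X kk (%a b. F (SX b) (f (SX a)) e)" if "e <: E" for e
 using that by (intro L; simp add: apc)+
 have b2: "bilin E E kk (%c d. F x (g c) d)" "bilin E E kk (%c d. F x (g (SE d)) (SE c))" if "x <: X" for x
 using that by (intro L; simp add: apc)+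
 have fS: "f (SX (p0 a)) = g (SE (q0 a))" if "a <: P" for a
 using that fp_gq[of a] by (simp add: bialg_map_antipode[OF hX hY f] bialg_map_antipode[OF hE hY g] apc del: R.P_simps(1)) simp
 have "sm X E (sg v) (%x e. dl X x (%a b. F a (f b) e))
 = dl P v (%a r. dl P r (%b c. F (SX (p0 c)) (f (SX (p0 b))) (SE (q0 a))))"
 unfolding sg_sm[OF v b(1)]
 proof (rule smc)
 fix a r assume m: "a <: P" "r <: P"
 show "dl X (SX (p0 r)) (%a' b. F a' (f b) (SE (q0 a))) = dl P r (%b c. F (SX (p0 c)) (f (SX (p0 b))) (SE (q0 a)))"
 using m antipode_comul[OF hX pd(2)[OF m(2)] b1(1)] pd(5)[OF m(2) b1(2)] by (simp add: apc del: R.P_simps(1))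
 qed
 also have "... = dl P v (%r c. dl P r (%a b. F (SX (p0 c)) (f (SX (p0 b))) (SE (q0 a))))"
 by (rule Pd(7)[OF vP, symmetric]) (intro L; simp add: apc del: R.P_simps(1))
 also have "... = dl P v (%r c. dl E (SE (q0 r)) (%a b. F (SX (p0 c)) (g a) b))"
 proof (rule smc)
 fix c r assume m: "r <: P" "c <: P"
 show "dl P r (%a b. F (SX (p0 c)) (f (SX (p0 b))) (SE (q0 a))) = dl E (SE (q0 r)) (%a b. F (SX (p0 c)) (g a) b)"
 using m antipode_comul[OF hE qd(2)[OF m(1)] b2(1)] qd(5)[OF m(1) b2(2)] by (simp add: apc fS del: R.P_simps(1))
 qed
 also have "... = sm X E (sg v) (%x e. dl E e (%c d. F x (g c) d))" by (rule sg_sm[OF v b(2), symmetric])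
 finally show "sm X E (sg v) (%x e. dl X x (%a b. F a (f b) e)) = sm X E (sg v) (%x e. dl E e (%c d. F x (g c) d))" .
qed

text \<open>In the fourfold coproduct the middle pair meets in \<open>X\<close> and cancels first,
  then the outer pair cancels in \<open>E\<close>. For the other identity \<open>X\<close> and
  \<open>E\<close> exchange roles.\<close>

lemma P_antipode: "is_antipode P (\<lambda>v\<in>CP. rP (sg v))"
 unfolding is_antipode_iff[OF bP]
proof (intro conjI ballI allI impI)
 have "lin P P (\<lambda>v\<in>CP. rP (sg v)) = lin P P (%v. rP (sg v))" by (rule lin_cong) (simp_all add: Pd(3))
 thus "(\<lambda>v\<in>CP. rP (sg v)) : lin_maps P P"
 using lin_o[OF lin_rP lin_sg] by (simp add: lin_maps_iff)
 have i: "iP (rP (sg v)) = sg v" "rP (sg v) : CP" "sg v <: XE" if "v : CP" for v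
 using sg_pb[OF that] R.r pbD(1)[OF sg_pb[OF that]] by (simp_all add: iP_rP[OF pbD(1)] proj_pb)
 fix x ph assume xP: "x <: P" and ph: "lin P kk ph"
 hence x: "x : CP" by simp
 define PH where "PH w = ph (rP w)" for w
 have PH: "lin XE kk PH" unfolding PH_def by (rule lin_o[OF ph lin_rP])
 note Wl = lin_talg[OF X(1) E(1)]
 have em: "elt X E x e*[talg X E]elt X E x' e' = elt X E (x*[X]x') (e*[E]e')"
 if "x <: X" "e <: E" "x' <: X" "e' <: E" for x e x' e'
 using that elt_mult_elt[OF X(1) E(1)] by blast
 note L = ap_lin lin_o[OF PH]
 have l1: "lin XE kk (%w. PH (w*[talg X E]w'))" "lin XE kk (%w. PH (w'*[talg X E]w))" if "w' <: XE" for w'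
 by (rule lin_o[OF PH Wl(1)[OF lin_id that]]) (rule lin_o[OF PH Wl(2)[OF vspace_XE(1) lin_id that]])
 have one: "PH (elt X E (aone X) (aone E)) = ph (aone P)" by (simp add: PH_def)
 have "dl P x (%a b. ph ((\<lambda>v\<in>CP. rP (sg v)) a*[P]b)) = dl P x (%a b. PH (sg a*[talg X E]iP b))"
 by (rule smc) (simp add: i PH_def)
 also have "... = dl P x (%a b. dl P a (%a1 a2. dl P b (%b1 b2. PH (elt X E (SX (p0 a2)*[X]p0 b1) (SE (q0 a1)*[E]q0 b2)))))"
 proof (rule smc)
 fix a b assume "a <: P" "b <: P"
 hence m: "a : CP" "b : CP" by simp_all
 have "PH (sg a*[talg X E]iP b) = dl P a (%a1 a2. PH (elt X E (SX (p0 a2)) (SE (q0 a1))*[talg X E]iP b))"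
 by (rule sg_form[OF m(1) l1(1)[OF iP_closed[OF m(2)]]])
 also have "... = dl P a (%a1 a2. dl P b (%b1 b2. PH (elt X E (SX (p0 a2)) (SE (q0 a1))*[talg X E]elt X E (p0 b1) (q0 b2))))"
 by (rule smc, rule iP_form[OF m(2) l1(2)]) (simp add: apc)
 finally show "PH (sg a*[talg X E]iP b) = dl P a (%a1 a2. dl P b (%b1 b2. PH (elt X E (SX (p0 a2)*[X]p0 b1) (SE (q0 a1)*[E]q0 b2))))"
 by (simp add: em apc del: R.P_simps(1))
 qed
 also have "... = dl P x (%a r. dl P r (%m d. dl P m (%b c. PH (elt X E (SX (p0 b)*[X]p0 c) (SE (q0 a)*[E]q0 d)))))"
 by (rule dl_regroup[OF bP xP]) (intro L; simp add: apc del: R.P_simps(1))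
 also have "... = dl P x (%a r. dl P r (%m d. eps P m * PH (elt X E (aone X) (SE (q0 a)*[E]q0 d))))"
 proof (rule smc, rule smc)
 fix a m d assume k: "a <: P" "m <: P" "d <: P"
 have l: "lin X kk (%z. PH (elt X E z (SE (q0 a)*[E]q0 d)))" using k by (intro L; simp add: apc del: R.P_simps(1))
 have b: "bilin X X kk (%b c. PH (elt X E (SX b*[X]c) (SE (q0 a)*[E]q0 d)))" using k by (intro L; simp add: apc del: R.P_simps(1))
 show "dl P m (%b c. PH (elt X E (SX (p0 b)*[X]p0 c) (SE (q0 a)*[E]q0 d))) = eps P m * PH (elt X E (aone X) (SE (q0 a)*[E]q0 d))"
 using antipode_inv(1)[OF hX pd(2)[OF k(2)] l] pd(5)[OF k(2) b] pd(6)[OF k(2)] by simp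
 qed
 also have "... = dl P x (%a r. PH (elt X E (aone X) (SE (q0 a)*[E]q0 r)))"
 by (rule smc, rule Pd(8)) ((intro L)?; simp add: apc del: R.P_simps(1))+
 also have "... = eps P x * ph (aone P)"
 proof -
 have l: "lin E kk (%z. PH (elt X E (aone X) z))" by (intro L; simp add: apc)
 have b: "bilin E E kk (%b c. PH (elt X E (aone X) (SE b*[E]c)))" by (intro L; simp add: apc)
 show ?thesis
 using antipode_inv(1)[OF hE qd(2)[OF xP] l] qd(5)[OF xP b] qd(6)[OF xP] one by simp
 qed
 finally show "dl P x (%a b. ph ((\<lambda>v\<in>CP. rP (sg v)) a*[P]b)) = eps P x * ph (aone P)" .
 have "dl P x (%a b. ph (a*[P](\<lambda>v\<in>CP. rP (sg v)) b)) = dl P x (%a b. PH (iP a*[talg X E]sg b))"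
 by (rule smc) (simp add: i PH_def)
 also have "... = dl P x (%a b. dl P a (%a1 a2. dl P b (%b1 b2. PH (elt X E (p0 a1*[X]SX (p0 b2)) (q0 a2*[E]SE (q0 b1))))))"
 proof (rule smc)
 fix a b assume "a <: P" "b <: P"
 hence m: "a : CP" "b : CP" by simp_all
 have "PH (iP a*[talg X E]sg b) = dl P a (%a1 a2. PH (elt X E (p0 a1) (q0 a2)*[talg X E]sg b))"
 by (rule iP_form[OF m(1) l1(1)[OF i(3)[OF m(2)]]])
 also have "... = dl P a (%a1 a2. dl P b (%b1 b2. PH (elt X E (p0 a1) (q0 a2)*[talg X E]elt X E (SX (p0 b2)) (SE (q0 b1)))))"
 by (rule smc, rule sg_form[OF m(2) l1(2)]) (simp add: apc)
 finally show "PH (iP a*[talg X E]sg b) = dl P a (%a1 a2. dl P b (%b1 b2. PH (elt X E (p0 a1*[X]SX (p0 b2)) (q0 a2*[E]SE (q0 b1)))))"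
 by (simp add: em apc del: R.P_simps(1))
 qed
 also have "... = dl P x (%a r. dl P r (%m d. dl P m (%b c. PH (elt X E (p0 a*[X]SX (p0 d)) (q0 b*[E]SE (q0 c))))))"
 by (rule dl_regroup[OF bP xP]) (intro L; simp add: apc del: R.P_simps(1))
 also have "... = dl P x (%a r. dl P r (%m d. eps P m * PH (elt X E (p0 a*[X]SX (p0 d)) (aone E))))"
 proof (rule smc, rule smc)
 fix a m d assume k: "a <: P" "m <: P" "d <: P"
 have l: "lin E kk (%z. PH (elt X E (p0 a*[X]SX (p0 d)) z))" using k by (intro L; simp add: apc del: R.P_simps(1))
 have b: "bilin E E kk (%b c. PH (elt X E (p0 a*[X]SX (p0 d)) (b*[E]SE c)))" using k by (intro L; simp add: apc del: R.P_simps(1))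
 show "dl P m (%b c. PH (elt X E (p0 a*[X]SX (p0 d)) (q0 b*[E]SE (q0 c)))) = eps P m * PH (elt X E (p0 a*[X]SX (p0 d)) (aone E))"
 using antipode_inv(2)[OF hE qd(2)[OF k(2)] l] qd(5)[OF k(2) b] qd(6)[OF k(2)] by simp
 qed
 also have "... = dl P x (%a r. PH (elt X E (p0 a*[X]SX (p0 r)) (aone E)))"
 by (rule smc, rule Pd(8)) ((intro L)?; simp add: apc del: R.P_simps(1))+
 also have "... = eps P x * ph (aone P)"
 proof -
 have l: "lin X kk (%z. PH (elt X E z (aone E)))" by (intro L; simp add: apc)
 have b: "bilin X X kk (%b c. PH (elt X E (b*[X]SX c) (aone E)))" by (intro L; simp add: apc)
 show ?thesis
 using antipode_inv(2)[OF hX pd(2)[OF xP] l] pd(5)[OF xP b] pd(6)[OF xP] one by simp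
 qed
 finally show "dl P x (%a b. ph (a*[P](\<lambda>v\<in>CP. rP (sg v)) b)) = eps P x * ph (aone P)" .
qed

lemma hopf_P: "hopf_algebra P"
 unfolding hopf_algebra_def using bP P_antipode by blast

lemma P_qp:
 assumes v: "v : CP" and F: "bilin E X kk F"
 shows "dl P v (%a b. si (%s' t'. ss (%s t. F (uE s'*[E]q0 b*[E]uE s) (uX t'*[X]p0 a*[X]uX t))))
 = dl P v (%a b. F (q0 a) (p0 b))"
proof -
 note L = ap_lin bilinD(2,3)[OF F]
 have b: "bilin W W kk (%a b. F (qW a) (pW b))"
 unfolding bilin_W by (intro bilinI bilinD(2,3)[OF F] pqW; simp add: linD(1)[OF pqW(1)] linD(1)[OF pqW(2)])
 have "dl P v (%a b. F (q0 a) (p0 b)) = dl W (iP v) (%a b. F (qW a) (pW b))"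
 by (rule R.dl_P_eq[OF v b]) (simp add: p0_def q0_def)
 also have "... = sm X E (iP v) (%x e. si (%s' t'. ss (%s t. F (uE s'*[E]e*[E]uE s) (uX t'*[X]x*[X]uX t))))"
 by (rule dl_W_qp[OF iP_closed[OF v] F])
 also have "... = dl P v (%a b. si (%s' t'. ss (%s t. F (uE s'*[E]q0 b*[E]uE s) (uX t'*[X]p0 a*[X]uX t))))"
 by (rule iP_sm[OF v]) (intro L; simp add: apc)
 finally show ?thesis by (rule sym)
qed

lemma pq_conj:
 assumes "b <: B" "c <: B" "v <: P"
 shows "p0 (uP b*[P]v*[P]uP c) = uX b*[X]p0 v*[X]uX c"
 and "q0 (uP b*[P]v*[P]uP c) = uE b*[E]q0 v*[E]uE c"
 using assms bmapD(2)[OF uP(1) bB bP] by (simp_all add: pd(3) qd(3) uP(2,3) Pd(20) del: R.P_simps)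

lemma sh_qp: "sh P uP E X q0 p0"
 unfolding sh_def
proof (intro ballI allI impI)
 fix v F assume "v <: P" and F: "bilin E X kk F"
 hence v: "v : CP" by simp
 show "dl P v (%a c. si (%s' t'. ss (%s t. F (q0 (uP s'*[P]c*[P]uP s)) (p0 (uP t'*[P]a*[P]uP t)))))
 = dl P v (%a c. F (q0 a) (p0 c))"
 unfolding P_qp[OF v F, symmetric] by (rule smc, rule smc, rule smc) (simp only: pq_conj)
qed

text \<open>The one relation that is not built into the construction. Rewriting with
  \<open>P_qp\<close> leaves \<open>x \<otimes> e\<close> conjugated by \<open>S21 S\<close>; by
  \<open>pb_central\<close> the pullback commutes with that element, so the conjugation
  cancels.\<close>

lemma sh_pq: "sh P uP X E p0 q0"
 unfolding sh_def
proof (intro ballI allI impI)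
 fix v F assume "v <: P" and F: "bilin X E kk F"
 hence v: "v : CP" by simp
 note L = ap_lin bilinD(2,3)[OF F]
 let ?G = "%s' t' s'' t'' x e. F (uX s'*[X]uX t''*[X]x) (uE t'*[E]uE s''*[E]e)"
 have "dl P v (%a c. si (%s' t'. ss (%s t. F (p0 (uP s'*[P]c*[P]uP s)) (q0 (uP t'*[P]a*[P]uP t)))))
 = dl P v (%a c. si (%s' t'. ss (%s t. F (uX s'*[X]p0 c*[X]uX s) (uE t'*[E]q0 a*[E]uE t))))"
 by (rule smc, rule smc, rule smc) (simp only: pq_conj)
 \<comment> \<open>\<open>P_qp\<close> is applied backwards, to a form that already contains the
   conjugation by \<open>S\<close>; this produces the second, flipped copy.\<close>
 also have "... = dl P v (%a c. si (%s'' t''. ss (%sg tu. si (%s' t'. ss (%s t.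
 F (uX s'*[X](uX t''*[X]p0 a*[X]uX tu)*[X]uX s) (uE t'*[E](uE s''*[E]q0 c*[E]uE sg)*[E]uE t))))))"
 by (rule P_qp[OF v, symmetric, where F = "%e x. si (%s' t'. ss (%s t. F (uX s'*[X]x*[X]uX s) (uE t'*[E]e*[E]uE t)))"])
 (intro L; simp add: apc)
 also have "... = sm X E (iP v) (%x e. si (%s'' t''. ss (%sg tu. si (%s' t'. ss (%s t.
 F (uX s'*[X](uX t''*[X]x*[X]uX tu)*[X]uX s) (uE t'*[E](uE s''*[E]e*[E]uE sg)*[E]uE t))))))"
 by (rule iP_sm[OF v, symmetric]) (intro L; simp add: apc)
 also have "... = sm X E (iP v) (%x e. si (%s'' t''. si (%s' t'. ss (%sg tu. ss (%s t.
 ?G s' t' s'' t'' (x*[X]uX tu*[X]uX s) (e*[E]uE sg*[E]uE t))))))"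
 by (rule smc, rule smc, subst sm_swap) (simp add: X(17) E(17) apc)
 also have "... = si (%s'' t''. si (%s' t'. sm X E (iP v) (%x e. ss (%sg tu. ss (%s t.
 ?G s' t' s'' t'' (x*[X]uX tu*[X]uX s) (e*[E]uE sg*[E]uE t))))))"
 by (subst sm_swap, rule smc, rule sm_swap)
 also have "... = si (%s'' t''. si (%s' t'. sm X E (iP v) (%x e. ss (%sg tu. ss (%s t.
 ?G s' t' s'' t'' (uX tu*[X]uX s*[X]x) (uE sg*[E]uE t*[E]e))))))"
 by (rule smc, rule smc, rule pb_central[OF inj_uY iP_pb[OF v]]) (intro L; simp add: apc)
 also have "... = sm X E (iP v) (%x e. si (%s'' t''. si (%s' t'. ss (%sg tu. ss (%s t.
 ?G s' t' s'' t'' (uX tu*[X]uX s*[X]x) (uE sg*[E]uE t*[E]e))))))"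
 by (subst sm_swap[of X E], rule smc, rule sm_swap[symmetric])
 \<comment> \<open>What remains in front of \<open>x \<otimes> e\<close> is the inverse of
   \<open>S\<close>, the inverse of \<open>S21\<close>, then \<open>S21\<close> and
   \<open>S\<close>; it cancels from the inside.\<close>
 also have "... = sm X E (iP v) (%x e. F x e)"
 proof (rule smc)
 fix x e assume m: "x <: X" "e <: E"
 have "si (%s'' t''. si (%s' t'. ss (%sg tu. ss (%s t. ?G s' t' s'' t'' (uX tu*[X]uX s*[X]x) (uE sg*[E]uE t*[E]e)))))
 = si (%s' t'. si (%s'' t''. ss (%sg tu. ss (%s t. ?G s' t' s'' t'' (uX tu*[X]uX s*[X]x) (uE sg*[E]uE t*[E]e)))))"
 by (rule sm_swap)
 also have "... = si (%s' t'. ss (%s t. F (uX s'*[X]uX s*[X]x) (uE t'*[E]uE t*[E]e)))"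
 proof (rule smc)
 fix s' t' assume k: "s' <: B" "t' <: B"
 have "si (%s'' t''. ss (%sg tu. ss (%s t. F (uX s'*[X]uX (t''*[B]tu)*[X]uX s*[X]x) (uE t'*[E]uE (s''*[B]sg)*[E]uE t*[E]e))))
 = ss (%s t. F (uX s'*[X]uX (aone B)*[X]uX s*[X]x) (uE t'*[E]uE (aone B)*[E]uE t*[E]e))"
 by (rule ss_inv(2)[where F = "%sg tu. ss (%s t. F (uX s'*[X]uX tu*[X]uX s*[X]x) (uE t'*[E]uE sg*[E]uE t*[E]e))"])
 (use m k in \<open>intro L; simp add: apc\<close>)
 thus "si (%s'' t''. ss (%sg tu. ss (%s t. ?G s' t' s'' t'' (uX tu*[X]uX s*[X]x) (uE sg*[E]uE t*[E]e))))
 = ss (%s t. F (uX s'*[X]uX s*[X]x) (uE t'*[E]uE t*[E]e))"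
 using m k by (simp add: UX(3,4) UE(3,4) X(17,18) E(17,18) apc)
 qed
 also have "... = si (%s' t'. ss (%s t. F (uX (s'*[B]s)*[X]x) (uE (t'*[B]t)*[E]e)))"
 using m by (simp add: UX(3) UE(3) X(17) E(17) apc)
 also have "... = F (uX (aone B)*[X]x) (uE (aone B)*[E]e)" by (rule ss_inv(2)[where F = "%sg tu. F (uX sg*[X]x) (uE tu*[E]e)"]) (use m in \<open>intro L; simp add: apc\<close>)
 finally show "si (%s'' t''. si (%s' t'. ss (%sg tu. ss (%s t. ?G s' t' s'' t'' (uX tu*[X]uX s*[X]x) (uE sg*[E]uE t*[E]e))))) = F x e"
 using m by (simp add: UX(4) UE(4) X(18) E(18))
 qed
 also have "... = dl P v (%a c. F (p0 a) (q0 c))" by (rule iP_sm[OF v F])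
 finally show "dl P v (%a c. si (%s' t'. ss (%s t. F (p0 (uP s'*[P]c*[P]uP s)) (q0 (uP t'*[P]a*[P]uP t))))) = ..." .
qed

lemma qc_P: "qc P uP"
proof (rule qc_jointly[OF bP uP(1) bX bE p0_map q0_map])
 \<comment> \<open>Reassembly of an element from its two projections, as \<open>det\<close>
   requires: project the simple tensor into the pullback.\<close>
 show "bilin X E P (%x e. rP (elt X E x e))" by (intro bilinI lin_o[OF lin_rP] XEL lin_id)
 show "dl P v (%a b. ph (rP (elt X E (p0 a) (q0 b)))) = ph v" if "v <: P" "lin P kk ph" for v ph
 using iP_form[of v "%w. ph (rP w)"] that lin_o[OF that(2) lin_rP] R.ri[of v] by simp
 show "sh P uP X X p0 p0" by (rule sh_same[OF bP uP(1) bX p0_map uP(2) uX qcX])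
 show "sh P uP E E q0 q0" by (rule sh_same[OF bP uP(1) bE q0_map uP(3) uE qcE])
qed (rule sh_pq sh_qp)+

end

context split_cospan
begin

lemma proj_one:
 assumes x: "x <: X" and F: "bilin X E kk F"
 shows "sm X E (proj (elt X E x (aone E))) F = dl X x (%a b. F (a*[X]ka b) (aone E))"
proof -
 note L = pb_lin bilinD(2,3)[OF F]
 have w: "elt X E x (aone E) <: XE" using x by (simp add: cl)
 have b: "bilin E E kk (%c d. F (a*[X]ka b*[X]s (g c)) d)" if "a <: X" "b <: X" for a b
 using that by (intro L; simp add: pcl)
 have b': "bilin X E kk (%x e. dl X x (%a b. dl E e (%c d. F (a*[X]ka b*[X]s (g c)) d)))"
 by (intro L; simp add: pcl)
 show ?thesis
 unfolding sm_proj[OF w F] sm_elt[OF X(3) E(3) b' x E(16)] by (rule smc) (simp add: E(11)[OF b] g'(4) s'(4) X(19) pcl)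
qed

text \<open>The product \<open>x1 (ka x2) s(f x3)\<close> collapses because \<open>ka\<close> is the
  convolution inverse of the composite of \<open>s\<close> and \<open>f\<close>.\<close>

lemma coinv_recover:
 assumes x: "x <: X" and ph: "lin X kk ph"
 shows "dl X x (%a b. dl X a (%a1 a2. ph ((a1*[X]ka a2)*[X]s (f b)))) = ph x" (is "?l32 = _")
proof -
 note L = pb_lin lin_o[OF ph] lin_o[OF lin_antipode[OF hX]]
 have "?l32 = dl X x (%a r. dl X r (%a2 b. ph ((a*[X]ka a2)*[X]s (f b))))"
 by (rule X(7)[OF x, where G = "%a1 a2 b. ph ((a1*[X]ka a2)*[X]s (f b))"]) (intro L; simp add: pcl)
 also have "... = dl X x (%a r. dl X r (%a2 b. ph (a*[X]s (f (antipode X a2*[X]b)))))"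
 by (simp add: X(17) f'(3) s'(3) bialg_map_antipode[OF hX hY f, symmetric] antipode_closed[OF hX] pcl)
 also have "... = dl X x (%a r. ph a * eps X r)"
 proof (rule smc)
 fix a r assume m: "a <: X" "r <: X"
 have "dl X r (%a2 b. ph (a*[X]s (f (antipode X a2*[X]b)))) = eps X r * ph (a*[X]s (f (aone X)))"
 by (rule antipode_inv(1)[OF hX m(2)]) (use m in \<open>intro L; simp add: pcl\<close>)
 thus "dl X r (%a2 b. ph (a*[X]s (f (antipode X a2*[X]b)))) = ph a * eps X r"
 using m by (simp add: f'(4) s'(4) X(19))
 qed
 also have "... = ph x" by (rule X(9)[OF x ph])
 finally show ?thesis .
qed

end

lemma bialg_map_inverse:
 assumes H: "bialgebra H" and K: "bialgebra K" and f: "f : bialg_maps H K"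
 and g: "!!y. y <: K ==> g y <: H" and gf: "!!x. x <: H ==> g (f x) = x"
 and fg: "!!y. y <: K ==> f (g y) = y"
 shows "(\<lambda>y\<in>car K. g y) : bialg_maps K H"
proof (rule bialg_mapsI[OF K H])
 note f' = bmapD[OF f H K]
 note H' = bialgD[OF H] algebraD[OF bialgD(1)[OF H]]
 note K' = bialgD[OF K] algebraD[OF bialgD(1)[OF K]]
 have eq: "x = g y" if "x <: H" "f x = y" for x y using gf[OF that(1)] that(2) by simp
 have l: "lin K H g"
 proof (rule linI)
 fix x y c assume m: "x <: K" "y <: K"
 show "g x <: H" by (rule g[OF m(1)])
 show "g (vadd K x y) = vadd H (g x) (g y)" by (rule eq[symmetric]) (use m H'(3) linD(2)[OF f'(1)] in \<open>simp_all add: g fg\<close>)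
 show "g (vsmul K c x) = vsmul H c (g x)" by (rule eq[symmetric]) (use m H'(3) linD(3)[OF f'(1)] in \<open>simp_all add: g fg\<close>)
 qed
 thus "(\<lambda>y\<in>car K. g y) : lin_maps K H"
 using lin_cong[of K "\<lambda>y\<in>car K. g y" g H] K'(3) by (simp add: lin_maps_iff)
 show "(\<lambda>y\<in>car K. g y) (aone K) = aone H"
 using eq[OF H'(16) f'(4)] K'(16) by simp
 fix y assume y: "y <: K"
 show "(\<lambda>y\<in>car K. g y) (y*[K]y') = (\<lambda>y\<in>car K. g y) y*[H](\<lambda>y\<in>car K. g y) y'"
 if "y' <: K" for y'
 using eq[of "g y*[H]g y'" "y*[K]y'"] y that by (simp add: g fg f'(3) H'(20) K'(20))
 show "eps H ((\<lambda>y\<in>car K. g y) y) = eps K y"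
 using f'(6)[OF g[OF y]] y by (simp add: fg)
 fix F assume F: "bilin H H kk F"
 have b: "bilin K K kk (%a b. F (g a) (g b))" by (intro bilinI bilinD(2,3)[OF F] l; simp add: g)
 have "dl K (f (g y)) (%a b. F (g a) (g b)) = dl H (g y) (%a b. F (g (f a)) (g (f b)))"
 by (rule f'(5)[OF g[OF y] b])
 thus "dl H ((\<lambda>y\<in>car K. g y) y) F = dl K y (%a b. F ((\<lambda>y\<in>car K. g y) a) ((\<lambda>y\<in>car K. g y) b))"
 using y by (simp add: fg gf)
qed

section \<open>The coslice category\<close>

abbreviation al :: "(('h \<times> 'r) \<times> 'm) => 'h" where "al X == fst (fst X)"

locale coslice_cat = qt_hopf B S for B :: "('k::field, 'u) bialg" and S +
 assumes inf: "infinite (UNIV :: 'u set)"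
begin

definition obj :: "('k, 'u) bialg => ('u => 'u) => bool" where
 "obj H u <-> hopf_algebra H & alg_ext H & u : bialg_maps B H & qc H u & inj_on u (car B)"

text \<open>The R-matrix of an object under \<open>(B,S)\<close> is forced to be the image of
  \<open>S\<close>, so an object amounts to \<open>H\<close> and \<open>u\<close>.\<close>

definition ob :: "('k, 'u) bialg => ('u => 'u) => (('k, 'u) bialg \<times> (('u \<times> 'u) \<Rightarrow>\<^sub>0 'k) set) \<times> ('u => 'u)" where
 "ob H u = ((H, tmap B B H H u u S), u)"

abbreviation "C == QTrHopf_coslice_inj B S"

lemma ob_simps [simp]: "al (ob H u) = H" "snd (ob H u) = u" by (simp_all add: ob_def)

lemma Ob_iff: "X : Ob C <-> obj (al X) (snd X) & X = ob (al X) (snd X)"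
proof -
 obtain H R u where X: "X = ((H, R), u)" by (metis prod.collapse)
 have q: "quasitriangular H (tmap B B H H u u S) <-> hopf_algebra H & qc H u" if "u : bialg_maps B H"
 using quasitriangular_push_iff[OF _ that] by (auto simp: quasitriangular_def)
 show ?thesis
 unfolding X using q by (auto simp: QTrHopf_coslice_inj_def full_subcat_def coslice_def QTrHopf_def obj_def ob_def)
qed

lemma obI: "obj H u ==> ob H u : Ob C" by (simp add: Ob_iff)

lemma objD:
 assumes "X : Ob C"
 shows "hopf_algebra (al X)" "alg_ext (al X)" "snd X : bialg_maps B (al X)" "qc (al X) (snd X)"
 "inj_on (snd X) (car B)" "bialgebra (al X)"
 using assms by (auto simp: Ob_iff obj_def hopf_algebra_def)

lemma cat_simps: "idt C X = idm (al X)" "cmp C X Y Z g f = compose (car (al X)) g f"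
 by (cases X; cases Y; cases Z; auto simp: QTrHopf_coslice_inj_def full_subcat_def coslice_def QTrHopf_def split: prod.splits)+

text \<open>Compatibility with the R-matrices is automatic, both being images of the same
  \<open>S\<close> along compatible units.\<close>

lemma Hom_iff:
 assumes X: "X : Ob C" and Y: "Y : Ob C"
 shows "f : Hom C X Y <-> f : bialg_maps (al X) (al Y) & (\<forall>b\<in>car B. f (snd X b) = snd Y b)"
proof -
 obtain H R u where XX: "X = ((H, R), u)" by (metis prod.collapse)
 obtain K Q v where YY: "Y = ((K, Q), v)" by (metis prod.collapse)
 have R: "R = tmap B B H H u u S" "Q = tmap B B K K v v S" using X Y by (simp_all add: XX YY Ob_iff ob_def)
 note x = objD[OF X, unfolded XX fst_conv snd_conv]
 note y = objD[OF Y, unfolded YY fst_conv snd_conv]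
 have "tmap H H K K f f R = Q" if f: "f : bialg_maps H K" and e: "\<forall>b\<in>car B. f (u b) = v b"
 proof (rule tens_eqI)
 note f' = bmapD[OF f x(6) y(6)]
 note hv = bialgD(3)[OF x(6)] bialgD(3)[OF y(6)]
 note um = bmapD[OF x(3) bB x(6)]
 note vm = bmapD[OF y(3) bB y(6)]
 show "vspace K" "vspace K" by (fact hv(2))+
 have Rc: "R <: (tens H H)" unfolding R by (rule tmap_closed[OF B(3,3) hv(1,1) um(1,1) S_closed(1)])
 show "tmap H H K K f f R <: (tens K K)" by (rule tmap_closed[OF hv(1,1,2,2) f'(1,1) Rc])
 show "Q <: (tens K K)" unfolding R by (rule tmap_closed[OF B(3,3) hv(2,2) vm(1,1) S_closed(1)])
 fix F assume F: "bilin K K kk F"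
 have F': "bilin H H kk (%a b. F (f a) (f b))" by (intro bilinI bilinD(2,3)[OF F] f'(1); simp add: f'(2))
 have "sm K K (tmap H H K K f f R) F = ss (%s t. F (f (u s)) (f (u t)))"
 unfolding sm_tmap[OF hv(1,1,2,2) f'(1,1) Rc F] unfolding R by (rule push_sm(1)[OF x(6) x(3) F'])
 also have "... = sm K K Q F"
 unfolding R push_sm(1)[OF y(6) y(3) F] by (rule smc) (simp add: e)
 finally show "sm K K (tmap H H K K f f R) F = sm K K Q F" .
 qed
 moreover have "compose (car B) f u = v <-> (\<forall>b\<in>car B. f (u b) = v b)"
 proof
 show "compose (car B) f u = v ==> \<forall>b\<in>car B. f (u b) = v b" by (auto simp: compose_def)
 assume "\<forall>b\<in>car B. f (u b) = v b"
 thus "compose (car B) f u = v"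
 using bmapD(7)[OF y(3) bB y(6)] by (intro extensionalityI[of _ "car B"]) (auto simp: compose_def)
 qed
 ultimately show ?thesis by (auto simp: XX YY QTrHopf_coslice_inj_def full_subcat_def coslice_def QTrHopf_def)
qed

lemma HomD:
 assumes "X : Ob C" "Y : Ob C" "f : Hom C X Y"
 shows "f : bialg_maps (al X) (al Y)" "b <: B ==> f (snd X b) = snd Y b"
 "x <: (al X) ==> f x <: (al Y)" "f : extensional (car (al X))"
 using assms bmapD(2,7)[OF _ objD(6)[OF assms(1)] objD(6)[OF assms(2)]] by (auto simp: Hom_iff)

lemma cmp_eq_iff:
 "cmp C X Y Z g f = cmp C X Y' Z' g' f' <-> (\<forall>x\<in>car (al X). g (f x) = g' (f' x))"
 unfolding cat_simps by (auto simp: compose_def fun_eq_iff restrict_def)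

lemma cmp_eq_iff':
 assumes "X : Ob C" "Z : Ob C" "h : Hom C X Z"
 shows "cmp C X Y Z' g f = h <-> (\<forall>x\<in>car (al X). g (f x) = h x)"
 unfolding cat_simps using HomD(4)[OF assms] by (auto simp: compose_def fun_eq_iff restrict_def extensional_def)

lemma category_C: "category C"
proof
 fix X assume X: "X : Ob C"
 note x = objD[OF X]
 show i: "idt C X : Hom C X X"
 using idm_bialg_map[OF x(6)] bmapD(2)[OF x(3) bB x(6)] by (simp add: Hom_iff[OF X X] cat_simps)
 fix Y f assume Y: "Y : Ob C" and f: "f : Hom C X Y"
 show "cmp C X Y Y (idt C Y) f = f" using HomD(3)[OF X Y f] by (simp add: cmp_eq_iff'[OF X Y f] cat_simps(1))
 show "cmp C X X Y f (idt C X) = f" by (simp add: cmp_eq_iff'[OF X Y f] cat_simps(1))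
 fix Z g assume Z: "Z : Ob C" and g: "g : Hom C Y Z"
 show "cmp C X Y Z g f : Hom C X Z"
 unfolding Hom_iff[OF X Z] cat_simps
 using bialg_map_comp[OF x(6) objD(6)[OF Y] objD(6)[OF Z] HomD(1)[OF X Y f] HomD(1)[OF Y Z g]]
 HomD(2)[OF X Y f] HomD(2)[OF Y Z g] bmapD(2)[OF x(3) bB x(6)] by (simp add: compose_def)
next
 fix W X Y Z f g h assume o: "W : Ob C" "X : Ob C" "Y : Ob C" "Z : Ob C"
 and f: "f : Hom C W X" and "g : Hom C X Y" "h : Hom C Y Z"
 show "cmp C W Y Z h (cmp C W X Y g f) = cmp C W X Z (cmp C X Y Z h g) f"
 unfolding cmp_eq_iff using HomD(3)[OF o(1,2) f] by (simp add: cat_simps compose_def)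
qed

sublocale C: category C by (rule category_C)

lemma pb_carrier_points:
 assumes Y: "Y : Ob C" and a: "(X, f, s) : Ob (points C Y)" and E: "E : Ob C" and g: "g : Hom C E Y"
 obtains j :: "(('u \<times> 'u) \<Rightarrow>\<^sub>0 'k) set => 'u"
 where "pb_carrier B S (al X) (snd X) (al E) (snd E) (al Y) (snd Y) f s g j"
proof -
 have X: "X : Ob C" and f: "f : Hom C X Y" and s: "s : Hom C Y X" and fs: "cmp C Y X Y f s = idt C Y"
 using a by (simp_all add: points_def)
 note x = objD[OF X] and y = objD[OF Y] and e = objD[OF E]
 \<comment> \<open>The place where infinity of \<open>'u\<close> is used: the tensor product of two
   objects has room in the universe.\<close>
 obtain j :: "(('u \<times> 'u) \<Rightarrow>\<^sub>0 'k) set => 'u" where "inj_on j (car (tens (al X) (al E)))"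
 using ex_inj_tens[OF inf bialgD(3)[OF x(6)] bialgD(3)[OF e(6)]] by blast
 moreover have "f (s z) = z" if "z <: (al Y)" for z
 using fs that unfolding cmp_eq_iff'[OF Y Y C.idt_closed[OF Y]] by (simp add: cat_simps)
 ultimately have "pb_carrier B S (al X) (snd X) (al E) (snd E) (al Y) (snd Y) f s g j"
 using x y e HomD[OF X Y f] HomD[OF Y X s] HomD[OF E Y g] by unfold_locales
 thus ?thesis by (rule that)
qed

end

context pb_carrier
begin

text \<open>Places the coinvariant part of \<open>x\<close> in the image of the pullback, so that it
  can be transported through an abstract isomorphism of pullbacks.\<close>

lemma p0_rP_one:
 assumes x: "x <: X" and ph: "lin X kk ph"
 shows "ph (p0 (rP (elt X E x (aone E)))) = dl X x (%a b. ph (a*[X]ka b))" (is "?l33 = _")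
proof -
 have w: "elt X E x (aone E) <: XE" using x by (simp add: cl)
 have c: "rP (elt X E x (aone E)) : CP" using R.r w by simp
 have "?l33 = sm X E (proj (elt X E x (aone E))) (%x e. ph x * eps E e)"
 using pqW_form(1)[OF proj_closed[OF w] ph] c by (simp add: p0_def iP_rP[OF w])
 also have "... = dl X x (%a b. ph (a*[X]ka b) * eps E (aone E))" by (rule proj_one[OF x]) (intro plin lin_o[OF ph])
 finally show ?thesis by (simp add: E(13))
qed

end

context coslice_cat
begin

end

section \<open>The universal property in the coslice category\<close>

locale coslice_pb = coslice_cat B S +
 A: pb_carrier B S "al X" "snd X" "al E" "snd E" "al Y" "snd Y" f s g j
 for B :: "('k::field, 'u) bialg" and S
 and X E Y :: "(('k, 'u) bialg \<times> (('u \<times> 'u) \<Rightarrow>\<^sub>0 'k) set) \<times> ('u => 'u)"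
 and f s g :: "'u => 'u" and j :: "(('u \<times> 'u) \<Rightarrow>\<^sub>0 'k) set => 'u" +
 assumes X: "X : Ob C" and E: "E : Ob C" and Y: "Y : Ob C"
begin

definition "PC = ob A.P A.uP"

lemma PC_simps [simp]: "al PC = A.P" "snd PC = A.uP" by (simp_all add: PC_def)

lemma PC: "PC : Ob C"
 unfolding PC_def by (rule obI) (auto simp: obj_def A.hopf_P A.R.alg_ext_P A.uP(1) A.qc_P intro!: A.inj_uP objD[OF X])

lemma p0_Hom: "A.p0 : Hom C PC X" and q0_Hom: "A.q0 : Hom C PC E"
 using A.p0_map A.q0_map A.uP(2,3) by (simp_all add: Hom_iff[OF PC] X E)

lemma into_Hom:
 assumes T: "T : Ob C" and a: "a : Hom C T X" and b: "b : Hom C T E"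
 and ab: "!!y. y <: (al T) ==> f (a y) = g (b y)"
 shows "A.into (al T) a b : Hom C T PC"
 and "y <: (al T) ==> A.p0 (A.into (al T) a b y) = a y"
 and "y <: (al T) ==> A.q0 (A.into (al T) a b y) = b y"
 and "y <: (al T) ==> A.iP (A.into (al T) a b y) = A.jt (al T) a b y"
proof -
 note t = objD[OF T]
 note I = A.into_map[OF t(6) HomD(1)[OF T X a] HomD(1)[OF T E b] t(3) HomD(2)[OF T X a] HomD(2)[OF T E b] t(4) ab]
 have J: "A.p0 (A.into (al T) a b y) = a y" "A.q0 (A.into (al T) a b y) = b y"
 "A.iP (A.into (al T) a b y) = A.jt (al T) a b y" if "y <: (al T)" for y
 using I(2-4) that by blast+
 thus "y <: (al T) ==> A.p0 (A.into (al T) a b y) = a y"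
 "y <: (al T) ==> A.q0 (A.into (al T) a b y) = b y"
 "y <: (al T) ==> A.iP (A.into (al T) a b y) = A.jt (al T) a b y"
 by blast+
 note u = bmapD[OF t(3) bB t(6)]
 \<comment> \<open>That the induced map respects units is itself an instance of uniqueness, for maps
   out of \<open>B\<close>.\<close>
 have "compose (car B) (A.into (al T) a b) (snd T) = A.uP"
 proof (rule A.into_unique[OF bB bialg_map_comp[OF bB t(6) A.bP t(3) I(1)] A.uP(1)])
 fix c assume c: "c <: B"
 show "A.p0 (compose (car B) (A.into (al T) a b) (snd T) c) = A.p0 (A.uP c)"
 using c HomD(2)[OF T X a c] by (simp add: compose_def J(1)[OF u(2)[OF c]] A.uP(2))
 show "A.q0 (compose (car B) (A.into (al T) a b) (snd T) c) = A.q0 (A.uP c)"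
 using c HomD(2)[OF T E b c] by (simp add: compose_def J(2)[OF u(2)[OF c]] A.uP(3))
 qed
 hence "A.into (al T) a b (snd T c) = A.uP c" if "c <: B" for c
 using compose_eq[OF that, of "A.into (al T) a b" "snd T"] by (simp only:)
 thus "A.into (al T) a b : Hom C T PC"
 using I(1) by (simp add: Hom_iff[OF T PC])
qed

lemma PC_pullback: "is_pullback C X E Y f g PC A.p0 A.q0"
 unfolding is_pullback_def
proof (intro conjI ballI impI)
 show "cmp C PC X Y f A.p0 = cmp C PC E Y g A.q0"
 unfolding cmp_eq_iff by (simp add: A.fp_gq)
 fix T a b assume T: "T : Ob C" and a: "a : Hom C T X" and b: "b : Hom C T E"
 and "cmp C T X Y f a = cmp C T E Y g b"
 hence ab: "!!y. y <: (al T) ==> f (a y) = g (b y)" unfolding cmp_eq_iff by blast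
 note I = into_Hom[OF T a b ab]
 show "\<exists>!t. t : Hom C T PC & cmp C T PC X A.p0 t = a & cmp C T PC E A.q0 t = b"
 unfolding cmp_eq_iff'[OF T X a] cmp_eq_iff'[OF T E b]
 proof (rule ex1I[of _ "A.into (al T) a b"])
 show "A.into (al T) a b : Hom C T PC & (\<forall>x\<in>car (al T). A.p0 (A.into (al T) a b x) = a x) &
 (\<forall>x\<in>car (al T). A.q0 (A.into (al T) a b x) = b x)" using I(1-3) by blast
 fix t assume t: "t : Hom C T PC & (\<forall>x\<in>car (al T). A.p0 (t x) = a x) & (\<forall>x\<in>car (al T). A.q0 (t x) = b x)"
 show "t = A.into (al T) a b" by (rule A.into_unique[OF objD(6)[OF T]]) (use t I HomD(1)[OF T PC] in \<open>simp_all del: A.R.P_simps\<close>)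
 qed
qed (rule PC p0_Hom q0_Hom)+

end

section \<open>Reflection of isomorphisms and protomodularity\<close>

context coslice_cat
begin

lemma coslice_pb_points:
 assumes Y: "Y : Ob C" and a: "(X, f, s) : Ob (points C Y)" and E: "E : Ob C" and g: "g : Hom C E Y"
 obtains j :: "(('u \<times> 'u) \<Rightarrow>\<^sub>0 'k) set => 'u" where "coslice_pb B S X E Y f s g j"
proof -
 have X: "X : Ob C" using a by (simp add: points_def)
 obtain j :: "(('u \<times> 'u) \<Rightarrow>\<^sub>0 'k) set => 'u"
 where "pb_carrier B S (al X) (snd X) (al E) (snd E) (al Y) (snd Y) f s g j"
 by (rule pb_carrier_points[OF Y a E g])
 hence "coslice_pb B S X E Y f s g j" by (intro coslice_pb.intro coslice_cat_axioms coslice_pb_axioms.intro X E Y)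
 thus ?thesis by (rule that)
qed

text \<open>Coinvariant parts live in the pullbacks, so the inverse \<open>l\<close> there yields an
  inverse \<open>rh\<close> of \<open>h\<close> on them. The section takes care of the rest: the
  inverse of \<open>h\<close> sends \<open>x\<close> to \<open>rh(x1) s(f' x2)\<close>, and
  \<open>coinv_recover\<close> verifies both composites.\<close>

lemma reflect_iso:
 assumes Y: "Y : Ob C" and E: "E : Ob C" and g: "g : Hom C E Y"
 and a: "(X, f, s) : Ob (points C Y)" and a': "(X', f', s') : Ob (points C Y)"
 and h: "h : Hom C X X'" and hf: "!!x. x <: (al X) ==> f' (h x) = f x"
 and hs: "!!y. y <: (al Y) ==> h (s y) = s' y"
 and P: "is_pullback C X E Y f g P p q" and P': "is_pullback C X' E Y f' g P' p' q'"
 and k: "k : Hom C P P'" and l: "l : Hom C P' P"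
 and qk: "!!x. x <: (al P) ==> q' (k x) = q x" and pk: "!!x. x <: (al P) ==> p' (k x) = h (p x)"
 and lk: "!!x. x <: (al P) ==> l (k x) = x" and kl: "!!x. x <: (al P') ==> k (l x) = x"
 shows "\<exists>h'. (\<forall>x\<in>car (al X'). h' x <: (al X) & h (h' x) = x) & (\<forall>x\<in>car (al X). h' (h x) = x)"
proof -
 obtain j :: "(('u \<times> 'u) \<Rightarrow>\<^sub>0 'k) set => 'u" where "coslice_pb B S X E Y f s g j"
 by (rule coslice_pb_points[OF Y a E g])
 then interpret L: coslice_pb B S X E Y f s g j .
 obtain j' :: "(('u \<times> 'u) \<Rightarrow>\<^sub>0 'k) set => 'u" where "coslice_pb B S X' E Y f' s' g j'"
 by (rule coslice_pb_points[OF Y a' E g])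
 then interpret L': coslice_pb B S X' E Y f' s' g j' .
 note X = L.X and X' = L'.X
 have o: "P : Ob C" "P' : Ob C" "p : Hom C P X" "q : Hom C P E" "p' : Hom C P' X'" "q' : Hom C P' E"
 using P P' by (simp_all add: is_pullback_def)
 have pq: "f (p x) = g (q x)" if "x <: (al P)" for x
 using P that unfolding is_pullback_def cmp_eq_iff by blast
 \<comment> \<open>\<open>P\<close> and \<open>P'\<close> are arbitrary pullbacks; \<open>m\<close>
   and \<open>m'\<close> compare the explicit ones with them, so that elements become
   available.\<close>
 obtain m where m: "m : Hom C L.PC P" "!!x. x <: L.A.P ==> p (m x) = L.A.p0 x" "!!x. x <: L.A.P ==> q (m x) = L.A.q0 x"
 proof -
 have "cmp C L.PC X Y f L.A.p0 = cmp C L.PC E Y g L.A.q0" using L.PC_pullback by (simp add: is_pullback_def)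
 hence "\<exists>!t. t : Hom C L.PC P & cmp C L.PC P X p t = L.A.p0 & cmp C L.PC P E q t = L.A.q0"
 using P L.PC L.p0_Hom L.q0_Hom unfolding is_pullback_def by blast
 thus ?thesis
 unfolding cmp_eq_iff'[OF L.PC X L.p0_Hom] cmp_eq_iff'[OF L.PC E L.q0_Hom] L.PC_simps using that by blast
 qed
 obtain m' where m': "m' : Hom C L'.PC P'" "!!x. x <: L'.A.P ==> p' (m' x) = L'.A.p0 x" "!!x. x <: L'.A.P ==> q' (m' x) = L'.A.q0 x"
 proof -
 have "cmp C L'.PC X' Y f' L'.A.p0 = cmp C L'.PC E Y g L'.A.q0" using L'.PC_pullback by (simp add: is_pullback_def)
 hence "\<exists>!t. t : Hom C L'.PC P' & cmp C L'.PC P' X' p' t = L'.A.p0 & cmp C L'.PC P' E q' t = L'.A.q0"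
 using P' L'.PC L'.p0_Hom L'.q0_Hom unfolding is_pullback_def by blast
 thus ?thesis
 unfolding cmp_eq_iff'[OF L'.PC X' L'.p0_Hom] cmp_eq_iff'[OF L'.PC E L'.q0_Hom] L'.PC_simps using that by blast
 qed
 define hp where "hp = cmp C L.PC X X' h L.A.p0"
 have hp: "hp : Hom C L.PC X'" unfolding hp_def by (rule C.cmp_closed[OF L.PC X X' L.p0_Hom h])
 have hpv: "hp v = h (L.A.p0 v)" if "v : L.A.CP" for v using that by (simp add: hp_def cat_simps compose_def)
 have p0c: "L.A.p0 v <: (al X)" "L.A.q0 v <: (al E)" if "v : L.A.CP" for v
 using that HomD(3)[OF L.PC X L.p0_Hom] HomD(3)[OF L.PC E L.q0_Hom] by simp_all
 have hc: "h x <: (al X')" if "x <: (al X)" for x using HomD(3)[OF X X' h that] .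
 have hpq: "f' (hp y) = g (L.A.q0 y)" if "y <: (al L.PC)" for y
 using that by (simp add: hpv hf p0c L.A.fp_gq)
 \<comment> \<open>The counterpart of \<open>k\<close> between the explicit pullbacks, where its
   values are known as tensors.\<close>
 define k0 where "k0 = L'.A.into L.A.P hp L.A.q0"
 have k0: "k0 : Hom C L.PC L'.PC" "!!y. y : L.A.CP ==> L'.A.p0 (k0 y) = hp y" "!!y. y : L.A.CP ==> L'.A.q0 (k0 y) = L.A.q0 y"
 "!!y. y : L.A.CP ==> L'.A.iP (k0 y) = L'.A.jt L.A.P hp L.A.q0 y"
 using L'.into_Hom[OF L.PC hp L.q0_Hom hpq] by (simp_all add: k0_def)
 have k0c: "k0 y : L'.A.CP" if "y : L.A.CP" for y using HomD(3)[OF L.PC L'.PC k0(1)] that by simp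
 have mc: "m y <: (al P)" if "y : L.A.CP" for y using HomD(3)[OF L.PC o(1) m(1)] that by simp
 have mc': "m' y <: (al P')" if "y : L'.A.CP" for y using HomD(3)[OF L'.PC o(2) m'(1)] that by simp
 \<comment> \<open>Both composites induce the same cone and land in \<open>P'\<close>, hence agree
   by uniqueness.\<close>
 have mk: "m' (k0 y) = k (m y)" if y: "y : L.A.CP" for y
 proof -
 have c: "cmp C L.PC X' Y f' hp = cmp C L.PC E Y g L.A.q0" unfolding cmp_eq_iff using hpq by simp
 have u: "\<exists>!t. t : Hom C L.PC P' & cmp C L.PC P' X' p' t = hp & cmp C L.PC P' E q' t = L.A.q0"
 using P' L.PC hp L.q0_Hom c unfolding is_pullback_def by blast
 have "cmp C L.PC L'.PC P' m' k0 = cmp C L.PC P P' k m"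
 proof (rule ex1E[OF u])
 fix t assume t: "\<forall>t'. t' : Hom C L.PC P' & cmp C L.PC P' X' p' t' = hp & cmp C L.PC P' E q' t' = L.A.q0 --> t' = t"
 have "cmp C L.PC L'.PC P' m' k0 = t" by (rule t[rule_format], unfold cmp_eq_iff'[OF L.PC X' hp] cmp_eq_iff'[OF L.PC E L.q0_Hom])
 (use C.cmp_closed[OF L.PC L'.PC o(2) k0(1) m'(1)] in \<open>simp_all add: cat_simps(2) compose_def m' k0 k0c\<close>)
 moreover have "cmp C L.PC P P' k m = t" by (rule t[rule_format], unfold cmp_eq_iff'[OF L.PC X' hp] cmp_eq_iff'[OF L.PC E L.q0_Hom])
 (use C.cmp_closed[OF L.PC o(1,2) m(1) k] in \<open>simp_all add: cat_simps(2) compose_def m pk qk mc hpv\<close>)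
 ultimately show ?thesis by simp
 qed
 thus ?thesis using y unfolding cmp_eq_iff by simp
 qed
 \<comment> \<open>Place the coinvariant part of \<open>x\<close> in the explicit pullback of
   \<open>f'\<close>, pass to \<open>P'\<close>, apply the inverse \<open>l\<close> and project to
   \<open>X\<close>.\<close>
 define rh where "rh x = p (l (m' (L'.A.rP (elt (al X') (al E) x (aone (al E))))))" for x
 have rc: "L'.A.rP (elt (al X') (al E) x (aone (al E))) : L'.A.CP" if "x <: (al X')" for x
 using L'.A.R.r that by (simp add: L'.A.cl)
 have rc1: "L.A.rP (elt (al X) (al E) x (aone (al E))) : L.A.CP" if "x <: (al X)" for x
 using L.A.R.r that by (simp add: L.A.cl)
 have lc: "l y <: (al P)" if "y <: (al P')" for y using HomD(3)[OF o(2,1) l that] .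
 have pc: "p y <: (al X)" if "y <: (al P)" for y using HomD(3)[OF o(1) X o(3) that] .
 have rhc: "rh x <: (al X)" if "x <: (al X')" for x
 unfolding rh_def by (intro pc lc mc' rc that)
 have linH: "lin (al U) (al V) t" if "U : Ob C" "V : Ob C" "t : Hom C U V" for U V t
 using bmapD(1)[OF HomD(1)[OF that] objD(6)[OF that(1)] objD(6)[OF that(2)]] .
 have rhl: "lin (al X') (al X) rh"
 unfolding rh_def[abs_def] by (intro lin_o[OF linH[OF o(1) X o(3)]] lin_o[OF linH[OF o(2,1) l]] lin_o[OF linH[OF L'.PC o(2) m'(1), simplified]]
 lin_o[OF L'.A.lin_rP] L'.A.XEL lin_id) (simp add: L'.A.cl)
 have hrh: "ph (h (rh x)) = dl (al X') x (%a b. ph (a*[al X']L'.A.ka b))"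
 if "x <: (al X')" "lin (al X') kk ph" for x ph
 proof -
 have "h (rh x) = L'.A.p0 (L'.A.rP (elt (al X') (al E) x (aone (al E))))"
 unfolding rh_def using that(1) by (simp add: pk[symmetric] lc mc' rc kl m'(2))
 thus ?thesis using L'.A.p0_rP_one[OF that] by simp
 qed
 have kah: "L'.A.ka (h b) = h (L.A.ka b)" if "b <: (al X)" for b
 using that by (simp add: hf hs L.A.pcl)
 have hm: "h (x*[al X]y) = h x*[al X']h y" if "x <: (al X)" "y <: (al X)" for x y
 using bmapD(3)[OF HomD(1)[OF X X' h] objD(6)[OF X] objD(6)[OF X']] that by blast
 have hd: "dl (al X') (h x) F = dl (al X) x (%a b. F (h a) (h b))" if "x <: (al X)" "bilin (al X') (al X') kk F" for x F
 using bmapD(5)[OF HomD(1)[OF X X' h] objD(6)[OF X] objD(6)[OF X']] that by blast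
 \<comment> \<open>Embedding coinvariant parts commutes with \<open>h\<close> and \<open>k0\<close>,
   because \<open>h\<close> respects coproducts and carries \<open>ka\<close> to
   \<open>ka\<close>.\<close>
 have k0r: "L'.A.rP (elt (al X') (al E) (h x) (aone (al E))) = k0 (L.A.rP (elt (al X) (al E) x (aone (al E))))"
 if x: "x <: (al X)" for x
 proof -
 let ?w = "elt (al X) (al E) x (aone (al E))"
 let ?w' = "elt (al X') (al E) (h x) (aone (al E))"
 have w: "?w <: (tens (al X) (al E))" "?w' <: (tens (al X') (al E))" using x hc[OF x] by (simp_all add: L.A.cl L'.A.cl)
 have "L'.A.iP (L'.A.rP ?w') = L'.A.iP (k0 (L.A.rP ?w))"
 proof (rule tens_eqI[OF L'.A.X(3) L'.A.E(3)])
 show "L'.A.iP (L'.A.rP ?w') <: (tens (al X') (al E))" by (rule L'.A.iP_closed[OF rc[OF hc[OF x]]])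
 show "L'.A.iP (k0 (L.A.rP ?w)) <: (tens (al X') (al E))" by (rule L'.A.iP_closed[OF k0c[OF rc1[OF x]]])
 fix F assume F: "bilin (al X') (al E) kk F"
 have F': "bilin (al X) (al E) kk (%x e. F (h x) e)" by (intro bilinI bilinD(2,3)[OF F] linH[OF X X' h] lin_id; simp add: hc)
 have b: "bilin (al X') (al X') kk (%a b. F (a*[al X']L'.A.ka b) (aone (al E)))"
 by (intro L'.A.pb_lin bilinD(2,3)[OF F]; simp add: L'.A.pcl)
 have "sm (al X') (al E) (L'.A.iP (L'.A.rP ?w')) F = dl (al X') (h x) (%a b. F (a*[al X']L'.A.ka b) (aone (al E)))"
 unfolding L'.A.iP_rP[OF w(2)] by (rule L'.A.proj_one[OF hc[OF x] F])
 also have "... = dl (al X) x (%a b. F (h (a*[al X]L.A.ka b)) (aone (al E)))"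
 unfolding hd[OF x b] by (rule smc) (simp add: kah hm L.A.pcl)
 also have "... = sm (al X) (al E) (L.A.iP (L.A.rP ?w)) (%x e. F (h x) e)"
 unfolding L.A.iP_rP[OF w(1)] by (rule L.A.proj_one[OF x F', symmetric])
 also have "... = dl L.A.P (L.A.rP ?w) (%a b. F (h (L.A.p0 a)) (L.A.q0 b))"
 by (rule L.A.iP_sm[OF rc1[OF x] F'])
 also have "... = dl L.A.P (L.A.rP ?w) (%a b. F (hp a) (L.A.q0 b))"
 by (rule smc) (simp add: hpv)
 also have "... = sm (al X') (al E) (L'.A.iP (k0 (L.A.rP ?w))) F"
 unfolding k0(4)[OF rc1[OF x]] by (rule L'.A.jt_sm[OF L.A.bP HomD(1)[OF L.PC X' hp, simplified] L.A.q0_map _ F, symmetric]) (simp add: rc1[OF x])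
 finally show "sm (al X') (al E) (L'.A.iP (L'.A.rP ?w')) F = sm (al X') (al E) (L'.A.iP (k0 (L.A.rP ?w))) F" .
 qed
 hence "L'.A.rP (L'.A.iP (L'.A.rP ?w')) = L'.A.rP (L'.A.iP (k0 (L.A.rP ?w)))" by (rule arg_cong)
 thus ?thesis unfolding L'.A.R.ri[OF rc[OF hc[OF x]]] L'.A.R.ri[OF k0c[OF rc1[OF x]]] .
 qed
 have rhh: "ph (rh (h x)) = dl (al X) x (%a b. ph (a*[al X]L.A.ka b))"
 if "x <: (al X)" "lin (al X) kk ph" for x ph
 proof -
 have "rh (h x) = L.A.p0 (L.A.rP (elt (al X) (al E) x (aone (al E))))"
 unfolding rh_def k0r[OF that(1)] using rc1[OF that(1)] by (simp add: mk lk mc m(2))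
 thus ?thesis using L.A.p0_rP_one[OF that] by simp
 qed
 note XL = L.A.XL and Xc = L.A.X(20)
 have bH: "bilin (al X') (al X') (al X) (%a b. rh a*[al X]s (f' b))"
 by (intro bilinI XL rhl lin_o[OF linH[OF Y X]] linH[OF X' Y]) (use a a' in \<open>simp_all add: points_def rhc L.A.pcl L'.A.pcl\<close>)
 define h' where "h' x = tlift (al X') (al X') (al X) (%a b. rh a*[al X]s (f' b)) (acomul (al X') x)" for x
 have h'c: "h' x <: (al X)" if "x <: (al X')" for x
 unfolding h'_def using that bH L.A.X(3) L'.A.X(3,6) by simp
 have h'f: "ph (h' x) = dl (al X') x (%a b. ph (rh a*[al X]s (f' b)))"
 if "x <: (al X')" "lin (al X) kk ph" for x ph
 unfolding h'_def by (rule functional_tlift[OF L'.A.X(3,3) L.A.X(3) bH that(2) L'.A.X(6)[OF that(1)]])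
 have 1: "h (h' x) = x" if x: "x <: (al X')" for x
 proof (rule functional_eqI[OF L'.A.X(3) hc[OF h'c[OF x]] x])
 fix ph assume ph: "lin (al X') kk ph"
 have "ph (h (h' x)) = dl (al X') x (%a b. ph (h (rh a)*[al X']s' (f' b)))"
 using h'f[OF x lin_o[OF ph linH[OF X X' h]]] by (simp add: hm rhc hs L.A.pcl L'.A.pcl)
 also have "... = dl (al X') x (%a b. dl (al X') a (%a1 a2. ph ((a1*[al X']L'.A.ka a2)*[al X']s' (f' b))))"
 by (rule smc, rule hrh[of _ "%z. ph (z*[al X']s' (f' _))"]) (auto intro!: lin_o[OF ph] L'.A.XL lin_id simp: L'.A.pcl)
 also have "... = ph x" by (rule L'.A.coinv_recover[OF x ph])
 finally show "ph (h (h' x)) = ph x" .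
 qed
 have 2: "h' (h x) = x" if x: "x <: (al X)" for x
 proof (rule functional_eqI[OF L.A.X(3) h'c[OF hc[OF x]] x])
 fix ph assume ph: "lin (al X) kk ph"
 have b: "bilin (al X') (al X') kk (%a b. ph (rh a*[al X]s (f' b)))"
 by (intro bilinI lin_o[OF ph] bilinD(2,3)[OF bH] lin_id)
 have "ph (h' (h x)) = dl (al X) x (%a b. ph (rh (h a)*[al X]s (f b)))"
 unfolding h'f[OF hc[OF x] ph] hd[OF x b] by (rule smc) (simp add: hf)
 also have "... = dl (al X) x (%a b. dl (al X) a (%a1 a2. ph ((a1*[al X]L.A.ka a2)*[al X]s (f b))))"
 by (rule smc, rule rhh[of _ "%z. ph (z*[al X]s (f _))"]) (auto intro!: lin_o[OF ph] L.A.XL lin_id simp: L.A.pcl)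
 also have "... = ph x" by (rule L.A.coinv_recover[OF x ph])
 finally show "ph (h' (h x)) = ph x" .
 qed
 show ?thesis using 1 2 h'c by blast
qed

theorem protomodular_C: "protomodular C"
 unfolding protomodular_def
proof (intro conjI ballI allI impI)
 show "category C" by (rule category_C)
next
 fix Y a assume Y: "Y : Ob C" and a: "a : Ob (points C Y)"
 obtain X f s where aa: "a = (X, f, s)" by (cases a)
 show "case a of (X, f, s) => \<forall>E\<in>Ob C. \<forall>g\<in>Hom C E Y. \<exists>P p q. is_pullback C X E Y f g P p q"
 unfolding aa prod.case
 proof (intro ballI)
 fix E g assume E: "E : Ob C" and g: "g : Hom C E Y"
 obtain j :: "(('u \<times> 'u) \<Rightarrow>\<^sub>0 'k) set => 'u" where "coslice_pb B S X E Y f s g j"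
 by (rule coslice_pb_points[OF Y a[unfolded aa] E g])
 then interpret L: coslice_pb B S X E Y f s g j .
 show "\<exists>P p q. is_pullback C X E Y f g P p q" using L.PC_pullback by blast
 qed
next
 fix Y E g a a' h d d' p p' k
 assume Y: "Y : Ob C" and E: "E : Ob C" and g: "g : Hom C E Y" and a: "a : Ob (points C Y)" and a': "a' : Ob (points C Y)"
 and h: "h : Hom (points C Y) a a'" and d: "inverse_image C E Y g a d p" and d': "inverse_image C E Y g a' d' p'"
 and k: "k : Hom (points C E) d d'" and kh: "cmp C (fst d) (fst d') (fst a') p' k = cmp C (fst d) (fst a) (fst a') h p"
 and iso: "isomorphism (points C E) d d' k"
 obtain X f s where aa: "a = (X, f, s)" by (cases a)
 obtain X' f' s' where aa': "a' = (X', f', s')" by (cases a')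
 obtain P q t where dd: "d = (P, q, t)" by (cases d)
 obtain P' q' t' where dd': "d' = (P', q', t')" by (cases d')
 note un = aa aa' dd dd'
 have X: "X : Ob C" "X' : Ob C" and fs: "f : Hom C X Y" "s : Hom C Y X" "f' : Hom C X' Y" "s' : Hom C Y X'"
 using a a' by (simp_all add: un points_def)
 have P: "P : Ob C" "P' : Ob C" and q: "q : Hom C P E" "q' : Hom C P' E"
 using d d' by (simp_all add: un inverse_image_def points_def)
 have h1: "h : Hom C X X'" and hf: "\<forall>x\<in>car (al X). f' (h x) = f x" and hs: "\<forall>y\<in>car (al Y). h (s y) = s' y"
 using h by (simp_all add: un points_def cmp_eq_iff'[OF X(1) Y fs(1)] cmp_eq_iff'[OF Y X(2) fs(4)])
 have k1: "k : Hom C P P'" and qk: "\<forall>x\<in>car (al P). q' (k x) = q x"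
 using k by (simp_all add: un points_def cmp_eq_iff'[OF P(1) E q(1)])
 note idt_iff = cmp_eq_iff'[OF _ _ C.idt_closed]
 obtain l where l0: "l : Hom (points C E) d' d" "cmp (points C E) d d' d l k = idt (points C E) d"
 "cmp (points C E) d' d d' k l = idt (points C E) d'"
 using iso unfolding isomorphism_def by blast
 hence l: "l : Hom C P' P" and "cmp C P P' P l k = idt C P" "cmp C P' P P' k l = idt C P'"
 by (simp_all add: un points_def)
 hence lk: "\<forall>x\<in>car (al P). l (k x) = x" and kl: "\<forall>x\<in>car (al P'). k (l x) = x"
 unfolding idt_iff[OF P(1,1,1)] idt_iff[OF P(2,2,2)] by (simp_all add: cat_simps(1))
 have pk: "\<forall>x\<in>car (al P). p' (k x) = h (p x)"
 using kh by (simp add: un cmp_eq_iff)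
 have pb: "is_pullback C X E Y f g P p q" "is_pullback C X' E Y f' g P' p' q'"
 using d d' by (simp_all add: un inverse_image_def)
 have "\<exists>h'. (\<forall>x\<in>car (al X'). h' x <: (al X) & h (h' x) = x) & (\<forall>x\<in>car (al X). h' (h x) = x)"
 by (rule reflect_iso[OF Y E g a[unfolded aa] a'[unfolded aa'] h1 hf[rule_format] hs[rule_format] pb k1 l
 qk[rule_format] pk[rule_format] lk[rule_format] kl[rule_format]])
 then obtain h' where h': "!!x. x <: (al X') ==> h' x <: (al X)" "!!x. x <: (al X') ==> h (h' x) = x"
 "!!x. x <: (al X) ==> h' (h x) = x" by blast
 \<comment> \<open>A bijective bialgebra map has a bialgebra inverse once restricted to the carrier;
   compatibility with the points is then checked on elements.\<close>
 define hi where "hi = (\<lambda>y\<in>car (al X'). h' y)"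
 have hi: "hi : Hom C X' X"
 unfolding hi_def Hom_iff[OF X(2,1)]
 proof
 show "(\<lambda>y\<in>car (al X'). h' y) : bialg_maps (al X') (al X)"
 by (rule bialg_map_inverse[OF objD(6)[OF X(1)] objD(6)[OF X(2)] HomD(1)[OF X h1] h'(1,3,2)])
 show "\<forall>b\<in>car B. (\<lambda>y\<in>car (al X'). h' y) (snd X' b) = snd X b"
 proof
 fix b assume b: "b <: B"
 have "snd X b <: (al X)" "snd X' b <: (al X')"
 using b bmapD(2)[OF objD(3) bB objD(6)] X by blast+
 thus "(\<lambda>y\<in>car (al X'). h' y) (snd X' b) = snd X b"
 using HomD(2)[OF X h1 b] h'(3)[of "snd X b"] by simp
 qed
 qed
 have "f (hi x) = f' x" if "x <: (al X')" for x
 using that hf[rule_format, OF h'(1)[OF that]] h'(2)[OF that] by (simp add: hi_def)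
 moreover have "hi (s' y) = s y" if "y <: (al Y)" for y
 using that hs h'(3)[OF HomD(3)[OF Y X(1) fs(2) that]] HomD(3)[OF Y X(2) fs(4) that] by (simp add: hi_def)
 ultimately have "hi : Hom (points C Y) a' a"
 using hi by (simp add: un points_def cmp_eq_iff'[OF X(2) Y fs(3)] cmp_eq_iff'[OF Y X(1) fs(2)])
 moreover have "cmp C X X' X hi h = idt C X" "cmp C X' X X' h hi = idt C X'"
 unfolding idt_iff[OF X(1,1,1)] idt_iff[OF X(2,2,2)]
 using h' HomD(3)[OF X h1] by (simp_all add: cat_simps(1) hi_def)
 hence "cmp (points C Y) a a' a hi h = idt (points C Y) a" "cmp (points C Y) a' a a' h hi = idt (points C Y) a'"
 by (simp_all add: un points_def)
 ultimately show "isomorphism (points C Y) a a' h" unfolding isomorphism_def using h by blast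
qed

end

section \<open>Bimodules\<close>

lemma bimodD:
 assumes "bimodule B X"
 shows "vspace X"
 and "b <: B ==> x <: X ==> lact X b x <: X"
 and "b <: B ==> x <: X ==> ract X x b <: X"
 and "bilin B X X (lact X)" and "bilin B X X (%b x. ract X x b)"
 and "x <: X ==> lact X (aone B) x = x" and "x <: X ==> ract X x (aone B) = x"
 and "[|b <: B; b' <: B; x <: X|] ==> lact X (b*[B]b') x = lact X b (lact X b' x)"
 and "[|b <: B; b' <: B; x <: X|] ==> ract X x (b*[B]b') = ract X (ract X x b) b'"
 and "[|b <: B; b' <: B; x <: X|] ==> ract X (lact X b x) b' = lact X b (ract X x b')"
 using assms unfolding bimodule_def bilin_def lin_def by blast+

lemma bimoduleI:
 assumes "vspace X" "bilin B X X (lact X)" "bilin B X X (%b x. ract X x b)"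
 and "!!x. x <: X ==> lact X (aone B) x = x" "!!x. x <: X ==> ract X x (aone B) = x"
 and "!!b b' x. [|b <: B; b' <: B; x <: X|] ==> lact X (b*[B]b') x = lact X b (lact X b' x)"
 and "!!b b' x. [|b <: B; b' <: B; x <: X|] ==> ract X x (b*[B]b') = ract X (ract X x b) b'"
 and "!!b b' x. [|b <: B; b' <: B; x <: X|] ==> ract X (lact X b x) b' = lact X b (ract X x b')"
 shows "bimodule B X"
 using assms unfolding bimodule_def bilin_def lin_def by simp

lemma bimod_mapD:
 assumes "f : bimod_maps B X Y"
 shows "lin X Y f" "x <: X ==> f x <: Y" "f : extensional (car X)"
 and "b <: B ==> x <: X ==> f (lact X b x) = lact Y b (f x)"
 and "b <: B ==> x <: X ==> f (ract X x b) = ract Y (f x) b"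
 using assms unfolding bimod_maps_def by (auto simp: lin_maps_iff linD)

lemma unit_I_simps [simp]:
 "car (unit_I B) = car B" "vadd (unit_I B) = vadd B" "vsmul (unit_I B) = vsmul B" "vzero (unit_I B) = vzero B"
 "lact (unit_I B) = amul B" "ract (unit_I B) = amul B" by (simp_all add: unit_I_def vect.extend_def vect.truncate_def bimod.fields_def)

lemma unit_J_simps [simp]:
 "car (unit_J B) = UNIV" "vadd (unit_J B) = (+)" "vsmul (unit_J B) = (*)" "vzero (unit_J B) = 0"
 "lact (unit_J B) b c = eps B b * c" "ract (unit_J B) c b = c * eps B b"
 by (simp_all add: unit_J_def vect.extend_def bimod.fields_def)

lemma reversion_simps [simp]:
 "car (reversion B X) = car X" "vadd (reversion B X) = vadd X" "vsmul (reversion B X) = vsmul X"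
 "vzero (reversion B X) = vzero X" "lact (reversion B X) b x = ract X x (antipode B b)"
 "ract (reversion B X) x b = lact X (antipode B b) x" by (simp_all add: reversion_def vect.extend_def vect.truncate_def bimod.fields_def)

lemma bull_simps [simp]:
 "car (bull B X Y) = car (tens X Y)" "vadd (bull B X Y) = vadd (tens X Y)"
 "vsmul (bull B X Y) = vsmul (tens X Y)" "vzero (bull B X Y) = vzero (tens X Y)"
 "lact (bull B X Y) b t = lact2 B X Y (acomul B b) t" "ract (bull B X Y) t b = ract2 B X Y t (acomul B b)"
 by (simp_all add: bull_def vect.extend_def bimod.fields_def)

lemma lin_unit:
 "lin (unit_I B) V f = lin B V f" "lin V (unit_I B) g = lin V B g"
 "lin (unit_J B) V h = lin kk V h" "lin V (unit_J B) k = lin V kk k"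
 "lin (bull B X Y) V l = lin (tens X Y) V l" "lin V (bull B X Y) m = lin V (tens X Y) m"
 "lin (reversion B X) V n = lin X V n" "lin V (reversion B X) n' = lin V X n'"
 by (simp_all add: lin_def)

text \<open>Covers the left and the right action of \<open>B \<otimes> B\<close> at once; pairing
  with a form dissolves the two nested lifts.\<close>

lemma act2:
 assumes v: "vspace B" "vspace X" "vspace Y" and \<alpha>: "bilin B X X \<alpha>" and \<beta>: "bilin B Y Y \<beta>" and r: "r <: (tens B B)"
 defines "act == %t. tlift B B (tens X Y) (%b b'. tlift X Y (tens X Y) (%x y. elt X Y (\<alpha> b x) (\<beta> b' y)) t) r"
 shows "lin (tens X Y) (tens X Y) act"
 and "t <: (tens X Y) ==> bilin X Y kk F ==>
 sm X Y (act t) F = sm B B r (%b b'. sm X Y t (%x y. F (\<alpha> b x) (\<beta> b' y)))"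
proof -
 note L = bilinI lin_elt[OF v(2,3)] bilinD(2,3)[OF \<alpha>] bilinD(2,3)[OF \<beta>] lin_id
 note c = bilinD(1)[OF \<alpha>] bilinD(1)[OF \<beta>]
 have b1: "bilin X Y (tens X Y) (%x y. elt X Y (\<alpha> b x) (\<beta> b' y))" if "b <: B" "b' <: B" for b b'
 using that by (intro L; simp add: c)
 have b2: "bilin B B (tens X Y) (%b b'. tlift X Y (tens X Y) (%x y. elt X Y (\<alpha> b x) (\<beta> b' y)) t)"
 if "t <: (tens X Y)" for t by (rule bilinI; rule lin_tlift_body; use that v b1 in \<open>(intro L(2-))?; simp add: c\<close>)
 show "lin (tens X Y) (tens X Y) act"
 unfolding act_def by (rule lin_tlift_body) (use v b1 b2 r in \<open>auto intro!: lin_tlift\<close>)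
 assume t: "t <: (tens X Y)" and F: "bilin X Y kk F"
 have "sm X Y (act t) F = sm B B r (%b b'. sm X Y (tlift X Y (tens X Y) (%x y. elt X Y (\<alpha> b x) (\<beta> b' y)) t) F)"
 unfolding act_def by (rule sm_tlift[OF v(1,1,2,3) b2[OF t] F r])
 also have "... = sm B B r (%b b'. sm X Y t (%x y. F (\<alpha> b x) (\<beta> b' y)))"
 by (rule smc) (simp add: sm_tlift[OF v(2,3,2,3) b1 F t] F v c)
 finally show "sm X Y (act t) F = sm B B r (%b b'. sm X Y t (%x y. F (\<alpha> b x) (\<beta> b' y)))" .
qed

lemma lact2_props:
 assumes "vspace B" "bimodule B X" "bimodule B Y" "r <: (tens B B)"
 shows "lin (tens X Y) (tens X Y) (lact2 B X Y r)"
 and "t <: (tens X Y) ==> bilin X Y kk F ==>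
 sm X Y (lact2 B X Y r t) F = sm B B r (%b b'. sm X Y t (%x y. F (lact X b x) (lact Y b' y)))"
 using act2[OF assms(1) bimodD(1)[OF assms(2)] bimodD(1)[OF assms(3)] bimodD(4)[OF assms(2)] bimodD(4)[OF assms(3)] assms(4)]
 unfolding lact2_def by simp_all

lemma ract2_props:
 assumes "vspace B" "bimodule B X" "bimodule B Y" "r <: (tens B B)"
 shows "lin (tens X Y) (tens X Y) (%t. ract2 B X Y t r)"
 and "t <: (tens X Y) ==> bilin X Y kk F ==>
 sm X Y (ract2 B X Y t r) F = sm B B r (%b b'. sm X Y t (%x y. F (ract X x b) (ract Y y b')))"
 using act2[OF assms(1) bimodD(1)[OF assms(2)] bimodD(1)[OF assms(3)] bimodD(5)[OF assms(2)] bimodD(5)[OF assms(3)] assms(4)]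
 unfolding ract2_def by simp_all

subsection \<open>Tensor products over \<open>B\<close>\<close>

text \<open>The closure properties under which the balancing relations are sound. They also cover
  the products \<open>bull\<close>, for which only closure under the actions is established.\<close>

definition balanceable :: "('k::field, 'b, 'z) alg_scheme => ('k, 'b, 'x, 'w) bimod_scheme =>
 ('k, 'b, 'y, 'v) bimod_scheme => bool" where
 "balanceable B X Y <-> vspace X & vspace Y & (\<forall>b\<in>car B. \<forall>x\<in>car X. ract X x b <: X) &
 (\<forall>b\<in>car B. \<forall>y\<in>car Y. lact Y b y <: Y)"

abbreviation balanced where
 "balanced B X Y f == (\<forall>b\<in>car B. \<forall>x\<in>car X. \<forall>y\<in>car Y. f (ract X x b) y = f x (lact Y b y))"

lemma circ_simps:
 "car (circ B X Y) = car (quot_space (ker\<^sub>B B X Y) X Y)" "vadd (circ B X Y) = vadd (quot_space (ker\<^sub>B B X Y) X Y)"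
 "vsmul (circ B X Y) = vsmul (quot_space (ker\<^sub>B B X Y) X Y)" "vzero (circ B X Y) = vzero (quot_space (ker\<^sub>B B X Y) X Y)"
 "lact (circ B X Y) b = clift B X Y (quot_space (ker\<^sub>B B X Y) X Y) (%x y. celt B X Y (lact X b x) y)"
 "ract (circ B X Y) t b = clift B X Y (quot_space (ker\<^sub>B B X Y) X Y) (%x y. celt B X Y x (ract Y y b)) t"
 by (simp_all add: circ_def Let_def vect.extend_def bimod.fields_def)

lemma lin_circ:
 "lin (circ B X Y) V f = lin (quot_space (ker\<^sub>B B X Y) X Y) V f" "lin V (circ B X Y) g = lin V (quot_space (ker\<^sub>B B X Y) X Y) g"
 "lin_maps (circ B X Y) V = lin_maps (quot_space (ker\<^sub>B B X Y) X Y) V"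
 by (simp_all add: lin_def lin_maps_def circ_simps)

context
 fixes B :: "('k::field, 'b, 'z) alg_scheme" and X :: "('k, 'b, 'x, 'w) bimod_scheme" and Y :: "('k, 'b, 'y, 'v) bimod_scheme"
 assumes bal: "balanceable B X Y"
begin

abbreviation (input) "rels == {Poly_Mapping.single (ract X x b, y) (1::'k) - Poly_Mapping.single (x, lact Y b y) 1 | x b y.
 x <: X & b <: B & y : car Y}"

lemma tensor_quot_circ: "tensor_quot X Y rels"
proof
 show "vspace X" "vspace Y" using bal by (simp_all add: balanceable_def)
 fix p assume "p : rels"
 then obtain x b y where p: "p = Poly_Mapping.single (ract X x b, y) 1 - Poly_Mapping.single (x, lact Y b y) 1"
 and m: "x <: X" "b <: B" "y <: Y" by blast
 have "kys p <= {(ract X x b, y), (x, lact Y b y)}"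
 unfolding p by (auto simp: in_keys_iff lookup_minus lookup_single when_def split: if_splits)
 thus "kys p <= car X \<times> car Y" using bal m by (auto simp: balanceable_def)
qed

lemma ker_eq: "ker\<^sub>B B X Y = fs.span (bilin_rels X Y \<union> rels)"
 and celt_eq: "celt B X Y x y = coset_of (fs.span (bilin_rels X Y \<union> rels)) (Poly_Mapping.single (x, y) 1)"
 by (simp_all add: ker\<^sub>B_def celt_def)

lemma vspace_circ: "vspace (circ B X Y)"
proof -
 have "vspace (circ B X Y) = vspace (quot_space (ker\<^sub>B B X Y) X Y)" by (rule vspace_cong) (simp_all add: circ_simps)
 thus ?thesis using tensor_quot.vspace_Q[OF tensor_quot_circ] by (simp add: ker_eq)
qed

lemma bilin_celt: "bilin X Y (circ B X Y) (celt B X Y)"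
proof -
 have "bilin X Y (quot_space (ker\<^sub>B B X Y) X Y) (celt B X Y)"
 unfolding ker_eq celt_eq by (rule tensor_quot.bilin_qe[OF tensor_quot_circ])
 thus ?thesis by (simp add: bilin_def lin_circ)
qed

lemma celt_closed: "x <: X ==> y <: Y ==> celt B X Y x y <: (circ B X Y)"
 by (rule bilinD(1)[OF bilin_celt])

lemma celt_balanced: "balanced B X Y (celt B X Y)"
proof (intro ballI)
 fix b x y assume m: "b <: B" "x <: X" "y <: Y"
 hence "Poly_Mapping.single (ract X x b, y) (1::'k) - Poly_Mapping.single (x, lact Y b y) 1 : rels" by blast
 thus "celt B X Y (ract X x b) y = celt B X Y x (lact Y b y)"
 unfolding celt_eq by (simp add: coset_eq_iff fs.span_base)
qed

lemma circ_lin_eq: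
 assumes "lin (circ B X Y) Z g" "lin (circ B X Y) Z h" "t <: (circ B X Y)"
 and "!!x y. x <: X ==> y <: Y ==> g (celt B X Y x y) = h (celt B X Y x y)"
 shows "g t = h t" by (rule tensor_quot.Q_lin_eq[OF tensor_quot_circ, of Z g h t, folded ker_eq celt_eq])
 (use assms in \<open>simp_all only: lin_circ circ_simps(1)\<close>)

lemma clift_maps:
 assumes Z: "vspace Z" and f: "bilin X Y Z f" and b: "balanced B X Y f"
 shows "clift B X Y Z f : lin_maps (circ B X Y) Z"
 and "x <: X ==> y <: Y ==> clift B X Y Z f (celt B X Y x y) = f x y"
proof -
 have "ev Z (%a. f (fst a) (snd a)) p = vzero Z" if pr: "p : rels" for p
 proof -
 obtain x c y where p: "p = Poly_Mapping.single (ract X x c, y) 1 - Poly_Mapping.single (x, lact Y c y) 1"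
 and m: "x <: X" "c <: B" "y <: Y" using pr by blast
 have cl: "f (fst a) (snd a) <: Z" if "a : car X \<times> car Y" for a
 using that f by (auto simp: bilinD)
 have k: "(ract X x c, y) : car X \<times> car Y" "(x, lact Y c y) : car X \<times> car Y"
 using bal m by (auto simp: balanceable_def)
 have "ev Z (%a. f (fst a) (snd a)) p = vadd Z (f (ract X x c) y) (vsmul Z (-1) (f x (lact Y c y)))"
 unfolding p using k cl[OF k(1)] cl[OF k(2)] Z by (simp add: ev_diff[OF Z cl] ev_single[OF Z cl])
 thus ?thesis using b m cl[OF k(2)] vneg(1)[OF Z] by simp
 qed
 from tensor_quot.the_lift[OF tensor_quot_circ Z f this, folded ker_eq celt_eq]
 show "clift B X Y Z f : lin_maps (circ B X Y) Z"
 "x <: X ==> y <: Y ==> clift B X Y Z f (celt B X Y x y) = f x y"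
 unfolding clift_def lin_circ by blast+
qed

text \<open>Identifies a given multiplication with the lift of its values on \<open>celt\<close>, so
  that two bimonoids with the same products of elements have the same \<open>mul\<close>.\<close>

lemma clift_unique:
 assumes Z: "vspace Z" and g: "g : lin_maps (circ B X Y) Z"
 and f: "!!x y. x <: X ==> y <: Y ==> g (celt B X Y x y) = f x y"
 shows "clift B X Y Z f = g"
 unfolding clift_def
proof (rule the_equality)
 show "g : lin_maps (quot_space (ker\<^sub>B B X Y) X Y) Z & (\<forall>x\<in>car X. \<forall>y\<in>car Y. g (celt B X Y x y) = f x y)"
 using g f by (simp add: lin_circ)
 fix h assume h: "h : lin_maps (quot_space (ker\<^sub>B B X Y) X Y) Z & (\<forall>x\<in>car X. \<forall>y\<in>car Y. h (celt B X Y x y) = f x y)"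
 hence h': "h : lin_maps (circ B X Y) Z" by (simp add: lin_circ)
 show "h = g"
 proof (rule extensionalityI[of _ "car (circ B X Y)"])
 show "h : extensional (car (circ B X Y))" "g : extensional (car (circ B X Y))"
 using h' g by (simp_all add: lin_maps_iff)
 show "h t = g t" if "t <: (circ B X Y)" for t by (rule circ_lin_eq[OF lin_mapsD[OF h'] lin_mapsD[OF g] that]) (use h f in simp)
 qed
qed

end

lemma balanceable_bimod: "bimodule B X ==> bimodule B Y ==> balanceable B X Y"
 by (simp add: balanceable_def bimodD)

context
 fixes B :: "('k::field, 'b, 'z) alg_scheme" and X :: "('k, 'b, 'x, 'w) bimod_scheme" and Y :: "('k, 'b, 'y, 'v) bimod_scheme"
 assumes X: "bimodule B X" and Y: "bimodule B Y"
begin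

lemmas bXY = balanceable_bimod[OF X Y]
lemmas celt_lin = bilinD(2,3)[OF bilin_celt[OF bXY]]

lemma circ_act:
 assumes b: "b <: B"
 shows "lin (circ B X Y) (circ B X Y) (lact (circ B X Y) b)"
 and "lin (circ B X Y) (circ B X Y) (%t. ract (circ B X Y) t b)"
 and "x <: X ==> y <: Y ==> lact (circ B X Y) b (celt B X Y x y) = celt B X Y (lact X b x) y"
 and "x <: X ==> y <: Y ==> ract (circ B X Y) (celt B X Y x y) b = celt B X Y x (ract Y y b)"
proof -
 let ?Q = "quot_space (ker\<^sub>B B X Y) X Y"
 have Q: "vspace ?Q"
 using vspace_circ[OF bXY] vspace_cong[of "circ B X Y" ?Q] by (simp add: circ_simps)
 have bl: "bilin X Y ?Q (%x y. celt B X Y (lact X b x) y)" "bilin X Y ?Q (%x y. celt B X Y x (ract Y y b))"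
 using b by (auto intro!: bilinI celt_lin[unfolded lin_circ] bilinD(3)[OF bimodD(4)[OF X]] bilinD(3)[OF bimodD(5)[OF Y]]
 simp: bimodD(2)[OF X] bimodD(3)[OF Y])
 have ba: "balanced B X Y (%x y. celt B X Y (lact X b x) y)" "balanced B X Y (%x y. celt B X Y x (ract Y y b))"
 using celt_balanced[OF bXY] b by (simp_all add: bimodD(2)[OF X] bimodD(3)[OF Y] bimodD(10)[OF Y] bimodD(10)[OF X, symmetric])
 note c1 = clift_maps[OF bXY Q bl(1) ba(1)] and c2 = clift_maps[OF bXY Q bl(2) ba(2)]
 show "lin (circ B X Y) (circ B X Y) (lact (circ B X Y) b)" "lin (circ B X Y) (circ B X Y) (%t. ract (circ B X Y) t b)"
 using lin_mapsD[OF c1(1)] lin_mapsD[OF c2(1)] by (simp_all add: circ_simps(5,6) lin_circ)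
 show "x <: X ==> y <: Y ==> lact (circ B X Y) b (celt B X Y x y) = celt B X Y (lact X b x) y"
 "x <: X ==> y <: Y ==> ract (circ B X Y) (celt B X Y x y) b = celt B X Y x (ract Y y b)"
 using c1(2) c2(2) by (simp_all add: circ_simps(5,6))
qed

end

lemma balanceable_circ:
 assumes "bimodule B X" "bimodule B Y" "bimodule B Z"
 shows "balanceable B (circ B X Y) Z" "balanceable B Z (circ B X Y)"
 using assms vspace_circ[OF balanceable_bimod[OF assms(1,2)]] linD(1)[OF circ_act(1)[OF assms(1,2)]] linD(1)[OF circ_act(2)[OF assms(1,2)]]
 by (auto simp: balanceable_def bimodD)

lemma cmap_props:
 assumes bal: "balanceable B X Y" "balanceable B X' Y'" and f: "lin X X' f" and g: "lin Y Y' g"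
 and fr: "!!b x. b <: B ==> x <: X ==> f (ract X x b) = ract X' (f x) b"
 and gl: "!!b y. b <: B ==> y <: Y ==> g (lact Y b y) = lact Y' b (g y)"
 shows "lin (circ B X Y) (circ B X' Y') (cmap B X Y X' Y' f g)"
 and "x <: X ==> y <: Y ==> cmap B X Y X' Y' f g (celt B X Y x y) = celt B X' Y' (f x) (g y)"
proof -
 have b: "bilin X Y (circ B X' Y') (%x y. celt B X' Y' (f x) (g y))"
 by (intro bilinI bilinD(2,3)[OF bilin_celt[OF bal(2)]] f g linD(1)[OF f] linD(1)[OF g])
 have "balanced B X Y (%x y. celt B X' Y' (f x) (g y))"
 using celt_balanced[OF bal(2)] fr gl linD(1)[OF f] linD(1)[OF g] by simp
 from clift_maps[OF bal(1) vspace_circ[OF bal(2)] b this]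
 show "lin (circ B X Y) (circ B X' Y') (cmap B X Y X' Y' f g)"
 "x <: X ==> y <: Y ==> cmap B X Y X' Y' f g (celt B X Y x y) = celt B X' Y' (f x) (g y)"
 unfolding cmap_def by auto
qed

lemma circ_induct [consumes 2, case_names celt add]:
 assumes "balanceable B X Y" "t <: (circ B X Y)"
 and "!!x y. x <: X ==> y <: Y ==> P (celt B X Y x y)"
 and "!!s t. s <: (circ B X Y) ==> t <: (circ B X Y) ==> P s ==> P t ==> P (vadd (circ B X Y) s t)"
 shows "P t"
 using tensor_quot.Q_induct[OF tensor_quot_circ[OF assms(1)], of t P, folded ker_eq[OF assms(1)] celt_eq[OF assms(1)]] assms(2-)
 unfolding circ_simps by blast

lemma lin_clift_body:
 assumes bal: "balanceable B X Y" and Z: "vspace Z" and V: "vspace V"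
 and f: "!!v. v <: V ==> bilin X Y Z (f v)" "!!v. v <: V ==> balanced B X Y (f v)"
 and l: "!!x y. x <: X ==> y <: Y ==> lin V Z (%v. f v x y)" and t: "t <: (circ B X Y)"
 shows "lin V Z (%v. clift B X Y Z (f v) t)"
 using bal t
proof (induction t rule: circ_induct)
 case (celt x y)
 have "lin V Z (%v. clift B X Y Z (f v) (celt B X Y x y)) = lin V Z (%v. f v x y)"
 by (rule lin_cong[OF _ V]) (use clift_maps(2)[OF bal Z f] celt in blast)
 thus ?case using l celt by simp
next
 case (add s t)
 have "lin V Z (%v. clift B X Y Z (f v) (vadd (circ B X Y) s t))
 = lin V Z (%v. vadd Z (clift B X Y Z (f v) s) (clift B X Y Z (f v) t))"
 by (rule lin_cong[OF _ V]) (rule linD(2)[OF lin_mapsD[OF clift_maps(1)[OF bal Z f]] add(1,2)])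
 thus ?case using lin_vadd[OF Z add(3,4)] by simp
qed

text \<open>The inner lift is balanced because the left action on \<open>circ B Y Z\<close> is that
  of \<open>Y\<close>, and the outer one because the right action on \<open>circ B X Y\<close> is
  that of \<open>Y\<close>.\<close>

lemma cassoc_props:
 assumes X: "bimodule B X" and Y: "bimodule B Y" and Z: "bimodule B Z"
 shows "lin (circ B (circ B X Y) Z) (circ B X (circ B Y Z)) (cassoc B X Y Z)"
 and "[|x <: X; y <: Y; z <: Z|] ==>
 cassoc B X Y Z (celt B (circ B X Y) Z (celt B X Y x y) z) = celt B X (circ B Y Z) x (celt B Y Z y z)"
proof -
 let ?T = "circ B X (circ B Y Z)"
 note bXY = balanceable_bimod[OF X Y] and bYZ = balanceable_bimod[OF Y Z]
 note bT = balanceable_circ(2)[OF Y Z X] and bS = balanceable_circ(1)[OF X Y Z]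
 note T = vspace_circ[OF bT]
 note L = bilinI bilinD(2,3)[OF bilin_celt[OF bT]] bilinD(2,3)[OF bilin_celt[OF bYZ]] lin_id
 note c = celt_closed[OF bYZ]
 have b1: "bilin X Y ?T (%x y. celt B X (circ B Y Z) x (celt B Y Z y z))" if "z <: Z" for z
 using that by (intro L; simp add: c)
 have bl: "balanced B X Y (%x y. celt B X (circ B Y Z) x (celt B Y Z y z))" if z: "z <: Z" for z
 proof (intro ballI)
 fix b x y assume m: "b <: B" "x <: X" "y <: Y"
 show "celt B X (circ B Y Z) (ract X x b) (celt B Y Z y z) = celt B X (circ B Y Z) x (celt B Y Z (lact Y b y) z)"
 using celt_balanced[OF bT] m c[OF m(3) z] circ_act(3)[OF Y Z m(1) m(3) z] by simp
 qed
 let ?g = "%t z. clift B X Y ?T (%x y. celt B X (circ B Y Z) x (celt B Y Z y z)) t"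
 note g = clift_maps[OF bXY T b1 bl]
 have lg: "lin (circ B X Y) ?T (%t. ?g t z)" if "z <: Z" for z using lin_mapsD[OF g(1)[OF that that]] .
 have b2: "bilin (circ B X Y) Z ?T ?g" by (rule bilinI; (rule lg | rule lin_clift_body[OF bXY T bimodD(1)[OF Z] b1 bl]); (assumption | (intro L; simp add: c))?)
 have bg: "balanced B (circ B X Y) Z ?g"
 proof (intro ballI)
 fix b t z assume m: "b <: B" "t <: (circ B X Y)" "z <: Z"
 have z': "lact Z b z <: Z" using m bimodD(2)[OF Z] by blast
 show "?g (ract (circ B X Y) t b) z = ?g t (lact Z b z)"
 proof (rule circ_lin_eq[OF bXY lin_o[OF lg[OF m(3)] circ_act(2)[OF X Y m(1)]] lg[OF z'] m(2)])
 fix x y assume k: "x <: X" "y <: Y"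
 have y': "ract Y y b <: Y" using m k bimodD(3)[OF Y] by blast
 show "?g (ract (circ B X Y) (celt B X Y x y) b) z = ?g (celt B X Y x y) (lact Z b z)"
 using circ_act(4)[OF X Y m(1) k] g(2)[OF m(3,3) k(1) y'] g(2)[OF z' z' k] celt_balanced[OF bYZ] m k by simp
 qed
 qed
 from clift_maps[OF bS T b2 bg]
 show "lin (circ B (circ B X Y) Z) ?T (cassoc B X Y Z)" unfolding cassoc_def by blast
 show "[|x <: X; y <: Y; z <: Z|] ==>
 cassoc B X Y Z (celt B (circ B X Y) Z (celt B X Y x y) z) = celt B X (circ B Y Z) x (celt B Y Z y z)"
 unfolding cassoc_def using clift_maps(2)[OF bS T b2 bg] g(2) celt_closed[OF bXY] by simp
qed

lemma tmap_sel_cong: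
 assumes "car X = car V" "vadd X = vadd V" "vsmul X = vsmul V" "car Y = car W" "vadd Y = vadd W" "vsmul Y = vsmul W"
 "car X' = car V'" "vadd X' = vadd V'" "vsmul X' = vsmul V'" "car Y' = car W'" "vadd Y' = vadd W'" "vsmul Y' = vsmul W'"
 shows "tmap X Y X' Y' = tmap V W V' W'" by (intro ext) (simp only: tmap_def tlift_def tens_cong(1,2)[OF assms(1-6)] tens_cong(1,2)[OF assms(7-12)] assms(1,4))

section \<open>The unit objects and the interchange law\<close>

context qt_hopf
begin

lemma bimodule_I: "bimodule B (unit_I B)"
proof (rule bimoduleI)
 show "vspace (unit_I B)" using B(3) vspace_cong[of "unit_I B" B] by simp
 show "bilin B (unit_I B) (unit_I B) (lact (unit_I B))" "bilin B (unit_I B) (unit_I B) (%b x. ract (unit_I B) x b)"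
 unfolding bilin_def lin_unit by (simp_all add: BL)
qed (simp_all add: B)

lemma bimodule_J: "bimodule B (unit_J B)"
proof (rule bimoduleI)
 show "vspace (unit_J B)" using vspace_ground vspace_cong[of "unit_J B" kk] by simp
 show "bilin B (unit_J B) (unit_J B) (lact (unit_J B))" "bilin B (unit_J B) (unit_J B) (%b x. ract (unit_J B) x b)"
 unfolding bilin_def lin_unit fun_eq_iff[of "lact (unit_J B) _" "%c. eps B _ * c", THEN iffD2, OF allI, OF unit_J_simps(5)]
 fun_eq_iff[of "ract (unit_J B) _" "%b. _ * eps B b", THEN iffD2, OF allI, OF unit_J_simps(6)]
 by (auto intro!: lin_mult B(5))
qed (simp_all add: B)

lemma bull_balanceable:
 assumes "bimodule B X" "bimodule B Y" "bimodule B Z" "bimodule B V"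
 shows "balanceable B (bull B X Y) (bull B Z V)" "balanceable B (bull B X Y) Z" "balanceable B Z (bull B X Y)"
proof -
 have v: "vspace (bull B X Y)" if "bimodule B X" "bimodule B Y" for X :: "('k, 'b, 'x, 'w) bimod_scheme" and Y :: "('k, 'b, 'y, 'v) bimod_scheme"
 using vspace_tens[OF bimodD(1)[OF that(1)] bimodD(1)[OF that(2)]] vspace_cong[of "bull B X Y" "tens X Y"] by simp
 show "balanceable B (bull B X Y) (bull B Z V)" "balanceable B (bull B X Y) Z" "balanceable B Z (bull B X Y)"
 using assms v[OF assms(1,2)] v[OF assms(3,4)] linD(1)[OF lact2_props(1)[OF B(3) assms(1,2) B(6)]] linD(1)[OF ract2_props(1)[OF B(3) assms(1,2) B(6)]]
 linD(1)[OF lact2_props(1)[OF B(3) assms(3,4) B(6)]] by (simp_all add: balanceable_def bimodD)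
qed

text \<open>Both diagonal actions use the same coproduct of \<open>b\<close>, and each of its legs
  moves across its own balanced tensor; hence the law is well defined over \<open>B\<close>.\<close>

lemma interchange_props:
 assumes X: "bimodule B X"
 shows "lin (circ B (bull B X X) (bull B X X)) (tens (circ B X X) (circ B X X)) (interchange B X X X X)"
 and "[|s <: (tens X X); t <: (tens X X); bilin (circ B X X) (circ B X X) kk F|] ==>
 sm (circ B X X) (circ B X X) (interchange B X X X X (celt B (bull B X X) (bull B X X) s t)) F
 = sm X X s (%a e. sm X X t (%c d. F (celt B X X a c) (celt B X X e d)))"
proof -
 let ?C = "circ B X X" and ?U = "bull B X X"
 let ?T = "bull B ?C ?C"
 note bX = balanceable_bimod[OF X X] and bU = bull_balanceable(1)[OF X X X X]
 note C = vspace_circ[OF bX] and vX = bimodD(1)[OF X]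
 have vT: "vspace (tens ?C ?C)" "vspace ?T" using C vspace_cong[of ?T "tens ?C ?C"] by simp_all
 \<comment> \<open>A lift depends on its target only through carrier, addition and scalars, so
   \<open>bull\<close> may be replaced by the plain tensor product.\<close>
 have tl: "tlift X X ?T = tlift X X (tens ?C ?C)"
 unfolding tlift_def fun_eq_iff by (simp add: lin_maps_def)
 note L = bilinI lin_elt[OF C C] bilinD(2,3)[OF bilin_celt[OF bX]] lin_id
 note c = celt_closed[OF bX]
 let ?h = "%a e. tlift X X (tens ?C ?C) (%c d. elt ?C ?C (celt B X X a c) (celt B X X e d))"
 let ?g = "%s t. tlift X X (tens ?C ?C) (%a e. ?h a e t) s"
 have b1: "bilin X X (tens ?C ?C) (%c d. elt ?C ?C (celt B X X a c) (celt B X X e d))" if "a <: X" "e <: X" for a e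
 using that by (intro L; simp add: c)
 have b2: "bilin X X (tens ?C ?C) (%a e. ?h a e t)" if "t <: (tens X X)" for t
 by (rule bilinI; rule lin_tlift_body; use that vX vT b1 in \<open>(intro L(2-))?; simp add: c\<close>)
 have b3: "bilin ?U ?U (tens ?C ?C) ?g"
 unfolding bilin_def lin_unit
 proof (intro conjI ballI)
 fix s assume s: "s <: ?U"
 show "lin (tens X X) (tens ?C ?C) (%t. ?g s t)" by (rule lin_tlift_body) (use s vX vT b1 b2 in \<open>auto intro!: lin_tlift\<close>)
 show "lin (tens X X) (tens ?C ?C) (%t. ?g t s)"
 using lin_tlift[OF vX vX vT(1) b2 lin_id] s by simp
 qed
 have gc: "?g s t <: (tens ?C ?C)" if "s <: (tens X X)" "t <: (tens X X)" for s t
 using that b2 vX vT by simp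
 have gs: "sm ?C ?C (?g s t) F = sm X X s (%a e. sm X X t (%c d. F (celt B X X a c) (celt B X X e d)))"
 if "s <: (tens X X)" "t <: (tens X X)" and F: "bilin ?C ?C kk F" for s t F
 proof -
 have "sm ?C ?C (?g s t) F = sm X X s (%a e. sm ?C ?C (?h a e t) F)"
 by (rule sm_tlift[OF vX vX C C b2[OF that(2)] F that(1)])
 also have "... = sm X X s (%a e. sm X X t (%c d. F (celt B X X a c) (celt B X X e d)))"
 by (rule smc) (simp add: sm_tlift[OF vX vX C C b1 F that(2)] F C c)
 finally show ?thesis .
 qed
 have ba: "balanced B ?U ?U ?g"
 proof (intro ballI)
 fix b s t assume b: "b <: B" and "s <: ?U" "t <: ?U"
 hence st: "s <: (tens X X)" "t <: (tens X X)" by simp_all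
 note r = ract2_props[OF B(3) X X B(6)[OF b]] and l = lact2_props[OF B(3) X X B(6)[OF b]]
 show "?g (ract ?U s b) t = ?g s (lact ?U b t)"
 proof (rule tens_eqI[OF C C])
 show "?g (ract ?U s b) t <: (tens ?C ?C)" "?g s (lact ?U b t) <: (tens ?C ?C)"
 using gc st linD(1)[OF r(1)] linD(1)[OF l(1)] by simp_all
 fix F assume F: "bilin ?C ?C kk F"
 note LF = bilinI lin_smI bilinD(2,3)[OF F] L(4-)
 have f1: "bilin X X kk (%a e. sm X X t (%c d. F (celt B X X a c) (celt B X X e d)))" by (intro LF; simp add: c)
 have f2: "bilin X X kk (%c d. F (celt B X X a c) (celt B X X e d))" if "a <: X" "e <: X" for a e
 using that by (intro LF; simp add: c)
 have "sm ?C ?C (?g (ract ?U s b) t) F = sm B B (acomul B b) (%b b'. sm X X s (%a e. sm X X t (%c d. F (celt B X X (ract X a b) c) (celt B X X (ract X e b') d))))"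
 using gs[OF linD(1)[OF r(1) st(1)] st(2) F] r(2)[OF st(1) f1] by simp
 also have "... = sm B B (acomul B b) (%b b'. sm X X s (%a e. sm X X t (%c d. F (celt B X X a (lact X b c)) (celt B X X e (lact X b' d)))))"
 using celt_balanced[OF bX] by simp
 also have "... = sm X X s (%a e. sm B B (acomul B b) (%b b'. sm X X t (%c d. F (celt B X X a (lact X b c)) (celt B X X e (lact X b' d)))))"
 by (rule sm_swap)
 also have "... = sm ?C ?C (?g s (lact ?U b t)) F"
 using gs[OF st(1) linD(1)[OF l(1) st(2)] F] l(2)[OF st(2) f2] by simp
 finally show "sm ?C ?C (?g (ract ?U s b) t) F = sm ?C ?C (?g s (lact ?U b t)) F" .
 qed
 qed
 have cl: "clift B ?U ?U ?T ?g = clift B ?U ?U (tens ?C ?C) ?g"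
 unfolding clift_def fun_eq_iff by (simp add: lin_maps_def)
 have i: "interchange B X X X X = clift B ?U ?U (tens ?C ?C) ?g" by (simp add: interchange_def Let_def tl cl)
 note cp = clift_maps[OF bU vT(1) b3 ba]
 show "lin (circ B ?U ?U) (tens ?C ?C) (interchange B X X X X)" unfolding i using cp(1) by blast
 show "[|s <: (tens X X); t <: (tens X X); bilin ?C ?C kk F|] ==>
 sm ?C ?C (interchange B X X X X (celt B ?U ?U s t)) F
 = sm X X s (%a e. sm X X t (%c d. F (celt B X X a c) (celt B X X e d)))"
 unfolding i using cp(2) gs by simp
qed

lemma mult_J_elt: "mult_J B (celt B (unit_J B) (unit_J B) c c') = c * c'" (is "?l34 = _") and lin_mult_J: "lin (circ B (unit_J B) (unit_J B)) kk (mult_J B)"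
proof -
 have b: "bilin (unit_J B) (unit_J B) (unit_J B) (%c c'. c * c')"
 unfolding bilin_def lin_unit by (auto intro!: lin_mult lin_id)
 have ba: "balanced B (unit_J B) (unit_J B) (%c c'. c * c')" by simp
 note c = clift_maps[OF balanceable_bimod[OF bimodule_J bimodule_J] bimodD(1)[OF bimodule_J] b ba]
 show "?l34 = c * c'" unfolding mult_J_def using c(2) by simp
 show "lin (circ B (unit_J B) (unit_J B)) kk (mult_J B)" unfolding mult_J_def using lin_mapsD[OF c(1)] by (simp add: lin_unit)
qed

end

section \<open>Bimonoids and bialgebras under \<open>B\<close>\<close>

text \<open>One dictionary for both directions: starting from a bimonoid or from a bialgebra, the
  other record is built to satisfy these equations, and the comparison is carried out once.\<close>

locale corr = qt_hopf B S for B :: "('k::field, 'b, 'z) bialg_scheme" and S +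
 fixes H :: "('k, 'b, 'v, 'hz) bimon_scheme" and A :: "('k, 'v, 'az) bialg_scheme"
 assumes sel: "car A = car H" "vadd A = vadd H" "vsmul A = vsmul H" "vzero A = vzero H"
 "acomul A = com H" "eps A = cou H"
 and bH: "bimodule B H" and mulm: "mul H : lin_maps (circ B H H) H"
 and mu: "x <: H ==> y <: H ==> mul H (celt B H H x y) = x*[A]y"
 and la: "b <: B ==> x <: H ==> lact H b x = unt H b*[A]x"
 and ra: "b <: B ==> x <: H ==> ract H x b = x*[A]unt H b"
 and one: "aone A = unt H (aone B)"
begin

lemma linA: "lin A V f = lin H V f" "lin V A g = lin V H g" "lin_maps A V = lin_maps H V" "lin_maps V A = lin_maps V H"
 by (simp_all only: lin_def lin_maps_def sel)

lemma bilinA: "bilin A A V F = bilin H H V F" "bilin V W A G = bilin V W H G" "trilin A A A V T = trilin H H H V T"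
 by (simp_all only: bilin_def trilin_def linA sel)

lemma tensA: "tens A A = tens H H" "elt A A = elt H H" "sm A A = sm H H" "bilin_rels A A = bilin_rels H H"
 by (rule tens_cong; simp only: sel)+ (simp only: bilin_rels_def sel)

lemma vspaceA: "vspace A = vspace H" by (rule vspace_cong) (simp_all only: sel)

lemma coalgebraA: "coalgebra A D e = coalgebra H D e"
 unfolding coalgebra_iff vspaceA linA(1,3) bilinA(3) tensA(1,3) sel(1) ..

lemma IB: "tens (unit_I B) (unit_I B) = tens B B" "elt (unit_I B) (unit_I B) = elt B B" "sm (unit_I B) (unit_I B) = sm B B"
 by (rule tens_cong; simp)+

lemma tmapI: "tmap (unit_I B) (unit_I B) H H = tmap B B A A" by (rule tmap_sel_cong) (simp_all add: sel)

lemmas bHH = balanceable_bimod[OF bH bH]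
lemmas vH = bimodD(1)[OF bH]
lemmas lmul = lin_mapsD[OF mulm]
lemmas bU = bull_balanceable(1)[OF bH bH bH bH]

text \<open>Tested on \<open>celt\<close>, the compatibility axiom of a bimonoid becomes
  multiplicativity of the coproduct.\<close>

lemma mul_interchange:
 assumes com: "com H : bimod_maps B H (bull B H H)"
 shows "[|x <: H; y <: H; bilin H H kk F|] ==> sm H H (tmap (circ B H H) (circ B H H) H H (mul H) (mul H) (interchange B H H H H
 (cmap B H H (bull B H H) (bull B H H) (com H) (com H) (celt B H H x y)))) F
 = sm H H (com H x) (%a b. sm H H (com H y) (%c d. F (a*[A]c) (b*[A]d)))"
 and "lin (circ B H H) (tens H H) (%t. tmap (circ B H H) (circ B H H) H H (mul H) (mul H) (interchange B H H H H
 (cmap B H H (bull B H H) (bull B H H) (com H) (com H) t)))"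
proof -
 let ?C = "circ B H H"
 note cm = bimod_mapD[OF com]
 note cp = cmap_props[OF bHH bU cm(1,1) cm(5,4)]
 note ip = interchange_props[OF bH]
 note vC = vspace_circ[OF bHH]
 show "lin ?C (tens H H) (%t. tmap ?C ?C H H (mul H) (mul H) (interchange B H H H H
 (cmap B H H (bull B H H) (bull B H H) (com H) (com H) t)))" by (rule lin_o[OF lin_tmap[OF vC vC vH vH lmul lmul] lin_o[OF ip(1) cp(1)]])
 assume m: "x <: H" "y <: H" and F: "bilin H H kk F"
 have c: "com H x <: (tens H H)" "com H y <: (tens H H)" using cm(2)[OF m(1)] cm(2)[OF m(2)] by simp_all
 have ic: "interchange B H H H H (celt B (bull B H H) (bull B H H) (com H x) (com H y)) <: (tens ?C ?C)"
 by (rule linD(1)[OF ip(1) celt_closed[OF bU]]) (use c in simp_all)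
 have cpe: "cmap B H H (bull B H H) (bull B H H) (com H) (com H) (celt B H H x y) = celt B (bull B H H) (bull B H H) (com H x) (com H y)"
 by (rule cp(2); (assumption | rule m))
 have F': "bilin ?C ?C kk (%s t. F (mul H s) (mul H t))" by (intro bilinI bilinD(2,3)[OF F] lmul linD(1)[OF lmul])
 show "sm H H (tmap ?C ?C H H (mul H) (mul H) (interchange B H H H H
 (cmap B H H (bull B H H) (bull B H H) (com H) (com H) (celt B H H x y)))) F
 = sm H H (com H x) (%a b. sm H H (com H y) (%c d. F (a*[A]c) (b*[A]d)))"
 unfolding cpe sm_tmap[OF vC vC vH vH lmul lmul ic F] ip(2)[OF c F'] by (simp add: mu)
qed

lemma mul_counit:
 assumes cou: "cou H : bimod_maps B H (unit_J B)"
 shows "x <: H ==> y <: H ==>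
 mult_J B (cmap B H H (unit_J B) (unit_J B) (cou H) (cou H) (celt B H H x y)) = cou H x * cou H y"
 and "lin (circ B H H) kk (%t. mult_J B (cmap B H H (unit_J B) (unit_J B) (cou H) (cou H) t))"
proof -
 note cm = bimod_mapD[OF cou]
 note cp = cmap_props[OF bHH balanceable_bimod[OF bimodule_J bimodule_J] cm(1,1) cm(5,4)]
 show "x <: H ==> y <: H ==>
 mult_J B (cmap B H H (unit_J B) (unit_J B) (cou H) (cou H) (celt B H H x y)) = cou H x * cou H y"
 by (simp add: cp(2) mult_J_elt)
 show "lin (circ B H H) kk (%t. mult_J B (cmap B H H (unit_J B) (unit_J B) (cou H) (cou H) t))"
 by (rule lin_o[OF lin_mult_J cp(1)])
qed

text \<open>Both sides of the associativity law are determined by triple products of elements.\<close>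

lemma mul_assoc_sides:
 assumes mul: "mul H : bimod_maps B (circ B H H) H"
 shows "[|x <: H; y <: H; z <: H|] ==>
 mul H (cmap B (circ B H H) H H H (mul H) (idm H) (celt B (circ B H H) H (celt B H H x y) z)) = (x*[A]y)*[A]z"
 and "[|x <: H; y <: H; z <: H|] ==>
 mul H (cmap B H (circ B H H) H H (idm H) (mul H) (cassoc B H H H (celt B (circ B H H) H (celt B H H x y) z))) = x*[A](y*[A]z)"
 and "lin (circ B (circ B H H) H) H (%t. mul H (cmap B (circ B H H) H H H (mul H) (idm H) t))"
 and "lin (circ B (circ B H H) H) H (%t. mul H (cmap B H (circ B H H) H H (idm H) (mul H) (cassoc B H H H t)))"
proof -
 note m = bimod_mapD[OF mul]
 note b1 = balanceable_circ(1)[OF bH bH bH] and b2 = balanceable_circ(2)[OF bH bH bH]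
 have i: "idm H (lact H b x) = lact H b (idm H x)" "idm H (ract H x b) = ract H (idm H x) b"
 if "b <: B" "x <: H" for b x using that bimodD(2,3)[OF bH] by simp_all
 note c1 = cmap_props[OF b1 bHH m(1) lin_idm[OF vH] m(5) i(1)]
 note c2 = cmap_props[OF b2 bHH lin_idm[OF vH] m(1) i(2) m(4)]
 note a = cassoc_props[OF bH bH bH]
 have xy: "x*[A]y <: H" if "x <: H" "y <: H" for x y
 using linD(1)[OF lmul celt_closed[OF bHH that]] mu[OF that] by simp
 show "[|x <: H; y <: H; z <: H|] ==>
 mul H (cmap B (circ B H H) H H H (mul H) (idm H) (celt B (circ B H H) H (celt B H H x y) z)) = (x*[A]y)*[A]z"
 "[|x <: H; y <: H; z <: H|] ==>
 mul H (cmap B H (circ B H H) H H (idm H) (mul H) (cassoc B H H H (celt B (circ B H H) H (celt B H H x y) z))) = x*[A](y*[A]z)"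
 by (simp_all add: c1(2) c2(2) a(2) celt_closed[OF bHH] mu xy)
 show "lin (circ B (circ B H H) H) H (%t. mul H (cmap B (circ B H H) H H H (mul H) (idm H) t))"
 by (rule lin_o[OF lmul c1(1)])
 show "lin (circ B (circ B H H) H) H (%t. mul H (cmap B H (circ B H H) H H (idm H) (mul H) (cassoc B H H H t)))"
 by (rule lin_o[OF lmul lin_o[OF c2(1) a(1)]])
qed

lemma bilin_amul: "bilin A A A (amul A)"
 unfolding bilin_def linA sel
proof (intro conjI ballI)
 note l = bilinD(2,3)[OF bilin_celt[OF bHH] lin_id]
 fix x assume x: "x <: H"
 have "lin H H (%y. mul H (celt B H H x y)) = lin H H (%y. x*[A]y)" by (rule lin_cong[OF _ vH]) (simp add: mu x)
 thus "lin H H (amul A x)" using lin_o[OF lmul l(2)[OF x]] by simp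
 have "lin H H (%y. mul H (celt B H H y x)) = lin H H (%y. y*[A]x)" by (rule lin_cong[OF _ vH]) (simp add: mu x)
 thus "lin H H (%y. y*[A]x)" using lin_o[OF lmul l(1)[OF x]] by simp
qed

lemma to_bialg:
 assumes bm: "bimonoid B H"
 shows "bialgebra A" and "unt H : bialg_maps B A"
proof -
 have cm: "circ_monoid B H" and bc: "bull_comonoid B H"
 and c1: "!!t. t <: (circ B H H) ==> com H (mul H t) = tmap (circ B H H) (circ B H H) H H (mul H) (mul H)
 (interchange B H H H H (cmap B H H (bull B H H) (bull B H H) (com H) (com H) t))"
 and c2: "!!t. t <: (circ B H H) ==> cou H (mul H t) = mult_J B (cmap B H H (unit_J B) (unit_J B) (cou H) (cou H) t)"
 and c3: "!!b. b <: B ==> com H (unt H b) = tmap (unit_I B) (unit_I B) H H (unt H) (unt H) (acomul B b)"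
 and c4: "!!b. b <: B ==> cou H (unt H b) = eps B b"
 using bm unfolding bimonoid_def by blast+
 have mul: "mul H : bimod_maps B (circ B H H) H" and unt: "unt H : bimod_maps B (unit_I B) H"
 and as: "!!t. t <: (circ B (circ B H H) H) ==> mul H (cmap B (circ B H H) H H H (mul H) (idm H) t)
 = mul H (cmap B H (circ B H H) H H (idm H) (mul H) (cassoc B H H H t))"
 using cm unfolding circ_monoid_def by blast+
 have co: "com H : bimod_maps B H (bull B H H)" and ce: "cou H : bimod_maps B H (unit_J B)" and cc: "coalgebra H (com H) (cou H)"
 using bc unfolding bull_comonoid_def by blast+
 note u = bimod_mapD[OF unt, unfolded unit_I_simps lin_unit]
 have m: "x*[A]y <: H" if "x <: H" "y <: H" for x y
 using linD(1)[OF lmul celt_closed[OF bHH that]] mu[OF that] by simp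
 have alg: "algebra A"
 unfolding algebra_iff vspaceA sel(1)
 proof (intro conjI ballI)
 fix x y z assume k: "x <: H" "y <: H" "z <: H"
 show "(x*[A]y)*[A]z = x*[A](y*[A]z)"
 using as[OF celt_closed[OF balanceable_circ(1)[OF bH bH bH] celt_closed[OF bHH k(1,2)] k(3)]] mul_assoc_sides(1,2)[OF mul k] by simp
 show "aone A*[A]x = x" "x*[A]aone A = x"
 using la[OF B(16) k(1)] ra[OF B(16) k(1)] bimodD(6,7)[OF bH k(1)] by (simp_all add: one)
 qed (use bilin_amul u(2)[OF B(16)] vH one in simp_all)
 \<comment> \<open>Multiplicativity of the unit is its left linearity over \<open>B\<close>, as the
   action is multiplication by the unit.\<close>
 have um: "unt H (b*[B]b') = unt H b*[A]unt H b'" if "b <: B" "b' <: B" for b b'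
 using u(4)[OF that] la[OF that(1) u(2)[OF that(2)]] by simp
 have cou1: "eps A (aone A) = 1" using c4[OF B(16)] B(13) by (simp add: sel one)
 show bA: "bialgebra A"
 proof (rule bialgebraI[OF alg _ _ _ _ cou1])
 show "coalgebra A (acomul A) (eps A)" using cc by (simp add: coalgebraA sel)
 fix F assume "bilin A A kk F"
 hence F: "bilin H H kk F" by (simp add: bilinA)
 note lu = linD(1)[OF u(1)]
 have "com H (unt H (aone B)) = elt H H (unt H (aone B)) (unt H (aone B))"
 unfolding c3[OF B(16)] acomul_mult(2)[OF bB] IB(2)[symmetric]
 by (rule tmap_elt) (use B(3,16) vH u(1) vspace_cong[of "unit_I B" B] in \<open>simp_all add: lin_unit\<close>)
 thus "dl A (aone A) F = F (aone A) (aone A)"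
 unfolding tensA sel one using F vH u(2)[OF B(16)] by simp
 fix x y assume "x <: A" "y <: A"
 hence k: "x <: H" "y <: H" by (simp_all add: sel)
 show "dl A (x*[A]y) F = dl A x (%a b. dl A y (%c d. F (a*[A]c) (b*[A]d)))"
 unfolding tensA sel using mul_interchange(1)[OF co k F] c1[OF celt_closed[OF bHH k]] by (simp add: mu k)
 next
 fix x y assume "x <: A" "y <: A"
 hence k: "x <: H" "y <: H" by (simp_all add: sel)
 show "eps A (x*[A]y) = eps A x * eps A y"
 unfolding sel using mul_counit(1)[OF ce k] c2[OF celt_closed[OF bHH k]] by (simp add: mu k)
 qed
 show "unt H : bialg_maps B A"
 unfolding bialg_maps_def linA tmapI[symmetric] sel
 using u(1,3) um c3 c4 by (simp add: lin_maps_iff one)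
qed

text \<open>All actions are multiplications by \<open>unt H\<close>. Linearity over \<open>B\<close>
  of the product is thus associativity, and linearity of coproduct and counit is their
  multiplicativity.\<close>

lemma from_bialg:
 assumes bA: "bialgebra A" and uA: "unt H : bialg_maps B A"
 shows "bimonoid B H"
proof -
 note A = bialgD[OF bA] algebraD[OF bialgD(1)[OF bA]]
 note U = bmapD[OF uA bB bA]
 note lact_lin = bilinD(3)[OF bimodD(4)[OF bH] lin_id] bilinD(3)[OF bimodD(5)[OF bH] lin_id]
 have cl: "x*[A]y <: H" if "x <: H" "y <: H" for x y using A(20) that by (simp add: sel)
 have uc: "unt H b <: H" if "b <: B" for b using U(2)[OF that] by (simp add: sel)
 have as: "(x*[A]y)*[A]z = x*[A]y*[A]z" if "x <: H" "y <: H" "z <: H" for x y z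
 using A(17) that by (simp add: sel)
 have mul: "mul H : bimod_maps B (circ B H H) H"
 unfolding bimod_maps_def
 proof (intro CollectI conjI ballI)
 show "mul H : lin_maps (circ B H H) H" by (rule mulm)
 fix b t assume b: "b <: B" and t: "t <: (circ B H H)"
 note ca = circ_act[OF bH bH b]
 show "mul H (lact (circ B H H) b t) = lact H b (mul H t)" by (rule circ_lin_eq[OF bHH lin_o[OF lmul ca(1)] lin_o[OF lact_lin(1)[OF b] lmul] t])
 (simp add: ca(3) mu la b as uc cl bimodD(2)[OF bH])
 show "mul H (ract (circ B H H) t b) = ract H (mul H t) b" by (rule circ_lin_eq[OF bHH lin_o[OF lmul ca(2)] lin_o[OF lact_lin(2)[OF b] lmul] t])
 (simp add: ca(4) mu ra b as uc cl)
 qed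
 have unt: "unt H : bimod_maps B (unit_I B) H"
 using U(1,3,7) by (simp add: bimod_maps_def lin_maps_iff lin_unit linA la ra uc)
 note u = bimod_mapD[OF unt]
 have i: "idm H (lact H b x) = lact H b (idm H x)" "idm H (ract H x b) = ract H (idm H x) b"
 if "b <: B" "x <: H" for b x using that bimodD(2,3)[OF bH] by simp_all
 have cm: "circ_monoid B H"
 unfolding circ_monoid_def
 proof (intro conjI ballI bH mul unt)
 note s = mul_assoc_sides[OF mul]
 note b1 = balanceable_circ(1)[OF bH bH bH]
 fix t assume t: "t <: (circ B (circ B H H) H)"
 show "mul H (cmap B (circ B H H) H H H (mul H) (idm H) t) = mul H (cmap B H (circ B H H) H H (idm H) (mul H) (cassoc B H H H t))"
 proof (rule circ_lin_eq[OF b1 s(3,4) t])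
 fix p z assume p: "p <: (circ B H H)" and z: "z <: H"
 note l = bilinD(2)[OF bilin_celt[OF b1] lin_id z]
 show "mul H (cmap B (circ B H H) H H H (mul H) (idm H) (celt B (circ B H H) H p z))
 = mul H (cmap B H (circ B H H) H H (idm H) (mul H) (cassoc B H H H (celt B (circ B H H) H p z)))"
 by (rule circ_lin_eq[OF bHH lin_o[OF s(3) l] lin_o[OF s(4) l] p]) (simp only: s(1,2) z as)
 qed
 next
 note bIH = balanceable_bimod[OF bimodule_I bH]
 have b: "bilin (unit_I B) H H (lact H)" using bimodD(4)[OF bH] by (simp add: bilin_def lin_unit)
 have ba: "balanced B (unit_I B) H (lact H)" using bimodD(8)[OF bH] by simp
 note c = cmap_props[OF bIH bHH u(1) lin_idm[OF vH] u(5) i(1)]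
 note k = clift_maps[OF bIH vH b ba, folded clunit_def]
 fix t assume t: "t <: (circ B (unit_I B) H)"
 show "mul H (cmap B (unit_I B) H H H (unt H) (idm H) t) = clunit B H t"
 proof (rule circ_lin_eq[OF bIH lin_o[OF lmul c(1)] lin_mapsD[OF k(1)] t])
 fix x y assume m: "x <: (unit_I B)" "y <: H"
 have "cmap B (unit_I B) H H H (unt H) (idm H) (celt B (unit_I B) H x y) = celt B H H (unt H x) (idm H y)"
 by (rule c(2); (assumption | rule m))
 thus "mul H (cmap B (unit_I B) H H H (unt H) (idm H) (celt B (unit_I B) H x y)) = clunit B H (celt B (unit_I B) H x y)"
 using k(2)[OF m] m by (simp add: mu uc la)
 qed
 next
 note bIH = balanceable_bimod[OF bH bimodule_I]
 have b: "bilin H (unit_I B) H (%x b. ract H x b)" using bimodD(5)[OF bH] by (simp add: bilin_def lin_unit)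
 have ba: "balanced B H (unit_I B) (%x b. ract H x b)" using bimodD(9)[OF bH] by simp
 note c = cmap_props[OF bIH bHH lin_idm[OF vH] u(1) i(2) u(4)]
 note k = clift_maps[OF bIH vH b ba, folded crunit_def]
 fix t assume t: "t <: (circ B H (unit_I B))"
 show "mul H (cmap B H (unit_I B) H H (idm H) (unt H) t) = crunit B H t"
 proof (rule circ_lin_eq[OF bIH lin_o[OF lmul c(1)] lin_mapsD[OF k(1)] t])
 fix x y assume m: "x <: H" "y <: (unit_I B)"
 have "cmap B H (unit_I B) H H (idm H) (unt H) (celt B H (unit_I B) x y) = celt B H H (idm H x) (unt H y)"
 by (rule c(2); (assumption | rule m))
 thus "mul H (cmap B H (unit_I B) H H (idm H) (unt H) (celt B H (unit_I B) x y)) = crunit B H (celt B H (unit_I B) x y)"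
 using k(2)[OF m] m by (simp add: mu uc ra)
 qed
 qed
 have cH: "coalgebra H (com H) (cou H)" using A(2) by (simp add: coalgebraA sel)
 note cHD = coalgebraD[OF cH]
 have cmaps: "com H : lin_maps H (tens H H)" "cou H : lin_maps H kk" using cH by (simp_all add: coalgebra_iff)
 have comm: "sm H H (com H (x*[A]y)) F = sm H H (com H x) (%a b. sm H H (com H y) (%c d. F (a*[A]c) (b*[A]d)))"
 if "x <: H" "y <: H" "bilin H H kk F" for x y F
 using A(10)[of x y F] that by (simp add: sel tensA bilinA)
 have comu: "sm H H (com H (unt H b)) F = sm B B (acomul B b) (%a c. F (unt H a) (unt H c))"
 if "b <: B" "bilin H H kk F" for b F
 using U(5)[of b F] that by (simp add: sel tensA bilinA)
 have AL: "lin V H f ==> y <: H ==> lin V H (%v. f v*[A]y)" "lin V H f ==> y <: H ==> lin V H (%v. y*[A]f v)"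
 for V :: "('k, 'w, 'wz) vect_scheme" and f y
 using alg_lin[OF A(1), of V f y] by (simp_all add: linA sel)
 have co: "com H : bimod_maps B H (bull B H H)"
 unfolding bimod_maps_def
 proof (intro CollectI conjI ballI)
 show "com H : lin_maps H (bull B H H)" using cmaps(1) by (simp add: lin_maps_iff lin_unit)
 fix b x assume m: "b <: B" "x <: H"
 note r = ract2_props[OF B(3) bH bH B(6)[OF m(1)]] and l = lact2_props[OF B(3) bH bH B(6)[OF m(1)]]
 have cx: "com H x <: (tens H H)" using linD(1)[OF cHD(2) m(2)] .
 show "com H (lact H b x) = lact (bull B H H) b (com H x)" unfolding bull_simps
 proof (rule tens_eqI[OF vH vH])
 show "com H (lact H b x) <: (tens H H)" by (rule linD(1)[OF cHD(2)]) (use m bimodD(2)[OF bH] in blast)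
 show "lact2 B H H (acomul B b) (com H x) <: (tens H H)" by (rule linD(1)[OF l(1) cx])
 fix F assume F: "bilin H H kk F"
 have F': "bilin H H kk (%a b. sm H H (com H x) (%c d. F (a*[A]c) (b*[A]d)))"
 by (intro bilinI lin_smI bilinD(2,3)[OF F] AL lin_id; simp add: cl)
 show "sm H H (com H (lact H b x)) F = sm H H (lact2 B H H (acomul B b) (com H x)) F"
 unfolding la[OF m] comm[OF uc[OF m(1)] m(2) F] comu[OF m(1) F'] l(2)[OF cx F] by (simp add: la)
 qed
 show "com H (ract H x b) = ract (bull B H H) (com H x) b" unfolding bull_simps
 proof (rule tens_eqI[OF vH vH])
 show "com H (ract H x b) <: (tens H H)" by (rule linD(1)[OF cHD(2)]) (use m bimodD(3)[OF bH] in blast)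
 show "ract2 B H H (com H x) (acomul B b) <: (tens H H)" by (rule linD(1)[OF r(1) cx])
 fix F assume F: "bilin H H kk F"
 have F': "bilin H H kk (%c d. F (a*[A]c) (e*[A]d))" if "a <: H" "e <: H" for a e
 using that by (intro bilinI bilinD(2,3)[OF F] AL lin_id; simp add: cl)
 show "sm H H (com H (ract H x b)) F = sm H H (ract2 B H H (com H x) (acomul B b)) F"
 unfolding ra[OF m] comm[OF m(2) uc[OF m(1)] F] r(2)[OF cx F]
 by (subst sm_swap[of B B]) (simp add: comu[OF m(1) F'] ra)
 qed
 qed
 have ce: "cou H : bimod_maps B H (unit_J B)"
 proof -
 have "cou H (x*[A]y) = cou H x * cou H y" if "x <: H" "y <: H" for x y
 using A(12)[of x y] that by (simp add: sel)
 moreover have "cou H (unt H b) = eps B b" if "b <: B" for b using U(6)[OF that] by (simp add: sel)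
 ultimately show ?thesis
 using cmaps(2) by (simp add: bimod_maps_def lin_maps_iff lin_unit la ra uc)
 qed
 show ?thesis
 unfolding bimonoid_def
 proof (intro conjI ballI)
 show "circ_monoid B H" by (rule cm)
 show "bull_comonoid B H" unfolding bull_comonoid_def using bH co ce cH by blast
 fix t assume t: "t <: (circ B H H)"
 show "com H (mul H t) = tmap (circ B H H) (circ B H H) H H (mul H) (mul H)
 (interchange B H H H H (cmap B H H (bull B H H) (bull B H H) (com H) (com H) t))"
 proof (rule circ_lin_eq[OF bHH lin_o[OF cHD(2) lmul] mul_interchange(2)[OF co] t])
 fix x y assume k: "x <: H" "y <: H"
 show "com H (mul H (celt B H H x y)) = tmap (circ B H H) (circ B H H) H H (mul H) (mul H)
 (interchange B H H H H (cmap B H H (bull B H H) (bull B H H) (com H) (com H) (celt B H H x y)))"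
 proof (rule tens_eqI[OF vH vH])
 show "com H (mul H (celt B H H x y)) <: (tens H H)" by (rule linD(1)[OF lin_o[OF cHD(2) lmul] celt_closed[OF bHH k]])
 show "tmap (circ B H H) (circ B H H) H H (mul H) (mul H)
 (interchange B H H H H (cmap B H H (bull B H H) (bull B H H) (com H) (com H) (celt B H H x y))) <: (tens H H)"
 by (rule linD(1)[OF mul_interchange(2)[OF co] celt_closed[OF bHH k]])
 fix F assume F: "bilin H H kk F"
 show "sm H H (com H (mul H (celt B H H x y))) F = sm H H (tmap (circ B H H) (circ B H H) H H (mul H) (mul H)
 (interchange B H H H H (cmap B H H (bull B H H) (bull B H H) (com H) (com H) (celt B H H x y)))) F"
 unfolding mul_interchange(1)[OF co k F] mu[OF k] by (rule comm[OF k F])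
 qed
 qed
 next
 fix t assume t: "t <: (circ B H H)"
 have "cou H (x*[A]y) = cou H x * cou H y" if "x <: H" "y <: H" for x y
 using A(12)[of x y] that by (simp add: sel)
 thus "cou H (mul H t) = mult_J B (cmap B H H (unit_J B) (unit_J B) (cou H) (cou H) t)"
 by (intro circ_lin_eq[OF bHH lin_o[OF cHD(3) lmul] mul_counit(2)[OF ce] t]) (simp add: mul_counit(1)[OF ce] mu)
 next
 fix b assume b: "b <: B"
 show "com H (unt H b) = tmap (unit_I B) (unit_I B) H H (unt H) (unt H) (acomul B b)" "cou H (unt H b) = eps B b"
 using uA b unfolding bialg_maps_def tmapI sel by simp_all
 qed
qed

end

section \<open>The Hopf condition\<close>

text \<open>Lets the product of \<open>H\<close> with itself over \<open>B\<close> be an argument of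
  \<open>bull\<close>, as the Hopf condition requires.\<close>

lemma bimodule_circ:
 assumes vB: "vspace B" and X: "bimodule B X" and Y: "bimodule B Y"
 and Bm: "!!b b'. b <: B ==> b' <: B ==> b*[B]b' <: B" and B1: "aone B <: B"
 shows "bimodule B (circ B X Y)"
proof (rule bimoduleI)
 let ?C = "circ B X Y"
 note bXY = balanceable_bimod[OF X Y]
 note vC = vspace_circ[OF bXY]
 note ca = circ_act[OF X Y]
 note cc = linD(1)[OF ca(1)] linD(1)[OF ca(2)]
 note Xd = bimodD[OF X] and Yd = bimodD[OF Y]
 note cl = bilinD(2,3)[OF bilin_celt[OF bXY]]
 show "vspace ?C" by (rule vC)
 have "lin B ?C (%b. lact ?C b t) & lin B ?C (%b. ract ?C t b)" if "t <: ?C" for t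
 using bXY that
 proof (induction rule: circ_induct)
 case (celt x y)
 have "lin B ?C (%b. lact ?C b (celt B X Y x y)) = lin B ?C (%b. celt B X Y (lact X b x) y)"
 "lin B ?C (%b. ract ?C (celt B X Y x y) b) = lin B ?C (%b. celt B X Y x (ract Y y b))"
 by (rule lin_cong[OF _ vB]; simp add: ca(3,4) celt)+
 moreover have "lin B ?C (%b. celt B X Y (lact X b x) y)" "lin B ?C (%b. celt B X Y x (ract Y y b))"
 using cl(1)[OF bilinD(2)[OF Xd(4) lin_id]] cl(2)[OF bilinD(2)[OF Yd(5) lin_id]] celt by blast+
 ultimately show ?case by simp
 next
 case (add s t)
 have "lin B ?C (%b. lact ?C b (vadd ?C s t)) = lin B ?C (%b. vadd ?C (lact ?C b s) (lact ?C b t))"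
 "lin B ?C (%b. ract ?C (vadd ?C s t) b) = lin B ?C (%b. vadd ?C (ract ?C s b) (ract ?C t b))"
 by (rule lin_cong[OF _ vB]; simp add: linD(2)[OF ca(1)] linD(2)[OF ca(2)] add)+
 thus ?case using add by (simp add: lin_vadd[OF vC])
 qed
 thus "bilin B ?C ?C (lact ?C)" "bilin B ?C ?C (%b x. ract ?C x b)"
 using ca(1,2) by (simp_all add: bilin_def)
 fix t assume t: "t <: ?C"
 show "lact ?C (aone B) t = t" by (rule circ_lin_eq[OF bXY ca(1)[OF B1] lin_id t]) (simp add: ca(3) B1 Xd)
 show "ract ?C t (aone B) = t" by (rule circ_lin_eq[OF bXY ca(2)[OF B1] lin_id t]) (simp add: ca(4) B1 Yd)
 fix b b' assume b: "b <: B" "b' <: B"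
 show "lact ?C (b*[B]b') t = lact ?C b (lact ?C b' t)" by (rule circ_lin_eq[OF bXY ca(1)[OF Bm[OF b]] lin_o[OF ca(1)[OF b(1)] ca(1)[OF b(2)]] t]) (simp add: ca(3) b Bm Xd)
 show "ract ?C t (b*[B]b') = ract ?C (ract ?C t b) b'" by (rule circ_lin_eq[OF bXY ca(2)[OF Bm[OF b]] lin_o[OF ca(2)[OF b(2)] ca(2)[OF b(1)]] t]) (simp add: ca(4) b Bm Yd)
 show "ract ?C (lact ?C b t) b' = lact ?C b (ract ?C t b')" by (rule circ_lin_eq[OF bXY lin_o[OF ca(2)[OF b(2)] ca(1)[OF b(1)]] lin_o[OF ca(1)[OF b(1)] ca(2)[OF b(2)]] t])
 (simp add: ca(3,4) b Xd Yd)
qed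

lemma tmap_ract:
 assumes vB: "vspace B" and X: "bimodule B X" and Y: "bimodule B Y" and X': "bimodule B X'" and Y': "bimodule B Y'"
 and r: "r <: (tens B B)" and f: "lin X X' f" and g: "lin Y Y' g" and t: "t <: (tens X Y)"
 and fr: "!!b x. b <: B ==> x <: X ==> f (ract X x b) = ract X' (f x) b"
 and gr: "!!b y. b <: B ==> y <: Y ==> g (ract Y y b) = ract Y' (g y) b"
 shows "tmap X Y X' Y' f g (ract2 B X Y t r) = ract2 B X' Y' (tmap X Y X' Y' f g t) r"
proof -
 note v = bimodD(1)[OF X] bimodD(1)[OF Y] bimodD(1)[OF X'] bimodD(1)[OF Y']
 note p = ract2_props[OF vB X Y r] and p' = ract2_props[OF vB X' Y' r]
 note c = linD(1)[OF p(1) t] tmap_closed[OF v f g t]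
 show ?thesis
 proof (rule tens_eqI[OF v(3,4) tmap_closed[OF v f g c(1)] linD(1)[OF p'(1) c(2)]])
 fix F assume F: "bilin X' Y' kk F"
 have F1: "bilin X Y kk (%x y. F (f x) (g y))" by (intro bilinI bilinD(2,3)[OF F] f g linD(1)[OF f] linD(1)[OF g])
 have F2: "bilin X' Y' kk (%x y. F (ract X' x b) (ract Y' y b'))" if "b <: B" "b' <: B" for b b'
 using that by (intro bilinI bilinD(2,3)[OF F] bilinD(3)[OF bimodD(5)[OF X'] lin_id] bilinD(3)[OF bimodD(5)[OF Y'] lin_id]
 bimodD(3)[OF X'] bimodD(3)[OF Y'])
 show "sm X' Y' (tmap X Y X' Y' f g (ract2 B X Y t r)) F = sm X' Y' (ract2 B X' Y' (tmap X Y X' Y' f g t) r) F"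
 unfolding sm_tmap[OF v f g c(1) F] p(2)[OF t F1] p'(2)[OF c(2) F]
 by (rule smc) (simp add: sm_tmap[OF v f g t F2] fr gr)
 qed
qed

lemma tmap_lact:
 assumes vB: "vspace B" and X: "bimodule B X" and Y: "bimodule B Y" and X': "bimodule B X'" and Y': "bimodule B Y'"
 and r: "r <: (tens B B)" and f: "lin X X' f" and g: "lin Y Y' g" and t: "t <: (tens X Y)"
 and fr: "!!b x. b <: B ==> x <: X ==> f (lact X b x) = lact X' b (f x)"
 and gr: "!!b y. b <: B ==> y <: Y ==> g (lact Y b y) = lact Y' b (g y)"
 shows "tmap X Y X' Y' f g (lact2 B X Y r t) = lact2 B X' Y' r (tmap X Y X' Y' f g t)"
proof -
 note v = bimodD(1)[OF X] bimodD(1)[OF Y] bimodD(1)[OF X'] bimodD(1)[OF Y']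
 note p = lact2_props[OF vB X Y r] and p' = lact2_props[OF vB X' Y' r]
 note c = linD(1)[OF p(1) t] tmap_closed[OF v f g t]
 show ?thesis
 proof (rule tens_eqI[OF v(3,4) tmap_closed[OF v f g c(1)] linD(1)[OF p'(1) c(2)]])
 fix F assume F: "bilin X' Y' kk F"
 have F1: "bilin X Y kk (%x y. F (f x) (g y))" by (intro bilinI bilinD(2,3)[OF F] f g linD(1)[OF f] linD(1)[OF g])
 have F2: "bilin X' Y' kk (%x y. F (lact X' b x) (lact Y' b' y))" if "b <: B" "b' <: B" for b b'
 using that by (intro bilinI bilinD(2,3)[OF F] bilinD(3)[OF bimodD(4)[OF X'] lin_id] bilinD(3)[OF bimodD(4)[OF Y'] lin_id]
 bimodD(2)[OF X'] bimodD(2)[OF Y'])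
 show "sm X' Y' (tmap X Y X' Y' f g (lact2 B X Y r t)) F = sm X' Y' (lact2 B X' Y' r (tmap X Y X' Y' f g t)) F"
 unfolding sm_tmap[OF v f g c(1) F] p(2)[OF t F1] p'(2)[OF c(2) F]
 by (rule smc) (simp add: sm_tmap[OF v f g t F2] fr gr)
 qed
qed

text \<open>The antipode identity evaluated at 1, whose coproduct is
  \<open>1 \<otimes> 1\<close>.\<close>

lemma antipode_one:
 assumes H: "hopf_algebra H"
 shows "antipode H (aone H) = aone H"
proof -
 note H' = bialgD[OF hopfD[OF H]] algebraD[OF bialgD(1)[OF hopfD[OF H]]]
 note c = antipode_closed[OF H]
 show ?thesis
 proof (rule functional_eqI[OF H'(3) c[OF H'(16)] H'(16)])
 fix ph assume ph: "lin H kk ph"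
 have "bilin H H kk (%a b. ph (antipode H a*[H]b))" by (intro bilinI lin_o[OF ph] alg_lin[OF H'(1)] lin_antipode[OF H] lin_id; simp add: c)
 from H'(11)[OF this] show "ph (antipode H (aone H)) = ph (aone H)"
 using antipode_inv(1)[OF H H'(16) ph] by (simp add: H'(13,16,19) c)
 qed
qed

locale corr_bialg = corr B S H A
 for B :: "('k::field, 'b, 'z) bialg_scheme" and S and H :: "('k, 'b, 'v, 'hz) bimon_scheme"
 and A :: "('k, 'v, 'az) bialg_scheme" +
 assumes bA: "bialgebra A" and uA: "unt H : bialg_maps B A"
begin

abbreviation "I' == unit_I B"
abbreviation "J' == unit_J B"
abbreviation "u == unt H"

lemmas bm = from_bialg[OF bA uA]
lemma mulb: "mul H : bimod_maps B (circ B H H) H" and comb: "com H : bimod_maps B H (bull B H H)"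
 and coub: "cou H : bimod_maps B H (unit_J B)"
 using bm unfolding bimonoid_def circ_monoid_def bull_comonoid_def by blast+

lemmas Ad = bialgD[OF bA, unfolded sel tensA linA bilinA] algebraD[OF bialgD(1)[OF bA], unfolded sel linA bilinA]
lemmas Au = bmapD[OF uA bB bA, unfolded sel tensA linA bilinA]
lemma AL: "lin V H f ==> y <: H ==> lin V H (%v. f v*[A]y)" "lin V H f ==> y <: H ==> lin V H (%v. y*[A]f v)"
 for V :: "('k, 'w, 'wz) vect_scheme" and f y
 using alg_lin[OF bialgD(1)[OF bA], of V f y] by (simp_all add: linA sel)
lemmas bHH' = bimodule_circ[OF B(3) bH bH B(20,16)]
lemmas lS = lin_antipode[OF hopf_B]
lemmas Sc = antipode_closed[OF hopf_B]
lemmas hl = bilinI lin_smI AL BL lin_id lin_o[OF Au(1)] lin_o[OF lS]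
lemmas hc = Ad(20) Au(2) Sc B(20,16)
lemma vI: "vspace I'" "vspace J'"
 using bimodD(1)[OF bimodule_I] bimodD(1)[OF bimodule_J] .

lemma smI: "sm H I' = sm H B" "sm I' H = sm B H" "tens H I' = tens H B" "elt H I' = elt H B" "tens I' H = tens B H" "elt I' H = elt B H"
 by (rule tens_cong; simp)+

text \<open>\<open>G1\<close> and \<open>G2\<close> map \<open>H\<close> linearly into the targets
  of the two Hopf identities; on linear forms both sides reduce to their values.\<close>

definition "G1 z = celt B (bull B H I') J' (elt H I' z (aone B)) 1"
definition "G2 z = celt B J' (bull B I' H) 1 (elt I' H (aone B) z)"

lemmas balG = bull_balanceable(2)[OF bH bimodule_I bimodule_J bimodule_J] bull_balanceable(3)[OF bimodule_I bH bimodule_J bimodule_J]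

lemma lin_G: "lin H (circ B (bull B H I') J') G1" "lin H (circ B J' (bull B I' H)) G2"
proof -
 have l: "lin H (bull B H I') (%z. elt H I' z (aone B))" "lin H (bull B I' H) (%z. elt I' H (aone B) z)"
 unfolding lin_unit using lin_elt(1)[OF vH vI(1) lin_id] lin_elt(2)[OF vI(1) vH lin_id] B(16) by simp_all
 show "lin H (circ B (bull B H I') J') G1" "lin H (circ B J' (bull B I' H)) G2"
 unfolding G1_def[abs_def] G2_def[abs_def]
 using bilinD(2)[OF bilin_celt[OF balG(1)] l(1)] bilinD(3)[OF bilin_celt[OF balG(2)] l(2)] by simp_all
qed

text \<open>The retraction sends the class of \<open>h\<close>, \<open>b\<close>, \<open>c\<close>
  to \<open>c h u(S b)\<close>. It is balanced because acting by \<open>d\<close> gives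
  \<open>h u(d1) u(S(b d2))\<close>, in which \<open>d1 S(d2)\<close> collapses to the counit of
  \<open>d\<close>.\<close>

lemma G1_inverse: "\<exists>R. lin (circ B (bull B H I') J') H R & (\<forall>z\<in>car H. R (G1 z) = z)"
proof -
 let ?r = "%t. tlift H B H (%h b. h*[A]u (antipode B b)) t"
 have b: "bilin H B H (%h b. h*[A]u (antipode B b))" by (intro hl; simp add: hc)
 have r: "lin (tens H B) H ?r" by (rule lin_mapsD[OF tlift_maps(1)[OF vH B(3) vH b]])
 have f: "bilin (bull B H I') J' H (%t c. vsmul H c (?r t))"
 unfolding bilin_def lin_unit smI bull_simps using linD(1)[OF r] vH r by (simp add: lin_vsmul lin_vsmul_left)
 have k: "?r (ract2 B H I' t (acomul B c)) = vsmul H (eps B c) (?r t)"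
 if t: "t <: (tens H B)" and c: "c <: B" for t c
 proof (rule functional_eqI[OF vH])
 note p = ract2_props[OF B(3) bH bimodule_I B(6)[OF c], unfolded smI]
 have t': "ract2 B H I' t (acomul B c) <: (tens H B)" using linD(1)[OF p(1) t] .
 show "?r (ract2 B H I' t (acomul B c)) <: H" "vsmul H (eps B c) (?r t) <: H"
 using linD(1)[OF r] t t' vH by simp_all
 fix ph assume ph: "lin H kk ph"
 have F: "bilin H B kk (%h b. ph (h*[A]u (antipode B b)))" by (intro hl lin_o[OF ph]; simp add: hc)
 hence F': "bilin H I' kk (%h b. ph (h*[A]u (antipode B b)))" by (simp add: bilin_def lin_unit)
 have "ph (?r (ract2 B H I' t (acomul B c))) = dl B c (%b b'. sm H B t (%x y. ph (ract H x b*[A]u (antipode B (y*[B]b')))))"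
 unfolding functional_tlift[OF vH B(3) vH b ph t'] p(2)[OF t F'] by simp
 also have "... = sm H B t (%x y. dl B c (%b b'. ph (ract H x b*[A]u (antipode B (y*[B]b')))))" by (rule sm_swap)
 also have "... = sm H B t (%x y. eps B c * ph (x*[A]u (antipode B y)))"
 proof (rule smc)
 fix x y assume m: "x <: H" "y <: B"
 have "dl B c (%b b'. ph (ract H x b*[A]u (antipode B (y*[B]b')))) = dl B c (%b b'. ph (x*[A]u (b*[B]antipode B b')*[A]u (antipode B y)))"
 using m by (simp add: ra antipode_mult[OF hopf_B] Au(3) Ad(17) hc)
 also have "... = eps B c * ph (x*[A]u (aone B)*[A]u (antipode B y))"
 by (rule antipode_inv(2)[OF hopf_B c]) (use m in \<open>intro hl lin_o[OF ph]; simp add: hc\<close>)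
 finally show "dl B c (%b b'. ph (ract H x b*[A]u (antipode B (y*[B]b')))) = eps B c * ph (x*[A]u (antipode B y))"
 using m by (simp add: Au(4) Ad(18) hc)
 qed
 also have "... = ph (vsmul H (eps B c) (?r t))"
 using functional_tlift[OF vH B(3) vH b ph t] linD(3)[OF ph linD(1)[OF r t]] by (simp add: sm_mult_left)
 finally show "ph (?r (ract2 B H I' t (acomul B c))) = ph (vsmul H (eps B c) (?r t))" .
 qed
 have ba: "balanced B (bull B H I') J' (%t c. vsmul H c (?r t))"
 using k linD(1)[OF r] vspaceD(5)[OF vH] by (simp add: smI mult.commute)
 note cp = clift_maps[OF balG(1) vH f ba]
 have "clift B (bull B H I') J' H (%t c. vsmul H c (?r t)) (G1 z) = z" if "z <: H" for z
 unfolding G1_def using that cp(2)[of "elt H B z (aone B)" 1] vH B(3) b by (simp add: smI hc Au(4) Ad antipode_one[OF hopf_B])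
 thus ?thesis using cp(1) by blast
qed

text \<open>Mirror image of \<open>G1_inverse\<close>, with values
  \<open>c u(S b) h\<close>.\<close>

lemma G2_inverse: "\<exists>R. lin (circ B J' (bull B I' H)) H R & (\<forall>z\<in>car H. R (G2 z) = z)"
proof -
 let ?r = "%t. tlift B H H (%b h. u (antipode B b)*[A]h) t"
 have b: "bilin B H H (%b h. u (antipode B b)*[A]h)" by (intro hl; simp add: hc)
 have r: "lin (tens B H) H ?r" by (rule lin_mapsD[OF tlift_maps(1)[OF B(3) vH vH b]])
 have f: "bilin J' (bull B I' H) H (%c t. vsmul H c (?r t))"
 unfolding bilin_def lin_unit smI bull_simps using linD(1)[OF r] vH r by (simp add: lin_vsmul lin_vsmul_left)
 have k: "?r (lact2 B I' H (acomul B c) t) = vsmul H (eps B c) (?r t)"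
 if t: "t <: (tens B H)" and c: "c <: B" for t c
 proof (rule functional_eqI[OF vH])
 note p = lact2_props[OF B(3) bimodule_I bH B(6)[OF c], unfolded smI]
 have t': "lact2 B I' H (acomul B c) t <: (tens B H)" using linD(1)[OF p(1) t] .
 show "?r (lact2 B I' H (acomul B c) t) <: H" "vsmul H (eps B c) (?r t) <: H"
 using linD(1)[OF r] t t' vH by simp_all
 fix ph assume ph: "lin H kk ph"
 have F: "bilin B H kk (%b h. ph (u (antipode B b)*[A]h))" by (intro hl lin_o[OF ph]; simp add: hc)
 hence F': "bilin I' H kk (%b h. ph (u (antipode B b)*[A]h))" by (simp add: bilin_def lin_unit)
 have "ph (?r (lact2 B I' H (acomul B c) t)) = dl B c (%b b'. sm B H t (%y x. ph (u (antipode B (b*[B]y))*[A]lact H b' x)))"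
 unfolding functional_tlift[OF B(3) vH vH b ph t'] p(2)[OF t F'] by simp
 also have "... = sm B H t (%y x. dl B c (%b b'. ph (u (antipode B (b*[B]y))*[A]lact H b' x)))" by (rule sm_swap)
 also have "... = sm B H t (%y x. eps B c * ph (u (antipode B y)*[A]x))"
 proof (rule smc)
 fix x y assume m: "y <: B" "x <: H"
 have "dl B c (%b b'. ph (u (antipode B (b*[B]y))*[A]lact H b' x)) = dl B c (%b b'. ph (u (antipode B y)*[A]u (antipode B b*[B]b')*[A]x))"
 using m by (simp add: la antipode_mult[OF hopf_B] Au(3) Ad(17) hc)
 also have "... = eps B c * ph (u (antipode B y)*[A]u (aone B)*[A]x)"
 by (rule antipode_inv(1)[OF hopf_B c]) (use m in \<open>intro hl lin_o[OF ph]; simp add: hc\<close>)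
 finally show "dl B c (%b b'. ph (u (antipode B (b*[B]y))*[A]lact H b' x)) = eps B c * ph (u (antipode B y)*[A]x)"
 using m by (simp add: Au(4) Ad(18) hc)
 qed
 also have "... = ph (vsmul H (eps B c) (?r t))"
 using functional_tlift[OF B(3) vH vH b ph t] linD(3)[OF ph linD(1)[OF r t]] by (simp add: sm_mult_left)
 finally show "ph (?r (lact2 B I' H (acomul B c) t)) = ph (vsmul H (eps B c) (?r t))" .
 qed
 have ba: "balanced B J' (bull B I' H) (%c t. vsmul H c (?r t))"
 using k linD(1)[OF r] vspaceD(5)[OF vH] by (simp add: smI mult.commute)
 note cp = clift_maps[OF balG(2) vH f ba]
 have "clift B J' (bull B I' H) H (%c t. vsmul H c (?r t)) (G2 z) = z" if "z <: H" for z
 unfolding G2_def using that cp(2)[of 1 "elt B H (aone B) z"] vH B(3) b by (simp add: smI hc Au(4) Ad antipode_one[OF hopf_B])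
 thus ?thesis using cp(1) by blast
qed

end

context corr_bialg
begin

abbreviation "HH == circ B H H"
abbreviation "Hr == reversion B H"

lemma vHr: "vspace Hr" and vHH: "vspace HH"
 using vH vspace_cong[of Hr H] vspace_circ[OF bHH] by simp_all

text \<open>The left side amounts to \<open>G1\<close> of the convolution product and the right side
  to a multiple of \<open>G1\<close> of the unit. Linearity of \<open>G1\<close> gives one
  implication, its retraction the other.\<close>

lemma hopf_side1:
 assumes s: "lin H H s" and h: "h <: H"
 shows "cmap B (bull B HH I') J' (bull B H I') J' (tmap HH I' H I' (mul H) (idm I')) (idm J')
 (phi B H H (tmap H H H Hr (idm H) s (com H h)))
 = vsmul (circ B (bull B H I') J') (cou H h) (celt B (bull B H I') J' (elt H I' (u (aone B)) (aone B)) 1)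
 <-> (\<forall>ph. lin H kk ph --> sm H H (com H h) (%a b. ph (a*[A]s b)) = cou H h * ph (u (aone B)))"
 (is "?l = ?r <-> ?Q")
proof -
 let ?U = "bull B H I'" and ?UU = "bull B HH I'"
 let ?C1 = "circ B ?U J'" and ?C2 = "circ B ?UU J'"
 let ?P = "%x y. celt B ?UU J' (elt HH I' (celt B H H x y) (aone B)) 1"
 let ?tm = "tmap HH I' H I' (mul H) (idm I')"
 note bal2 = bull_balanceable(2)[OF bHH' bimodule_I bimodule_J bimodule_J]
 note vC1 = vspace_circ[OF balG(1)] and vC2 = vspace_circ[OF bal2]
 note ltm = lin_tmap[OF vHH vI(1) vH vI(1) lmul lin_idm[OF vI(1)]]
 have lt: "lin ?UU ?U ?tm" using ltm by (simp only: lin_unit)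
 have tr: "?tm (ract ?UU t b) = ract ?U (?tm t) b" if "b <: B" "t <: ?UU" for b t
 unfolding bull_simps by (rule tmap_ract[OF B(3) bHH' bimodule_I bH bimodule_I B(6)[OF that(1)] lmul lin_idm[OF vI(1)]])
 (use that bimod_mapD(5)[OF mulb] B(20) in simp_all)
 note cp = cmap_props[OF bal2 balG(1) lt lin_idm[OF vI(2)] tr]
 have cl: "lin ?C2 ?C1 (cmap B ?UU J' ?U J' ?tm (idm J'))" by (rule cp(1); simp)
 have cP: "cmap B ?UU J' ?U J' ?tm (idm J') (?P x y) = G1 (x*[A]y)" if "x <: H" "y <: H" for x y
 proof -
 have e: "elt HH I' (celt B H H x y) (aone B) <: ?UU" "(1::'k) <: J'"
 using celt_closed[OF bHH that] B(16) vHH vI(1) by simp_all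
 have "cmap B ?UU J' ?U J' ?tm (idm J') (?P x y) = celt B ?U J' (?tm (elt HH I' (celt B H H x y) (aone B))) (idm J' 1)"
 by (rule cp(2)) (use e in simp_all)
 also have "?tm (elt HH I' (celt B H H x y) (aone B)) = elt H I' (mul H (celt B H H x y)) (idm I' (aone B))"
 by (rule tmap_elt[OF vHH vI(1) vH vI(1) lmul lin_idm[OF vI(1)] celt_closed[OF bHH that]]) (simp add: B(16))
 finally have e2: "cmap B ?UU J' ?U J' ?tm (idm J') (?P x y) = celt B ?U J' (elt H I' (mul H (celt B H H x y)) (idm I' (aone B))) (idm J' 1)" .
 show ?thesis unfolding e2 using that by (simp add: G1_def mu B(16))
 qed
 have bP: "bilin H Hr ?C2 ?P"
 unfolding bilin_def lin_unit
 proof (intro conjI ballI)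
 fix x assume x: "x <: H"
 have "lin H ?UU (%y. elt HH I' (celt B H H x y) (aone B))"
 unfolding lin_unit using lin_elt(1)[OF vHH vI(1)] bilinD(3)[OF bilin_celt[OF bHH] lin_id x] B(16) by simp
 thus "lin H ?C2 (%y. ?P x y)" using bilinD(2)[OF bilin_celt[OF bal2]] by simp
 next
 fix x assume "x <: Hr"
 hence x: "x <: H" by simp
 have "lin H ?UU (%y. elt HH I' (celt B H H y x) (aone B))"
 unfolding lin_unit using lin_elt(1)[OF vHH vI(1)] bilinD(2)[OF bilin_celt[OF bHH] lin_id x] B(16) by simp
 thus "lin H ?C2 (%y. ?P y x)" using bilinD(2)[OF bilin_celt[OF bal2]] by simp
 qed
 have lr: "lin H Hr s" using s by (simp only: lin_unit)
 note ii = lin_idm[OF vH]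
 have ch: "com H h <: (tens H H)" using Ad(6)[OF h] .
 note tc = tmap_closed[OF vH vH vH vHr ii lr ch]
 have L: "ph ?l = sm H H (com H h) (%a b. ph (G1 (a*[A]s b)))" if ph: "lin ?C1 kk ph" for ph
 proof -
 have F: "bilin H Hr kk (%x y. ph (G1 (x*[A]y)))"
 unfolding bilin_def lin_unit by (simp add: lin_o[OF ph lin_o[OF lin_G(1)]] AL)
 have "ph ?l = sm H Hr (tmap H H H Hr (idm H) s (com H h)) (%x y. ph (cmap B ?UU J' ?U J' ?tm (idm J') (?P x y)))"
 unfolding phi_def Let_def by (rule functional_tlift[OF vH vHr vC2 bP lin_o[OF ph cl] tc])
 also have "... = sm H Hr (tmap H H H Hr (idm H) s (com H h)) (%x y. ph (G1 (x*[A]y)))"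
 by (rule smc) (simp only: cP reversion_simps)
 also have "... = sm H H (com H h) (%a b. ph (G1 (a*[A]s b)))"
 unfolding sm_tmap[OF vH vH vH vHr ii lr ch F] by (rule smc) simp
 finally show ?thesis .
 qed
 have g1: "celt B ?U J' (elt H I' (u (aone B)) (aone B)) 1 = G1 (u (aone B))" by (simp add: G1_def)
 have rc: "G1 (u (aone B)) <: ?C1" using linD(1)[OF lin_G(1)] Au(2) B(16) by blast
 have R: "ph ?r = cou H h * ph (G1 (u (aone B)))" if ph: "lin ?C1 kk ph" for ph
 unfolding g1 using linD(3)[OF ph rc] by simp
 have lc: "?l <: ?C1"
 unfolding phi_def Let_def by (rule linD(1)[OF cl tlift_closed[OF vH vHr vC2 bP tc]])
 show ?thesis
 proof
 assume e: "?l = ?r"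
 obtain R where R': "lin ?C1 H R" "!!z. z <: H ==> R (G1 z) = z" using G1_inverse by blast
 show ?Q
 proof (intro allI impI)
 fix ps assume ps: "lin H kk ps"
 note l = lin_o[OF ps R'(1)]
 have "sm H H (com H h) (%a b. ps (R (G1 (a*[A]s b)))) = cou H h * ps (R (G1 (u (aone B))))"
 using L[OF l] R[OF l] unfolding e by simp
 thus "sm H H (com H h) (%a b. ps (a*[A]s b)) = cou H h * ps (u (aone B))"
 using R'(2) linD(1)[OF s] by (simp add: Ad(20) Au(2) B(16))
 qed
 next
 assume q: ?Q
 show "?l = ?r"
 proof (rule functional_eqI[OF vC1 lc])
 show "?r <: ?C1" unfolding g1 using vC1 rc by simp
 show "ph ?l = ph ?r" if ph: "lin ?C1 kk ph" for ph
 using q lin_o[OF ph lin_G(1)] unfolding L[OF ph] R[OF ph] by blast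
 qed
 qed
qed

lemma hopf_side2:
 assumes s: "lin H H s" and h: "h <: H"
 shows "cmap B J' (bull B I' HH) J' (bull B I' H) (idm J') (tmap I' HH I' H (idm I') (mul H))
 (psi B H H (tmap H H Hr H s (idm H) (com H h)))
 = vsmul (circ B J' (bull B I' H)) (cou H h) (celt B J' (bull B I' H) 1 (elt I' H (aone B) (u (aone B))))
 <-> (\<forall>ph. lin H kk ph --> sm H H (com H h) (%a b. ph (s a*[A]b)) = cou H h * ph (u (aone B)))"
 (is "?l = ?r <-> ?Q")
proof -
 let ?U = "bull B I' H" and ?UU = "bull B I' HH"
 let ?C1 = "circ B J' ?U" and ?C2 = "circ B J' ?UU"
 let ?P = "%x y. celt B J' ?UU 1 (elt I' HH (aone B) (celt B H H x y))"
 let ?tm = "tmap I' HH I' H (idm I') (mul H)"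
 note bal2 = bull_balanceable(3)[OF bimodule_I bHH' bimodule_J bimodule_J]
 note vC1 = vspace_circ[OF balG(2)] and vC2 = vspace_circ[OF bal2]
 note ltm = lin_tmap[OF vI(1) vHH vI(1) vH lin_idm[OF vI(1)] lmul]
 have lt: "lin ?UU ?U ?tm" using ltm by (simp only: lin_unit)
 have tr: "?tm (lact ?UU b t) = lact ?U b (?tm t)" if "b <: B" "t <: ?UU" for b t
 unfolding bull_simps by (rule tmap_lact[OF B(3) bimodule_I bHH' bimodule_I bH B(6)[OF that(1)] lin_idm[OF vI(1)] lmul])
 (use that bimod_mapD(4)[OF mulb] B(20) in simp_all)
 have ir: "idm J' (ract J' x b) = ract J' (idm J' x) b" if "b <: B" "x <: J'" for b x by simp
 note cp = cmap_props[OF bal2 balG(2) lin_idm[OF vI(2)] lt ir tr]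
 have cl: "lin ?C2 ?C1 (cmap B J' ?UU J' ?U (idm J') ?tm)" by (rule cp(1))
 have cP: "cmap B J' ?UU J' ?U (idm J') ?tm (?P x y) = G2 (x*[A]y)" if "x <: H" "y <: H" for x y
 proof -
 have e: "elt I' HH (aone B) (celt B H H x y) <: ?UU" "(1::'k) <: J'"
 using celt_closed[OF bHH that] B(16) vHH vI(1) by simp_all
 have "cmap B J' ?UU J' ?U (idm J') ?tm (?P x y) = celt B J' ?U (idm J' 1) (?tm (elt I' HH (aone B) (celt B H H x y)))"
 by (rule cp(2)) (use e in simp_all)
 also have "?tm (elt I' HH (aone B) (celt B H H x y)) = elt I' H (idm I' (aone B)) (mul H (celt B H H x y))"
 by (rule tmap_elt[OF vI(1) vHH vI(1) vH lin_idm[OF vI(1)] lmul _ celt_closed[OF bHH that]]) (simp add: B(16))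
 finally have e2: "cmap B J' ?UU J' ?U (idm J') ?tm (?P x y) = celt B J' ?U (idm J' 1) (elt I' H (idm I' (aone B)) (mul H (celt B H H x y)))" .
 show ?thesis unfolding e2 using that by (simp add: G2_def mu B(16))
 qed
 have bP: "bilin Hr H ?C2 ?P"
 unfolding bilin_def lin_unit
 proof (intro conjI ballI)
 fix x assume "x <: Hr"
 hence x: "x <: H" by simp
 have "lin H ?UU (%y. elt I' HH (aone B) (celt B H H x y))" "lin H ?UU (%y. elt I' HH (aone B) (celt B H H y x))"
 unfolding lin_unit using lin_elt(2)[OF vI(1) vHH] bilinD(2,3)[OF bilin_celt[OF bHH] lin_id x] B(16) by simp_all
 thus "lin H ?C2 (%y. ?P x y)" using bilinD(3)[OF bilin_celt[OF bal2]] by simp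
 next
 fix x assume x: "x <: H"
 have "lin H ?UU (%y. elt I' HH (aone B) (celt B H H y x))"
 unfolding lin_unit using lin_elt(2)[OF vI(1) vHH] bilinD(2,3)[OF bilin_celt[OF bHH] lin_id x] B(16) by simp_all
 thus "lin H ?C2 (%y. ?P y x)" using bilinD(3)[OF bilin_celt[OF bal2]] by simp
 qed
 have lr: "lin H Hr s" using s by (simp only: lin_unit)
 note ii = lin_idm[OF vH]
 have ch: "com H h <: (tens H H)" using Ad(6)[OF h] .
 note tc = tmap_closed[OF vH vH vHr vH lr ii ch]
 have L: "ph ?l = sm H H (com H h) (%a b. ph (G2 (s a*[A]b)))" if ph: "lin ?C1 kk ph" for ph
 proof -
 have F: "bilin Hr H kk (%x y. ph (G2 (x*[A]y)))"
 unfolding bilin_def lin_unit by (simp add: lin_o[OF ph lin_o[OF lin_G(2)]] AL)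
 have "ph ?l = sm Hr H (tmap H H Hr H s (idm H) (com H h)) (%x y. ph (cmap B J' ?UU J' ?U (idm J') ?tm (?P x y)))"
 unfolding psi_def Let_def by (rule functional_tlift[OF vHr vH vC2 bP lin_o[OF ph cl] tc])
 also have "... = sm Hr H (tmap H H Hr H s (idm H) (com H h)) (%x y. ph (G2 (x*[A]y)))"
 by (rule smc) (simp only: cP reversion_simps)
 also have "... = sm H H (com H h) (%a b. ph (G2 (s a*[A]b)))"
 unfolding sm_tmap[OF vH vH vHr vH lr ii ch F] by (rule smc) simp
 finally show ?thesis .
 qed
 have g1: "celt B J' ?U 1 (elt I' H (aone B) (u (aone B))) = G2 (u (aone B))" by (simp add: G2_def)
 have rc: "G2 (u (aone B)) <: ?C1" using linD(1)[OF lin_G(2)] Au(2) B(16) by blast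
 have R: "ph ?r = cou H h * ph (G2 (u (aone B)))" if ph: "lin ?C1 kk ph" for ph
 unfolding g1 using linD(3)[OF ph rc] by simp
 have lc: "?l <: ?C1"
 unfolding psi_def Let_def by (rule linD(1)[OF cl tlift_closed[OF vHr vH vC2 bP tc]])
 show ?thesis
 proof
 assume e: "?l = ?r"
 obtain R where R': "lin ?C1 H R" "!!z. z <: H ==> R (G2 z) = z" using G2_inverse by blast
 show ?Q
 proof (intro allI impI)
 fix ps assume ps: "lin H kk ps"
 note l = lin_o[OF ps R'(1)]
 have "sm H H (com H h) (%a b. ps (R (G2 (s a*[A]b)))) = cou H h * ps (R (G2 (u (aone B))))"
 using L[OF l] R[OF l] unfolding e by simp
 thus "sm H H (com H h) (%a b. ps (s a*[A]b)) = cou H h * ps (u (aone B))"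
 using R'(2) linD(1)[OF s] by (simp add: Ad(20) Au(2) B(16))
 qed
 next
 assume q: ?Q
 show "?l = ?r"
 proof (rule functional_eqI[OF vC1 lc])
 show "?r <: ?C1" unfolding g1 using vC1 rc by simp
 show "ph ?l = ph ?r" if ph: "lin ?C1 kk ph" for ph
 using q lin_o[OF ph lin_G(2)] unfolding L[OF ph] R[OF ph] by blast
 qed
 qed
qed

text \<open>Linearity over \<open>B\<close> of the antipode as a map to the reversion is automatic:
  antipodes reverse products and commute with the units, which is exactly how \<open>B\<close> acts
  on \<open>Hr\<close>.\<close>

lemma hopf_iff: "hopf_monoid B H <-> hopf_algebra A"
proof -
 have anti: "is_antipode A s <-> s : lin_maps H H & (\<forall>h\<in>car H.
 (\<forall>ph. lin H kk ph --> sm H H (com H h) (%a b. ph (a*[A]s b)) = cou H h * ph (u (aone B))) &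
 (\<forall>ph. lin H kk ph --> sm H H (com H h) (%a b. ph (s a*[A]b)) = cou H h * ph (u (aone B))))" for s
 unfolding is_antipode_iff[OF bA] linA tensA sel one by blast
 have lm: "s : lin_maps H Hr <-> s : lin_maps H H" for s by (simp add: lin_maps_iff lin_unit)
 show ?thesis
 proof
 assume "hopf_monoid B H"
 then obtain s where s: "s : bimod_maps B H Hr" and e: "\<forall>h\<in>car H.
 cmap B (bull B HH I') J' (bull B H I') J' (tmap HH I' H I' (mul H) (idm I')) (idm J')
 (phi B H H (tmap H H H Hr (idm H) s (com H h)))
 = vsmul (circ B (bull B H I') J') (cou H h) (celt B (bull B H I') J' (elt H I' (u (aone B)) (aone B)) 1) &
 cmap B J' (bull B I' HH) J' (bull B I' H) (idm J') (tmap I' HH I' H (idm I') (mul H))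
 (psi B H H (tmap H H Hr H s (idm H) (com H h)))
 = vsmul (circ B J' (bull B I' H)) (cou H h) (celt B J' (bull B I' H) 1 (elt I' H (aone B) (u (aone B))))"
 unfolding hopf_monoid_def Let_def by blast
 have sl: "s : lin_maps H H" using s lm unfolding bimod_maps_def by blast
 have "is_antipode A s"
 unfolding anti using sl e hopf_side1[OF lin_mapsD[OF sl]] hopf_side2[OF lin_mapsD[OF sl]] by simp
 thus "hopf_algebra A" unfolding hopf_algebra_def using bA by blast
 next
 assume hA: "hopf_algebra A"
 let ?s = "antipode A"
 have a: "is_antipode A ?s" by (rule antipode_is_antipode[OF hA])
 hence sl: "?s : lin_maps H H" by (simp add: anti)
 have sc: "?s x <: H" if "x <: H" for x using linD(1)[OF lin_mapsD[OF sl] that] .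
 have su: "?s (u b) = u (antipode B b)" if "b <: B" for b
 using bialg_map_antipode[OF hopf_B hA uA that] by simp
 have sm: "?s (x*[A]y) = ?s y*[A]?s x" if "x <: H" "y <: H" for x y
 using antipode_mult[OF hA] that by (simp add: sel)
 have "?s : bimod_maps B H Hr"
 unfolding bimod_maps_def using sl lm by (simp add: la ra sm su sc hc)
 moreover have "\<forall>h\<in>car H.
 cmap B (bull B HH I') J' (bull B H I') J' (tmap HH I' H I' (mul H) (idm I')) (idm J')
 (phi B H H (tmap H H H Hr (idm H) ?s (com H h)))
 = vsmul (circ B (bull B H I') J') (cou H h) (celt B (bull B H I') J' (elt H I' (u (aone B)) (aone B)) 1) &
 cmap B J' (bull B I' HH) J' (bull B I' H) (idm J') (tmap I' HH I' H (idm I') (mul H))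
 (psi B H H (tmap H H Hr H ?s (idm H) (com H h)))
 = vsmul (circ B J' (bull B I' H)) (cou H h) (celt B J' (bull B I' H) 1 (elt I' H (aone B) (u (aone B))))"
 using a hopf_side1[OF lin_mapsD[OF sl]] hopf_side2[OF lin_mapsD[OF sl]] unfolding anti by simp
 ultimately show "hopf_monoid B H" unfolding hopf_monoid_def Let_def using bm by blast
 qed
qed

text \<open>With actions given by multiplication by the unit, the two actions of \<open>S\<close>
  and its inverse in the braiding are the conjugation in \<open>qc\<close>.\<close>

lemma cocommutative_iff: "cocommutative B S H <-> qc A u"
proof -
 note l2 = lact2_props[OF B(3) bH bH S_closed(2)] and r2 = ract2_props[OF B(3) bH bH S_closed(1)]
 let ?f = "%x y. ract2 B H H (lact2 B H H Si (elt H H y x)) S"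
 have b: "bilin H H (tens H H) ?f" by (intro bilinI lin_o[OF r2(1)] lin_o[OF l2(1)] lin_elt[OF vH vH] lin_id)
 have br: "braiding B S H H = tlift H H (tens H H) ?f" by (simp add: braiding_def Si_def)
 have fs: "sm H H (?f x y) F = si (%s' t'. ss (%s t. F (u s'*[A]y*[A]u s) (u t'*[A]x*[A]u t)))"
 if m: "x <: H" "y <: H" and F: "bilin H H kk F" for x y F
 proof -
 have e: "elt H H y x <: (tens H H)" using m vH by simp
 have F1: "bilin H H kk (%x y. F (ract H x b) (ract H y b'))" if "b <: B" "b' <: B" for b b'
 using that by (intro bilinI bilinD(2,3)[OF F] bilinD(3)[OF bimodD(5)[OF bH] lin_id] bimodD(3)[OF bH])
 have F2: "bilin H H kk (%x y. F (ract H (lact H c x) b) (ract H (lact H c' y) b'))"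
 if "b <: B" "b' <: B" "c <: B" "c' <: B" for b b' c c'
 using that by (intro bilinI bilinD(2,3)[OF F1] bilinD(3)[OF bimodD(4)[OF bH] lin_id] bimodD(2)[OF bH])
 have "sm H H (?f x y) F = ss (%b b'. si (%c c'. F (ract H (lact H c y) b) (ract H (lact H c' x) b')))"
 unfolding r2(2)[OF linD(1)[OF l2(1) e] F] by (rule smc) (simp add: l2(2)[OF e F1] F2 vH m cong: smc)
 also have "... = si (%c c'. ss (%b b'. F (ract H (lact H c y) b) (ract H (lact H c' x) b')))" by (rule sm_swap)
 also have "... = si (%s' t'. ss (%s t. F (u s'*[A]y*[A]u s) (u t'*[A]x*[A]u t)))"
 using m by (simp add: la ra Ad(17) hc)
 finally show ?thesis .
 qed
 have ch: "com H h <: (tens H H)" if "h <: H" for h using Ad(6)[OF that] .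
 have bs: "sm H H (braiding B S H H (com H h)) F
 = sm H H (com H h) (%a c. si (%s' t'. ss (%s t. F (u s'*[A]c*[A]u s) (u t'*[A]a*[A]u t))))"
 if "h <: H" and F: "bilin H H kk F" for h F
 unfolding br sm_tlift[OF vH vH vH vH b F ch[OF that(1)]] by (rule smc) (rule fs[OF _ _ F])
 have bc: "braiding B S H H (com H h) <: (tens H H)" if "h <: H" for h
 unfolding br using tlift_closed[OF vH vH _ b ch[OF that]] vH by simp
 show ?thesis
 unfolding cocommutative_def qc_def sel tensA bilinA
 proof (intro iffI ballI allI impI)
 show "sm H H (com H x) (%a c. si (%s' t'. ss (%s t. F (u s'*[A]c*[A]u s) (u t'*[A]a*[A]u t)))) = sm H H (com H x) F"
 if "\<forall>x\<in>car H. braiding B S H H (com H x) = com H x" "x <: H" "bilin H H kk F" for x F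
 using bs[OF that(2,3)] that(1,2) by simp
 show "braiding B S H H (com H x) = com H x"
 if "\<forall>x\<in>car H. \<forall>F. bilin H H kk F -->
 sm H H (com H x) (%a c. si (%s' t'. ss (%s t. F (u s'*[A]c*[A]u s) (u t'*[A]a*[A]u t)))) = sm H H (com H x) F"
 "x <: H" for x by (rule tens_eqI[OF vH vH bc[OF that(2)] ch[OF that(2)]]) (use that bs in simp)
 qed
qed

end

text \<open>Multiplicativity and compatibility with the units imply linearity over \<open>B\<close>;
  conversely, products of elements are the values of \<open>mul\<close> on
  \<open>celt\<close>.\<close>

lemma bimonoid_maps_iff:
 assumes "corr_bialg B S H A" "corr_bialg B S K A'"
 shows "f : bimonoid_maps B H K <-> f : bialg_maps A A' & (\<forall>b\<in>car B. f (unt H b) = unt K b)"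
proof -
 interpret L: corr_bialg B S H A by fact
 interpret K: corr_bialg B S K A' by fact
 have tm: "tmap A A A' A' = tmap H H K K" by (rule tmap_sel_cong) (simp_all add: L.sel K.sel)
 have lm: "lin_maps A A' = lin_maps H K" by (simp only: L.linA K.linA)
 have cp: "lin (circ B H H) (circ B K K) (cmap B H H K K f f)"
 "[|x <: H; y <: H|] ==> cmap B H H K K f f (celt B H H x y) = celt B K K (f x) (f y)"
 if f: "f : bimod_maps B H K" for x y
 proof -
 note m = bimod_mapD[OF f]
 note c = cmap_props[OF L.bHH K.bHH m(1,1) m(5,4)]
 show "lin (circ B H H) (circ B K K) (cmap B H H K K f f)" by (rule c(1))
 show "cmap B H H K K f f (celt B H H x y) = celt B K K (f x) (f y)" if k: "x <: H" "y <: H"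
 by (rule c(2); (assumption | rule k))
 qed
 show ?thesis
 proof
 assume "f : bimonoid_maps B H K"
 hence f: "f : bimod_maps B H K" and m: "\<forall>t\<in>car (circ B H H). f (mul H t) = mul K (cmap B H H K K f f t)"
 and fu: "\<forall>b\<in>car B. f (unt H b) = unt K b" and c: "\<forall>x\<in>car H. com K (f x) = tmap H H K K f f (com H x)"
 and e: "\<forall>x\<in>car H. cou K (f x) = cou H x" unfolding bimonoid_maps_def by blast+
 note fm = bimod_mapD[OF f]
 have "f (x*[A]y) = f x*[A']f y" if "x <: H" "y <: H" for x y
 using m[rule_format, OF celt_closed[OF L.bHH that]] that by (simp add: cp(2)[OF f] L.mu K.mu fm(2))
 moreover have "f : lin_maps H K" using f by (simp add: bimod_maps_def)
 ultimately show "f : bialg_maps A A' & (\<forall>b\<in>car B. f (unt H b) = unt K b)"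
 using fu c e L.B(16) unfolding bialg_maps_def tm lm L.sel K.sel L.one K.one by simp
 next
 assume r: "f : bialg_maps A A' & (\<forall>b\<in>car B. f (unt H b) = unt K b)"
 hence fl: "f : lin_maps H K" and fm: "!!x y. x <: H ==> y <: H ==> f (x*[A]y) = f x*[A']f y"
 and fu: "\<forall>b\<in>car B. f (unt H b) = unt K b" and c: "\<forall>x\<in>car H. com K (f x) = tmap H H K K f f (com H x)"
 and e: "\<forall>x\<in>car H. cou K (f x) = cou H x"
 unfolding bialg_maps_def tm lm L.sel K.sel by simp_all
 note l = lin_mapsD[OF fl]
 have f: "f : bimod_maps B H K"
 unfolding bimod_maps_def using fl fu linD(1)[OF l] by (simp add: L.la L.ra K.la K.ra fm L.hc)
 have "f (mul H t) = mul K (cmap B H H K K f f t)" if "t <: (circ B H H)" for t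
 by (rule circ_lin_eq[OF L.bHH lin_o[OF l L.lmul] lin_o[OF K.lmul cp(1)[OF f]] that])
 (simp add: cp(2)[OF f] L.mu K.mu fm linD(1)[OF l])
 thus "f : bimonoid_maps B H K" unfolding bimonoid_maps_def using f fu c e by blast
 qed
qed

section \<open>Isomorphisms of categories\<close>

text \<open>A functor that is bijective on objects and the identity on maps. Points, pullbacks and
  isomorphisms then transfer by renaming objects.\<close>

locale strict_iso = D: category D for D :: "('p, 'm) cat" +
 fixes C :: "('o, 'm) cat" and Fo :: "'o => 'p"
 assumes bij: "bij_betw Fo (Ob C) (Ob D)"
 and hom: "X : Ob C ==> Y : Ob C ==> Hom C X Y = Hom D (Fo X) (Fo Y)"
 and idt: "X : Ob C ==> idt C X = idt D (Fo X)"
 and cmp: "X : Ob C ==> Y : Ob C ==> Z : Ob C ==> cmp C X Y Z g f = cmp D (Fo X) (Fo Y) (Fo Z) g f"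
begin

lemma Fo: "X : Ob C ==> Fo X : Ob D" and Ob_D: "Ob D = Fo ` Ob C"
 using bij by (auto simp: bij_betw_def)

lemma category_C: "category C"
 by unfold_locales (simp_all add: hom idt cmp Fo D.idt_closed D.cmp_closed D.idt_left D.idt_right D.cmp_assoc)

lemma isomorphic: "isomorphic_categories C D"
proof -
 interpret C: category C by (rule category_C)
 let ?Go = "inv_into (Ob C) Fo"
 have G: "?Go X : Ob C" "Fo (?Go X) = X" if "X : Ob D" for X
 using that inv_into_into[of X Fo "Ob C"] f_inv_into_f[of X Fo "Ob C"] by (simp_all add: Ob_D)
 have GF: "?Go (Fo X) = X" if "X : Ob C" for X
 using bij that by (simp add: bij_betw_def inv_into_f_f)
 have 1: "cat_functor C D Fo (%X Y f. f)"
 by unfold_locales (simp_all add: Fo hom idt cmp)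
 have 2: "cat_functor D C ?Go (%X Y f. f)"
 by unfold_locales (simp_all add: G hom idt cmp)
 show ?thesis
 unfolding isomorphic_categories_def using 1 2 G GF by blast
qed

definition "mp = (%(X, f, s). (Fo X, f, s))"

lemma points_Ob:
 assumes Y: "Y : Ob C"
 shows "a : Ob (points C Y) ==> mp a : Ob (points D (Fo Y))" "fst a : Ob C ==> mp a : Ob (points D (Fo Y)) ==> a : Ob (points C Y)"
 using Y by (auto simp: points_def mp_def hom idt cmp Fo)

lemma points_Hom:
 assumes Y: "Y : Ob C" and a: "a : Ob (points C Y)" "a' : Ob (points C Y)"
 shows "Hom (points C Y) a a' = Hom (points D (Fo Y)) (mp a) (mp a')"
 and "idt (points C Y) a = idt (points D (Fo Y)) (mp a)"
 and "cmp (points C Y) a a' a g f = cmp (points D (Fo Y)) (mp a) (mp a') (mp a) g f"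
 using Y a by (auto simp: points_def mp_def hom idt cmp Fo)

lemma points_iso:
 assumes Y: "Y : Ob C" and a: "a : Ob (points C Y)" and a': "a' : Ob (points C Y)"
 shows "isomorphism (points C Y) a a' h <-> isomorphism (points D (Fo Y)) (mp a) (mp a') h"
 unfolding isomorphism_def points_Hom(1)[OF Y a a'] points_Hom(1)[OF Y a' a] points_Hom(2)[OF Y a a'] points_Hom(2)[OF Y a' a]
 points_Hom(3)[OF Y a a'] points_Hom(3)[OF Y a' a] ..

lemma pullback_iff:
 assumes o: "X : Ob C" "E : Ob C" "Y : Ob C" "P : Ob C"
 shows "is_pullback C X E Y f g P p q <-> is_pullback D (Fo X) (Fo E) (Fo Y) f g (Fo P) p q"
 unfolding is_pullback_def Ob_D ball_simps using o by (simp add: hom cmp cong: ball_cong)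

lemma inverse_image_D:
 assumes o: "E : Ob C" "Y : Ob C" "a : Ob (points C Y)" and i: "inverse_image C E Y g a d p"
 shows "inverse_image D (Fo E) (Fo Y) g (mp a) (mp d) p" "d : Ob (points C E)"
proof -
 obtain X f s P q t where e: "a = (X, f, s)" "d = (P, q, t)" by (metis prod.collapse)
 show d: "d : Ob (points C E)" using i by (simp add: inverse_image_def e)
 have X: "X : Ob C" "P : Ob C" using o(3) d by (auto simp: e points_def)
 show "inverse_image D (Fo E) (Fo Y) g (mp a) (mp d) p"
 using i points_Ob(1)[OF o(1) d] pullback_iff[OF X(1) o(1,2) X(2)] o X by (simp add: inverse_image_def e mp_def cmp)
qed

lemma protomodular_C:
 assumes pD: "protomodular D"
 shows "protomodular C"
 unfolding protomodular_def
proof (intro conjI ballI allI impI)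
 show "category C" by (rule category_C)
next
 fix Y a assume Y: "Y : Ob C" and a: "a : Ob (points C Y)"
 obtain X f s where aa: "a = (X, f, s)" by (cases a)
 show "case a of (X, f, s) => \<forall>E\<in>Ob C. \<forall>g\<in>Hom C E Y. \<exists>P p q. is_pullback C X E Y f g P p q"
 unfolding aa prod.case
 proof (intro ballI)
 fix E g assume E: "E : Ob C" and g: "g : Hom C E Y"
 have X: "X : Ob C" using a by (simp add: aa points_def)
 have p: "(Fo X, f, s) : Ob (points D (Fo Y))" using points_Ob(1)[OF Y a] by (simp add: aa mp_def)
 have "\<forall>(X, f, s)\<in>Ob (points D (Fo Y)). \<forall>E\<in>Ob D. \<forall>g\<in>Hom D E (Fo Y). \<exists>P p q. is_pullback D X E (Fo Y) f g P p q"
 using pD Fo[OF Y] unfolding protomodular_def by blast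
 from bspec[OF this p] have "\<exists>P p q. is_pullback D (Fo X) (Fo E) (Fo Y) f g P p q"
 using Fo[OF E] g hom[OF E Y] by simp
 then obtain P' p' q' where P': "is_pullback D (Fo X) (Fo E) (Fo Y) f g P' p' q'" by blast
 then obtain P where P: "P : Ob C" "P' = Fo P" unfolding is_pullback_def Ob_D by blast
 show "\<exists>P p q. is_pullback C X E Y f g P p q"
 using P' pullback_iff[OF X E Y P(1)] unfolding P(2) by blast
 qed
next
 fix Y E g a a' h d d' p p' k
 assume Y: "Y : Ob C" and E: "E : Ob C" and g: "g : Hom C E Y" and a: "a : Ob (points C Y)" and a': "a' : Ob (points C Y)"
 and h: "h : Hom (points C Y) a a'" and d: "inverse_image C E Y g a d p" and d': "inverse_image C E Y g a' d' p'"
 and k: "k : Hom (points C E) d d'" and kh: "cmp C (fst d) (fst d') (fst a') p' k = cmp C (fst d) (fst a) (fst a') h p"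
 and iso: "isomorphism (points C E) d d' k"
 note dd = inverse_image_D[OF E Y a d] and dd' = inverse_image_D[OF E Y a' d']
 have f: "fst a : Ob C" "fst a' : Ob C" "fst d : Ob C" "fst d' : Ob C"
 using a a' dd(2) dd'(2) by (auto simp: points_def)
 have fm: "fst (mp x) = Fo (fst x)" for x by (simp add: mp_def split: prod.split)
 have D: "\<forall>Y\<in>Ob D. \<forall>E\<in>Ob D. \<forall>g\<in>Hom D E Y.
 \<forall>a\<in>Ob (points D Y). \<forall>a'\<in>Ob (points D Y). \<forall>h\<in>Hom (points D Y) a a'.
 \<forall>d d' p p' k. inverse_image D E Y g a d p --> inverse_image D E Y g a' d' p' -->
 k : Hom (points D E) d d' -->
 cmp D (fst d) (fst d') (fst a') p' k = cmp D (fst d) (fst a) (fst a') h p -->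
 isomorphism (points D E) d d' k --> isomorphism (points D Y) a a' h"
 using pD unfolding protomodular_def by blast
 show "isomorphism (points C Y) a a' h"
 unfolding points_iso[OF Y a a']
 proof (rule D[rule_format])
 show "Fo Y : Ob D" "Fo E : Ob D" by (rule Fo[OF Y], rule Fo[OF E])
 show "g : Hom D (Fo E) (Fo Y)" using g hom[OF E Y] by simp
 show "mp a : Ob (points D (Fo Y))" "mp a' : Ob (points D (Fo Y))" by (rule points_Ob(1)[OF Y a], rule points_Ob(1)[OF Y a'])
 show "h : Hom (points D (Fo Y)) (mp a) (mp a')" using h points_Hom(1)[OF Y a a'] by simp
 show "inverse_image D (Fo E) (Fo Y) g (mp a) (mp d) p" "inverse_image D (Fo E) (Fo Y) g (mp a') (mp d') p'" by (rule dd(1), rule dd'(1))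
 show "k : Hom (points D (Fo E)) (mp d) (mp d')" using k points_Hom(1)[OF E dd(2) dd'(2)] by simp
 show "cmp D (fst (mp d)) (fst (mp d')) (fst (mp a')) p' k = cmp D (fst (mp d)) (fst (mp a)) (fst (mp a')) h p"
 using kh f by (simp add: fm cmp)
 show "isomorphism (points D (Fo E)) (mp d) (mp d') k" using iso points_iso[OF E dd(2) dd'(2)] by simp
 qed
qed

end

section \<open>Hopf monoids and the coslice category\<close>

definition to_alg :: "('k::field, 'u) bialg => ('k, 'u, 'u) bimon => ('k, 'u) bialg" where
 "to_alg B H = \<lparr>carrier = car H, vzero = vzero H, vadd = vadd H, vsmul = vsmul H,
 amul = (%x y. if x <: H & y : car H then mul H (celt B H H x y) else undefined),
 aone = unt H (aone B), acomul = com H, acounit = cou H\<rparr>"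

text \<open>Separated from \<open>to_bimon\<close> because the product there is a lift over the very
  bimodule being defined.\<close>

definition to_bimod :: "('k::field, 'u) bialg => ('k, 'u) bialg => ('u => 'u) => ('k, 'u, 'u) bimod" where
 "to_bimod B A u = \<lparr>carrier = car A, vzero = vzero A, vadd = vadd A, vsmul = vsmul A,
 lact = (%b x. if b <: B & x : car A then u b*[A]x else undefined),
 ract = (%x b. if b <: B & x : car A then x*[A]u b else undefined)\<rparr>"

definition to_bimon :: "('k::field, 'u) bialg => ('k, 'u) bialg => ('u => 'u) => ('k, 'u, 'u) bimon" where
 "to_bimon B A u = (let M = to_bimod B A u in \<lparr>carrier = car M, vzero = vzero M, vadd = vadd M, vsmul = vsmul M,
 lact = lact M, ract = ract M, mul = clift B M M M (amul A), unt = u, com = acomul A, cou = eps A\<rparr>)"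

lemma to_alg_simps [simp]:
 "car (to_alg B H) = car H" "vzero (to_alg B H) = vzero H" "vadd (to_alg B H) = vadd H" "vsmul (to_alg B H) = vsmul H"
 "x <: H ==> y <: H ==> x*[to_alg B H]y = mul H (celt B H H x y)"
 "aone (to_alg B H) = unt H (aone B)" "acomul (to_alg B H) = com H" "eps (to_alg B H) = cou H"
 by (simp_all add: to_alg_def)

lemma to_bimon_simps [simp]:
 "car (to_bimon B A u) = car A" "vzero (to_bimon B A u) = vzero A" "vadd (to_bimon B A u) = vadd A"
 "vsmul (to_bimon B A u) = vsmul A" "unt (to_bimon B A u) = u" "com (to_bimon B A u) = acomul A" "cou (to_bimon B A u) = eps A"
 "b <: B ==> x <: A ==> lact (to_bimon B A u) b x = u b*[A]x"
 "b <: B ==> x <: A ==> ract (to_bimon B A u) x b = x*[A]u b" by (simp_all add: to_bimon_def to_bimod_def Let_def)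

lemma celt_cong:
 assumes "car X = car X'" "vadd X = vadd X'" "vsmul X = vsmul X'" "ract X = ract X'"
 and "car Y = car Y'" "vadd Y = vadd Y'" "vsmul Y = vsmul Y'" "lact Y = lact Y'"
 shows "ker\<^sub>B B X Y = ker\<^sub>B B X' Y'" "celt B X Y = celt B X' Y'"
proof -
 show k: "ker\<^sub>B B X Y = ker\<^sub>B B X' Y'" by (simp only: ker\<^sub>B_def bilin_rels_def assms)
 show "celt B X Y = celt B X' Y'" by (intro ext) (simp only: celt_def k)
qed

text \<open>Used because the same bimodule occurs both as a \<open>bimod\<close> record and as part
  of a \<open>bimon\<close> record.\<close>

lemma clift_cong:
 assumes "car X = car X'" "vadd X = vadd X'" "vsmul X = vsmul X'" "ract X = ract X'"
 and "car Y = car Y'" "vadd Y = vadd Y'" "vsmul Y = vsmul Y'" "lact Y = lact Y'"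
 and "car Z = car Z'" "vadd Z = vadd Z'" "vsmul Z = vsmul Z'"
 and "!!x y. x <: X' ==> y <: Y' ==> f x y = f' x y"
 shows "clift B X Y Z f = clift B X' Y' Z' f'"
proof -
 note c = celt_cong[OF assms(1-8)]
 have q: "quot_space (ker\<^sub>B B X' Y') X Y = quot_space (ker\<^sub>B B X' Y') X' Y'"
 by (simp only: quot_space_def assms)
 have "(\<forall>x\<in>car X'. \<forall>y\<in>car Y'. g (celt B X' Y' x y) = f x y)
 <-> (\<forall>x\<in>car X'. \<forall>y\<in>car Y'. g (celt B X' Y' x y) = f' x y)" for g
 using assms(12) by simp
 thus ?thesis
 unfolding clift_def c q lin_cong_space(2)[OF refl refl refl assms(9-11)] assms(1,5) by (simp only:)
qed

section \<open>Monic units and the comparison of objects\<close>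

context coslice_cat
begin

text \<open>The kernel \<open>K\<close> of \<open>f\<close> is a subbimodule of \<open>B\<close>,
  hence an object of the category. Its inclusion and the zero map have the same composite with a
  monic \<open>f\<close>, so \<open>K\<close> vanishes.\<close>

lemma monic_iff:
 fixes X :: "('k, 'u, 'u) bimod"
 assumes X: "bimodule B X" and f: "f : bimod_maps B (unit_I B) X"
 shows "monic (bimod_cat B) (unit_I B) X f <-> inj_on f (car B)"
proof
 note fm = bimod_mapD[OF f, unfolded lin_unit unit_I_simps]
 note vX = bimodD(1)[OF X]
 have v0: "f (vzero B) = vzero X" by (rule lin_vzero[OF fm(1) B(3) vX])
 assume m: "monic (bimod_cat B) (unit_I B) X f"
 define K where "K = {x : car B. f x = vzero X}"
 define Z :: "('k, 'u, 'u) bimod" where "Z = \<lparr>carrier = K, vzero = vzero B,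
 vadd = (%x y. if x : K & y : K then vadd B x y else undefined),
 vsmul = (%c x. if x : K then vsmul B c x else undefined),
 lact = (%b x. if b <: B & x : K then b*[B]x else undefined),
 ract = (%x b. if b <: B & x : K then x*[B]b else undefined)\<rparr>"
 have KB: "x <: B" if "x : K" for x using that by (simp add: K_def)
 have a0: "lact X b (vzero X) = vzero X" "ract X (vzero X) b = vzero X" if "b <: B" for b
 using lin_vzero[OF bilinD(3)[OF bimodD(4)[OF X] lin_id that] vX vX] lin_vzero[OF bilinD(3)[OF bimodD(5)[OF X] lin_id that] vX vX] .
 have K1: "vzero B : K" "x : K ==> y : K ==> vadd B x y : K" "x : K ==> vsmul B c x : K" for x y c
 using v0 linD(2,3)[OF fm(1)] vX B(3) by (auto simp: K_def)
 have K2: "b*[B]x : K" if "b <: B" "x : K" for b x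
 using that fm(4)[of b x] a0(1)[of b] B(20) by (simp add: K_def)
 have K3: "x*[B]b : K" if "b <: B" "x : K" for b x
 using that fm(5)[of b x] a0(2)[of b] B(20) by (simp add: K_def)
 note K = K1 K2 K3
 note Bv = vadd_assoc[OF B(3)] vspaceD(3-6)[OF B(3)] vadd_zero[OF B(3)] vneg[OF B(3)] vsmul_zero[OF B(3)] vsmul_one[OF B(3)] vsmul_vzero[OF B(3)]
 note Bl = linD(2,3)[OF BL(1)[OF lin_id]] linD(2,3)[OF BL(2)[OF lin_id]]
 have vZ: "vspace Z"
 proof (rule vspaceI)
 fix x y assume "x <: Z" "y <: Z"
 thus "vadd Z x y = vadd Z y x" using vadd_comm[OF B(3)] by (simp add: Z_def KB)
 qed (simp_all add: Z_def K KB Bv)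
 have Z: "bimodule B Z" by (rule bimoduleI[OF vZ]) (simp_all add: bilin_def lin_def Z_def K KB Bl B)
 have ZO: "Z : Ob (bimod_cat B)"
 using Z by (simp add: bimod_cat_def bimod_ext_def vect_ext_def) (simp add: Z_def)
 have 1: "(\<lambda>x\<in>K. x) : Hom (bimod_cat B) Z (unit_I B)" "(\<lambda>x\<in>K. vzero B) : Hom (bimod_cat B) Z (unit_I B)"
 using lin_vzero[OF BL(1)[OF lin_id] B(3,3)] lin_vzero[OF BL(2)[OF lin_id] B(3,3)] B(3)
 by (auto simp: bimod_cat_def bimod_maps_def lin_maps_def Z_def K KB)
 have "cmp (bimod_cat B) Z (unit_I B) X f (\<lambda>x\<in>K. x) = cmp (bimod_cat B) Z (unit_I B) X f (\<lambda>x\<in>K. vzero B)"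
 by (auto simp: bimod_cat_def compose_def fun_eq_iff Z_def v0) (simp add: K_def)
 hence "(\<lambda>x\<in>K. x) = (\<lambda>x\<in>K. vzero B)" using m ZO 1 unfolding monic_def by blast
 hence K0: "x = vzero B" if "x : K" for x using that by (auto simp: fun_eq_iff restrict_def split: if_splits)
 show "inj_on f (car B)"
 proof (rule inj_onI)
 fix x y assume k: "x <: B" "y <: B" "f x = f y"
 have "vadd B x (vsmul B (-1) y) : K"
 using k B(3) linD(2,3)[OF fm(1)] vneg(1)[OF vX] fm(2) by (simp add: K_def)
 thus "x = y" using vsub_eq_zero[OF B(3) k(1,2)] K0 by blast
 qed
next
 assume i: "inj_on f (car B)"
 show "monic (bimod_cat B) (unit_I B) X f"
 unfolding monic_def
 proof (intro conjI ballI impI)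
 show "f : Hom (bimod_cat B) (unit_I B) X" using f by (simp add: bimod_cat_def)
 fix Z g h assume g: "g : Hom (bimod_cat B) Z (unit_I B)" and h: "h : Hom (bimod_cat B) Z (unit_I B)"
 and e: "cmp (bimod_cat B) Z (unit_I B) X f g = cmp (bimod_cat B) Z (unit_I B) X f h"
 hence g: "g : bimod_maps B Z (unit_I B)" and h: "h : bimod_maps B Z (unit_I B)"
 and e: "compose (car Z) f g = compose (car Z) f h" by (simp_all add: bimod_cat_def)
 show "g = h"
 proof (rule extensionalityI[OF bimod_mapD(3)[OF g] bimod_mapD(3)[OF h]])
 fix z assume z: "z <: Z"
 have "f (g z) = f (h z)" using compose_eq[OF z, of f g] compose_eq[OF z, of f h] unfolding e by simp
 thus "g z = h z" using inj_onD[OF i] bimod_mapD(2)[OF g z] bimod_mapD(2)[OF h z] by simp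
 qed
 qed
qed

lemma bimod_truncate: "bimodule B (bimod.truncate H) = bimodule B H" "bimod_maps B X (bimod.truncate H) = bimod_maps B X H"
proof -
 have s: "car (bimod.truncate H) = car H" "vzero (bimod.truncate H) = vzero H" "vadd (bimod.truncate H) = vadd H"
 "vsmul (bimod.truncate H) = vsmul H" "lact (bimod.truncate H) = lact H" "ract (bimod.truncate H) = ract H"
 by (simp_all add: bimod.truncate_def)
 have v: "vspace (bimod.truncate H) = vspace H" by (rule vspace_cong) (simp_all only: s)
 show "bimodule B (bimod.truncate H) = bimodule B H" by (simp only: bimodule_def bilin_def lin_def v s)
 show "bimod_maps B X (bimod.truncate H) = bimod_maps B X H" by (simp only: bimod_maps_def lin_maps_def lin_def s)
qed

lemma Hopf_Ob:
 "H : Ob (Hopf_m_coc B S) <-> bimonoid B H & bimod_ext B H & hopf_monoid B H & cocommutative B S H & inj_on (unt H) (car B)"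
proof -
 have "monic (bimod_cat B) (unit_I B) (bimod.truncate H) (unt H) <-> inj_on (unt H) (car B)" if "bimonoid B H"
 using that by (intro monic_iff) (simp_all add: bimod_truncate bimonoid_def circ_monoid_def)
 thus ?thesis by (auto simp: Hopf_m_coc_def full_subcat_def bimonoid_cat_def)
qed

text \<open>The unit laws of the monoid, evaluated on \<open>celt\<close>, express both actions of
  \<open>B\<close> through the product, as the dictionary requires.\<close>

lemma corr_to_alg:
 assumes bm: "bimonoid B H"
 shows "corr_bialg B S H (to_alg B H)"
proof -
 have bH: "bimodule B H" and mul: "mul H : bimod_maps B (circ B H H) H" and unt: "unt H : bimod_maps B (unit_I B) H"
 and l: "\<forall>t\<in>car (circ B (unit_I B) H). mul H (cmap B (unit_I B) H H H (unt H) (idm H) t) = clunit B H t"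
 and r: "\<forall>t\<in>car (circ B H (unit_I B)). mul H (cmap B H (unit_I B) H H (idm H) (unt H) t) = crunit B H t"
 using bm unfolding bimonoid_def circ_monoid_def by - ((elim conjE, assumption)+)
 note u = bimod_mapD[OF unt]
 note vH = bimodD(1)[OF bH] and bHH = balanceable_bimod[OF bH bH]
 have i: "idm H (lact H b x) = lact H b (idm H x)" "idm H (ract H x b) = ract H (idm H x) b"
 if "b <: B" "x <: H" for b x using that bimodD(2,3)[OF bH] by simp_all
 have la: "lact H b x = mul H (celt B H H (unt H b) x)" if m: "b <: B" "x <: H" for b x
 proof -
 note bIH = balanceable_bimod[OF bimodule_I bH]
 have m': "b <: (unit_I B)" using m by simp
 have b: "bilin (unit_I B) H H (lact H)" using bimodD(4)[OF bH] by (simp add: bilin_def lin_unit)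
 have ba: "balanced B (unit_I B) H (lact H)" using bimodD(8)[OF bH] by simp
 note k = clift_maps[OF bIH vH b ba, folded clunit_def]
 note c = cmap_props[OF bIH bHH u(1) lin_idm[OF vH] u(5) i(1)]
 have "cmap B (unit_I B) H H H (unt H) (idm H) (celt B (unit_I B) H b x) = celt B H H (unt H b) (idm H x)"
 by (rule c(2); (assumption | rule m' m))
 thus ?thesis using bspec[OF l celt_closed[OF bIH m' m(2)]] k(2)[OF m' m(2)] m by simp
 qed
 have ra: "ract H x b = mul H (celt B H H x (unt H b))" if m: "b <: B" "x <: H" for b x
 proof -
 note bIH = balanceable_bimod[OF bH bimodule_I]
 have m': "b <: (unit_I B)" using m by simp
 have b: "bilin H (unit_I B) H (%x b. ract H x b)" using bimodD(5)[OF bH] by (simp add: bilin_def lin_unit)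
 have ba: "balanced B H (unit_I B) (%x b. ract H x b)" using bimodD(9)[OF bH] by simp
 note k = clift_maps[OF bIH vH b ba, folded crunit_def]
 note c = cmap_props[OF bIH bHH lin_idm[OF vH] u(1) i(2) u(4)]
 have "cmap B H (unit_I B) H H (idm H) (unt H) (celt B H (unit_I B) x b) = celt B H H (idm H x) (unt H b)"
 by (rule c(2); (assumption | rule m' m))
 thus ?thesis using bspec[OF r celt_closed[OF bIH m(2) m']] k(2)[OF m(2) m'] m by simp
 qed
 have uc: "unt H b <: H" if "b <: B" for b using u(2)[of b] that by simp
 have "corr B S H (to_alg B H)"
 proof (intro corr.intro corr_axioms.intro qt_hopf_axioms)
 show "mul H : lin_maps (circ B H H) H" using mul by (simp add: bimod_maps_def)
 fix b x assume m: "b <: B" "x <: H"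
 show "lact H b x = unt H b*[to_alg B H]x" by (simp only: to_alg_simps(5)[OF uc[OF m(1)] m(2)] la[OF m])
 show "ract H x b = x*[to_alg B H]unt H b" by (simp only: to_alg_simps(5)[OF m(2) uc[OF m(1)]] ra[OF m])
 qed (simp_all add: bH)
 then interpret K: corr B S H "to_alg B H" .
 show ?thesis by (intro corr_bialg.intro K.corr_axioms corr_bialg_axioms.intro K.to_bialg[OF bm])
qed

lemma corr_to_bimon:
 assumes bA: "bialgebra A" and uA: "u : bialg_maps B A"
 shows "corr_bialg B S (to_bimon B A u) A"
proof -
 let ?H = "to_bimon B A u"
 note A' = bialgD[OF bA] algebraD[OF bialgD(1)[OF bA]]
 note U = bmapD[OF uA bB bA]
 note L = alg_lin[OF A'(1)]
 have lH: "lin V ?H g = lin V A g" "lin ?H W k = lin A W k"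
 for V :: "('k, 'w, 'wz) vect_scheme" and W :: "('k, 'w, 'wz) vect_scheme" and g k by (simp_all add: lin_def)
 have vH: "vspace ?H" using A'(3) vspace_cong[of ?H A] by simp
 have bH: "bimodule B ?H"
 proof (rule bimoduleI[OF vH])
 have c: "lin A A (lact ?H b) = lin A A (%x. u b*[A]x)" "lin A A (%x. ract ?H x b) = lin A A (%x. x*[A]u b)" if "b <: B" for b
 by (rule lin_cong[OF _ A'(3)]; use that in simp)+
 have d: "lin B A (%b. lact ?H b x) = lin B A (%b. u b*[A]x)" "lin B A (%b. ract ?H x b) = lin B A (%b. x*[A]u b)" if "x <: A" for x
 by (rule lin_cong[OF _ B(3)]; use that in simp)+
 have lH': "lin ?H ?H g = lin A A g" "lin B ?H k = lin B A k" for g k by (simp_all add: lin_def)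
 show "bilin B ?H ?H (lact ?H)" "bilin B ?H ?H (%b x. ract ?H x b)"
 unfolding bilin_def lH' by (simp_all add: c d L U)
 qed (simp_all add: U A' B(16,20))
 note bHH = balanceable_bimod[OF bH bH]
 have lH': "lin ?H ?H g = lin A A g" for g by (simp add: lin_def)
 have b: "bilin ?H ?H ?H (amul A)" unfolding bilin_def lH' by (simp add: L)
 have ba: "balanced B ?H ?H (amul A)" by (simp add: A' U)
 note cp = clift_maps[OF bHH vH b ba]
 have mul: "mul ?H = clift B ?H ?H ?H (amul A)"
 proof -
 have "mul ?H = clift B (to_bimod B A u) (to_bimod B A u) (to_bimod B A u) (amul A)" by (simp add: to_bimon_def Let_def)
 also have "... = clift B ?H ?H ?H (amul A)" by (rule clift_cong) (simp_all add: to_bimon_def to_bimod_def Let_def)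
 finally show ?thesis .
 qed
 have "corr B S ?H A"
 by unfold_locales (use bH cp U A' in \<open>simp_all add: mul\<close>)
 then interpret K: corr B S ?H A .
 have "unt ?H : bialg_maps B A" using uA by simp
 thus ?thesis by (intro corr_bialg.intro K.corr_axioms corr_bialg_axioms.intro bA)
qed

lemma to_alg_obj:
 assumes H: "H : Ob (Hopf_m_coc B S)"
 shows "obj (to_alg B H) (unt H)"
proof -
 have h: "bimonoid B H" "bimod_ext B H" "hopf_monoid B H" "cocommutative B S H" "inj_on (unt H) (car B)"
 using H by (simp_all add: Hopf_Ob)
 interpret K: corr_bialg B S H "to_alg B H" by (rule corr_to_alg[OF h(1)])
 have "alg_ext (to_alg B H)" using h(2) by (simp add: alg_ext_def bimod_ext_def vect_ext_def) (simp add: to_alg_def)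
 thus ?thesis unfolding obj_def using h K.hopf_iff K.cocommutative_iff K.uA by blast
qed

lemma to_bimon_Ob:
 assumes o: "obj A u"
 shows "to_bimon B A u : Ob (Hopf_m_coc B S)" "to_alg B (to_bimon B A u) = A"
proof -
 have A: "hopf_algebra A" "alg_ext A" "u : bialg_maps B A" "qc A u" "inj_on u (car B)" using o by (simp_all add: obj_def)
 note bA = hopfD[OF A(1)]
 interpret K: corr_bialg B S "to_bimon B A u" A by (rule corr_to_bimon[OF bA A(3)])
 have "bimod_ext B (to_bimon B A u)"
 using A(2) by (simp add: bimod_ext_def alg_ext_def vect_ext_def) (simp add: to_bimon_def to_bimod_def Let_def)
 thus "to_bimon B A u : Ob (Hopf_m_coc B S)"
 unfolding Hopf_Ob using K.bm K.hopf_iff K.cocommutative_iff A by simp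
 show "to_alg B (to_bimon B A u) = A"
 proof (rule bialg.equality)
 \<comment> \<open>On the carrier this is \<open>K.mu\<close>; elsewhere both products are
   \<open>undefined\<close>, by \<open>alg_ext\<close>.\<close>
 show "amul (to_alg B (to_bimon B A u)) = amul A"
 proof (intro ext)
 fix x y
 show "x*[to_alg B (to_bimon B A u)]y = x*[A]y"
 using K.mu[of x y] A(2) by (auto simp: to_alg_def alg_ext_def)
 qed
 show "aone (to_alg B (to_bimon B A u)) = aone A" using K.one by simp
 qed simp_all
qed

text \<open>The actions are recovered from product and unit, and \<open>mul\<close> by uniqueness of
  lifts; extensionality settles all values outside the carriers.\<close>

lemma to_alg_inj:
 assumes H: "H : Ob (Hopf_m_coc B S)" and K: "K : Ob (Hopf_m_coc B S)"
 and e: "to_alg B H = to_alg B K" "unt H = unt K"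
 shows "H = K"
proof -
 interpret h: corr_bialg B S H "to_alg B H" by (rule corr_to_alg) (use H in \<open>simp add: Hopf_Ob\<close>)
 interpret k: corr_bialg B S K "to_alg B K" by (rule corr_to_alg) (use K in \<open>simp add: Hopf_Ob\<close>)
 have s: "car H = car K" "vzero H = vzero K" "vadd H = vadd K" "vsmul H = vsmul K" "com H = com K" "cou H = cou K"
 using e(1) by (simp_all add: to_alg_def)
 have x: "bimod_ext B H" "bimod_ext B K" using H K by (simp_all add: Hopf_Ob)
 have l: "lact H = lact K"
 proof (intro ext)
 fix b y show "lact H b y = lact K b y"
 using x h.la[of b y] k.la[of b y] e unfolding bimod_ext_def s(1) by (cases "b <: B & y <: K") auto
 qed
 have r: "ract H = ract K"
 proof (intro ext)
 fix b y show "ract H y b = ract K y b"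
 using x h.ra[of b y] k.ra[of b y] e unfolding bimod_ext_def s(1) by (cases "b <: B & y <: K") auto
 qed
 have "mul H = clift B H H H (amul (to_alg B H))" by (rule clift_unique[OF h.bHH h.vH h.mulm, symmetric]) (rule h.mu)
 also have "... = clift B K K K (amul (to_alg B K))" by (rule clift_cong) (simp_all only: s l r e)
 also have "... = mul K" by (rule clift_unique[OF k.bHH k.vH k.mulm]) (rule k.mu)
 finally show ?thesis using s l r e(2) by (intro bimon.equality) simp_all
qed

lemma Hopf_strict_iso: "strict_iso C (Hopf_m_coc B S) (%H. ob (to_alg B H) (unt H))"
proof (intro strict_iso.intro strict_iso_axioms.intro category_C)
 let ?Fo = "%H. ob (to_alg B H) (unt H)"
 have F: "?Fo H : Ob C" if "H : Ob (Hopf_m_coc B S)" for H by (rule obI[OF to_alg_obj[OF that]])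
 show "bij_betw ?Fo (Ob (Hopf_m_coc B S)) (Ob C)"
 unfolding bij_betw_def
 proof
 show "inj_on ?Fo (Ob (Hopf_m_coc B S))" by (rule inj_onI) (use to_alg_inj in \<open>simp add: ob_def\<close>)
 have "X : ?Fo ` Ob (Hopf_m_coc B S)" if X: "X : Ob C" for X
 proof
 have o: "obj (al X) (snd X)" "X = ob (al X) (snd X)" using X Ob_iff by blast+
 show "to_bimon B (al X) (snd X) : Ob (Hopf_m_coc B S)" by (rule to_bimon_Ob(1)[OF o(1)])
 show "X = ?Fo (to_bimon B (al X) (snd X))" using o(2) to_bimon_Ob(2)[OF o(1)] by simp
 qed
 thus "?Fo ` Ob (Hopf_m_coc B S) = Ob C" using F by blast
 qed
 fix X Y assume X: "X : Ob (Hopf_m_coc B S)" and Y: "Y : Ob (Hopf_m_coc B S)"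
 have b: "corr_bialg B S X (to_alg B X)" "corr_bialg B S Y (to_alg B Y)"
 by (rule corr_to_alg; use X Y in \<open>simp add: Hopf_Ob\<close>)+
 have "f : Hom (Hopf_m_coc B S) X Y <-> f : Hom C (?Fo X) (?Fo Y)" for f
 using bimonoid_maps_iff[OF b, of f] by (simp add: Hom_iff[OF F[OF X] F[OF Y]] Hopf_m_coc_def full_subcat_def bimonoid_cat_def)
 thus "Hom (Hopf_m_coc B S) X Y = Hom C (?Fo X) (?Fo Y)" by blast
 show "idt (Hopf_m_coc B S) X = idt C (?Fo X)" by (simp add: cat_simps Hopf_m_coc_def full_subcat_def bimonoid_cat_def)
 show "cmp (Hopf_m_coc B S) X Y Z g f = cmp C (?Fo X) (?Fo Y) (?Fo Z) g f" for Z g f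
 by (simp add: cat_simps Hopf_m_coc_def full_subcat_def bimonoid_cat_def)
qed

lemma isomorphic_protomodular:
 "isomorphic_categories (Hopf_m_coc B S) (QTrHopf_coslice_inj B S) & protomodular (Hopf_m_coc B S)"
 using strict_iso.isomorphic[OF Hopf_strict_iso] strict_iso.protomodular_C[OF Hopf_strict_iso protomodular_C] by blast

end

theorem corollary4p17:
  fixes B :: "('k::field, 'u) bialg"
    and S :: "(('u \<times> 'u) \<Rightarrow>\<^sub>0 'k) set"
  assumes "infinite (UNIV :: 'u set)"
    and "(B, S) \<in> Ob QTrHopf"
  shows "isomorphic_categories (Hopf_m_coc B S) (QTrHopf_coslice_inj B S) \<and>
    protomodular (Hopf_m_coc B S)"
proof -
  have "quasitriangular B S" using assms(2) by (simp add: QTrHopf_def)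
  then have "coslice_cat B S"
    by (intro coslice_cat.intro qt_hopf.intro coslice_cat_axioms.intro assms(1))
  then show ?thesis by (rule coslice_cat.isomorphic_protomodular)
qed

end
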